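(* Let $(R,\mathfrak m,k)$ be a commutative noetherian local ring with Hilbert series $H_R(t)=1+et+et^2+t^3$, and set $s=\operatorname{rank}_k(0:_R\mathfrak m)$. Assume there exists a non-zero exact zero divisor $a\in\mathfrak m$. Then the following are equivalent: (1) $R$ is a Koszul ring; (2) $e\ge s+2$. When these hold, every finitely generated $R$-module $M$ has a syzygy module that is Koszul.
   Context: $H_R(t)=\sum_{n\ge0}\operatorname{rank}_k(\mathfrak m^n/\mathfrak m^{n+1})t^n$. An element $a\in R$ is an exact zero divisor if $R\neq(0:_R a)\cong R/aR\neq0$. A finitely generated $R$-module $M$ is Koszul if $\operatorname{gr}_{\mathfrak m}(M)=\bigoplus_n\mathfrak m^nM/\mathfrak m^{n+1}M$ has a linear resolution over $\operatorname{gr}_{\mathfrak m}(R)=\bigoplus_n\mathfrak m^n/\mathfrak m^{n+1}$, i.e. $\operatorname{Tor}_i^{\operatorname{gr}R}(\operatorname{gr}M,k)_j=0$ for $j\neq i$ (equivalently, the linear part of a minimal free resolution of $M$ is acyclic); $R$ is Koszul if $k$ is a Koszul $R$-module. The $n$-th syzygy module of $M$ is the cokernel of the $n$-th differential of a minimal free resolution of $M$; a syzygy module of $M$ is a module isomorphic to the $n$-th syzygy module for some $n\ge0$. *)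

theory Defs
  imports "HOL-Algebra.Algebra"
begin

definition noetherian_ring :: "('a, 'b) ring_scheme \<Rightarrow> bool" where
  "noetherian_ring R \<longleftrightarrow> cring R \<and>
     (\<forall>I. ideal I R \<longrightarrow> (\<exists>S. finite S \<and> S \<subseteq> carrier R \<and> I = Idl\<^bsub>R\<^esub> S))"

definition local_noetherian_ring :: "('a, 'b) ring_scheme \<Rightarrow> bool" where
  "local_noetherian_ring R \<longleftrightarrow> noetherian_ring R \<and> (\<exists>!I. maximalideal I R)"

definition max_ideal :: "('a, 'b) ring_scheme \<Rightarrow> 'a set" where
  "max_ideal R = (THE I. maximalideal I R)"

fun ideal_power :: "('a, 'b) ring_scheme \<Rightarrow> 'a set \<Rightarrow> nat \<Rightarrow> 'a set" where
  "ideal_power R I 0 = carrier R"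
| "ideal_power R I (Suc n) = ideal_prod R I (ideal_power R I n)"

text \<open>rank over the residue field k = R/m of the quotient N/Q, where N, Q are
  R-submodules of R with m N \<subseteq> Q \<subseteq> N: the least size of a subset S of N whose
  residue classes span N/Q over k (the k-span of the classes of S is the image of
  the R-span Idl S, since m acts trivially on N/Q).\<close>
definition rank_res :: "('a, 'b) ring_scheme \<Rightarrow> 'a set \<Rightarrow> 'a set \<Rightarrow> nat" where
  "rank_res R N Q = (LEAST c. \<exists>S. finite S \<and> card S = c \<and> S \<subseteq> N \<and>
      (\<forall>x\<in>N. \<exists>y\<in>Idl\<^bsub>R\<^esub> S. x \<ominus>\<^bsub>R\<^esub> y \<in> Q))"

definition hilbert_fun :: "('a, 'b) ring_scheme \<Rightarrow> nat \<Rightarrow> nat" where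
  "hilbert_fun R n = rank_res R (ideal_power R (max_ideal R) n)
                                (ideal_power R (max_ideal R) (Suc n))"

definition annihilator :: "('a, 'b) ring_scheme \<Rightarrow> 'a set \<Rightarrow> 'a set" where
  "annihilator R Y = {x. x \<in> carrier R \<and> (\<forall>y\<in>Y. x \<otimes>\<^bsub>R\<^esub> y = \<zero>\<^bsub>R\<^esub>)}"

definition socle_rank :: "('a, 'b) ring_scheme \<Rightarrow> nat" where
  "socle_rank R = rank_res R (annihilator R (max_ideal R)) {\<zero>\<^bsub>R\<^esub>}"

definition exact_zero_divisor :: "('a, 'b) ring_scheme \<Rightarrow> 'a \<Rightarrow> bool" where
  "exact_zero_divisor R a \<longleftrightarrow> a \<in> carrier R \<and>
     annihilator R {a} \<noteq> carrier R \<and>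
     carrier (R Quot (PIdl\<^bsub>R\<^esub> a)) \<noteq> {\<zero>\<^bsub>R Quot (PIdl\<^bsub>R\<^esub> a)\<^esub>} \<and>
     (\<exists>f. bij_betw f (annihilator R {a}) (carrier (R Quot (PIdl\<^bsub>R\<^esub> a))) \<and>
        (\<forall>x\<in>annihilator R {a}. \<forall>y\<in>annihilator R {a}.
            f (x \<oplus>\<^bsub>R\<^esub> y) = f x \<oplus>\<^bsub>R Quot (PIdl\<^bsub>R\<^esub> a)\<^esub> f y) \<and>
        (\<forall>r\<in>carrier R. \<forall>x\<in>annihilator R {a}.
            f (r \<otimes>\<^bsub>R\<^esub> x) = ((PIdl\<^bsub>R\<^esub> a) +>\<^bsub>R\<^esub> r) \<otimes>\<^bsub>R Quot (PIdl\<^bsub>R\<^esub> a)\<^esub> f x))"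

definition vecs :: "('a, 'b) ring_scheme \<Rightarrow> nat \<Rightarrow> (nat \<Rightarrow> 'a) set" where
  "vecs R n = {v. (\<forall>j<n. v j \<in> carrier R) \<and> (\<forall>j\<ge>n. v j = \<zero>\<^bsub>R\<^esub>)}"

definition zero_vec :: "('a, 'b) ring_scheme \<Rightarrow> nat \<Rightarrow> 'a" where
  "zero_vec R = (\<lambda>j. \<zero>\<^bsub>R\<^esub>)"

definition free_module :: "('a, 'b) ring_scheme \<Rightarrow> nat \<Rightarrow> ('a, nat \<Rightarrow> 'a) module" where
  "free_module R n = \<lparr>carrier = vecs R n, monoid.mult = (\<lambda>v w. undefined), monoid.one = undefined,
      ring.zero = zero_vec R, ring.add = (\<lambda>v w j. v j \<oplus>\<^bsub>R\<^esub> w j),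
      module.smult = (\<lambda>r v j. r \<otimes>\<^bsub>R\<^esub> v j)\<rparr>"

definition matvec :: "('a, 'b) ring_scheme \<Rightarrow> (nat \<Rightarrow> nat \<Rightarrow> 'a) \<Rightarrow> nat \<Rightarrow> nat
                       \<Rightarrow> (nat \<Rightarrow> 'a) \<Rightarrow> (nat \<Rightarrow> 'a)" where
  "matvec R A rows cols v =
     (\<lambda>i. if i < rows then (\<Oplus>\<^bsub>R\<^esub> j\<in>{..<cols}. A i j \<otimes>\<^bsub>R\<^esub> v j) else \<zero>\<^bsub>R\<^esub>)"

definition linear_map :: "('a, 'b) ring_scheme \<Rightarrow> ('a, 'c) module \<Rightarrow> ('a, 'd) module
                           \<Rightarrow> ('c \<Rightarrow> 'd) \<Rightarrow> bool" where
  "linear_map R M N f \<longleftrightarrow> f \<in> carrier M \<rightarrow> carrier N \<and>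
     (\<forall>x\<in>carrier M. \<forall>y\<in>carrier M. f (x \<oplus>\<^bsub>M\<^esub> y) = f x \<oplus>\<^bsub>N\<^esub> f y) \<and>
     (\<forall>r\<in>carrier R. \<forall>x\<in>carrier M. f (r \<odot>\<^bsub>M\<^esub> x) = r \<odot>\<^bsub>N\<^esub> f x)"

definition finitely_generated_module :: "('a, 'b) ring_scheme \<Rightarrow> ('a, 'c) module \<Rightarrow> bool" where
  "finitely_generated_module R M \<longleftrightarrow> module R M \<and>
     (\<exists>(n::nat) g. (\<forall>i<n. g i \<in> carrier M) \<and>
        (\<forall>x\<in>carrier M. \<exists>c. (\<forall>i<n. c i \<in> carrier R) \<and>
            x = (\<Oplus>\<^bsub>M\<^esub> i\<in>{..<n}. c i \<odot>\<^bsub>M\<^esub> g i)))"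

definition min_free_resolution ::
  "('a, 'b) ring_scheme \<Rightarrow> ('a, 'c) module \<Rightarrow> (nat \<Rightarrow> nat) \<Rightarrow> (nat \<Rightarrow> nat \<Rightarrow> nat \<Rightarrow> 'a)
     \<Rightarrow> ((nat \<Rightarrow> 'a) \<Rightarrow> 'c) \<Rightarrow> bool" where
  "min_free_resolution R M b d \<epsilon> \<longleftrightarrow>
     (\<forall>i\<ge>1. \<forall>p<b (i - 1). \<forall>q<b i. d i p q \<in> max_ideal R) \<and>
     (\<forall>i\<ge>1. \<forall>w\<in>vecs R (b (i + 1)).
        matvec R (d i) (b (i - 1)) (b i) (matvec R (d (i + 1)) (b i) (b (i + 1)) w) = zero_vec R) \<and>
     (\<forall>i\<ge>1. \<forall>v\<in>vecs R (b i). matvec R (d i) (b (i - 1)) (b i) v = zero_vec R \<longrightarrow>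
        (\<exists>w\<in>vecs R (b (i + 1)). v = matvec R (d (i + 1)) (b i) (b (i + 1)) w)) \<and>
     linear_map R (free_module R (b 0)) M \<epsilon> \<and>
     \<epsilon> ` vecs R (b 0) = carrier M \<and>
     {v \<in> vecs R (b 0). \<epsilon> v = \<zero>\<^bsub>M\<^esub>} = matvec R (d 1) (b 0) (b 1) ` vecs R (b 1)"

text \<open>Acyclicity of the linear part lin(F) of the resolution: lin(F)_i = gr(F_i)(-i),
  whose internal degree (i+p) component is (m^p/m^(p+1))^(b i), with differential
  induced by the entries of d i modulo m^2. Acyclic = H_i(lin F) = 0 for i \<ge> 1,
  checked in each internal degree (the degree p-1 part is 0 for p = 0).\<close>
definition linear_part_acyclic ::
  "('a, 'b) ring_scheme \<Rightarrow> (nat \<Rightarrow> nat) \<Rightarrow> (nat \<Rightarrow> nat \<Rightarrow> nat \<Rightarrow> 'a) \<Rightarrow> bool" where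
  "linear_part_acyclic R b d \<longleftrightarrow>
     (\<forall>i\<ge>1. \<forall>p. \<forall>v\<in>vecs R (b i).
        (\<forall>q<b i. v q \<in> ideal_power R (max_ideal R) p) \<and>
        (\<forall>r<b (i - 1). matvec R (d i) (b (i - 1)) (b i) v r \<in> ideal_power R (max_ideal R) (p + 2))
        \<longrightarrow> (\<exists>w\<in>vecs R (b (i + 1)).
              (p = 0 \<longrightarrow> w = zero_vec R) \<and>
              (\<forall>q<b (i + 1). w q \<in> ideal_power R (max_ideal R) (p - 1)) \<and>
              (\<forall>q<b i. v q \<ominus>\<^bsub>R\<^esub> matvec R (d (i + 1)) (b i) (b (i + 1)) w q
                          \<in> ideal_power R (max_ideal R) (p + 1))))"

text \<open>Koszul module: the linear part of a minimal free resolution is acyclic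
  (equivalent to gr_m(M) having a linear resolution over gr_m(R)).\<close>
definition koszul_module :: "('a, 'b) ring_scheme \<Rightarrow> ('a, 'c) module \<Rightarrow> bool" where
  "koszul_module R M \<longleftrightarrow> finitely_generated_module R M \<and>
     (\<exists>b d \<epsilon>. min_free_resolution R M b d \<epsilon> \<and> linear_part_acyclic R b d)"

definition residue_module :: "('a, 'b) ring_scheme \<Rightarrow> ('a, 'a set) module" where
  "residue_module R = \<lparr>carrier = carrier (R Quot (max_ideal R)),
      monoid.mult = monoid.mult (R Quot (max_ideal R)), monoid.one = monoid.one (R Quot (max_ideal R)),
      ring.zero = ring.zero (R Quot (max_ideal R)), ring.add = ring.add (R Quot (max_ideal R)),
      module.smult = (\<lambda>r C. rcoset_mult R (max_ideal R) ((max_ideal R) +>\<^bsub>R\<^esub> r) C)\<rparr>"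

definition koszul_ring :: "('a, 'b) ring_scheme \<Rightarrow> bool" where
  "koszul_ring R \<longleftrightarrow> koszul_module R (residue_module R)"

text \<open>The n-th syzygy module (n \<ge> 1) of a resolution, realised as the image of
  d n inside R^(b (n-1)) (isomorphic to the cokernel of d (n+1)).\<close>
definition syzygy_module :: "('a, 'b) ring_scheme \<Rightarrow> (nat \<Rightarrow> nat) \<Rightarrow> (nat \<Rightarrow> nat \<Rightarrow> nat \<Rightarrow> 'a)
     \<Rightarrow> nat \<Rightarrow> ('a, nat \<Rightarrow> 'a) module" where
  "syzygy_module R b d n = (free_module R (b (n - 1)))
      \<lparr>carrier := matvec R (d n) (b (n - 1)) (b n) ` vecs R (b n)\<rparr>"

end

theory Submission
  imports Defs
begin

text \<open>Write \<open>\<mm>\<close> for the maximal ideal. Since \<open>\<mm>\<^sup>4 = 0\<close>, everything is controlled by lengths. The exact zero divisor \<open>a\<close>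
  has a partner \<open>a'\<close> such that \<open>a R\<close> and \<open>a' R\<close> annihilate each other exactly. If \<open>Y\<close> is the set of \<open>u \<in> \<mm>\<close> with
  \<open>u \<mm> \<subseteq> a R\<close>, then the socle is \<open>a' Y\<close> and \<open>\<mm> / Y\<close> has length \<open>e - s\<close> (when \<open>a, a' \<notin> \<mm>\<^sup>2\<close>, as is the case for
  \<open>e \<ge> 3\<close>).

  If \<open>e \<le> s + 1\<close>, then \<open>\<mm>\<close> is generated by \<open>Y\<close> and one element \<open>x\<close>, and a power of \<open>x\<close> gives a relation of the
  associated graded ring that is not a consequence of the quadratic ones; so \<open>R\<close> is not Koszul. The small cases with
  \<open>a \<in> \<mm>\<^sup>2\<close> or \<open>a' \<in> \<mm>\<^sup>2\<close> are excluded by the same kind of relation.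

  If \<open>e \<ge> s + 2\<close>, there are \<open>c, c' \<in> \<mm> - Y\<close> with \<open>c c' \<in> a \<mm>\<close>, and \<open>\<mm>\<^sup>2 = a \<mm> + c \<mm> = a \<mm> + c' \<mm>\<close>. In a minimal
  resolution \<open>F\<close> with differential \<open>d\<close>, an element \<open>w\<close> of \<open>F_n\<close> with \<open>d w \<in> \<mm>\<^sup>2 F\<close> extends to a cycle with values in
  the Tate complex on \<open>a, a', c, c'\<close>. A chain condition for the possible tails of such cycles in \<open>F_0\<close> forces
  \<open>w \<in> \<mm> F_n\<close> for large \<open>n\<close>. For these \<open>n\<close> the alternating sum of the Hilbert function of the \<open>n\<close>-th syzygy is
  non-increasing, and it is bounded below because the homology of multiplication by \<open>a, a'\<close> on the syzygies has constant
  length. Hence it is eventually constant, which means \<open>\<mm>\<^sup>3 F_n = d (\<mm>\<^sup>2 F_(n+1))\<close>. The two facts together are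
  acyclicity of the linear part. For the residue field both hold from the start.\<close>

section \<open>Length in modular lattices of sets\<close>

locale modular_lattice_of_sets =
  fixes L :: "'v set set" and join :: "'v set \<Rightarrow> 'v set \<Rightarrow> 'v set" (infixl "\<uplus>" 65)
  assumes Int_closed: "A \<in> L \<Longrightarrow> B \<in> L \<Longrightarrow> A \<inter> B \<in> L"
    and join_closed: "A \<in> L \<Longrightarrow> B \<in> L \<Longrightarrow> A \<uplus> B \<in> L"
    and join_upper1: "A \<in> L \<Longrightarrow> B \<in> L \<Longrightarrow> A \<subseteq> A \<uplus> B"
    and join_upper2: "A \<in> L \<Longrightarrow> B \<in> L \<Longrightarrow> B \<subseteq> A \<uplus> B"
    and join_least: "A \<in> L \<Longrightarrow> B \<in> L \<Longrightarrow> C \<in> L \<Longrightarrow> A \<subseteq> C \<Longrightarrow> B \<subseteq> C \<Longrightarrow> A \<uplus> B \<subseteq> C"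
    and modular_le: "A \<in> L \<Longrightarrow> B \<in> L \<Longrightarrow> C \<in> L \<Longrightarrow> A \<subseteq> C \<Longrightarrow> (A \<uplus> B) \<inter> C \<subseteq> A \<uplus> (B \<inter> C)"
begin

lemma join_absorb1: "A \<in> L \<Longrightarrow> B \<in> L \<Longrightarrow> B \<subseteq> A \<Longrightarrow> A \<uplus> B = A"
  using join_upper1 join_least by blast

lemma join_absorb2: "A \<in> L \<Longrightarrow> B \<in> L \<Longrightarrow> A \<subseteq> B \<Longrightarrow> A \<uplus> B = B"
  using join_upper2 join_least by blast

lemma join_commute: "A \<in> L \<Longrightarrow> B \<in> L \<Longrightarrow> A \<uplus> B = B \<uplus> A"
  using join_upper1 join_upper2 join_least join_closed by (meson subset_antisym)

lemma modular_law:
  assumes "A \<in> L" "B \<in> L" "C \<in> L" "A \<subseteq> C"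
  shows "(A \<uplus> B) \<inter> C = A \<uplus> (B \<inter> C)"
proof
  have "A \<uplus> (B \<inter> C) \<subseteq> A \<uplus> B"
    using join_upper1[OF assms(1,2)] join_upper2[OF assms(1,2)]
    by (intro join_least assms Int_closed join_closed) blast+
  moreover have "A \<uplus> (B \<inter> C) \<subseteq> C"
    by (rule join_least) (use assms Int_closed in auto)
  ultimately show "A \<uplus> (B \<inter> C) \<subseteq> (A \<uplus> B) \<inter> C" by blast
qed (rule modular_le[OF assms])

definition covers :: "'v set \<Rightarrow> 'v set \<Rightarrow> bool" where
  "covers A B \<longleftrightarrow> A \<in> L \<and> B \<in> L \<and> A \<subset> B \<and> (\<forall>D\<in>L. A \<subseteq> D \<longrightarrow> D \<subseteq> B \<longrightarrow> D = A \<or> D = B)"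

lemma coversI:
  assumes "A \<in> L" "B \<in> L" "A \<subseteq> B" "A \<noteq> B"
    and "\<And>D. D \<in> L \<Longrightarrow> A \<subseteq> D \<Longrightarrow> D \<subseteq> B \<Longrightarrow> D = A \<or> D = B"
  shows "covers A B"
  unfolding covers_def psubset_eq using assms by blast

lemma coversD:
  assumes "covers A B"
  shows "A \<in> L" "B \<in> L" "A \<subseteq> B" "A \<noteq> B"
    and "D \<in> L \<Longrightarrow> A \<subseteq> D \<Longrightarrow> D \<subseteq> B \<Longrightarrow> D = A \<or> D = B"
  using assms unfolding covers_def psubset_eq by blast+

lemma covers_diamond:
  assumes A: "A \<in> L" and B: "B \<in> L"
  shows "covers (A \<inter> B) A \<longleftrightarrow> covers B (A \<uplus> B)"
proof
  note J = join_closed[OF A B] and M = Int_closed[OF A B]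
  have sub: "A \<subseteq> A \<uplus> B" "B \<subseteq> A \<uplus> B" using join_upper1[OF A B] join_upper2[OF A B] .
  {
    assume cov: "covers (A \<inter> B) A"
    have "E = B \<or> E = A \<uplus> B" if E: "E \<in> L" "B \<subseteq> E" "E \<subseteq> A \<uplus> B" for E
    proof -
      have "B \<uplus> (A \<inter> E) = (B \<uplus> A) \<inter> E" using modular_law[OF B A E(1,2)] by simp
      also have "\<dots> = E" using E(3) join_commute[OF A B] by blast
      finally have "B \<uplus> (A \<inter> E) = E" .
      moreover have "A \<inter> E = A \<inter> B \<or> A \<inter> E = A"
        using coversD(5)[OF cov Int_closed[OF A E(1)]] E(2) by blast
      moreover have "B \<uplus> (A \<inter> B) = B" using join_absorb1[OF B M] by blast
      ultimately show ?thesis by (metis join_commute[OF A B])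
    qed
    moreover have "A \<uplus> B \<noteq> B" using coversD(4)[OF cov] sub by blast
    ultimately show "covers B (A \<uplus> B)" using coversI[OF B J] sub by blast
  next
    assume cov: "covers B (A \<uplus> B)"
    have "D = A \<inter> B \<or> D = A" if D: "D \<in> L" "A \<inter> B \<subseteq> D" "D \<subseteq> A" for D
    proof -
      have "(D \<uplus> B) \<inter> A = D \<uplus> (B \<inter> A)" by (rule modular_law[OF D(1) B A D(3)])
      also have "\<dots> = D" using join_absorb1[OF D(1) M D(2)] by (simp add: Int_commute)
      finally have "(D \<uplus> B) \<inter> A = D" .
      moreover have "D \<uplus> B \<subseteq> A \<uplus> B" by (rule join_least[OF D(1) B J]) (use D sub in auto)
      then have "D \<uplus> B = B \<or> D \<uplus> B = A \<uplus> B"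
        using coversD(5)[OF cov join_closed[OF D(1) B] join_upper2[OF D(1) B]] by blast
      ultimately show ?thesis using sub by blast
    qed
    moreover have "A \<inter> B \<noteq> A" using coversD(4)[OF cov] join_absorb2[OF A B] by auto
    ultimately show "covers (A \<inter> B) A" using coversI[OF M A] by blast
  }
qed

lemma join_join_absorb:
  assumes A: "A \<in> L" and B: "B \<in> L" and C: "C \<in> L" and AB: "A \<subseteq> B"
  shows "B \<uplus> (A \<uplus> C) = B \<uplus> C"
proof
  note AC = join_closed[OF A C]
  show "B \<uplus> (A \<uplus> C) \<subseteq> B \<uplus> C"
    using join_closed[OF B C] join_upper1[OF B C] join_upper2[OF B C] A B C AB AC by (intro join_least) blast+
  show "B \<uplus> C \<subseteq> B \<uplus> (A \<uplus> C)"
    using join_upper1[OF B AC] join_upper2[OF B AC] join_upper2[OF A C] join_closed[OF B AC]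
    by (intro join_least[OF B C]) blast+
qed

lemma covers_Int_join:
  assumes cov: "covers A B" and C: "C \<in> L"
  shows "A \<inter> C = B \<inter> C \<and> covers (A \<uplus> C) (B \<uplus> C) \<or> covers (A \<inter> C) (B \<inter> C) \<and> A \<uplus> C = B \<uplus> C"
proof -
  note A = coversD(1)[OF cov] and B = coversD(2)[OF cov] and AB = coversD(3)[OF cov]
  have BC: "B \<inter> C \<in> L" and AC: "A \<uplus> C \<in> L" using Int_closed[OF B C] join_closed[OF A C] .
  have "A \<uplus> (B \<inter> C) \<subseteq> B" by (rule join_least[OF A BC B AB]) blast
  then have "A \<uplus> (B \<inter> C) = A \<or> A \<uplus> (B \<inter> C) = B"
    using coversD(5)[OF cov join_closed[OF A BC] join_upper1[OF A BC]] by blast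
  then show ?thesis
  proof
    assume eqA: "A \<uplus> (B \<inter> C) = A"
    have "B \<inter> (A \<uplus> C) = A"
      using modular_law[OF A C B AB] eqA by (simp add: Int_commute)
    then have "covers (A \<uplus> C) (B \<uplus> (A \<uplus> C))" using covers_diamond[OF B AC] cov by simp
    moreover have "B \<uplus> (A \<uplus> C) = B \<uplus> C" by (rule join_join_absorb[OF A B C AB])
    moreover have "A \<inter> C = B \<inter> C" using join_upper2[OF A BC] eqA AB by blast
    ultimately show ?thesis by simp
  next
    assume eqB: "A \<uplus> (B \<inter> C) = B"
    then have "covers (B \<inter> C \<inter> A) (B \<inter> C)"
      using covers_diamond[OF BC A] cov unfolding join_commute[OF BC A] by simp
    moreover have "B \<inter> C \<inter> A = A \<inter> C" using AB by blast
    moreover have "A \<uplus> C = B \<uplus> C"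
    proof
      show "A \<uplus> C \<subseteq> B \<uplus> C"
        using join_upper1[OF B C] join_upper2[OF B C] AB join_closed[OF B C]
        by (intro join_least[OF A C]) blast+
      have "A \<uplus> (B \<inter> C) \<subseteq> A \<uplus> C"
        using join_upper1[OF A C] join_upper2[OF A C] by (intro join_least[OF A BC AC]) blast+
      then show "B \<uplus> C \<subseteq> A \<uplus> C" using eqB join_upper2[OF A C] by (intro join_least[OF B C AC]) simp_all
    qed
    ultimately show ?thesis by simp
  qed
qed

inductive has_length :: "'v set \<Rightarrow> 'v set \<Rightarrow> nat \<Rightarrow> bool" for A where
  has_length_0: "A \<in> L \<Longrightarrow> has_length A A 0"
| has_length_Suc: "has_length A B n \<Longrightarrow> covers B C \<Longrightarrow> has_length A C (Suc n)"

lemma has_lengthD: "has_length A B n \<Longrightarrow> A \<in> L \<and> B \<in> L \<and> A \<subseteq> B"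
  by (induction rule: has_length.induct) (auto simp: covers_def)

lemma has_length_covers: "covers A B \<Longrightarrow> has_length A B 1"
  using has_length_Suc[OF has_length_0] by (auto simp: covers_def)

lemma has_length_0_imp_eq: "has_length A B 0 \<Longrightarrow> A = B"
  by (erule has_length.cases) auto

lemma has_length_split:
  assumes "has_length A B n" "C \<in> L"
  shows "\<exists>p q. has_length (A \<inter> C) (B \<inter> C) p \<and> has_length (A \<uplus> C) (B \<uplus> C) q \<and> p + q = n"
  using assms(1)
proof (induction rule: has_length.induct)
  case has_length_0
  then have "has_length (A \<inter> C) (A \<inter> C) 0" "has_length (A \<uplus> C) (A \<uplus> C) 0"
    using assms(2) Int_closed join_closed has_length.has_length_0 by auto
  then show ?case by (intro exI[of _ 0]) simp
next
  case (has_length_Suc B n D)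
  then obtain p q where pq: "has_length (A \<inter> C) (B \<inter> C) p" "has_length (A \<uplus> C) (B \<uplus> C) q" "p + q = n"
    by blast
  from covers_Int_join[OF has_length_Suc.hyps(2) assms(2)] show ?case
  proof
    assume step: "B \<inter> C = D \<inter> C \<and> covers (B \<uplus> C) (D \<uplus> C)"
    have "has_length (A \<uplus> C) (D \<uplus> C) (Suc q)" using has_length.has_length_Suc[OF pq(2)] step by blast
    then show ?thesis using pq step by (intro exI[of _ p] exI[of _ "Suc q"]) auto
  next
    assume step: "covers (B \<inter> C) (D \<inter> C) \<and> B \<uplus> C = D \<uplus> C"
    have "has_length (A \<inter> C) (D \<inter> C) (Suc p)" using has_length.has_length_Suc[OF pq(1)] step by blast
    then show ?thesis using pq step by (intro exI[of _ "Suc p"] exI[of _ q]) auto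
  qed
qed

lemma has_length_refl_eq_0: "has_length A A n \<Longrightarrow> n = 0"
  by (erule has_length.cases) (auto dest: has_lengthD simp: covers_def)

lemma has_length_covers_eq_1: "covers A B \<Longrightarrow> has_length A B n \<Longrightarrow> n = 1"
proof (erule has_length.cases)
  fix D m C assume h: "covers A B" "B = C" "n = Suc m" "has_length A D m" "covers D C"
  then have "D = A" using has_lengthD[OF h(4)] unfolding covers_def by blast
  then show ?thesis using h has_length_refl_eq_0 by auto
qed (auto simp: covers_def)

theorem has_length_unique: "has_length A B n \<Longrightarrow> has_length A B m \<Longrightarrow> n = m"
proof (induction arbitrary: m rule: has_length.induct)
  case has_length_0
  then show ?case using has_length_refl_eq_0 by blast
next
  case (has_length_Suc B n C)
  have L: "A \<in> L" "B \<in> L" "A \<subseteq> B" "C \<in> L" "B \<subseteq> C"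
    using has_lengthD[OF has_length_Suc.hyps(1)] has_length_Suc.hyps(2) by (auto simp: covers_def)
  obtain p q where pq: "has_length (A \<inter> B) (C \<inter> B) p" "has_length (A \<uplus> B) (C \<uplus> B) q" "p + q = m"
    using has_length_split[OF has_length_Suc.prems L(2)] by blast
  have "A \<inter> B = A" "C \<inter> B = B" "A \<uplus> B = B" "C \<uplus> B = C" using L join_absorb1 join_absorb2 by auto
  then have "p = n" "q = 1" using pq has_length_Suc.IH has_length_covers_eq_1[OF has_length_Suc.hyps(2)] by auto
  then show ?case using pq by simp
qed

lemma has_length_trans: "has_length B C m \<Longrightarrow> has_length A B n \<Longrightarrow> has_length A C (n + m)"
  by (induction rule: has_length.induct) (auto intro: has_length_Suc)

lemma has_length_between:
  assumes "has_length Z T N" "A \<in> L" "B \<in> L" "Z \<subseteq> A" "A \<subseteq> B" "B \<subseteq> T"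
  shows "\<exists>n. has_length A B n"
proof -
  have ZT: "Z \<in> L" "T \<in> L" using has_lengthD[OF assms(1)] by auto
  obtain p where "has_length (Z \<inter> B) (T \<inter> B) p" using has_length_split[OF assms(1,3)] by blast
  moreover have "Z \<inter> B = Z" "T \<inter> B = B" using assms by auto
  ultimately have "has_length Z B p" by simp
  then obtain q where "has_length (Z \<uplus> A) (B \<uplus> A) q" using has_length_split assms(2) by blast
  moreover have "Z \<uplus> A = A" "B \<uplus> A = B" using assms ZT join_absorb1 join_absorb2 by auto
  ultimately show ?thesis by auto
qed

definition len :: "'v set \<Rightarrow> 'v set \<Rightarrow> nat" where
  "len A B = (THE n. has_length A B n)"

lemma len_eq: "has_length A B n \<Longrightarrow> len A B = n"
  unfolding len_def using has_length_unique by blast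

lemma len_refl [simp]: "A \<in> L \<Longrightarrow> len A A = 0"
  by (intro len_eq has_length_0)

end

locale finite_length_lattice_of_sets = modular_lattice_of_sets +
  fixes bottom top
  assumes bounds: "A \<in> L \<Longrightarrow> bottom \<subseteq> A \<and> A \<subseteq> top"
    and finite_length: "\<exists>n. has_length bottom top n"
begin

lemma has_length_len: "A \<in> L \<Longrightarrow> B \<in> L \<Longrightarrow> A \<subseteq> B \<Longrightarrow> has_length A B (len A B)"
  using finite_length bounds has_length_between len_eq by metis

lemma len_add:
  "A \<in> L \<Longrightarrow> B \<in> L \<Longrightarrow> C \<in> L \<Longrightarrow> A \<subseteq> B \<Longrightarrow> B \<subseteq> C \<Longrightarrow> len A C = len A B + len B C"
  by (rule len_eq[OF has_length_trans[of B C "len B C" A "len A B", OF has_length_len has_length_len]])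

lemma len_diamond:
  assumes A: "A \<in> L" and B: "B \<in> L"
  shows "len (A \<inter> B) A = len B (A \<uplus> B)"
proof -
  have AB: "A \<inter> B \<in> L" using Int_closed[OF A B] .
  obtain p q where pq: "has_length (A \<inter> B \<inter> B) (A \<inter> B) p" "has_length ((A \<inter> B) \<uplus> B) (A \<uplus> B) q"
    "p + q = len (A \<inter> B) A" using has_length_split[OF has_length_len[OF AB A] B] by blast
  have "p = 0" using pq(1) has_length_refl_eq_0 by (simp add: Int_assoc)
  moreover have "(A \<inter> B) \<uplus> B = B" using AB B join_absorb2 by auto
  ultimately show ?thesis using pq len_eq by auto
qed

lemma len_eq_0_iff: "A \<in> L \<Longrightarrow> B \<in> L \<Longrightarrow> A \<subseteq> B \<Longrightarrow> len A B = 0 \<longleftrightarrow> A = B"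
  using has_length_len[of A B] has_length_0_imp_eq[of A B] by auto

lemma len_mono:
  "A \<in> L \<Longrightarrow> B \<in> L \<Longrightarrow> C \<in> L \<Longrightarrow> D \<in> L \<Longrightarrow> A \<subseteq> B \<Longrightarrow> B \<subseteq> C \<Longrightarrow> C \<subseteq> D \<Longrightarrow> len B C \<le> len A D"
  using len_add[of A B D] len_add[of B C D] by auto

lemma len_eq_1_imp_covers:
  assumes "A \<in> L" "B \<in> L" "A \<subseteq> B" "len A B = 1"
  shows "covers A B"
proof -
  have "has_length A B (Suc 0)" using has_length_len[OF assms(1-3)] assms(4) by simp
  then show ?thesis by cases (use has_length_0_imp_eq in blast)
qed

end

section \<open>Submodules and their quotients\<close>

lemma submodule_subset: "submodule A R M \<Longrightarrow> A \<subseteq> carrier M"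
  and submodule_zero: "submodule A R M \<Longrightarrow> \<zero>\<^bsub>M\<^esub> \<in> A"
  and submodule_add: "submodule A R M \<Longrightarrow> x \<in> A \<Longrightarrow> y \<in> A \<Longrightarrow> x \<oplus>\<^bsub>M\<^esub> y \<in> A"
  and submodule_smult: "submodule A R M \<Longrightarrow> r \<in> carrier R \<Longrightarrow> x \<in> A \<Longrightarrow> r \<odot>\<^bsub>M\<^esub> x \<in> A"
  using subgroup.subset[OF submodule.axioms(1), of A R M] subgroup.one_closed[OF submodule.axioms(1), of A R M]
    subgroup.m_closed[OF submodule.axioms(1), of A R M] submodule.smult_closed[of A R M]
  by auto

lemma submodule_carrier: "submodule A R M \<Longrightarrow> x \<in> A \<Longrightarrow> x \<in> carrier M"
  using submodule_subset by blast

lemma set_add_iff: "z \<in> A <+>\<^bsub>M\<^esub> B \<longleftrightarrow> (\<exists>x\<in>A. \<exists>y\<in>B. z = x \<oplus>\<^bsub>M\<^esub> y)"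
  by (auto simp: set_add_def')

lemma set_addI: "x \<in> A \<Longrightarrow> y \<in> B \<Longrightarrow> x \<oplus>\<^bsub>M\<^esub> y \<in> A <+>\<^bsub>M\<^esub> B"
  by (auto simp: set_add_iff)

lemma set_add_mono: "A \<subseteq> A' \<Longrightarrow> B \<subseteq> B' \<Longrightarrow> A <+>\<^bsub>M\<^esub> B \<subseteq> A' <+>\<^bsub>M\<^esub> B'"
  unfolding set_add_def' by blast

definition cyclic_submodule :: "('a, 'b) ring_scheme \<Rightarrow> ('a, 'c, 'd) module_scheme \<Rightarrow> 'c \<Rightarrow> 'c set" where
  "cyclic_submodule R M x = (\<lambda>r. r \<odot>\<^bsub>M\<^esub> x) ` carrier R"

text \<open>For submodules \<open>A \<subseteq> B\<close>, the next two notions speak of the length of \<open>B/A\<close>; the third says that \<open>B/A\<close> is simple.\<close>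

abbreviation has_quotient_length ::
  "('a, 'b) ring_scheme \<Rightarrow> ('a, 'c, 'd) module_scheme \<Rightarrow> 'c set \<Rightarrow> 'c set \<Rightarrow> nat \<Rightarrow> bool" where
  "has_quotient_length R M \<equiv> modular_lattice_of_sets.has_length {A. submodule A R M}"

abbreviation quotient_length ::
  "('a, 'b) ring_scheme \<Rightarrow> ('a, 'c, 'd) module_scheme \<Rightarrow> 'c set \<Rightarrow> 'c set \<Rightarrow> nat" where
  "quotient_length R M \<equiv> modular_lattice_of_sets.len {A. submodule A R M}"

abbreviation simple_quotient ::
  "('a, 'b) ring_scheme \<Rightarrow> ('a, 'c, 'd) module_scheme \<Rightarrow> 'c set \<Rightarrow> 'c set \<Rightarrow> bool" where
  "simple_quotient R M \<equiv> modular_lattice_of_sets.covers {A. submodule A R M}"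

context module
begin

lemma submoduleI_smult:
  assumes A: "A \<subseteq> carrier M" and zero: "\<zero>\<^bsub>M\<^esub> \<in> A"
    and add: "\<And>x y. x \<in> A \<Longrightarrow> y \<in> A \<Longrightarrow> x \<oplus>\<^bsub>M\<^esub> y \<in> A"
    and smult: "\<And>r x. r \<in> carrier R \<Longrightarrow> x \<in> A \<Longrightarrow> r \<odot>\<^bsub>M\<^esub> x \<in> A"
  shows "submodule A R M"
proof (rule submoduleI[OF A zero _ add smult])
  fix x assume x: "x \<in> A"
  then have "(\<ominus> \<one>) \<odot>\<^bsub>M\<^esub> x = \<ominus>\<^bsub>M\<^esub> x" using smult_l_minus[of \<one> x] A by auto
  then show "\<ominus>\<^bsub>M\<^esub> x \<in> A" using smult[of "\<ominus> \<one>" x] x by simp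
qed

lemma submodule_minus: "submodule A R M \<Longrightarrow> x \<in> A \<Longrightarrow> y \<in> A \<Longrightarrow> x \<ominus>\<^bsub>M\<^esub> y \<in> A"
  unfolding a_minus_def by (intro submodule_add submoduleE(3))

lemma submodule_add_cancel:
  assumes A: "submodule A R M" "x \<in> A" and y: "y \<in> carrier M" and xy: "x \<oplus>\<^bsub>M\<^esub> y \<in> A"
  shows "y \<in> A"
proof -
  have "\<ominus>\<^bsub>M\<^esub> x \<oplus>\<^bsub>M\<^esub> (x \<oplus>\<^bsub>M\<^esub> y) \<in> A" by (rule submodule_add[OF A(1) submoduleE(3)[OF A] xy])
  then show ?thesis using submodule_carrier[OF A] y by (simp add: M.r_neg1)
qed

lemma minus_add_cancel: "x \<in> carrier M \<Longrightarrow> y \<in> carrier M \<Longrightarrow> y \<oplus>\<^bsub>M\<^esub> (x \<ominus>\<^bsub>M\<^esub> y) = x"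
  by (simp add: a_minus_def M.a_lcomm M.r_neg)

lemma minus_eq_zero_iff:
  assumes x: "x \<in> carrier M" and y: "y \<in> carrier M"
  shows "x \<ominus>\<^bsub>M\<^esub> y = \<zero>\<^bsub>M\<^esub> \<longleftrightarrow> x = y"
  using minus_add_cancel[OF x y] y by (auto simp: a_minus_def M.r_neg)

lemma zero_submodule: "submodule {\<zero>\<^bsub>M\<^esub>} R M"
  by (auto intro!: submoduleI_smult)

lemma submodule_Int: "submodule A R M \<Longrightarrow> submodule B R M \<Longrightarrow> submodule (A \<inter> B) R M"
  by (rule submoduleI_smult) (auto simp: submodule_zero submodule_add submodule_smult submodule_carrier)

lemma submodule_set_add:
  assumes A: "submodule A R M" and B: "submodule B R M"
  shows "submodule (A <+>\<^bsub>M\<^esub> B) R M"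
proof (rule submoduleI_smult)
  show "A <+>\<^bsub>M\<^esub> B \<subseteq> carrier M" using submodule_subset[OF A] submodule_subset[OF B] by (rule M.set_add_closed)
  show "\<zero>\<^bsub>M\<^esub> \<in> A <+>\<^bsub>M\<^esub> B" using set_addI[OF submodule_zero[OF A] submodule_zero[OF B], of M] by simp
next
  fix z w assume "z \<in> A <+>\<^bsub>M\<^esub> B" "w \<in> A <+>\<^bsub>M\<^esub> B"
  then obtain x y x' y' where h: "x \<in> A" "y \<in> B" "x' \<in> A" "y' \<in> B"
    and zw: "z = x \<oplus>\<^bsub>M\<^esub> y" "w = x' \<oplus>\<^bsub>M\<^esub> y'" by (auto simp: set_add_iff)
  have "z \<oplus>\<^bsub>M\<^esub> w = (x \<oplus>\<^bsub>M\<^esub> x') \<oplus>\<^bsub>M\<^esub> (y \<oplus>\<^bsub>M\<^esub> y')"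
    using h zw submodule_carrier[OF A] submodule_carrier[OF B] by (simp add: M.a_ac)
  also have "\<dots> \<in> A <+>\<^bsub>M\<^esub> B" by (intro set_addI submodule_add[OF A] submodule_add[OF B] h)
  finally show "z \<oplus>\<^bsub>M\<^esub> w \<in> A <+>\<^bsub>M\<^esub> B" .
next
  fix r z assume r: "r \<in> carrier R" and "z \<in> A <+>\<^bsub>M\<^esub> B"
  then obtain x y where h: "x \<in> A" "y \<in> B" and z: "z = x \<oplus>\<^bsub>M\<^esub> y" by (auto simp: set_add_iff)
  have "r \<odot>\<^bsub>M\<^esub> z = r \<odot>\<^bsub>M\<^esub> x \<oplus>\<^bsub>M\<^esub> r \<odot>\<^bsub>M\<^esub> y"
    using h z r submodule_carrier[OF A] submodule_carrier[OF B] by (simp add: smult_r_distr)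
  also have "\<dots> \<in> A <+>\<^bsub>M\<^esub> B" by (intro set_addI submodule_smult[OF A r] submodule_smult[OF B r] h)
  finally show "r \<odot>\<^bsub>M\<^esub> z \<in> A <+>\<^bsub>M\<^esub> B" .
qed

lemma set_add_assoc:
  assumes "submodule A R M" "submodule B R M" "submodule C R M"
  shows "(A <+>\<^bsub>M\<^esub> B) <+>\<^bsub>M\<^esub> C = A <+>\<^bsub>M\<^esub> (B <+>\<^bsub>M\<^esub> C)"
  unfolding set_add_def using assms by (intro M.add.set_mult_assoc) (auto dest: submodule_carrier)

lemma set_add_upper1:
  assumes A: "submodule A R M" and B: "submodule B R M"
  shows "A \<subseteq> A <+>\<^bsub>M\<^esub> B"
  using set_addI[OF _ submodule_zero[OF B], of _ A M] submodule_carrier[OF A] by (fastforce simp: subset_iff)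

lemma set_add_upper2:
  assumes A: "submodule A R M" and B: "submodule B R M"
  shows "B \<subseteq> A <+>\<^bsub>M\<^esub> B"
  using set_addI[OF submodule_zero[OF A], of _ B M] submodule_carrier[OF B] by (fastforce simp: subset_iff)

lemma set_add_least: "submodule C R M \<Longrightarrow> A \<subseteq> C \<Longrightarrow> B \<subseteq> C \<Longrightarrow> A <+>\<^bsub>M\<^esub> B \<subseteq> C"
  by (auto simp: set_add_iff intro!: submodule_add)

lemma modular_lattice_submodules: "modular_lattice_of_sets {A. submodule A R M} (set_add M)"
proof (unfold_locales; simp add: submodule_Int submodule_set_add set_add_upper1 set_add_upper2 set_add_least)
  fix A B C assume h: "submodule A R M" "submodule B R M" "submodule C R M" "A \<subseteq> C"
  show "(A <+>\<^bsub>M\<^esub> B) \<inter> C \<subseteq> A <+>\<^bsub>M\<^esub> (B \<inter> C)"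
  proof
    fix z assume "z \<in> (A <+>\<^bsub>M\<^esub> B) \<inter> C"
    then obtain x y where xy: "x \<in> A" "y \<in> B" "z = x \<oplus>\<^bsub>M\<^esub> y" "z \<in> C" by (auto simp: set_add_iff)
    have "y \<in> C" by (rule submodule_add_cancel[OF h(3), of x]) (use xy h submodule_carrier[OF h(2)] in auto)
    then show "z \<in> A <+>\<^bsub>M\<^esub> (B \<inter> C)" using xy by (auto simp: set_add_iff)
  qed
qed

sublocale lat: modular_lattice_of_sets "{A. submodule A R M}" "set_add M"
  by (rule modular_lattice_submodules)

lemma simple_quotientD:
  assumes "simple_quotient R M A B"
  shows "submodule A R M" "submodule B R M" "A \<subseteq> B" "A \<noteq> B"
    and "submodule D R M \<Longrightarrow> A \<subseteq> D \<Longrightarrow> D \<subseteq> B \<Longrightarrow> D = A \<or> D = B"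
  using lat.coversD[OF assms] by auto

lemma simple_quotientI:
  assumes "submodule A R M" "submodule B R M" "A \<subseteq> B" "A \<noteq> B"
    and "\<And>D. submodule D R M \<Longrightarrow> A \<subseteq> D \<Longrightarrow> D \<subseteq> B \<Longrightarrow> D = A \<or> D = B"
  shows "simple_quotient R M A B"
  using lat.coversI[of A B] assms by auto

lemma submodule_cyclic:
  assumes x: "x \<in> carrier M"
  shows "submodule (cyclic_submodule R M x) R M"
proof (rule submoduleI_smult)
  show "\<zero>\<^bsub>M\<^esub> \<in> cyclic_submodule R M x"
    unfolding cyclic_submodule_def using x by (intro image_eqI[of _ _ \<zero>]) simp_all
  fix u assume "u \<in> cyclic_submodule R M x"
  then obtain p where p: "p \<in> carrier R" "u = p \<odot>\<^bsub>M\<^esub> x" by (auto simp: cyclic_submodule_def)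
  show "s \<odot>\<^bsub>M\<^esub> u \<in> cyclic_submodule R M x" if "s \<in> carrier R" for s
    unfolding cyclic_submodule_def using p x that by (intro image_eqI[of _ _ "s \<otimes> p"]) (simp_all add: smult_assoc1)
  fix v assume "v \<in> cyclic_submodule R M x"
  then obtain q where q: "q \<in> carrier R" "v = q \<odot>\<^bsub>M\<^esub> x" by (auto simp: cyclic_submodule_def)
  show "u \<oplus>\<^bsub>M\<^esub> v \<in> cyclic_submodule R M x"
    unfolding cyclic_submodule_def using p q x by (intro image_eqI[of _ _ "p \<oplus> q"]) (simp_all add: smult_l_distr)
qed (use x in \<open>auto simp: cyclic_submodule_def\<close>)

lemma cyclic_submodule_self: "x \<in> carrier M \<Longrightarrow> x \<in> cyclic_submodule R M x"
  unfolding cyclic_submodule_def by (intro image_eqI[of _ _ \<one>]) simp_all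

lemma cyclic_submodule_least: "submodule A R M \<Longrightarrow> x \<in> A \<Longrightarrow> cyclic_submodule R M x \<subseteq> A"
  by (auto simp: cyclic_submodule_def intro: submodule_smult)

lemma simple_quotient_eq_add_cyclic:
  assumes BC: "simple_quotient R M B C" and x: "x \<in> C" "x \<notin> B"
  shows "C = B <+>\<^bsub>M\<^esub> cyclic_submodule R M x"
proof -
  note B = simple_quotientD(1)[OF BC] and C = simple_quotientD(2)[OF BC]
  note X = submodule_cyclic[OF submodule_carrier[OF C x(1)]]
  have "B <+>\<^bsub>M\<^esub> cyclic_submodule R M x \<subseteq> C"
    using set_add_least[OF C simple_quotientD(3)[OF BC]] cyclic_submodule_least[OF C x(1)] by blast
  moreover have "B <+>\<^bsub>M\<^esub> cyclic_submodule R M x \<noteq> B"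
    using set_add_upper2[OF B X] cyclic_submodule_self[OF submodule_carrier[OF C x(1)]] x(2) by blast
  ultimately show ?thesis
    using simple_quotientD(5)[OF BC submodule_set_add[OF B X] set_add_upper1[OF B X]] by blast
qed

end

locale finite_length_module = module +
  assumes finite_length: "\<exists>n. has_quotient_length R M {\<zero>\<^bsub>M\<^esub>} (carrier M) n"
begin

sublocale lattice: finite_length_lattice_of_sets "{A. submodule A R M}" "set_add M" "{\<zero>\<^bsub>M\<^esub>}" "carrier M"
  by unfold_locales (use finite_length submodule_zero submodule_carrier in auto)

lemma has_quotient_length_quotient_length:
  "submodule A R M \<Longrightarrow> submodule B R M \<Longrightarrow> A \<subseteq> B \<Longrightarrow> has_quotient_length R M A B (quotient_length R M A B)"
  using lattice.has_length_len by simp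

lemma quotient_length_add:
  "submodule A R M \<Longrightarrow> submodule B R M \<Longrightarrow> submodule C R M \<Longrightarrow> A \<subseteq> B \<Longrightarrow> B \<subseteq> C \<Longrightarrow>
    quotient_length R M A C = quotient_length R M A B + quotient_length R M B C"
  by (rule lattice.len_add) simp_all

lemma quotient_length_diamond:
  "submodule A R M \<Longrightarrow> submodule B R M \<Longrightarrow>
    quotient_length R M (A \<inter> B) A = quotient_length R M B (A <+>\<^bsub>M\<^esub> B)"
  using lattice.len_diamond by simp

lemma quotient_length_eq_0:
  "submodule A R M \<Longrightarrow> submodule B R M \<Longrightarrow> A \<subseteq> B \<Longrightarrow> quotient_length R M A B = 0 \<longleftrightarrow> A = B"
  using lattice.len_eq_0_iff by simp

lemma quotient_length_mono:
  "submodule A R M \<Longrightarrow> submodule B R M \<Longrightarrow> submodule C R M \<Longrightarrow> submodule D R M \<Longrightarrow>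
    A \<subseteq> B \<Longrightarrow> B \<subseteq> C \<Longrightarrow> C \<subseteq> D \<Longrightarrow> quotient_length R M B C \<le> quotient_length R M A D"
  by (rule lattice.len_mono[of A B C D]) simp_all

lemma quotient_length_1_imp_simple:
  "submodule A R M \<Longrightarrow> submodule B R M \<Longrightarrow> A \<subseteq> B \<Longrightarrow> quotient_length R M A B = 1 \<Longrightarrow> simple_quotient R M A B"
  using lattice.len_eq_1_imp_covers by simp

end

subsection \<open>Linear maps\<close>

locale module_hom_pair = M: module R M + N: module R N
  for R (structure) and M :: "('a, 'c) module" and N :: "('a, 'd) module" +
  fixes f
  assumes lin: "linear_map R M N f"
begin

lemma hom_closed: "x \<in> carrier M \<Longrightarrow> f x \<in> carrier N"
  and hom_add: "x \<in> carrier M \<Longrightarrow> y \<in> carrier M \<Longrightarrow> f (x \<oplus>\<^bsub>M\<^esub> y) = f x \<oplus>\<^bsub>N\<^esub> f y"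
  and hom_smult: "r \<in> carrier R \<Longrightarrow> x \<in> carrier M \<Longrightarrow> f (r \<odot>\<^bsub>M\<^esub> x) = r \<odot>\<^bsub>N\<^esub> f x"
  using lin unfolding linear_map_def by blast+

lemma hom_zero: "f \<zero>\<^bsub>M\<^esub> = \<zero>\<^bsub>N\<^esub>"
  using hom_smult[of "\<zero>" "\<zero>\<^bsub>M\<^esub>"] hom_closed[of "\<zero>\<^bsub>M\<^esub>"] by simp

lemma hom_uminus: "x \<in> carrier M \<Longrightarrow> f (\<ominus>\<^bsub>M\<^esub> x) = \<ominus>\<^bsub>N\<^esub> f x"
  using hom_smult[of "\<ominus> \<one>" x] hom_closed[of x] M.smult_l_minus[of \<one> x] N.smult_l_minus[of \<one> "f x"] by simp

lemma hom_minus: "x \<in> carrier M \<Longrightarrow> y \<in> carrier M \<Longrightarrow> f (x \<ominus>\<^bsub>M\<^esub> y) = f x \<ominus>\<^bsub>N\<^esub> f y"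
  by (simp add: a_minus_def hom_add hom_uminus)

lemma hom_minus_eq_zero:
  "x \<in> carrier M \<Longrightarrow> y \<in> carrier M \<Longrightarrow> f x = f y \<Longrightarrow> f (x \<ominus>\<^bsub>M\<^esub> y) = \<zero>\<^bsub>N\<^esub>"
  using hom_minus[of x y] N.minus_eq_zero_iff[of "f x" "f y"] hom_closed by simp

lemma submodule_image:
  assumes A: "submodule A R M"
  shows "submodule (f ` A) R N"
proof (rule N.submoduleI_smult)
  note A_carrier = submodule_carrier[OF A]
  show "f ` A \<subseteq> carrier N" using A_carrier hom_closed by blast
  show "\<zero>\<^bsub>N\<^esub> \<in> f ` A" using submodule_zero[OF A] hom_zero by force
  fix x assume "x \<in> f ` A"
  then obtain u where u: "u \<in> A" "x = f u" by blast
  show "r \<odot>\<^bsub>N\<^esub> x \<in> f ` A" if "r \<in> carrier R" for r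
    using u hom_smult[OF that A_carrier] submodule_smult[OF A that] by (metis imageI)
  fix y assume "y \<in> f ` A"
  then obtain v where "v \<in> A" "y = f v" by blast
  then show "x \<oplus>\<^bsub>N\<^esub> y \<in> f ` A" using u hom_add[OF A_carrier A_carrier] submodule_add[OF A] by (metis imageI)
qed

lemma submodule_vimage: "submodule B R N \<Longrightarrow> submodule {x \<in> carrier M. f x \<in> B} R M"
  by (rule M.submoduleI_smult)
    (auto simp: hom_zero hom_add hom_smult intro: submodule_zero submodule_add submodule_smult)

lemma simple_quotient_image:
  assumes AB: "simple_quotient R M A B" and ker: "\<And>x. x \<in> B \<Longrightarrow> f x = \<zero>\<^bsub>N\<^esub> \<Longrightarrow> x \<in> A"
  shows "simple_quotient R N (f ` A) (f ` B)"
proof (rule N.simple_quotientI)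
  note A = M.simple_quotientD(1)[OF AB] and B = M.simple_quotientD(2)[OF AB]
  note B_carrier = submodule_carrier[OF B] and AB_sub = M.simple_quotientD(3)[OF AB]
  show "submodule (f ` A) R N" "submodule (f ` B) R N" "f ` A \<subseteq> f ` B"
    using submodule_image[OF A] submodule_image[OF B] AB_sub by auto
  have "x \<in> A" if x: "x \<in> B" "f x \<in> f ` A" for x
  proof -
    obtain y where y: "y \<in> A" "f x = f y" using x(2) by blast
    have "f (x \<ominus>\<^bsub>M\<^esub> y) = \<zero>\<^bsub>N\<^esub>" using y x B_carrier AB_sub by (intro hom_minus_eq_zero) auto
    then have "x \<ominus>\<^bsub>M\<^esub> y \<in> A" using ker M.submodule_minus[OF B x(1)] y AB_sub by blast
    then have "y \<oplus>\<^bsub>M\<^esub> (x \<ominus>\<^bsub>M\<^esub> y) \<in> A" using y submodule_add[OF A] by blast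
    then show ?thesis using M.minus_add_cancel[of x y] B_carrier x y AB_sub by auto
  qed
  then show "f ` A \<noteq> f ` B" using AB_sub M.simple_quotientD(4)[OF AB] by blast
  fix D assume D: "submodule D R N" "f ` A \<subseteq> D" "D \<subseteq> f ` B"
  let ?E = "{x \<in> carrier M. f x \<in> D} \<inter> B"
  have "submodule ?E R M" by (rule M.submodule_Int[OF submodule_vimage[OF D(1)] B])
  moreover have "A \<subseteq> ?E" using AB_sub D B_carrier by auto
  ultimately have "?E = A \<or> ?E = B" using M.simple_quotientD(5)[OF AB] by blast
  moreover have "f ` ?E = D" using D(3) B_carrier by auto
  ultimately show "D = f ` A \<or> D = f ` B" by (elim disjE) simp_all
qed

lemma simple_quotient_vimage:
  assumes IJ: "simple_quotient R N I J" and B: "submodule B R M" and fB: "f ` B = J"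
  shows "simple_quotient R M {x \<in> B. f x \<in> I} B"
proof (rule M.simple_quotientI)
  note I = N.simple_quotientD(1)[OF IJ] and B_carrier = submodule_carrier[OF B]
  have "{x \<in> B. f x \<in> I} = {x \<in> carrier M. f x \<in> I} \<inter> B" using B_carrier by blast
  then show "submodule {x \<in> B. f x \<in> I} R M" using M.submodule_Int[OF submodule_vimage[OF I] B] by simp
  show "{x \<in> B. f x \<in> I} \<noteq> B" using N.simple_quotientD(3,4)[OF IJ] fB by blast
  fix D assume D: "submodule D R M" "{x \<in> B. f x \<in> I} \<subseteq> D" "D \<subseteq> B"
  have "I \<subseteq> f ` D" using D(2) fB N.simple_quotientD(3)[OF IJ] by blast
  moreover have "f ` D \<subseteq> J" using D(3) fB by blast
  ultimately consider "f ` D = I" | "f ` D = J"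
    using N.simple_quotientD(5)[OF IJ submodule_image[OF D(1)]] by blast
  then show "D = {x \<in> B. f x \<in> I} \<or> D = B"
  proof cases
    case 1
    then show ?thesis using D(2,3) by blast
  next
    case 2
    have "v \<in> D" if v: "v \<in> B" for v
    proof -
      obtain u where u: "u \<in> D" "f v = f u" using v fB 2 by (metis imageE imageI)
      have uv: "u \<in> carrier M" "v \<in> carrier M" using u(1) v D(3) B_carrier by auto
      have "f (v \<ominus>\<^bsub>M\<^esub> u) = \<zero>\<^bsub>N\<^esub>" by (rule hom_minus_eq_zero[OF uv(2,1) u(2)])
      then have "v \<ominus>\<^bsub>M\<^esub> u \<in> D"
        using M.submodule_minus[OF B v subsetD[OF D(3) u(1)]] D(2) submodule_zero[OF I] by auto
      then show ?thesis using submodule_add[OF D(1) u(1)] M.minus_add_cancel[OF uv(2,1)] by fastforce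
    qed
    then show ?thesis using D(3) by blast
  qed
qed (use B in auto)

lemma has_quotient_length_image:
  assumes "has_quotient_length R M A B n" and "\<And>x. x \<in> B \<Longrightarrow> f x = \<zero>\<^bsub>N\<^esub> \<Longrightarrow> x \<in> A"
  shows "has_quotient_length R N (f ` A) (f ` B) n"
  using assms
proof (induction rule: M.lat.has_length.induct)
  case has_length_0
  then show ?case using submodule_image N.lat.has_length_0 by simp
next
  case (has_length_Suc B n C)
  have "A \<subseteq> B" "B \<subseteq> C"
    using M.lat.has_lengthD[OF has_length_Suc.hyps(1)] M.simple_quotientD(3)[OF has_length_Suc.hyps(2)] by auto
  have "has_quotient_length R N (f ` A) (f ` B) n"
    by (rule has_length_Suc.IH) (use has_length_Suc.prems \<open>B \<subseteq> C\<close> in blast)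
  moreover have "simple_quotient R N (f ` B) (f ` C)"
    by (rule simple_quotient_image[OF has_length_Suc.hyps(2)]) (use has_length_Suc.prems \<open>A \<subseteq> B\<close> in blast)
  ultimately show ?case by (rule N.lat.has_length_Suc)
qed

end

lemma module_hom_pairI: "module R M \<Longrightarrow> module R N \<Longrightarrow> linear_map R M N f \<Longrightarrow> module_hom_pair R M N f"
  by (intro module_hom_pair.intro module_hom_pair_axioms.intro)

lemma quotient_length_image:
  assumes M: "finite_length_module R M" and N: "module R N" and f: "linear_map R M N f"
    and A: "submodule A R M" and B: "submodule B R M" "A \<subseteq> B"
    and ker: "\<And>x. x \<in> B \<Longrightarrow> f x = \<zero>\<^bsub>N\<^esub> \<Longrightarrow> x \<in> A"
  shows "quotient_length R N (f ` A) (f ` B) = quotient_length R M A B"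
proof -
  interpret M: finite_length_module R M by fact
  interpret module_hom_pair R M N f by (intro module_hom_pairI M.module_axioms N f)
  show ?thesis
    by (rule N.lat.len_eq[OF has_quotient_length_image[OF M.has_quotient_length_quotient_length[OF A B] ker]])
qed

section \<open>Free modules\<close>

definition regular_module :: "('a, 'b) ring_scheme \<Rightarrow> ('a, 'a) module" where
  "regular_module R = \<lparr>carrier = carrier R, monoid.mult = monoid.mult R, monoid.one = monoid.one R,
      ring.zero = \<zero>\<^bsub>R\<^esub>, ring.add = ring.add R, module.smult = monoid.mult R\<rparr>"

lemma regular_module_simps [simp]:
  "carrier (regular_module R) = carrier R" "\<zero>\<^bsub>regular_module R\<^esub> = \<zero>\<^bsub>R\<^esub>"
  "x \<oplus>\<^bsub>regular_module R\<^esub> y = x \<oplus>\<^bsub>R\<^esub> y" "r \<odot>\<^bsub>regular_module R\<^esub> x = r \<otimes>\<^bsub>R\<^esub> x"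
  by (simp_all add: regular_module_def)

lemma free_module_simps [simp]:
  "carrier (free_module R n) = vecs R n" "\<zero>\<^bsub>free_module R n\<^esub> = zero_vec R"
  "v \<oplus>\<^bsub>free_module R n\<^esub> w = (\<lambda>j. v j \<oplus>\<^bsub>R\<^esub> w j)" "r \<odot>\<^bsub>free_module R n\<^esub> v = (\<lambda>j. r \<otimes>\<^bsub>R\<^esub> v j)"
  by (simp_all add: free_module_def)

definition ideal_vecs :: "('a, 'b) ring_scheme \<Rightarrow> 'a set \<Rightarrow> nat \<Rightarrow> (nat \<Rightarrow> 'a) set" where
  "ideal_vecs R I n = {v \<in> vecs R n. \<forall>j<n. v j \<in> I}"

definition single_vec :: "('a, 'b) ring_scheme \<Rightarrow> nat \<Rightarrow> 'a \<Rightarrow> nat \<Rightarrow> 'a" where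
  "single_vec R k r = (\<lambda>j. if j = k then r else \<zero>\<^bsub>R\<^esub>)"

definition dot_prod :: "('a, 'b) ring_scheme \<Rightarrow> nat \<Rightarrow> (nat \<Rightarrow> 'a) \<Rightarrow> (nat \<Rightarrow> 'a) \<Rightarrow> 'a" where
  "dot_prod R n u v = (\<Oplus>\<^bsub>R\<^esub> j\<in>{..<n}. u j \<otimes>\<^bsub>R\<^esub> v j)"

definition lin_comb :: "('a, 'c) module \<Rightarrow> nat \<Rightarrow> (nat \<Rightarrow> 'c) \<Rightarrow> (nat \<Rightarrow> 'a) \<Rightarrow> 'c" where
  "lin_comb M n g v = (\<Oplus>\<^bsub>M\<^esub> k\<in>{..<n}. v k \<odot>\<^bsub>M\<^esub> g k)"

lemma matvec_eq_dot_prod: "matvec R A r c v i = (if i < r then dot_prod R c (A i) v else \<zero>\<^bsub>R\<^esub>)"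
  unfolding matvec_def dot_prod_def by simp

context cring
begin

abbreviation Reg :: "('a, 'a) module" where "Reg \<equiv> regular_module R"

abbreviation Free :: "nat \<Rightarrow> ('a, nat \<Rightarrow> 'a) module" where "Free n \<equiv> free_module R n"

lemma module_regular: "module R Reg"
proof (rule moduleI)
  show "abelian_group Reg"
    by (rule abelian_groupI) (auto simp: a_ac intro: l_neg)
qed (auto simp: l_distr r_distr m_assoc is_cring)

lemma submodule_regular_iff: "submodule I R Reg \<longleftrightarrow> ideal I R"
proof
  assume I: "submodule I R Reg"
  interpret M: module R Reg by (rule module_regular)
  have uminus: "\<ominus> x \<in> I" if "x \<in> I" for x
    using submodule_smult[OF I, of "\<ominus> \<one>" x] submodule_carrier[OF I that] that by (simp add: l_minus)
  show "ideal I R"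
  proof (rule idealI[OF ring_axioms])
    show "subgroup I (add_monoid R)"
      using submodule_subset[OF I] submodule_zero[OF I] submodule_add[OF I] uminus
      by (intro subgroup.intro) (auto simp flip: a_inv_def)
    show "x \<otimes> a \<in> I" "a \<otimes> x \<in> I" if "a \<in> I" "x \<in> carrier R" for a x
      using submodule_smult[OF I that(2,1)] submodule_carrier[OF I that(1)] m_comm[of a x] that by auto
  qed
next
  assume "ideal I R"
  then interpret ideal I R .
  show "submodule I R Reg"
    by (rule module.submoduleI_smult[OF module_regular]) (auto simp: I_l_closed)
qed

lemma ideal_zero: "ideal I R \<Longrightarrow> \<zero> \<in> I"
  and ideal_add: "ideal I R \<Longrightarrow> x \<in> I \<Longrightarrow> y \<in> I \<Longrightarrow> x \<oplus> y \<in> I"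
  and ideal_uminus: "ideal I R \<Longrightarrow> x \<in> I \<Longrightarrow> \<ominus> x \<in> I"
  by (simp_all add: ideal_def additive_subgroup.zero_closed additive_subgroup.a_closed
    additive_subgroup.a_inv_closed)

lemma ideal_minus: "ideal I R \<Longrightarrow> x \<in> I \<Longrightarrow> y \<in> I \<Longrightarrow> x \<ominus> y \<in> I"
  unfolding a_minus_def by (intro ideal_add ideal_uminus)

lemma vecs_carrier: "v \<in> vecs R n \<Longrightarrow> v j \<in> carrier R"
  unfolding vecs_def by (cases "j < n") auto

lemma vecsI: "(\<And>j. v j \<in> carrier R) \<Longrightarrow> (\<And>j. j \<ge> n \<Longrightarrow> v j = \<zero>) \<Longrightarrow> v \<in> vecs R n"
  unfolding vecs_def by auto

lemma vecs_ge: "v \<in> vecs R n \<Longrightarrow> j \<ge> n \<Longrightarrow> v j = \<zero>"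
  unfolding vecs_def by auto

lemma vecs_eqI: "v \<in> vecs R n \<Longrightarrow> w \<in> vecs R n \<Longrightarrow> (\<And>j. j < n \<Longrightarrow> v j = w j) \<Longrightarrow> v = w"
  by (rule ext) (metis not_less vecs_ge)

lemma zero_vec_in_vecs [simp]: "zero_vec R \<in> vecs R n"
  unfolding vecs_def zero_vec_def by auto

lemma vecs_0: "vecs R 0 = {zero_vec R}"
  by (auto simp: vecs_def zero_vec_def)

lemma module_Free: "module R (Free n)"
proof (rule moduleI)
  show "abelian_group (Free n)"
  proof (rule abelian_groupI)
    fix x assume "x \<in> carrier (Free n)"
    then have x: "x \<in> vecs R n" by simp
    show "\<exists>y\<in>carrier (Free n). y \<oplus>\<^bsub>Free n\<^esub> x = \<zero>\<^bsub>Free n\<^esub>"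
    proof (rule bexI[of _ "\<lambda>j. \<ominus> x j"])
      show "(\<lambda>j. \<ominus> x j) \<oplus>\<^bsub>Free n\<^esub> x = \<zero>\<^bsub>Free n\<^esub>" using vecs_carrier[OF x] by (simp add: l_neg zero_vec_def)
      show "(\<lambda>j. \<ominus> x j) \<in> carrier (Free n)" using vecs_carrier[OF x] vecs_ge[OF x] by (auto intro!: vecsI)
    qed
  qed (auto simp: zero_vec_def vecs_carrier vecs_ge a_ac intro!: vecsI)
qed (auto simp: vecs_carrier vecs_ge l_distr r_distr m_assoc is_cring intro!: vecsI)

lemma vecs_submodule: "submodule (vecs R n) R (Free n)"
  using module.carrier_is_submodule[OF module_Free, of n] by simp

lemma zero_vec_submodule: "submodule {zero_vec R} R (Free n)"
  using module.zero_submodule[OF module_Free, of n] by simp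

lemma vecs_add: "v \<in> vecs R n \<Longrightarrow> w \<in> vecs R n \<Longrightarrow> (\<lambda>j. v j \<oplus> w j) \<in> vecs R n"
  using submodule_add[OF vecs_submodule] by simp

lemma vecs_smult: "r \<in> carrier R \<Longrightarrow> v \<in> vecs R n \<Longrightarrow> (\<lambda>j. r \<otimes> v j) \<in> vecs R n"
  using submodule_smult[OF vecs_submodule] by simp

lemma Free_minus:
  assumes v: "v \<in> vecs R n" and w: "w \<in> vecs R n"
  shows "v \<ominus>\<^bsub>Free n\<^esub> w = (\<lambda>j. v j \<ominus> w j)"
proof -
  interpret M: module R "Free n" by (rule module_Free)
  have "\<ominus>\<^bsub>Free n\<^esub> w = (\<ominus> \<one>) \<odot>\<^bsub>Free n\<^esub> w" using M.smult_l_minus[of \<one> w] w M.smult_one[of w] by simp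
  then show ?thesis using vecs_carrier[OF w] by (simp add: a_minus_def l_minus)
qed

lemma ideal_vecs_vecs: "v \<in> ideal_vecs R I n \<Longrightarrow> v \<in> vecs R n"
  unfolding ideal_vecs_def by auto

lemma ideal_vecs_submodule:
  assumes "ideal I R"
  shows "submodule (ideal_vecs R I n) R (Free n)"
proof -
  interpret ideal I R by fact
  show ?thesis
    by (rule module.submoduleI_smult[OF module_Free])
      (auto simp: ideal_vecs_def vecs_add vecs_smult I_l_closed, simp add: zero_vec_def)
qed

lemma zero_vec_ideal_vecs: "ideal I R \<Longrightarrow> zero_vec R \<in> ideal_vecs R I n"
  using submodule_zero[OF ideal_vecs_submodule] by simp

lemma ideal_vecs_entry: "ideal I R \<Longrightarrow> v \<in> ideal_vecs R I n \<Longrightarrow> v j \<in> I"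
  using ideal_zero[of I] vecs_ge[of v n j] by (cases "j < n") (auto simp: ideal_vecs_def)

lemma ideal_vecsI: "v \<in> vecs R n \<Longrightarrow> (\<And>j. j < n \<Longrightarrow> v j \<in> I) \<Longrightarrow> v \<in> ideal_vecs R I n"
  unfolding ideal_vecs_def by auto

lemma ideal_vecs_mono: "I \<subseteq> J \<Longrightarrow> ideal_vecs R I n \<subseteq> ideal_vecs R J n"
  unfolding ideal_vecs_def by auto

lemma ideal_vecs_carrier: "ideal_vecs R (carrier R) n = vecs R n"
  unfolding ideal_vecs_def vecs_def by auto

lemma ideal_vecs_0: "ideal_vecs R {\<zero>} n = {zero_vec R}"
  by (auto simp: ideal_vecs_def intro!: vecs_eqI[of _ n]) (simp_all add: zero_vec_def)

lemma single_vec_vecs: "k < n \<Longrightarrow> r \<in> carrier R \<Longrightarrow> single_vec R k r \<in> vecs R n"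
  unfolding single_vec_def vecs_def by auto

lemma single_vec_ideal_vecs: "k < n \<Longrightarrow> ideal I R \<Longrightarrow> r \<in> I \<Longrightarrow> single_vec R k r \<in> ideal_vecs R I n"
  using ideal_zero ideal.Icarr by (intro ideal_vecsI single_vec_vecs) (auto simp: single_vec_def)

lemma single_vec_eq_smult: "r \<in> carrier R \<Longrightarrow> single_vec R k r = (\<lambda>j. r \<otimes> single_vec R k \<one> j)"
  by (auto simp: single_vec_def)

lemma vec_induct [consumes 1, case_names zero add single]:
  assumes v: "v \<in> vecs R n" and z: "P (zero_vec R)"
    and add: "\<And>x y. x \<in> vecs R n \<Longrightarrow> y \<in> vecs R n \<Longrightarrow> P x \<Longrightarrow> P y \<Longrightarrow> P (\<lambda>j. x j \<oplus> y j)"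
    and single: "\<And>k. k < n \<Longrightarrow> P (single_vec R k (v k))"
  shows "P v"
proof -
  let ?cut = "\<lambda>m j. if j < m then v j else \<zero>"
  have cut: "?cut m \<in> vecs R n" for m using v by (auto simp: vecs_def)
  have "P (?cut m)" if "m \<le> n" for m
    using that
  proof (induction m)
    case 0
    then show ?case using z by (simp add: zero_vec_def)
  next
    case (Suc m)
    then have "P (\<lambda>j. ?cut m j \<oplus> single_vec R m (v m) j)"
      using vecs_carrier[OF v] by (intro add single cut single_vec_vecs) auto
    moreover have "(\<lambda>j. ?cut m j \<oplus> single_vec R m (v m) j) = ?cut (Suc m)"
      by (rule ext) (auto simp: single_vec_def vecs_carrier[OF v] less_Suc_eq)
    ultimately show ?case by simp
  qed
  from this[of n] have "P (?cut n)" by simp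
  moreover have "?cut n = v" by (rule ext) (auto simp: vecs_ge[OF v])
  ultimately show ?thesis by simp
qed

lemma linear_map_single_vec:
  assumes "module R M" "linear_map R (Free n) M f" "k < n" "r \<in> carrier R"
  shows "f (single_vec R k r) = r \<odot>\<^bsub>M\<^esub> f (single_vec R k \<one>)"
proof -
  interpret module_hom_pair R "Free n" M f by (intro module_hom_pairI module_Free assms)
  show ?thesis
    using hom_smult[OF assms(4), of "single_vec R k \<one>"] single_vec_vecs[OF assms(3) one_closed]
    by (simp add: single_vec_eq_smult[OF assms(4)])
qed

lemma linear_map_in_submodule:
  assumes M: "module R M" and f: "linear_map R (Free n) M f" and B: "submodule B R M"
    and v: "v \<in> vecs R n" and gen: "\<And>k. k < n \<Longrightarrow> v k \<odot>\<^bsub>M\<^esub> f (single_vec R k \<one>) \<in> B"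
  shows "f v \<in> B"
proof -
  interpret module_hom_pair R "Free n" M f by (intro module_hom_pairI module_Free M f)
  from v show ?thesis
  proof (induction rule: vec_induct)
    case (add x y)
    then show ?case using hom_add[of x y] submodule_add[OF B] by simp
  next
    case (single k)
    then show ?case using linear_map_single_vec[OF M f single vecs_carrier[OF v]] gen[OF single] by simp
  qed (use hom_zero submodule_zero[OF B] in simp)
qed

lemma linear_map_eqI:
  assumes M: "module R M" and f: "linear_map R (Free n) M f" and g: "linear_map R (Free n) M g"
    and eq: "\<And>k. k < n \<Longrightarrow> f (single_vec R k \<one>) = g (single_vec R k \<one>)" and v: "v \<in> vecs R n"
  shows "f v = g v"
proof -
  interpret f: module_hom_pair R "Free n" M f by (intro module_hom_pairI module_Free M f)
  interpret g: module_hom_pair R "Free n" M g by (intro module_hom_pairI module_Free M g)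
  from v show ?thesis
  proof (induction rule: vec_induct)
    case (add x y)
    then show ?case using f.hom_add[of x y] g.hom_add[of x y] by simp
  next
    case (single k)
    show ?case
      unfolding linear_map_single_vec[OF M f single vecs_carrier[OF v]]
        linear_map_single_vec[OF M g single vecs_carrier[OF v]] eq[OF single] ..
  qed (use f.hom_zero g.hom_zero in simp)
qed

lemma linear_map_smult: "r \<in> carrier R \<Longrightarrow> linear_map R (Free n) (Free n) (\<lambda>v j. r \<otimes> v j)"
  unfolding linear_map_def by (auto simp: vecs_carrier vecs_smult r_distr m_lcomm)

lemma ideal_finsum_closed:
  assumes I: "ideal I R" and "finite A" "\<And>i. i \<in> A \<Longrightarrow> f i \<in> I"
  shows "finsum R f A \<in> I"
  using assms(2,3)
proof (induction rule: finite_induct)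
  case (insert x A)
  then show ?case using ideal.Icarr[OF I] ideal_add[OF I] by (subst finsum_insert) auto
qed (simp add: ideal_zero[OF I])

lemma dot_prod_closed:
  "(\<And>j. j < n \<Longrightarrow> u j \<in> carrier R) \<Longrightarrow> (\<And>j. j < n \<Longrightarrow> v j \<in> carrier R) \<Longrightarrow> dot_prod R n u v \<in> carrier R"
  unfolding dot_prod_def by (rule finsum_closed) auto

lemma dot_prod_cong:
  "(\<And>j. j < n \<Longrightarrow> u j \<otimes> v j = u' j \<otimes> v' j) \<Longrightarrow> (\<And>j. j < n \<Longrightarrow> u' j \<otimes> v' j \<in> carrier R) \<Longrightarrow>
   dot_prod R n u v = dot_prod R n u' v'"
  unfolding dot_prod_def by (rule finsum_cong') auto

lemma dot_prod_add_right:
  assumes "\<And>j. j < n \<Longrightarrow> u j \<in> carrier R" "\<And>j. j < n \<Longrightarrow> v j \<in> carrier R" "\<And>j. j < n \<Longrightarrow> w j \<in> carrier R"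
  shows "dot_prod R n u (\<lambda>j. v j \<oplus> w j) = dot_prod R n u v \<oplus> dot_prod R n u w"
proof -
  have "dot_prod R n u (\<lambda>j. v j \<oplus> w j) = (\<Oplus>j\<in>{..<n}. u j \<otimes> v j \<oplus> u j \<otimes> w j)"
    unfolding dot_prod_def by (rule finsum_cong') (auto simp: assms r_distr)
  also have "\<dots> = dot_prod R n u v \<oplus> dot_prod R n u w"
    unfolding dot_prod_def by (rule finsum_addf) (auto simp: assms)
  finally show ?thesis .
qed

lemma dot_prod_smult_right:
  assumes "r \<in> carrier R" "\<And>j. j < n \<Longrightarrow> u j \<in> carrier R" "\<And>j. j < n \<Longrightarrow> v j \<in> carrier R"
  shows "dot_prod R n u (\<lambda>j. r \<otimes> v j) = r \<otimes> dot_prod R n u v"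
proof -
  have "dot_prod R n u (\<lambda>j. r \<otimes> v j) = (\<Oplus>j\<in>{..<n}. r \<otimes> (u j \<otimes> v j))"
    unfolding dot_prod_def by (rule finsum_cong') (auto simp: assms m_lcomm)
  also have "\<dots> = r \<otimes> dot_prod R n u v"
    unfolding dot_prod_def by (rule finsum_rdistr[symmetric]) (auto simp: assms)
  finally show ?thesis .
qed

lemma dot_prod_comm:
  "(\<And>j. j < n \<Longrightarrow> u j \<in> carrier R) \<Longrightarrow> (\<And>j. j < n \<Longrightarrow> v j \<in> carrier R) \<Longrightarrow> dot_prod R n u v = dot_prod R n v u"
  unfolding dot_prod_def by (auto intro!: finsum_cong' simp: m_comm)

lemma dot_prod_add_left:
  "(\<And>j. j < n \<Longrightarrow> u j \<in> carrier R) \<Longrightarrow> (\<And>j. j < n \<Longrightarrow> v j \<in> carrier R) \<Longrightarrow> (\<And>j. j < n \<Longrightarrow> w j \<in> carrier R) \<Longrightarrow>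
   dot_prod R n (\<lambda>j. v j \<oplus> w j) u = dot_prod R n v u \<oplus> dot_prod R n w u"
  using dot_prod_add_right[of n u v w] dot_prod_comm[of n u] by simp

lemma dot_prod_smult_left:
  "r \<in> carrier R \<Longrightarrow> (\<And>j. j < n \<Longrightarrow> u j \<in> carrier R) \<Longrightarrow> (\<And>j. j < n \<Longrightarrow> v j \<in> carrier R) \<Longrightarrow>
   dot_prod R n (\<lambda>j. r \<otimes> v j) u = r \<otimes> dot_prod R n v u"
  using dot_prod_smult_right[of r n u v] dot_prod_comm[of n u] by simp

lemma dot_prod_ideal:
  "ideal I R \<Longrightarrow> (\<And>j. j < n \<Longrightarrow> u j \<in> carrier R) \<Longrightarrow> (\<And>j. j < n \<Longrightarrow> v j \<in> I) \<Longrightarrow> dot_prod R n u v \<in> I"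
  unfolding dot_prod_def by (rule ideal_finsum_closed) (auto simp: ideal.I_l_closed)

lemma linear_map_dot_prod:
  "(\<And>j. j < n \<Longrightarrow> u j \<in> carrier R) \<Longrightarrow> linear_map R (Free n) Reg (dot_prod R n u)"
  unfolding linear_map_def by (auto simp: vecs_carrier dot_prod_closed dot_prod_add_right dot_prod_smult_right)

lemma dot_prod_single_vec:
  assumes "k < n" "r \<in> carrier R" "\<And>j. j < n \<Longrightarrow> u j \<in> carrier R"
  shows "dot_prod R n u (single_vec R k r) = u k \<otimes> r"
proof -
  have "dot_prod R n u (single_vec R k r) = (\<Oplus>j\<in>{..<n}. if k = j then u j \<otimes> r else \<zero>)"
    unfolding dot_prod_def single_vec_def by (rule finsum_cong') (use assms in auto)
  also have "\<dots> = u k \<otimes> r" using finsum_singleton[of k "{..<n}" "\<lambda>j. u j \<otimes> r"] assms by auto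
  finally show ?thesis .
qed

lemma linear_map_matvec:
  assumes "\<And>i j. i < r \<Longrightarrow> j < c \<Longrightarrow> A i j \<in> carrier R"
  shows "linear_map R (Free c) (Free r) (matvec R A r c)"
  unfolding linear_map_def
  using assms
  by (auto simp: matvec_eq_dot_prod vecs_carrier dot_prod_closed dot_prod_add_right dot_prod_smult_right
      intro!: vecsI)

lemma linear_map_lin_comb:
  assumes M: "module R M" and g: "\<And>k. k < n \<Longrightarrow> g k \<in> carrier M"
  shows "linear_map R (Free n) M (lin_comb M n g)"
proof -
  interpret M: module R M by fact
  show ?thesis unfolding linear_map_def
  proof (intro conjI ballI funcsetI)
    fix v assume v: "v \<in> carrier (Free n)"
    show "lin_comb M n g v \<in> carrier M"
      unfolding lin_comb_def using v g by (intro M.finsum_closed) (auto simp: vecs_carrier)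
    fix w assume w: "w \<in> carrier (Free n)"
    have "lin_comb M n g (v \<oplus>\<^bsub>Free n\<^esub> w) = (\<Oplus>\<^bsub>M\<^esub>k\<in>{..<n}. v k \<odot>\<^bsub>M\<^esub> g k \<oplus>\<^bsub>M\<^esub> w k \<odot>\<^bsub>M\<^esub> g k)"
      unfolding lin_comb_def by (rule M.finsum_cong') (use v w g in \<open>auto simp: vecs_carrier M.smult_l_distr\<close>)
    also have "\<dots> = lin_comb M n g v \<oplus>\<^bsub>M\<^esub> lin_comb M n g w"
      unfolding lin_comb_def by (rule M.finsum_addf) (use v w g in \<open>auto simp: vecs_carrier\<close>)
    finally show "lin_comb M n g (v \<oplus>\<^bsub>Free n\<^esub> w) = lin_comb M n g v \<oplus>\<^bsub>M\<^esub> lin_comb M n g w" .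
  next
    fix s v assume sv: "s \<in> carrier R" "v \<in> carrier (Free n)"
    have "lin_comb M n g (s \<odot>\<^bsub>Free n\<^esub> v) = (\<Oplus>\<^bsub>M\<^esub>k\<in>{..<n}. s \<odot>\<^bsub>M\<^esub> (v k \<odot>\<^bsub>M\<^esub> g k))"
      unfolding lin_comb_def by (rule M.finsum_cong') (use sv g in \<open>auto simp: vecs_carrier M.smult_assoc1\<close>)
    also have "\<dots> = s \<odot>\<^bsub>M\<^esub> lin_comb M n g v"
      unfolding lin_comb_def by (rule M.finsum_smult_ldistr[symmetric]) (use sv g in \<open>auto simp: vecs_carrier\<close>)
    finally show "lin_comb M n g (s \<odot>\<^bsub>Free n\<^esub> v) = s \<odot>\<^bsub>M\<^esub> lin_comb M n g v" .
  qed
qed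

lemma lin_comb_hom:
  "module R M \<Longrightarrow> (\<And>k. k < n \<Longrightarrow> g k \<in> carrier M) \<Longrightarrow> module_hom_pair R (Free n) M (lin_comb M n g)"
  by (intro module_hom_pairI module_Free linear_map_lin_comb)

lemma lin_comb_single_vec:
  assumes M: "module R M" and g: "\<And>k. k < n \<Longrightarrow> g k \<in> carrier M" and k: "k < n" "r \<in> carrier R"
  shows "lin_comb M n g (single_vec R k r) = r \<odot>\<^bsub>M\<^esub> g k"
proof -
  interpret M: module R M by fact
  have "lin_comb M n g (single_vec R k r) = (\<Oplus>\<^bsub>M\<^esub>j\<in>{..<n}. if k = j then r \<odot>\<^bsub>M\<^esub> g j else \<zero>\<^bsub>M\<^esub>)"
    unfolding lin_comb_def single_vec_def by (rule M.finsum_cong') (use g k in auto)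
  also have "\<dots> = r \<odot>\<^bsub>M\<^esub> g k" using M.finsum_singleton[of k "{..<n}" "\<lambda>j. r \<odot>\<^bsub>M\<^esub> g j"] g k by auto
  finally show ?thesis .
qed

lemma lin_comb_in_submodule:
  assumes M: "module R M" and A: "submodule A R M" and g: "\<And>k. k < n \<Longrightarrow> g k \<in> carrier M" and v: "v \<in> vecs R n"
    and gA: "\<And>k. k < n \<Longrightarrow> v k \<odot>\<^bsub>M\<^esub> g k \<in> A"
  shows "lin_comb M n g v \<in> A"
proof (rule linear_map_in_submodule[OF M linear_map_lin_comb[OF M g] A v])
  interpret M: module R M by fact
  show "v k \<odot>\<^bsub>M\<^esub> lin_comb M n g (single_vec R k \<one>) \<in> A" if "k < n" for k
    using lin_comb_single_vec[OF M g that one_closed] g[OF that] gA[OF that] by simp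
qed

lemma lin_comb_image_least:
  assumes M: "module R M" and A: "submodule A R M" and g: "\<And>k. k < n \<Longrightarrow> g k \<in> A"
  shows "lin_comb M n g ` vecs R n \<subseteq> A"
proof
  fix z assume "z \<in> lin_comb M n g ` vecs R n"
  then obtain v where v: "v \<in> vecs R n" "z = lin_comb M n g v" by blast
  show "z \<in> A" unfolding v(2)
    by (rule lin_comb_in_submodule[OF M A submodule_carrier[OF A g] v(1) submodule_smult[OF A
      vecs_carrier[OF v(1)] g]])
qed

lemma lin_comb_image_generator:
  assumes M: "module R M" and g: "\<And>k. k < n \<Longrightarrow> g k \<in> carrier M" and k: "k < n"
  shows "g k \<in> lin_comb M n g ` vecs R n"
proof -
  interpret M: module R M by fact
  have "g k = lin_comb M n g (single_vec R k \<one>)" using lin_comb_single_vec[OF M g k one_closed] g[OF k] by simp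
  then show ?thesis using single_vec_vecs[OF k one_closed] by blast
qed

lemma submodule_lin_comb_image:
  assumes "module R M" "\<And>k. k < n \<Longrightarrow> g k \<in> carrier M"
  shows "submodule (lin_comb M n g ` vecs R n) R M"
  using module_hom_pair.submodule_image[OF lin_comb_hom[OF assms] vecs_submodule] .

lemma linear_map_eq_lin_comb:
  assumes M: "module R M" and f: "linear_map R (Free n) M f" and v: "v \<in> vecs R n"
  shows "f v = lin_comb M n (\<lambda>k. f (single_vec R k \<one>)) v"
proof (rule linear_map_eqI[OF M f _ _ v])
  interpret module_hom_pair R "Free n" M f by (intro module_hom_pairI module_Free M f)
  have g: "f (single_vec R k \<one>) \<in> carrier M" if "k < n" for k
    using hom_closed single_vec_vecs[OF that one_closed] by simp
  show "linear_map R (Free n) M (lin_comb M n (\<lambda>k. f (single_vec R k \<one>)))" by (rule linear_map_lin_comb[OF M g])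
  show "f (single_vec R k \<one>) = lin_comb M n (\<lambda>k. f (single_vec R k \<one>)) (single_vec R k \<one>)" if "k < n" for k
    using lin_comb_single_vec[OF M g that one_closed] g[OF that] by simp
qed

lemma lin_comb_Free:
  assumes g: "\<And>k. k < t \<Longrightarrow> g k \<in> vecs R n" and v: "v \<in> vecs R t"
  shows "lin_comb (Free n) t g v = matvec R (\<lambda>i k. g k i) n t v"
proof (rule linear_map_eqI[OF module_Free _ _ _ v])
  show "linear_map R (Free t) (Free n) (lin_comb (Free n) t g)"
    by (rule linear_map_lin_comb[OF module_Free]) (use g in simp)
  show "linear_map R (Free t) (Free n) (matvec R (\<lambda>i k. g k i) n t)"
    by (rule linear_map_matvec) (use g vecs_carrier in auto)
  fix k assume k: "k < t"
  have "lin_comb (Free n) t g (single_vec R k \<one>) = g k"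
    using lin_comb_single_vec[OF module_Free _ k one_closed, of g n] g vecs_carrier[OF g[OF k]] by simp
  moreover have "matvec R (\<lambda>i k. g k i) n t (single_vec R k \<one>) = g k"
    using dot_prod_single_vec[OF k one_closed] vecs_carrier[OF g] vecs_ge[OF g[OF k]] k
    by (auto simp: matvec_eq_dot_prod fun_eq_iff not_less)
  ultimately show "lin_comb (Free n) t g (single_vec R k \<one>) = matvec R (\<lambda>i k. g k i) n t (single_vec R k \<one>)"
    by simp
qed

lemma lin_comb_Suc:
  assumes M: "module R M" and g: "\<And>k. k \<le> n \<Longrightarrow> g k \<in> carrier M" and v: "\<And>k. k \<le> n \<Longrightarrow> v k \<in> carrier R"
  shows "lin_comb M (Suc n) g v = lin_comb M n g v \<oplus>\<^bsub>M\<^esub> v n \<odot>\<^bsub>M\<^esub> g n"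
proof -
  interpret M: module R M by fact
  have "lin_comb M (Suc n) g v = v n \<odot>\<^bsub>M\<^esub> g n \<oplus>\<^bsub>M\<^esub> lin_comb M n g v"
    unfolding lin_comb_def lessThan_Suc by (subst M.finsum_insert) (use g v in auto)
  also have "\<dots> = lin_comb M n g v \<oplus>\<^bsub>M\<^esub> v n \<odot>\<^bsub>M\<^esub> g n"
    using g v by (intro M.a_comm) (auto simp: lin_comb_def intro!: M.finsum_closed)
  finally show ?thesis .
qed

lemma lin_comb_cong:
  assumes M: "module R M" and "\<And>k. k < n \<Longrightarrow> g k \<in> carrier M" "\<And>k. k < n \<Longrightarrow> v k \<in> carrier R"
    and "\<And>k. k < n \<Longrightarrow> w k = v k"
  shows "lin_comb M n g w = lin_comb M n g v"
proof -
  interpret M: module R M by fact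
  show ?thesis unfolding lin_comb_def by (rule M.finsum_cong') (use assms in auto)
qed

lemma lin_comb_image_Suc:
  assumes M: "module R M" and g: "\<And>k. k \<le> n \<Longrightarrow> g k \<in> carrier M"
  shows "lin_comb M (Suc n) g ` vecs R (Suc n) = lin_comb M n g ` vecs R n <+>\<^bsub>M\<^esub> cyclic_submodule R M (g n)"
proof
  show "lin_comb M (Suc n) g ` vecs R (Suc n) \<subseteq> lin_comb M n g ` vecs R n <+>\<^bsub>M\<^esub> cyclic_submodule R M (g n)"
  proof
    fix z assume "z \<in> lin_comb M (Suc n) g ` vecs R (Suc n)"
    then obtain v where v: "v \<in> vecs R (Suc n)" "z = lin_comb M (Suc n) g v" by blast
    note v_carrier = vecs_carrier[OF v(1)]
    let ?w = "v(n := \<zero>)"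
    have "?w \<in> vecs R n" using v(1) by (auto simp: vecs_def)
    moreover have "lin_comb M n g ?w = lin_comb M n g v" by (rule lin_comb_cong[OF M]) (use g v_carrier in auto)
    moreover have "z = lin_comb M n g v \<oplus>\<^bsub>M\<^esub> v n \<odot>\<^bsub>M\<^esub> g n"
      unfolding v(2) by (rule lin_comb_Suc[OF M]) (use g v_carrier in auto)
    ultimately show "z \<in> lin_comb M n g ` vecs R n <+>\<^bsub>M\<^esub> cyclic_submodule R M (g n)"
      using v_carrier by (auto simp: cyclic_submodule_def set_add_iff) (metis image_eqI)
  qed
  show "lin_comb M n g ` vecs R n <+>\<^bsub>M\<^esub> cyclic_submodule R M (g n) \<subseteq> lin_comb M (Suc n) g ` vecs R (Suc n)"
  proof
    fix z assume "z \<in> lin_comb M n g ` vecs R n <+>\<^bsub>M\<^esub> cyclic_submodule R M (g n)"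
    then obtain v r where v: "v \<in> vecs R n" "r \<in> carrier R" "z = lin_comb M n g v \<oplus>\<^bsub>M\<^esub> r \<odot>\<^bsub>M\<^esub> g n"
      by (auto simp: set_add_iff cyclic_submodule_def)
    note v_carrier = vecs_carrier[OF v(1)]
    let ?w = "v(n := r)"
    have "?w \<in> vecs R (Suc n)" using v(1,2) by (auto simp: vecs_def)
    moreover have "lin_comb M n g ?w = lin_comb M n g v" by (rule lin_comb_cong[OF M]) (use g v_carrier in auto)
    moreover have "lin_comb M (Suc n) g ?w = lin_comb M n g ?w \<oplus>\<^bsub>M\<^esub> ?w n \<odot>\<^bsub>M\<^esub> g n"
      by (rule lin_comb_Suc[OF M]) (use g v_carrier v(2) in auto)
    ultimately show "z \<in> lin_comb M (Suc n) g ` vecs R (Suc n)" using v(3) by (metis fun_upd_same imageI)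
  qed
qed

lemma linear_map_coordinate: "m < n \<Longrightarrow> linear_map R (Free n) Reg (\<lambda>v. v m)"
  unfolding linear_map_def by (auto simp: vecs_carrier)

definition staircase_vecs :: "'a set \<Rightarrow> 'a set \<Rightarrow> nat \<Rightarrow> nat \<Rightarrow> (nat \<Rightarrow> 'a) set" where
  "staircase_vecs I J m n = {v \<in> vecs R n. \<forall>j<n. v j \<in> (if j < m then J else I)}"

lemma staircase_vecs_submodule:
  assumes I: "ideal I R" and J: "ideal J R"
  shows "submodule (staircase_vecs I J m n) R (Free n)"
proof -
  define T where "T j = (if j < m then J else I)" for j
  have T: "ideal (T j) R" for j using I J by (simp add: T_def)
  have "submodule {v \<in> vecs R n. \<forall>j<n. v j \<in> T j} R (Free n)"
    by (rule module.submoduleI_smult[OF module_Free])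
      (auto simp: vecs_add vecs_smult ideal_add[OF T] ideal.I_l_closed[OF T], simp add: zero_vec_def
        ideal_zero[OF T])
  then show ?thesis by (simp add: staircase_vecs_def T_def)
qed

lemma simple_quotient_staircase_vecs:
  assumes IJ: "simple_quotient R Reg I J" and m: "m < n"
  shows "simple_quotient R (Free n) (staircase_vecs I J m n) (staircase_vecs I J (Suc m) n)"
proof -
  interpret Reg: module R Reg by (rule module_regular)
  interpret module_hom_pair R "Free n" Reg "\<lambda>v. v m"
    by (intro module_hom_pairI module_Free module_regular linear_map_coordinate m)
  have I: "ideal I R" and J: "ideal J R" and IJ_sub: "I \<subseteq> J"
    using Reg.simple_quotientD(1-3)[OF IJ] by (simp_all add: submodule_regular_iff)
  have "(\<lambda>v. v m) ` staircase_vecs I J (Suc m) n = J"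
  proof
    show "J \<subseteq> (\<lambda>v. v m) ` staircase_vecs I J (Suc m) n"
    proof
      fix r assume r: "r \<in> J"
      have "single_vec R m r \<in> staircase_vecs I J (Suc m) n"
        using single_vec_vecs[OF m ideal.Icarr[OF J r]] r ideal_zero[OF I] ideal_zero[OF J]
        by (simp add: staircase_vecs_def single_vec_def)
      then show "r \<in> (\<lambda>v. v m) ` staircase_vecs I J (Suc m) n" by (rule rev_image_eqI) (simp add: single_vec_def)
    qed
  qed (use m in \<open>auto simp: staircase_vecs_def\<close>)
  moreover have "{v \<in> staircase_vecs I J (Suc m) n. v m \<in> I} = staircase_vecs I J m n"
    using m IJ_sub by (auto simp: staircase_vecs_def less_Suc_eq split: if_splits)
  ultimately show ?thesis using simple_quotient_vimage[OF IJ staircase_vecs_submodule[OF I J, of "Suc m"]] by simp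
qed

lemma has_quotient_length_ideal_vecs_simple:
  assumes IJ: "simple_quotient R Reg I J"
  shows "has_quotient_length R (Free n) (ideal_vecs R I n) (ideal_vecs R J n) n"
proof -
  interpret Reg: module R Reg by (rule module_regular)
  interpret M: module R "Free n" by (rule module_Free)
  have ideals: "ideal I R" "ideal J R"
    using Reg.simple_quotientD(1,2)[OF IJ] by (simp_all add: submodule_regular_iff)
  have "has_quotient_length R (Free n) (staircase_vecs I J 0 n) (staircase_vecs I J m n) m" if "m \<le> n" for m
    using that
  proof (induction m)
    case 0
    then show ?case using M.lat.has_length_0 staircase_vecs_submodule[OF ideals] by simp
  next
    case (Suc m)
    then show ?case using M.lat.has_length_Suc[OF _ simple_quotient_staircase_vecs[OF IJ, of m]] by simp
  qed
  from this[of n] have "has_quotient_length R (Free n) (staircase_vecs I J 0 n) (staircase_vecs I J n n) n" by simp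
  moreover have "staircase_vecs I J 0 n = ideal_vecs R I n" "staircase_vecs I J n n = ideal_vecs R J n"
    unfolding staircase_vecs_def ideal_vecs_def by auto
  ultimately show ?thesis by simp
qed

lemma has_quotient_length_ideal_vecs:
  assumes "has_quotient_length R Reg I J k"
  shows "has_quotient_length R (Free n) (ideal_vecs R I n) (ideal_vecs R J n) (k * n)"
proof -
  interpret Reg: module R Reg by (rule module_regular)
  interpret M: module R "Free n" by (rule module_Free)
  show ?thesis using assms
  proof (induction rule: Reg.lat.has_length.induct)
    case has_length_0
    then show ?case using M.lat.has_length_0 ideal_vecs_submodule submodule_regular_iff by simp
  next
    case (has_length_Suc J k K)
    show ?case
      using M.lat.has_length_trans[OF has_quotient_length_ideal_vecs_simple[OF has_length_Suc.hyps(2)]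
        has_length_Suc.IH]
      by (simp add: add.commute)
  qed
qed

end
section \<open>Local rings\<close>

lemma (in cring) exists_maximalideal:
  assumes I: "ideal I R" "\<one> \<notin> I"
  shows "\<exists>J. maximalideal J R \<and> I \<subseteq> J"
proof -
  let ?A = "{J. ideal J R \<and> \<one> \<notin> J \<and> I \<subseteq> J}"
  have "\<exists>M\<in>?A. \<forall>K\<in>?A. M \<subseteq> K \<longrightarrow> K = M"
  proof (rule subset_Zorn_nonempty)
    show "?A \<noteq> {}" using I by blast
    fix C assume C: "C \<noteq> {}" "subset.chain ?A C"
    have "subset.chain {J. ideal J R} C" using C(2) unfolding subset.chain_def by blast
    from chain_Union_is_ideal[OF this] have "ideal (\<Union>C) R" using C(1) by simp
    moreover have "J \<in> ?A" if "J \<in> C" for J using C(2) that unfolding subset.chain_def by blast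
    ultimately show "\<Union>C \<in> ?A" using C(1) by blast
  qed
  then obtain M where "M \<in> ?A" and max: "\<forall>K\<in>?A. M \<subseteq> K \<longrightarrow> K = M" by (rule bexE)
  then have M: "ideal M R" "\<one> \<notin> M" "I \<subseteq> M" by simp_all
  have "maximalideal M R"
  proof (rule maximalidealI[OF M(1)])
    show "carrier R \<noteq> M" using M(2) by blast
    fix J assume J: "ideal J R" "M \<subseteq> J" "J \<subseteq> carrier R"
    then show "J = M \<or> J = carrier R"
      using ideal.one_imp_carrier[OF J(1)] bspec[OF max, of J] M(3) by (cases "\<one> \<in> J") auto
  qed
  then show ?thesis using M(3) by blast
qed

locale local_cring = cring +
  assumes unique_maximalideal: "\<exists>!I. maximalideal I R"
begin

abbreviation \<mm> :: "'a set" where "\<mm> \<equiv> max_ideal R"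

lemma maximalideal_\<mm>: "maximalideal \<mm> R"
  unfolding max_ideal_def by (rule theI'[OF unique_maximalideal])

lemma \<mm>_ideal: "ideal \<mm> R"
  using maximalideal_\<mm> by (rule maximalideal.axioms(1))

lemma one_notin_\<mm>: "\<one> \<notin> \<mm>"
  using ideal.one_imp_carrier[OF \<mm>_ideal] maximalideal.I_notcarr[OF maximalideal_\<mm>] by blast

lemma \<mm>_carrier: "x \<in> \<mm> \<Longrightarrow> x \<in> carrier R"
  by (rule ideal.Icarr[OF \<mm>_ideal])

lemma notin_\<mm>_inverse:
  assumes x: "x \<in> carrier R" "x \<notin> \<mm>"
  obtains y where "y \<in> carrier R" "y \<otimes> x = \<one>"
proof -
  have "\<one> \<in> PIdl x"
  proof (rule ccontr)
    assume "\<one> \<notin> PIdl x"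
    then obtain J where "maximalideal J R" "PIdl x \<subseteq> J"
      using exists_maximalideal[OF cgenideal_ideal[OF x(1)]] by blast
    then have "PIdl x \<subseteq> \<mm>" using unique_maximalideal maximalideal_\<mm> by blast
    then show False using cgenideal_self[OF x(1)] x(2) by blast
  qed
  then show ?thesis using that unfolding cgenideal_def by auto
qed

lemma one_minus_\<mm>:
  assumes x: "x \<in> \<mm>"
  shows "\<one> \<ominus> x \<notin> \<mm>"
proof
  assume "\<one> \<ominus> x \<in> \<mm>"
  then have "(\<one> \<ominus> x) \<oplus> x \<in> \<mm>" using ideal_add[OF \<mm>_ideal] x by blast
  moreover have "(\<one> \<ominus> x) \<oplus> x = \<one>" using \<mm>_carrier[OF x] by algebra
  ultimately show False using one_notin_\<mm> by simp
qed

lemma submodule_smult_cancel: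
  assumes M: "module R M" and A: "submodule A R M" and t: "t \<in> carrier R" "t \<notin> \<mm>"
    and x: "x \<in> carrier M" "t \<odot>\<^bsub>M\<^esub> x \<in> A"
  shows "x \<in> A"
proof -
  interpret M: module R M by fact
  obtain s where s: "s \<in> carrier R" "s \<otimes> t = \<one>" using notin_\<mm>_inverse[OF t] .
  have "s \<odot>\<^bsub>M\<^esub> (t \<odot>\<^bsub>M\<^esub> x) = x" using s t x by (simp flip: M.smult_assoc1)
  then show ?thesis using submodule_smult[OF A s(1) x(2)] by simp
qed

lemma ideal_mult_cancel:
  "ideal I R \<Longrightarrow> t \<in> carrier R \<Longrightarrow> t \<notin> \<mm> \<Longrightarrow> x \<in> carrier R \<Longrightarrow> t \<otimes> x \<in> I \<Longrightarrow> x \<in> I"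
  using submodule_smult_cancel[OF module_regular, of I t x] by (simp add: submodule_regular_iff)

lemma simple_quotient_\<mm>: "simple_quotient R Reg \<mm> (carrier R)"
proof -
  interpret M: module R Reg by (rule module_regular)
  have "D = \<mm> \<or> D = carrier R" if "submodule D R Reg" "\<mm> \<subseteq> D" "D \<subseteq> carrier R" for D
    using maximalideal.I_maximal[OF maximalideal_\<mm>] that submodule_regular_iff by blast
  then show ?thesis
    using \<mm>_ideal maximalideal.I_notcarr[OF maximalideal_\<mm>] \<mm>_carrier M.carrier_is_submodule
    by (intro M.simple_quotientI) (auto simp: submodule_regular_iff)
qed

lemma simple_quotient_add_cyclic:
  assumes M: "module R M" and B: "submodule B R M" and x: "x \<in> carrier M" "x \<notin> B"
    and kill: "\<And>r. r \<in> \<mm> \<Longrightarrow> r \<odot>\<^bsub>M\<^esub> x \<in> B"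
  shows "simple_quotient R M B (B <+>\<^bsub>M\<^esub> cyclic_submodule R M x)"
proof -
  interpret M: module R M by fact
  note X = M.submodule_cyclic[OF x(1)]
  show ?thesis
  proof (rule M.simple_quotientI[OF B M.submodule_set_add[OF B X] M.set_add_upper1[OF B X]])
    show "B \<noteq> B <+>\<^bsub>M\<^esub> cyclic_submodule R M x"
      using M.set_add_upper2[OF B X] M.cyclic_submodule_self[OF x(1)] x(2) by blast
    fix D assume D: "submodule D R M" "B \<subseteq> D" "D \<subseteq> B <+>\<^bsub>M\<^esub> cyclic_submodule R M x"
    show "D = B \<or> D = B <+>\<^bsub>M\<^esub> cyclic_submodule R M x"
    proof (cases "D = B")
      case False
      then obtain z where z: "z \<in> D" "z \<notin> B" using D by blast
      then obtain u r where ur: "u \<in> B" "r \<in> carrier R" "z = u \<oplus>\<^bsub>M\<^esub> r \<odot>\<^bsub>M\<^esub> x"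
        using subsetD[OF D(3) z(1)] by (auto simp: set_add_iff cyclic_submodule_def)
      have "r \<odot>\<^bsub>M\<^esub> x \<in> D" using M.submodule_add_cancel[OF D(1), of u] ur z D(2) x by blast
      moreover have "r \<notin> \<mm>" using kill[of r] ur z submodule_add[OF B] by blast
      ultimately have "x \<in> D" using submodule_smult_cancel[OF M D(1) ur(2) _ x(1)] by blast
      then show ?thesis using M.set_add_least[OF D(1,2) M.cyclic_submodule_least[OF D(1)]] D(3) by blast
    qed simp
  qed
qed

subsection \<open>Generators\<close>

lemma has_quotient_length_generators:
  assumes M: "module R M" and "has_quotient_length R M Q N n"
  shows "\<exists>g. (\<forall>k<n. g k \<in> N) \<and> N \<subseteq> Q <+>\<^bsub>M\<^esub> lin_comb M n g ` vecs R n"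
proof -
  interpret M: module R M by fact
  show ?thesis using assms(2)
  proof (induction rule: M.lat.has_length.induct)
    case has_length_0
    then have "submodule Q R M" by simp
    then have "Q \<subseteq> Q <+>\<^bsub>M\<^esub> lin_comb M 0 g ` vecs R 0" for g :: "nat \<Rightarrow> _"
      by (intro M.set_add_upper1 submodule_lin_comb_image[OF M]) auto
    then show ?case by auto
  next
    case (has_length_Suc B n C)
    then obtain g where g: "\<And>k. k < n \<Longrightarrow> g k \<in> B" "B \<subseteq> Q <+>\<^bsub>M\<^esub> lin_comb M n g ` vecs R n" by blast
    have BC: "submodule B R M" "submodule C R M" "B \<subseteq> C" "B \<noteq> C"
      using M.simple_quotientD[OF has_length_Suc.hyps(2)] by auto
    have Q: "submodule Q R M" using M.lat.has_lengthD[OF has_length_Suc.hyps(1)] by simp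
    obtain x where x: "x \<in> C" "x \<notin> B" using BC by blast
    let ?g = "g(n := x)"
    have gC: "?g k \<in> C" if "k \<le> n" for k using that g(1)[of k] BC x by (auto simp: le_less)
    have gM: "?g k \<in> carrier M" if "k \<le> n" for k using submodule_carrier[OF BC(2) gC[OF that]] .
    let ?I = "lin_comb M n ?g ` vecs R n" and ?X = "cyclic_submodule R M x"
    have "g k \<in> carrier M" if "k < n" for k using gM[of k] that by simp
    then have "lin_comb M n g v = lin_comb M n ?g v" if "v \<in> vecs R n" for v
      unfolding lin_comb_def using vecs_carrier[OF that] by (intro M.finsum_cong') auto
    then have "lin_comb M n g ` vecs R n = ?I" by (rule image_cong[OF refl])
    then have "B \<subseteq> Q <+>\<^bsub>M\<^esub> ?I" using g(2) by simp
    then have "C \<subseteq> (Q <+>\<^bsub>M\<^esub> ?I) <+>\<^bsub>M\<^esub> ?X"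
      using set_add_mono[OF _ subset_refl] by (subst M.simple_quotient_eq_add_cyclic[OF has_length_Suc.hyps(2) x])
    also have "\<dots> = Q <+>\<^bsub>M\<^esub> (?I <+>\<^bsub>M\<^esub> ?X)"
      using submodule_carrier[OF BC(2) x(1)]
      by (intro M.set_add_assoc Q submodule_lin_comb_image[OF M gM] M.submodule_cyclic) auto
    also have "?I <+>\<^bsub>M\<^esub> ?X = lin_comb M (Suc n) ?g ` vecs R (Suc n)"
      using lin_comb_image_Suc[of M n ?g, OF M gM] by simp
    finally show ?case using gC by (intro exI[of _ ?g]) (simp add: less_Suc_eq_le del: fun_upd_apply)
  qed
qed

lemma has_quotient_length_lin_comb_image:
  assumes M: "module R M" and Q: "submodule Q R M"
    and g: "\<And>k. k < n \<Longrightarrow> g k \<in> carrier M" and kill: "\<And>k r. k < n \<Longrightarrow> r \<in> \<mm> \<Longrightarrow> r \<odot>\<^bsub>M\<^esub> g k \<in> Q"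
  shows "\<exists>l\<le>n. has_quotient_length R M Q (Q <+>\<^bsub>M\<^esub> lin_comb M n g ` vecs R n) l"
proof -
  interpret M: module R M by fact
  show ?thesis using g kill
  proof (induction n)
    case 0
    have "lin_comb M 0 g ` vecs R 0 = {\<zero>\<^bsub>M\<^esub>}" by (simp add: vecs_0 lin_comb_def)
    then have "Q <+>\<^bsub>M\<^esub> lin_comb M 0 g ` vecs R 0 = Q"
      using M.set_add_upper1[OF Q M.zero_submodule] M.set_add_least[OF Q subset_refl, of "{\<zero>\<^bsub>M\<^esub>}"]
        submodule_zero[OF Q] by auto
    then show ?case using M.lat.has_length_0[of Q] Q by auto
  next
    case (Suc n)
    have gM: "g k \<in> carrier M" if "k \<le> n" for k using Suc.prems(1)[of k] that by simp
    let ?I = "lin_comb M n g ` vecs R n" and ?X = "cyclic_submodule R M (g n)"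
    let ?U = "Q <+>\<^bsub>M\<^esub> ?I"
    have I: "submodule ?I R M" by (rule submodule_lin_comb_image[OF M gM]) simp
    have U: "submodule ?U R M" by (rule M.submodule_set_add[OF Q I])
    have X: "submodule ?X R M" by (rule M.submodule_cyclic[OF gM[OF le_refl]])
    have "Q <+>\<^bsub>M\<^esub> lin_comb M (Suc n) g ` vecs R (Suc n) = Q <+>\<^bsub>M\<^esub> (?I <+>\<^bsub>M\<^esub> ?X)"
      using lin_comb_image_Suc[of M n g, OF M gM] by simp
    also have "\<dots> = ?U <+>\<^bsub>M\<^esub> ?X" by (rule M.set_add_assoc[OF Q I X, symmetric])
    finally have eq: "Q <+>\<^bsub>M\<^esub> lin_comb M (Suc n) g ` vecs R (Suc n) = ?U <+>\<^bsub>M\<^esub> ?X" .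
    obtain l where l: "l \<le> n" "has_quotient_length R M Q ?U l" using Suc by auto
    show ?case
    proof (cases "g n \<in> ?U")
      case True
      then have "?U <+>\<^bsub>M\<^esub> ?X = ?U"
        using M.set_add_upper1[OF U X] M.set_add_least[OF U subset_refl M.cyclic_submodule_least[OF U]] by blast
      then show ?thesis using l eq by (intro exI[of _ l]) simp
    next
      case False
      have "simple_quotient R M ?U (?U <+>\<^bsub>M\<^esub> ?X)"
        by (rule simple_quotient_add_cyclic[OF M U gM[OF le_refl] False])
          (use Suc.prems(2)[of n] M.set_add_upper1[OF Q I] in blast)
      then show ?thesis using M.lat.has_length_Suc[OF l(2)] l(1) eq by (intro exI[of _ "Suc l"]) simp
    qed
  qed
qed

lemma generator_in_submodule:
  assumes M: "module R M" and g: "\<And>k. k < n \<Longrightarrow> g k \<in> carrier M" and B: "submodule B R M"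
    and v: "v \<in> vecs R n" "lin_comb M n g v \<in> B" and k0: "k0 < n" "v k0 \<notin> \<mm>"
    and others: "\<And>k. k < n \<Longrightarrow> k \<noteq> k0 \<Longrightarrow> g k \<in> B"
  shows "g k0 \<in> B"
proof -
  interpret M: module R M by fact
  interpret f: module_hom_pair R "Free n" M "lin_comb M n g" by (rule lin_comb_hom[OF M g])
  let ?w = "v(k0 := \<zero>)"
  have w: "?w \<in> vecs R n" using v(1) by (auto simp: vecs_def)
  note vk = vecs_carrier[OF v(1), of k0] and single_vecs = single_vec_vecs[OF k0(1) vecs_carrier[OF v(1)]]
  have wk: "?w k \<odot>\<^bsub>M\<^esub> g k \<in> B" if k: "k < n" for k
    using others[OF k] g[OF k] submodule_zero[OF B] submodule_smult[OF B vecs_carrier[OF v(1)]] by auto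
  have wB: "lin_comb M n g ?w \<in> B" by (rule lin_comb_in_submodule[OF M B g w wk])
  have "v = ?w \<oplus>\<^bsub>Free n\<^esub> single_vec R k0 (v k0)" using vecs_carrier[OF v(1)] by (auto simp: single_vec_def)
  then have "lin_comb M n g v = lin_comb M n g (?w \<oplus>\<^bsub>Free n\<^esub> single_vec R k0 (v k0))" by (rule arg_cong)
  also have "\<dots> = lin_comb M n g ?w \<oplus>\<^bsub>M\<^esub> v k0 \<odot>\<^bsub>M\<^esub> g k0"
    using f.hom_add[of ?w "single_vec R k0 (v k0)"] w single_vecs lin_comb_single_vec[OF M g k0(1) vk] by simp
  finally have "v k0 \<odot>\<^bsub>M\<^esub> g k0 \<in> B"
    using M.submodule_add_cancel[OF B wB] v(2) vk g[OF k0(1)] by simp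
  then show ?thesis by (rule submodule_smult_cancel[OF M B vk k0(2) g[OF k0(1)]])
qed

lemma minimal_generators:
  assumes M: "module R M" and A: "submodule A R M"
    and fg: "\<exists>n g. (\<forall>k<n. g k \<in> A) \<and> A \<subseteq> lin_comb M n g ` vecs R n"
  obtains t g where "\<And>k. k < t \<Longrightarrow> g k \<in> A" "lin_comb M t g ` vecs R t = A"
    "\<And>v. v \<in> vecs R t \<Longrightarrow> lin_comb M t g v = \<zero>\<^bsub>M\<^esub> \<Longrightarrow> v \<in> ideal_vecs R \<mm> t"
proof -
  let ?P = "\<lambda>n. \<exists>g. (\<forall>k<n. g k \<in> A) \<and> A \<subseteq> lin_comb M n g ` vecs R n"
  define t where "t = (LEAST n. ?P n)"
  have "?P t" unfolding t_def by (rule LeastI_ex[OF fg])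
  then obtain g where g: "\<And>k. k < t \<Longrightarrow> g k \<in> A" "A \<subseteq> lin_comb M t g ` vecs R t" by blast
  have gM: "g k \<in> carrier M" if "k < t" for k using submodule_carrier[OF A g(1)[OF that]] .
  have "v \<in> ideal_vecs R \<mm> t" if v: "v \<in> vecs R t" and v0: "lin_comb M t g v = \<zero>\<^bsub>M\<^esub>" for v
  proof (rule ccontr)
    assume "v \<notin> ideal_vecs R \<mm> t"
    then obtain k0 where k0: "k0 < t" "v k0 \<notin> \<mm>" using v unfolding ideal_vecs_def by blast
    obtain m where tm: "t = Suc m" using k0 by (cases t) auto
    define h where "h k = g (if k < k0 then k else Suc k)" for k
    have hA: "h k \<in> A" if "k < m" for k unfolding h_def using that tm g(1) by auto
    note hM = submodule_carrier[OF A hA]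
    let ?B = "lin_comb M m h ` vecs R m"
    have B: "submodule ?B R M" by (rule submodule_lin_comb_image[OF M hM])
    have others: "g k \<in> ?B" if k: "k < t" "k \<noteq> k0" for k
    proof -
      define k' where "k' = (if k < k0 then k else k - 1)"
      have "k' < m" "g k = h k'" using k k0(1) tm by (auto simp: k'_def h_def)
      then show ?thesis using lin_comb_image_generator[of M m h k', OF M hM] by simp
    qed
    have "g k0 \<in> ?B"
      by (rule generator_in_submodule[OF M gM B v _ k0 others]) (simp_all add: v0 submodule_zero[OF B])
    then have "g k \<in> ?B" if "k < t" for k using others[OF that] by (cases "k = k0") auto
    then have "A \<subseteq> ?B" using lin_comb_image_least[of M _ t g, OF M B] g(2) by blast
    then have "?P m" using hA by blast
    then have "t \<le> m" unfolding t_def by (rule Least_le)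
    then show False using tm by simp
  qed
  moreover have "lin_comb M t g ` vecs R t = A" using lin_comb_image_least[of M A t g, OF M A g(1)] g(2) by blast
  ultimately show ?thesis using that g(1) by blast
qed

lemma nakayama:
  assumes M: "module R M" and A: "submodule A R M"
    and fg: "\<exists>n g. (\<forall>k<n. g k \<in> A) \<and> A \<subseteq> lin_comb M n g ` vecs R n"
    and \<mm>A: "\<And>B. submodule B R M \<Longrightarrow> (\<And>r x. r \<in> \<mm> \<Longrightarrow> x \<in> A \<Longrightarrow> r \<odot>\<^bsub>M\<^esub> x \<in> B) \<Longrightarrow> A \<subseteq> B"
  shows "A = {\<zero>\<^bsub>M\<^esub>}"
proof -
  obtain t g where g: "\<And>k. k < t \<Longrightarrow> g k \<in> A" "lin_comb M t g ` vecs R t = A"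
    and ker: "\<And>v. v \<in> vecs R t \<Longrightarrow> lin_comb M t g v = \<zero>\<^bsub>M\<^esub> \<Longrightarrow> v \<in> ideal_vecs R \<mm> t"
    using minimal_generators[OF M A fg] by blast
  note gM = submodule_carrier[OF A g(1)]
  interpret module_hom_pair R "Free t" M "lin_comb M t g" by (rule lin_comb_hom[OF M gM])
  have sub: "A \<subseteq> lin_comb M t g ` ideal_vecs R \<mm> t"
  proof (rule \<mm>A)
    show "submodule (lin_comb M t g ` ideal_vecs R \<mm> t) R M"
      by (rule submodule_image[OF ideal_vecs_submodule[OF \<mm>_ideal]])
    fix r x assume r: "r \<in> \<mm>" and "x \<in> A"
    then obtain w where w: "w \<in> vecs R t" "x = lin_comb M t g w" using g(2) by blast
    have "r \<odot>\<^bsub>M\<^esub> x = lin_comb M t g (\<lambda>j. r \<otimes> w j)" using hom_smult[of r w] \<mm>_carrier[OF r] w by simp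
    moreover have "(\<lambda>j. r \<otimes> w j) \<in> ideal_vecs R \<mm> t"
      using vecs_smult[OF \<mm>_carrier[OF r] w(1)] ideal.I_r_closed[OF \<mm>_ideal r] vecs_carrier[OF w(1)]
      by (simp add: ideal_vecs_def)
    ultimately show "r \<odot>\<^bsub>M\<^esub> x \<in> lin_comb M t g ` ideal_vecs R \<mm> t" by blast
  qed
  have "t = 0"
  proof (rule ccontr)
    assume "t \<noteq> 0"
    then have t: "0 < t" by simp
    obtain v where v: "v \<in> ideal_vecs R \<mm> t" "g 0 = lin_comb M t g v" using sub g(1)[OF t] by blast
    note v_vecs = ideal_vecs_vecs[OF v(1)] and single_vecs = single_vec_vecs[OF t one_closed]
    have "lin_comb M t g (single_vec R 0 \<one>) = lin_comb M t g v"
      using lin_comb_single_vec[OF M gM t one_closed] gM[OF t] v(2) by simp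
    then have "lin_comb M t g (single_vec R 0 \<one> \<ominus>\<^bsub>Free t\<^esub> v) = \<zero>\<^bsub>M\<^esub>"
      using single_vecs v_vecs by (intro hom_minus_eq_zero) auto
    moreover have "single_vec R 0 \<one> \<ominus>\<^bsub>Free t\<^esub> v \<in> vecs R t"
      using M.submodule_minus[OF vecs_submodule single_vecs v_vecs] .
    ultimately have "(single_vec R 0 \<one> \<ominus>\<^bsub>Free t\<^esub> v) 0 \<in> \<mm>" using ideal_vecs_entry[OF \<mm>_ideal ker] by blast
    then have "\<one> \<ominus> v 0 \<in> \<mm>" using Free_minus[OF single_vecs v_vecs] by (simp add: single_vec_def)
    then show False using one_minus_\<mm> ideal_vecs_entry[OF \<mm>_ideal v(1)] by blast
  qed
  then show ?thesis using g(2) hom_zero by (simp add: vecs_0)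
qed

subsection \<open>Ranks over the residue field\<close>

lemma genideal_lin_comb:
  assumes S: "finite S" "S \<subseteq> carrier R"
  obtains g where "\<And>k. k < card S \<Longrightarrow> g k \<in> S" "Idl S = lin_comb Reg (card S) g ` vecs R (card S)"
proof -
  obtain g where g: "bij_betw g {..<card S} S"
    using ex_bij_betw_nat_finite[OF S(1)] by (auto simp: lessThan_atLeast0)
  have gS: "g k \<in> S" if "k < card S" for k using bij_betwE[OF g] that by simp
  have gR: "g k \<in> carrier Reg" if "k < card S" for k using gS[OF that] S(2) by auto
  have "g k \<in> lin_comb Reg (card S) g ` vecs R (card S)" if "k < card S" for k
    by (rule lin_comb_image_generator[OF module_regular gR that])
  then have "g ` {..<card S} \<subseteq> lin_comb Reg (card S) g ` vecs R (card S)" by (intro image_subsetI) simp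
  then have "S \<subseteq> lin_comb Reg (card S) g ` vecs R (card S)" unfolding bij_betw_imp_surj_on[OF g] .
  moreover have "ideal (lin_comb Reg (card S) g ` vecs R (card S)) R"
    unfolding submodule_regular_iff[symmetric] by (rule submodule_lin_comb_image[OF module_regular gR])
  ultimately have "Idl S \<subseteq> lin_comb Reg (card S) g ` vecs R (card S)" using genideal_minimal by blast
  moreover have "lin_comb Reg (card S) g ` vecs R (card S) \<subseteq> Idl S"
    by (rule lin_comb_image_least[OF module_regular])
      (use genideal_ideal[OF S(2)] genideal_self[OF S(2)] gS submodule_regular_iff in auto)
  ultimately show ?thesis using that gS by blast
qed

definition generates_mod :: "'a set \<Rightarrow> 'a set \<Rightarrow> 'a set \<Rightarrow> bool" where
  "generates_mod Q N S \<longleftrightarrow> finite S \<and> S \<subseteq> N \<and> (\<forall>x\<in>N. \<exists>y\<in>Idl S. x \<ominus> y \<in> Q)"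

lemma rank_res_eq_Least: "rank_res R N Q = (LEAST c. \<exists>S. generates_mod Q N S \<and> card S = c)"
  unfolding rank_res_def generates_mod_def by (rule arg_cong[where f = Least]) auto

lemma generates_mod_imp_has_quotient_length:
  assumes N: "ideal N R" and Q: "ideal Q R" and QN: "Q \<subseteq> N"
    and kill: "\<And>r x. r \<in> \<mm> \<Longrightarrow> x \<in> N \<Longrightarrow> r \<otimes> x \<in> Q" and S: "generates_mod Q N S"
  shows "\<exists>l\<le>card S. has_quotient_length R Reg Q N l"
proof -
  interpret M: module R Reg by (rule module_regular)
  have sub: "finite S" "S \<subseteq> N" "S \<subseteq> carrier R" using S ideal.Icarr[OF N] by (auto simp: generates_mod_def)
  obtain g where g: "\<And>k. k < card S \<Longrightarrow> g k \<in> S" and gen: "Idl S = lin_comb Reg (card S) g ` vecs R (card S)"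
    by (rule genideal_lin_comb[OF sub(1,3)]) (rule that)
  have "x \<in> Q <+>\<^bsub>Reg\<^esub> Idl S" if x: "x \<in> N" for x
  proof -
    obtain y where y: "y \<in> Idl S" "x \<ominus> y \<in> Q" using S x by (auto simp: generates_mod_def)
    have "(x \<ominus> y) \<oplus> y = x" using ideal.Icarr[OF N x] ideal.Icarr[OF genideal_ideal[OF sub(3)] y(1)] by algebra
    then show ?thesis using set_addI[OF y(2,1), of Reg] by simp
  qed
  then have "Q <+>\<^bsub>Reg\<^esub> Idl S = N"
    using M.set_add_least[of N Q "Idl S"] N QN genideal_minimal[OF N sub(2)] submodule_regular_iff by blast
  moreover have "\<exists>l\<le>card S. has_quotient_length R Reg Q (Q <+>\<^bsub>Reg\<^esub> lin_comb Reg (card S) g ` vecs R (card S)) l"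
    by (rule has_quotient_length_lin_comb_image[OF module_regular])
      (use Q kill subsetD[OF sub(2) g] subsetD[OF sub(3) g] in \<open>auto simp: submodule_regular_iff\<close>)
  ultimately show ?thesis using gen by simp
qed

lemma has_quotient_length_imp_generates_mod:
  assumes len: "has_quotient_length R Reg Q N n"
  shows "\<exists>S. generates_mod Q N S \<and> card S \<le> n"
proof -
  interpret M: module R Reg by (rule module_regular)
  have Q: "ideal Q R" and N: "ideal N R" using M.lat.has_lengthD[OF len] by (auto simp: submodule_regular_iff)
  obtain g where g: "\<And>k. k < n \<Longrightarrow> g k \<in> N" "N \<subseteq> Q <+>\<^bsub>Reg\<^esub> lin_comb Reg n g ` vecs R n"
    using has_quotient_length_generators[OF module_regular len] by blast
  let ?S = "g ` {..<n}"
  have S: "?S \<subseteq> N" "?S \<subseteq> carrier R" using g(1) ideal.Icarr[OF N] by auto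
  note I = genideal_ideal[OF S(2)]
  have sub: "lin_comb Reg n g ` vecs R n \<subseteq> Idl ?S"
    using I subsetD[OF genideal_self[OF S(2)]]
    by (intro lin_comb_image_least module_regular) (simp_all add: submodule_regular_iff)
  have "\<exists>y\<in>Idl ?S. x \<ominus> y \<in> Q" if x: "x \<in> N" for x
  proof -
    obtain q y where qy: "q \<in> Q" "y \<in> Idl ?S" "x = q \<oplus> y"
      using subsetD[OF g(2) x] sub by (auto simp: set_add_iff)
    have "x \<ominus> y = q" using qy(3) ideal.Icarr[OF Q qy(1)] ideal.Icarr[OF I qy(2)] by algebra
    then show ?thesis using qy by blast
  qed
  moreover have "card ?S \<le> n" using card_image_le[of "{..<n}" g] by simp
  ultimately show ?thesis using S(1) by (intro exI[of _ ?S]) (auto simp: generates_mod_def)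
qed

theorem has_quotient_length_rank_res:
  assumes N: "ideal N R" and Q: "ideal Q R" and QN: "Q \<subseteq> N"
    and kill: "\<And>r x. r \<in> \<mm> \<Longrightarrow> x \<in> N \<Longrightarrow> r \<otimes> x \<in> Q"
    and fg: "\<exists>S. finite S \<and> S \<subseteq> carrier R \<and> N = Idl S"
  shows "has_quotient_length R Reg Q N (rank_res R N Q)"
proof -
  obtain S0 where S0: "finite S0" "S0 \<subseteq> carrier R" "N = Idl S0" using fg by blast
  have "x \<ominus> x \<in> Q" if "x \<in> N" for x using ideal.Icarr[OF N that] ideal_zero[OF Q] by (simp add: a_minus_def r_neg)
  then have "generates_mod Q N S0" using S0 genideal_self[OF S0(2)] by (auto simp: generates_mod_def)
  then have "\<exists>c S. generates_mod Q N S \<and> card S = c" by blast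
  then have "\<exists>S. generates_mod Q N S \<and> card S = rank_res R N Q" unfolding rank_res_eq_Least by (rule LeastI_ex)
  then obtain l where l: "l \<le> rank_res R N Q" "has_quotient_length R Reg Q N l"
    using generates_mod_imp_has_quotient_length[OF N Q QN kill] by metis
  obtain T where T: "generates_mod Q N T" "card T \<le> l"
    using has_quotient_length_imp_generates_mod[OF l(2)] by blast
  then have "rank_res R N Q \<le> card T" unfolding rank_res_eq_Least by (intro Least_le) blast
  then show ?thesis using l T(2) by (metis le_antisym le_trans)
qed

end

subsection \<open>Powers of the maximal ideal\<close>

context local_cring
begin

abbreviation \<mm>pow :: "nat \<Rightarrow> 'a set" where "\<mm>pow n \<equiv> ideal_power R \<mm> n"

abbreviation ideal_times :: "'a set \<Rightarrow> 'a \<Rightarrow> 'a set" (infixl "\<bullet>" 75) where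
  "I \<bullet> y \<equiv> (\<lambda>x. x \<otimes> y) ` I"

definition socle :: "'a set" where "socle = annihilator R \<mm>"

lemma \<mm>pow_ideal: "ideal (\<mm>pow n) R"
  by (induction n) (auto intro: ideal_prod_is_ideal \<mm>_ideal oneideal)

lemma \<mm>pow_carrier: "x \<in> \<mm>pow n \<Longrightarrow> x \<in> carrier R"
  by (rule ideal.Icarr[OF \<mm>pow_ideal])

lemmas \<mm>pow_zero = ideal_zero[OF \<mm>pow_ideal]
  and \<mm>pow_add = ideal_add[OF \<mm>pow_ideal]
  and \<mm>pow_uminus = ideal_uminus[OF \<mm>pow_ideal]
  and \<mm>pow_minus = ideal_minus[OF \<mm>pow_ideal]

lemma \<mm>pow_smult: "r \<in> carrier R \<Longrightarrow> x \<in> \<mm>pow n \<Longrightarrow> r \<otimes> x \<in> \<mm>pow n"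
  by (rule ideal.I_l_closed[OF \<mm>pow_ideal])

lemma \<mm>pow_smult_right: "r \<in> carrier R \<Longrightarrow> x \<in> \<mm>pow n \<Longrightarrow> x \<otimes> r \<in> \<mm>pow n"
  by (rule ideal.I_r_closed[OF \<mm>pow_ideal])

lemma \<mm>pow_1: "\<mm>pow (Suc 0) = \<mm>"
  using ideal_prod_one[OF \<mm>_ideal] by simp

lemma \<mm>pow_Suc_subset:
  assumes I: "ideal I R" and products: "\<And>u v. u \<in> \<mm> \<Longrightarrow> v \<in> \<mm>pow n \<Longrightarrow> u \<otimes> v \<in> I"
  shows "\<mm>pow (Suc n) \<subseteq> I"
proof
  fix x assume "x \<in> \<mm>pow (Suc n)"
  then have "x \<in> ideal_prod R \<mm> (\<mm>pow n)" by simp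
  then show "x \<in> I"
    by (induction rule: ideal_prod.induct)
      (use products additive_subgroup.a_closed[OF ideal.axioms(1)[OF I]] in auto)
qed

lemma \<mm>_mult_\<mm>pow: "u \<in> \<mm> \<Longrightarrow> v \<in> \<mm>pow n \<Longrightarrow> u \<otimes> v \<in> \<mm>pow (Suc n)"
  using ideal_prod.prod by fastforce

lemma linear_map_mult: "y \<in> carrier R \<Longrightarrow> linear_map R Reg Reg (\<lambda>x. x \<otimes> y)"
  unfolding linear_map_def by (auto simp: l_distr m_assoc)

lemma ideal_preimage_mult:
  assumes I: "ideal I R" and y: "y \<in> carrier R"
  shows "ideal {x \<in> carrier R. x \<otimes> y \<in> I} R"
proof -
  interpret module_hom_pair R Reg Reg "\<lambda>x. x \<otimes> y" by (intro module_hom_pairI module_regular linear_map_mult y)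
  show ?thesis using submodule_vimage[of I] I by (simp add: submodule_regular_iff)
qed

lemma \<mm>pow_mult: "x \<in> \<mm>pow i \<Longrightarrow> y \<in> \<mm>pow j \<Longrightarrow> x \<otimes> y \<in> \<mm>pow (i + j)"
proof (induction i arbitrary: x)
  case 0
  then show ?case using \<mm>pow_smult[of x y j] by simp
next
  case (Suc i)
  have yc: "y \<in> carrier R" using \<mm>pow_carrier Suc by blast
  have "\<mm>pow (Suc i) \<subseteq> {x \<in> carrier R. x \<otimes> y \<in> \<mm>pow (Suc i + j)}"
  proof (rule \<mm>pow_Suc_subset[OF ideal_preimage_mult[OF \<mm>pow_ideal yc]])
    fix u v assume uv: "u \<in> \<mm>" "v \<in> \<mm>pow i"
    have uv_carrier: "u \<in> carrier R" "v \<in> carrier R" using uv \<mm>_carrier \<mm>pow_carrier by auto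
    have "u \<otimes> (v \<otimes> y) \<in> \<mm>pow (Suc (i + j))" using \<mm>_mult_\<mm>pow uv Suc by blast
    then show "u \<otimes> v \<in> {x \<in> carrier R. x \<otimes> y \<in> \<mm>pow (Suc i + j)}" using uv_carrier yc by (simp add: m_assoc)
  qed
  then show ?case using Suc by blast
qed

lemma \<mm>_mult_\<mm>: "x \<in> \<mm> \<Longrightarrow> y \<in> \<mm> \<Longrightarrow> x \<otimes> y \<in> \<mm>pow 2"
  using \<mm>pow_mult[of x 1 y 1] \<mm>pow_1 by (simp add: numeral_2_eq_2)

lemma \<mm>_mult_sq: "x \<in> \<mm> \<Longrightarrow> y \<in> \<mm>pow 2 \<Longrightarrow> x \<otimes> y \<in> \<mm>pow 3"
  using \<mm>_mult_\<mm>pow[of x y 2] by (simp add: numeral_3_eq_3)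

lemma \<mm>pow_Suc_le: "\<mm>pow (Suc n) \<subseteq> \<mm>pow n"
  by (rule \<mm>pow_Suc_subset[OF \<mm>pow_ideal]) (use \<mm>_carrier \<mm>pow_smult in blast)

lemma \<mm>pow_antimono: "i \<le> j \<Longrightarrow> \<mm>pow j \<subseteq> \<mm>pow i"
  by (induction rule: dec_induct) (use \<mm>pow_Suc_le in blast)+

lemma \<mm>pow_submodule: "submodule (\<mm>pow n) R Reg"
  using \<mm>pow_ideal submodule_regular_iff by simp

lemma \<mm>_submodule: "submodule \<mm> R Reg"
  using \<mm>_ideal submodule_regular_iff by simp

lemma submodule_mult_image:
  assumes "y \<in> carrier R" "submodule I R Reg"
  shows "submodule (I \<bullet> y) R Reg"
  using module_hom_pair.submodule_image[OF module_hom_pairI[OF module_regular module_regular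
    linear_map_mult[OF assms(1)]] assms(2)] .

lemma \<mm>pow_Suc_subset_mult:
  assumes y: "y \<in> carrier R" and sub: "\<mm>pow (Suc n) \<subseteq> \<mm>pow n \<bullet> y"
  shows "\<mm>pow (Suc (Suc n)) \<subseteq> \<mm>pow (Suc n) \<bullet> y"
proof (rule \<mm>pow_Suc_subset)
  show "ideal (\<mm>pow (Suc n) \<bullet> y) R"
    using submodule_mult_image[OF y \<mm>pow_submodule] submodule_regular_iff by blast
  fix u v assume u: "u \<in> \<mm>" and "v \<in> \<mm>pow (Suc n)"
  then obtain t where t: "t \<in> \<mm>pow n" "v = t \<otimes> y" using sub by blast
  have "u \<otimes> v = (u \<otimes> t) \<otimes> y" using t \<mm>_carrier[OF u] \<mm>pow_carrier[OF t(1)] y by (simp add: m_assoc)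
  then show "u \<otimes> v \<in> \<mm>pow (Suc n) \<bullet> y" using \<mm>_mult_\<mm>pow[OF u t(1)] by blast
qed

lemma PIdl_eq_image: "PIdl y = carrier R \<bullet> y"
  unfolding cgenideal_def by auto

lemma PIdl_submodule: "y \<in> carrier R \<Longrightarrow> submodule (PIdl y) R Reg"
  using cgenideal_ideal submodule_regular_iff by blast

lemma socle_submodule: "submodule socle R Reg"
  unfolding socle_def annihilator_def
  by (rule module.submoduleI_smult[OF module_regular]) (auto simp: \<mm>_carrier l_distr m_assoc)

end

section \<open>Exact zero divisors in short local rings\<close>

locale short_ring = local_cring +
  fixes e :: nat
  assumes \<mm>pow_4: "\<mm>pow 4 = {\<zero>}"
    and has_length_\<mm>_mod_sq: "has_quotient_length R Reg (\<mm>pow 2) (\<mm>pow 1) e"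
    and has_length_sq_mod_cube: "has_quotient_length R Reg (\<mm>pow 3) (\<mm>pow 2) e"
    and has_length_cube: "has_quotient_length R Reg (\<mm>pow 4) (\<mm>pow 3) 1"
begin

abbreviation len\<^sub>R where "len\<^sub>R \<equiv> quotient_length R Reg"

lemma \<mm>pow_ge4: "n \<ge> 4 \<Longrightarrow> x \<in> \<mm>pow n \<Longrightarrow> x = \<zero>"
  using \<mm>pow_antimono[of 4 n] \<mm>pow_4 by blast

lemma has_length_ring: "has_quotient_length R Reg {\<zero>} (carrier R) (2 * e + 2)"
proof -
  interpret S0: module R Reg by (rule module_regular)
  have "has_quotient_length R Reg (\<mm>pow 1) (carrier R) 1"
    using S0.lat.has_length_covers[OF simple_quotient_\<mm>] \<mm>pow_1 by simp
  then have "has_quotient_length R Reg (\<mm>pow 4) (carrier R) (1 + e + e + 1)"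
    using S0.lat.has_length_trans has_length_\<mm>_mod_sq has_length_sq_mod_cube has_length_cube by blast
  then show ?thesis using \<mm>pow_4 by (simp add: mult_2)
qed

sublocale S: finite_length_module R Reg
proof -
  interpret S0: module R Reg by (rule module_regular)
  show "finite_length_module R Reg" by unfold_locales (use has_length_ring in auto)
qed

lemma len_\<mm>pow: "len\<^sub>R {\<zero>} (carrier R) = 2 * e + 2" "len\<^sub>R \<mm> (carrier R) = 1" "len\<^sub>R (\<mm>pow 2) \<mm> = e"
  "len\<^sub>R (\<mm>pow 3) (\<mm>pow 2) = e" "len\<^sub>R {\<zero>} (\<mm>pow 3) = 1" "len\<^sub>R {\<zero>} (\<mm>pow 2) = e + 1"
proof -
  show steps: "len\<^sub>R {\<zero>} (carrier R) = 2 * e + 2" "len\<^sub>R \<mm> (carrier R) = 1" "len\<^sub>R (\<mm>pow 2) \<mm> = e"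
    "len\<^sub>R (\<mm>pow 3) (\<mm>pow 2) = e" "len\<^sub>R {\<zero>} (\<mm>pow 3) = 1"
    using S.lat.len_eq[OF has_length_ring] S.lat.len_eq[OF S.lat.has_length_covers[OF simple_quotient_\<mm>]]
      S.lat.len_eq[OF has_length_\<mm>_mod_sq] S.lat.len_eq[OF has_length_sq_mod_cube]
      S.lat.len_eq[OF has_length_cube] \<mm>pow_1 \<mm>pow_4 by simp_all
  show "len\<^sub>R {\<zero>} (\<mm>pow 2) = e + 1"
    using S.quotient_length_add[of "{\<zero>}" "\<mm>pow 3" "\<mm>pow 2"] steps S.zero_submodule \<mm>pow_submodule
      \<mm>pow_antimono[of 2 3] \<mm>pow_zero by auto
qed

lemma len_mult_image:
  assumes y: "y \<in> carrier R" and A: "submodule A R Reg" and B: "submodule B R Reg" "A \<subseteq> B"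
    and ker: "\<And>x. x \<in> B \<Longrightarrow> x \<otimes> y = \<zero> \<Longrightarrow> x \<in> A"
  shows "len\<^sub>R (A \<bullet> y) (B \<bullet> y) = len\<^sub>R A B"
  by (rule quotient_length_image[OF S.finite_length_module_axioms module_regular linear_map_mult[OF y] A B])
    (use ker in auto)

lemma submodule_0: "submodule {\<zero>} R Reg" using S.zero_submodule by simp

lemma submodule_R: "submodule (carrier R) R Reg" using S.carrier_is_submodule by simp

lemma \<mm>pow_3_neq_0: "\<mm>pow 3 \<noteq> {\<zero>}"
  using len_\<mm>pow(5) S.lat.len_refl[of "{\<zero>}"] submodule_0 by auto

lemma \<mm>pow_2_subset: "\<mm>pow 2 \<subseteq> \<mm>" using \<mm>pow_antimono[of 1 2] \<mm>pow_1 by simp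

end

locale exact_pair = short_ring +
  fixes a a'
  assumes a_in_\<mm>: "a \<in> \<mm>" and a'_in_\<mm>: "a' \<in> \<mm>"
    and ann_a: "x \<in> carrier R \<Longrightarrow> x \<otimes> a = \<zero> \<longleftrightarrow> x \<in> PIdl a'"
    and ann_a': "x \<in> carrier R \<Longrightarrow> x \<otimes> a' = \<zero> \<longleftrightarrow> x \<in> PIdl a"
begin

lemma swap: "exact_pair R e a' a"
  by unfold_locales (use a_in_\<mm> a'_in_\<mm> ann_a ann_a' in auto)

lemma a_carrier: "a \<in> carrier R" and a'_carrier: "a' \<in> carrier R"
  using a_in_\<mm> a'_in_\<mm> \<mm>_carrier by auto

lemma PIdl_a_subset: "PIdl a \<subseteq> \<mm>"
  using a_in_\<mm> ideal.I_l_closed[OF \<mm>_ideal] unfolding cgenideal_def by blast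

lemmas PIdl_a_submodule = PIdl_submodule[OF a_carrier]
lemmas PIdl_a'_submodule = PIdl_submodule[OF a'_carrier]

lemma a_mult_a': "a \<otimes> a' = \<zero>"
  using ann_a'[OF a_carrier] cgenideal_self[OF a_carrier] by simp

lemma mult_a'_PIdl_a: "PIdl a \<bullet> a' = {\<zero>}"
proof
  show "PIdl a \<bullet> a' \<subseteq> {\<zero>}" using ann_a' submodule_carrier[OF PIdl_a_submodule] by auto
  show "{\<zero>} \<subseteq> PIdl a \<bullet> a'" using a_mult_a' cgenideal_self[OF a_carrier] by force
qed

lemma len_PIdl_a': "len\<^sub>R {\<zero>} (PIdl a') = len\<^sub>R (PIdl a) (carrier R)"
proof -
  have "len\<^sub>R (PIdl a \<bullet> a') (carrier R \<bullet> a') = len\<^sub>R (PIdl a) (carrier R)"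
    by (rule len_mult_image[OF a'_carrier PIdl_a_submodule submodule_R])
      (use submodule_subset[OF PIdl_a_submodule] ann_a' in auto)
  then show ?thesis unfolding mult_a'_PIdl_a PIdl_eq_image[of a'] .
qed

lemma len_PIdl_a_add_len_PIdl_a': "len\<^sub>R {\<zero>} (PIdl a) + len\<^sub>R {\<zero>} (PIdl a') = 2 * e + 2"
proof -
  have "len\<^sub>R {\<zero>} (carrier R) = len\<^sub>R {\<zero>} (PIdl a) + len\<^sub>R (PIdl a) (carrier R)"
    by (rule S.quotient_length_add[OF submodule_0 PIdl_a_submodule submodule_R])
      (use submodule_zero[OF PIdl_a_submodule] submodule_subset[OF PIdl_a_submodule] in auto)
  then show ?thesis using len_PIdl_a' len_\<mm>pow by simp
qed

lemma len_PIdl_a_mod_a\<mm>: "len\<^sub>R (\<mm> \<bullet> a) (PIdl a) = 1"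
proof -
  have "PIdl a' \<subseteq> \<mm>" using exact_pair.PIdl_a_subset[OF swap] .
  then have "len\<^sub>R (\<mm> \<bullet> a) (carrier R \<bullet> a) = len\<^sub>R \<mm> (carrier R)"
    by (intro len_mult_image[OF a_carrier \<mm>_submodule submodule_R])
      (use submodule_subset[OF \<mm>_submodule] ann_a in auto)
  then show ?thesis using len_\<mm>pow PIdl_eq_image by simp
qed

lemma len_PIdl_a: "len\<^sub>R {\<zero>} (PIdl a) = len\<^sub>R {\<zero>} (\<mm> \<bullet> a) + 1"
proof -
  have mult_submodule: "submodule (\<mm> \<bullet> a) R Reg" by (rule submodule_mult_image[OF a_carrier \<mm>_submodule])
  have "len\<^sub>R {\<zero>} (PIdl a) = len\<^sub>R {\<zero>} (\<mm> \<bullet> a) + len\<^sub>R (\<mm> \<bullet> a) (PIdl a)"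
    by (rule S.quotient_length_add[OF submodule_0 mult_submodule PIdl_a_submodule])
      (use submodule_zero[OF mult_submodule] \<mm>_carrier PIdl_eq_image in auto)
  then show ?thesis using len_PIdl_a_mod_a\<mm> by simp
qed

lemma len_PIdl_a_le_Suc:
  assumes "\<mm> \<bullet> a \<subseteq> \<mm>pow k"
  shows "len\<^sub>R {\<zero>} (PIdl a) \<le> len\<^sub>R {\<zero>} (\<mm>pow k) + 1"
proof -
  have mult_submodule: "submodule (\<mm> \<bullet> a) R Reg" by (rule submodule_mult_image[OF a_carrier \<mm>_submodule])
  have "len\<^sub>R {\<zero>} (\<mm> \<bullet> a) \<le> len\<^sub>R {\<zero>} (\<mm>pow k)"
    by (intro S.quotient_length_mono submodule_0 mult_submodule \<mm>pow_submodule assms)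
      (use submodule_zero[OF mult_submodule] in auto)
  then show ?thesis using len_PIdl_a by simp
qed

lemma len_PIdl_a_le: "len\<^sub>R {\<zero>} (PIdl a) \<le> e + 2"
  using len_PIdl_a_le_Suc[of 2] \<mm>_mult_\<mm>[OF _ a_in_\<mm>] len_\<mm>pow(6) by auto

lemma len_PIdl_a_le_2: "a \<in> \<mm>pow 2 \<Longrightarrow> len\<^sub>R {\<zero>} (PIdl a) \<le> 2"
  using len_PIdl_a_le_Suc[of 3] \<mm>_mult_sq[of _ a] len_\<mm>pow(5) by (auto simp: numeral_2_eq_2)

lemma e_le_2: "a \<in> \<mm>pow 2 \<Longrightarrow> e \<le> 2"
  using len_PIdl_a_le_2 exact_pair.len_PIdl_a_le[OF swap] len_PIdl_a_add_len_PIdl_a' by simp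

lemma mult_a_in_sq: "a \<notin> \<mm>pow 2 \<Longrightarrow> r \<in> carrier R \<Longrightarrow> r \<otimes> a \<in> \<mm>pow 2 \<Longrightarrow> r \<in> \<mm>"
  using ideal_mult_cancel[OF \<mm>pow_ideal _ _ a_carrier] by blast

abbreviation "len_sq_mod_a \<equiv> len\<^sub>R (PIdl a) (PIdl a <+>\<^bsub>Reg\<^esub> \<mm>pow 2)"

lemma PIdl_a_add_sq_submodule: "submodule (PIdl a <+>\<^bsub>Reg\<^esub> \<mm>pow 2) R Reg"
  by (rule S.submodule_set_add[OF PIdl_a_submodule \<mm>pow_submodule])

lemma PIdl_a_add_sq_subset: "(PIdl a <+>\<^bsub>Reg\<^esub> \<mm>pow 2) \<subseteq> \<mm>"
  by (rule S.set_add_least[OF \<mm>_submodule PIdl_a_subset \<mm>pow_2_subset])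

lemma PIdl_a_Int_sq: "a \<notin> \<mm>pow 2 \<Longrightarrow> PIdl a \<inter> \<mm>pow 2 = \<mm> \<bullet> a"
proof
  assume a: "a \<notin> \<mm>pow 2"
  show "PIdl a \<inter> \<mm>pow 2 \<subseteq> \<mm> \<bullet> a" using mult_a_in_sq[OF a] PIdl_eq_image by auto
  show "\<mm> \<bullet> a \<subseteq> PIdl a \<inter> \<mm>pow 2"
    using a_in_\<mm> \<mm>pow_1 \<mm>pow_mult[of _ 1 a 1] \<mm>_carrier PIdl_eq_image by (auto simp: numeral_2_eq_2)
qed

lemma len_\<mm>_mod_a: assumes "a \<notin> \<mm>pow 2" shows "len\<^sub>R (PIdl a) \<mm> + 1 = e + len_sq_mod_a"
proof -
  have "len\<^sub>R (\<mm>pow 2) (PIdl a <+>\<^bsub>Reg\<^esub> \<mm>pow 2) = 1"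
    using S.quotient_length_diamond[OF PIdl_a_submodule \<mm>pow_submodule[of 2]] PIdl_a_Int_sq[OF assms]
      len_PIdl_a_mod_a\<mm> by simp
  moreover have "len\<^sub>R (\<mm>pow 2) \<mm> = len\<^sub>R (\<mm>pow 2) (PIdl a <+>\<^bsub>Reg\<^esub> \<mm>pow 2) + len\<^sub>R (PIdl a <+>\<^bsub>Reg\<^esub> \<mm>pow 2) \<mm>"
    by (rule S.quotient_length_add[OF \<mm>pow_submodule PIdl_a_add_sq_submodule \<mm>_submodule
      S.set_add_upper2[OF PIdl_a_submodule \<mm>pow_submodule] PIdl_a_add_sq_subset])
  moreover have "len\<^sub>R (PIdl a) \<mm> = len_sq_mod_a + len\<^sub>R (PIdl a <+>\<^bsub>Reg\<^esub> \<mm>pow 2) \<mm>"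
    by (rule S.quotient_length_add[OF PIdl_a_submodule PIdl_a_add_sq_submodule \<mm>_submodule
      S.set_add_upper1[OF PIdl_a_submodule \<mm>pow_submodule] PIdl_a_add_sq_subset])
  ultimately show ?thesis using len_\<mm>pow by simp
qed

lemma len_ring_mod_a: assumes "a \<notin> \<mm>pow 2" shows "len\<^sub>R (PIdl a) (carrier R) = e + len_sq_mod_a"
proof -
  have "len\<^sub>R (PIdl a) (carrier R) = len\<^sub>R (PIdl a) \<mm> + len\<^sub>R \<mm> (carrier R)"
    by (rule S.quotient_length_add[OF PIdl_a_submodule \<mm>_submodule submodule_R PIdl_a_subset])
      (use \<mm>_carrier in auto)
  then show ?thesis using len_\<mm>_mod_a[OF assms] len_\<mm>pow by simp
qed

lemma sq_subset_PIdl_a: assumes "len_sq_mod_a = 0" shows "\<mm>pow 2 \<subseteq> PIdl a"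
  using S.quotient_length_eq_0[OF PIdl_a_submodule PIdl_a_add_sq_submodule
    S.set_add_upper1[OF PIdl_a_submodule \<mm>pow_submodule]] assms S.set_add_upper2[OF PIdl_a_submodule
    \<mm>pow_submodule[of 2]] by blast

lemma sq_eq_mult_a: assumes "a \<notin> \<mm>pow 2" "\<mm>pow 2 \<subseteq> PIdl a" shows "\<mm>pow 2 = \<mm> \<bullet> a"
  using assms PIdl_a_Int_sq by auto

lemma mult_a_sq_subset: "\<mm>pow 2 \<bullet> a \<subseteq> \<mm>pow 3"
  using \<mm>_mult_sq[OF a_in_\<mm>] m_comm[OF a_carrier \<mm>pow_carrier] by auto

lemma len_sq_mod_a_neq_0:
  assumes a: "a \<notin> \<mm>pow 2" and a': "a' \<notin> \<mm>pow 2"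
  shows "len_sq_mod_a \<noteq> 0"
proof
  assume len0: "len_sq_mod_a = 0"
  have "\<mm>pow (Suc 1) \<subseteq> \<mm>pow 1 \<bullet> a"
    using sq_eq_mult_a[OF a sq_subset_PIdl_a[OF len0]] \<mm>pow_1 by (simp add: numeral_2_eq_2)
  then have "\<mm>pow 3 \<subseteq> \<mm>pow 2 \<bullet> a"
    using \<mm>pow_Suc_subset_mult[OF a_carrier, of 1] by (simp add: numeral_3_eq_3 numeral_2_eq_2)
  then have cube: "\<mm>pow 2 \<bullet> a = \<mm>pow 3" using mult_a_sq_subset by blast
  let ?Q = "\<mm>pow 2 \<inter> PIdl a'"
  have Q: "submodule ?Q R Reg" by (rule S.submodule_Int[OF \<mm>pow_submodule PIdl_a'_submodule])
  have "?Q \<bullet> a = {\<zero>}"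
    using ann_a submodule_carrier[OF PIdl_a'_submodule] submodule_zero[OF Q] a_carrier
    by (auto intro!: image_eqI[of _ _ "\<zero>"])
  moreover have "len\<^sub>R (?Q \<bullet> a) (\<mm>pow 2 \<bullet> a) = len\<^sub>R ?Q (\<mm>pow 2)"
    by (rule len_mult_image[OF a_carrier Q \<mm>pow_submodule]) (use ann_a \<mm>pow_carrier in auto)
  ultimately have "len\<^sub>R ?Q (\<mm>pow 2) = 1" using cube len_\<mm>pow by simp
  moreover have "len\<^sub>R {\<zero>} (\<mm>pow 2) = len\<^sub>R {\<zero>} ?Q + len\<^sub>R ?Q (\<mm>pow 2)"
    by (rule S.quotient_length_add[OF submodule_0 Q \<mm>pow_submodule]) (use submodule_zero[OF Q] in auto)
  moreover have "len\<^sub>R {\<zero>} (PIdl a') = len\<^sub>R {\<zero>} ?Q + len\<^sub>R ?Q (PIdl a')"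
    by (rule S.quotient_length_add[OF submodule_0 Q PIdl_a'_submodule]) (use submodule_zero[OF Q] in auto)
  moreover have "len\<^sub>R {\<zero>} (PIdl a') = e" using len_PIdl_a' len_ring_mod_a[OF a] len0 by simp
  ultimately have "len\<^sub>R ?Q (PIdl a') = 0" using len_\<mm>pow by simp
  then have "?Q = PIdl a'" using S.quotient_length_eq_0[OF Q PIdl_a'_submodule] by blast
  then show False using cgenideal_self[OF a'_carrier] a' by blast
qed

lemma len_sq_mod_a_eq_1: assumes "a \<notin> \<mm>pow 2" "a' \<notin> \<mm>pow 2" shows "len_sq_mod_a = 1"
proof -
  have "len\<^sub>R {\<zero>} (PIdl a) = e + len\<^sub>R (PIdl a') (PIdl a' <+>\<^bsub>Reg\<^esub> \<mm>pow 2)"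
    using exact_pair.len_PIdl_a'[OF swap] exact_pair.len_ring_mod_a[OF swap assms(2)] by simp
  moreover have "len\<^sub>R {\<zero>} (PIdl a') = e + len_sq_mod_a" using len_PIdl_a' len_ring_mod_a[OF assms(1)] by simp
  ultimately have "len_sq_mod_a + len\<^sub>R (PIdl a') (PIdl a' <+>\<^bsub>Reg\<^esub> \<mm>pow 2) = 2"
    using len_PIdl_a_add_len_PIdl_a' by simp
  then show ?thesis using len_sq_mod_a_neq_0[OF assms] exact_pair.len_sq_mod_a_neq_0[OF swap assms(2,1)] by simp
qed

definition socle_mod_a :: "'a set" where "socle_mod_a = {u \<in> \<mm>. \<forall>v\<in>\<mm>. u \<otimes> v \<in> PIdl a}"

lemma socle_mod_a_submodule: "submodule socle_mod_a R Reg"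
proof (rule S.submoduleI_smult)
  fix u v assume "u \<in> socle_mod_a" "v \<in> socle_mod_a"
  then show "u \<oplus>\<^bsub>Reg\<^esub> v \<in> socle_mod_a"
    using submodule_add[OF \<mm>_submodule] submodule_add[OF PIdl_a_submodule]
    by (auto simp: socle_mod_a_def \<mm>_carrier l_distr)
next
  fix r u assume "r \<in> carrier R" "u \<in> socle_mod_a"
  then show "r \<odot>\<^bsub>Reg\<^esub> u \<in> socle_mod_a"
    using submodule_smult[OF \<mm>_submodule] submodule_smult[OF PIdl_a_submodule]
    by (auto simp: socle_mod_a_def \<mm>_carrier m_assoc)
qed (use \<mm>_carrier submodule_zero[OF \<mm>_submodule] submodule_zero[OF PIdl_a_submodule]
  in \<open>auto simp: socle_mod_a_def\<close>)

lemma socle_mod_a_subset: "socle_mod_a \<subseteq> \<mm>"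
  unfolding socle_mod_a_def by blast

lemma mult_socle_mod_a:
  assumes "w \<in> \<mm>" "y \<in> socle_mod_a"
  shows "w \<otimes> y \<in> PIdl a"
  using assms m_comm[of w y] \<mm>_carrier unfolding socle_mod_a_def by auto

lemma socle_mod_a_carrier: "u \<in> socle_mod_a \<Longrightarrow> u \<in> carrier R"
  unfolding socle_mod_a_def using \<mm>_carrier by blast

lemma PIdl_a_subset_socle_mod_a: "PIdl a \<subseteq> socle_mod_a"
proof
  fix u assume u: "u \<in> PIdl a"
  have "u \<otimes> v \<in> PIdl a" if "v \<in> \<mm>" for v
    by (rule ideal.I_r_closed[OF cgenideal_ideal[OF a_carrier] u \<mm>_carrier[OF that]])
  then show "u \<in> socle_mod_a" using u PIdl_a_subset unfolding socle_mod_a_def by blast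
qed

lemma socle_subset_PIdl_a: "socle \<subseteq> PIdl a"
  using ann_a' a'_in_\<mm> unfolding socle_def annihilator_def by auto

lemma socle_subset_PIdl_a': "socle \<subseteq> PIdl a'"
  by (rule exact_pair.socle_subset_PIdl_a[OF swap])

lemma cube_subset_socle: "\<mm>pow 3 \<subseteq> socle"
proof
  fix x assume x: "x \<in> \<mm>pow 3"
  have "x \<otimes> y = \<zero>" if "y \<in> \<mm>" for y
    using \<mm>pow_mult[OF x, of y 1] that \<mm>pow_1 \<mm>pow_4 by (simp add: numeral_eq_Suc del: ideal_power.simps)
  then show "x \<in> socle" unfolding socle_def annihilator_def using \<mm>pow_carrier[OF x] by blast
qed

lemma sq_subset_socle_mod_a: "\<mm>pow 2 \<subseteq> socle_mod_a"
proof
  fix u assume u: "u \<in> \<mm>pow 2"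
  have "u \<otimes> v \<in> PIdl a" if "v \<in> \<mm>" for v
    using \<mm>pow_mult[OF u, of v 1] that \<mm>pow_1 cube_subset_socle socle_subset_PIdl_a
    by (auto simp: numeral_eq_Suc simp del: ideal_power.simps)
  then show "u \<in> socle_mod_a" using u \<mm>pow_2_subset unfolding socle_mod_a_def by blast
qed

lemma socle_eq_mult_a':
  assumes neq: "PIdl a \<noteq> \<mm>"
  shows "socle = socle_mod_a \<bullet> a'"
proof
  show "socle \<subseteq> socle_mod_a \<bullet> a'"
  proof
    fix z assume z: "z \<in> socle"
    then obtain t where t: "t \<in> carrier R" "z = t \<otimes> a'" using socle_subset_PIdl_a' PIdl_eq_image by blast
    have ty: "t \<otimes> y \<in> PIdl a" if y: "y \<in> \<mm>" for y
    proof -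
      have "(t \<otimes> y) \<otimes> a' = z \<otimes> y" using t \<mm>_carrier[OF y] a'_carrier by (simp add: m_ac)
      also have "\<dots> = \<zero>" using z y unfolding socle_def annihilator_def by blast
      finally show ?thesis using ann_a' t(1) \<mm>_carrier[OF y] by simp
    qed
    have "t \<in> \<mm>"
    proof (rule ccontr)
      assume "t \<notin> \<mm>"
      then have "\<mm> \<subseteq> PIdl a"
        using ideal_mult_cancel[OF cgenideal_ideal[OF a_carrier] t(1)] ty \<mm>_carrier by blast
      then show False using neq PIdl_a_subset by blast
    qed
    then show "z \<in> socle_mod_a \<bullet> a'" using t ty unfolding socle_mod_a_def by blast
  qed
  show "socle_mod_a \<bullet> a' \<subseteq> socle"
  proof
    fix z assume "z \<in> socle_mod_a \<bullet> a'"
    then obtain t where t: "t \<in> socle_mod_a" "z = t \<otimes> a'" by blast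
    have "z \<otimes> v = \<zero>" if v: "v \<in> \<mm>" for v
    proof -
      have "z \<otimes> v = (t \<otimes> v) \<otimes> a'"
        using t(2) socle_mod_a_carrier[OF t(1)] \<mm>_carrier[OF v] a'_carrier by (simp add: m_ac)
      then show ?thesis using ann_a'[of "t \<otimes> v"] t(1) v \<mm>_carrier by (simp add: socle_mod_a_def)
    qed
    then show "z \<in> socle" unfolding socle_def annihilator_def using t socle_mod_a_carrier a'_carrier by simp
  qed
qed

lemma len_\<mm>_mod_socle_mod_a:
  assumes "a \<notin> \<mm>pow 2" "a' \<notin> \<mm>pow 2" "e \<ge> 1"
  shows "len\<^sub>R socle_mod_a \<mm> + len\<^sub>R {\<zero>} socle = e"
proof -
  have len_\<mm>: "len\<^sub>R (PIdl a) \<mm> = e" using len_\<mm>_mod_a[OF assms(1)] len_sq_mod_a_eq_1[OF assms(1,2)] by simp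
  then have ne: "PIdl a \<noteq> \<mm>" using assms(3) S.lat.len_refl[of \<mm>] \<mm>_submodule by auto
  have "len\<^sub>R (PIdl a \<bullet> a') (socle_mod_a \<bullet> a') = len\<^sub>R (PIdl a) socle_mod_a"
    by (rule len_mult_image[OF a'_carrier PIdl_a_submodule socle_mod_a_submodule PIdl_a_subset_socle_mod_a])
      (simp add: ann_a' socle_mod_a_carrier)
  then have "len\<^sub>R {\<zero>} socle = len\<^sub>R (PIdl a) socle_mod_a" using mult_a'_PIdl_a socle_eq_mult_a'[OF ne] by simp
  moreover have "len\<^sub>R (PIdl a) \<mm> = len\<^sub>R (PIdl a) socle_mod_a + len\<^sub>R socle_mod_a \<mm>"
    by (rule S.quotient_length_add[OF PIdl_a_submodule socle_mod_a_submodule \<mm>_submodule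
      PIdl_a_subset_socle_mod_a]) (auto simp: socle_mod_a_def)
  ultimately show ?thesis using len_\<mm> by simp
qed

lemma mult_a_sq_eq_cube: assumes "a \<notin> \<mm>pow 2" "a' \<notin> \<mm>pow 2" shows "\<mm>pow 2 \<bullet> a = \<mm>pow 3"
proof -
  let ?a2 = "\<mm>pow 2 \<bullet> a"
  have mult_submodule: "submodule ?a2 R Reg" by (rule submodule_mult_image[OF a_carrier \<mm>pow_submodule])
  have cov: "simple_quotient R Reg {\<zero>} (\<mm>pow 3)"
    by (rule S.quotient_length_1_imp_simple[OF submodule_0 \<mm>pow_submodule]) (use \<mm>pow_zero len_\<mm>pow in auto)
  then have "?a2 = {\<zero>} \<or> ?a2 = \<mm>pow 3"
    using mult_submodule submodule_zero[OF mult_submodule] mult_a_sq_subset unfolding S.lat.covers_def by auto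
  moreover have "?a2 \<noteq> {\<zero>}"
  proof
    assume z: "?a2 = {\<zero>}"
    have "\<mm>pow 2 \<subseteq> PIdl a'"
    proof
      fix x assume "x \<in> \<mm>pow 2"
      then show "x \<in> PIdl a'" using z ann_a[of x] \<mm>pow_carrier[of x 2] by blast
    qed
    then have "(PIdl a' <+>\<^bsub>Reg\<^esub> \<mm>pow 2) = PIdl a'"
      using S.set_add_least[OF PIdl_a'_submodule] S.set_add_upper1[OF PIdl_a'_submodule \<mm>pow_submodule]
      by blast
    then have "len\<^sub>R (PIdl a') (PIdl a' <+>\<^bsub>Reg\<^esub> \<mm>pow 2) = 0"
      using S.lat.len_refl[of "PIdl a'"] PIdl_a'_submodule by simp
    then show False using exact_pair.len_sq_mod_a_eq_1[OF swap assms(2,1)] by simp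
  qed
  ultimately show ?thesis by blast
qed

lemma PIdl_a_add_\<mm>c:
  assumes ann: "a \<notin> \<mm>pow 2" "a' \<notin> \<mm>pow 2" and c: "c \<in> \<mm>" "c \<notin> socle_mod_a"
  shows "PIdl a <+>\<^bsub>Reg\<^esub> \<mm> \<bullet> c = PIdl a <+>\<^bsub>Reg\<^esub> \<mm>pow 2"
proof -
  note cR = \<mm>_carrier[OF c(1)]
  note \<mm>c = submodule_mult_image[OF cR \<mm>_submodule]
  have "simple_quotient R Reg (PIdl a) (PIdl a <+>\<^bsub>Reg\<^esub> \<mm>pow 2)"
    by (rule S.quotient_length_1_imp_simple[OF PIdl_a_submodule PIdl_a_add_sq_submodule
          S.set_add_upper1[OF PIdl_a_submodule \<mm>pow_submodule] len_sq_mod_a_eq_1[OF ann]])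
  moreover have "PIdl a <+>\<^bsub>Reg\<^esub> \<mm> \<bullet> c \<subseteq> PIdl a <+>\<^bsub>Reg\<^esub> \<mm>pow 2"
    using \<mm>_mult_\<mm>[OF _ c(1)] by (intro set_add_mono) auto
  moreover have "PIdl a <+>\<^bsub>Reg\<^esub> \<mm> \<bullet> c \<noteq> PIdl a"
  proof
    assume "PIdl a <+>\<^bsub>Reg\<^esub> \<mm> \<bullet> c = PIdl a"
    then have "\<mm> \<bullet> c \<subseteq> PIdl a" using S.set_add_upper2[OF PIdl_a_submodule \<mm>c] by simp
    then have "c \<otimes> v \<in> PIdl a" if "v \<in> \<mm>" for v using that m_comm[OF cR \<mm>_carrier[OF that]] by auto
    then show False using c unfolding socle_mod_a_def by blast
  qed
  ultimately show ?thesis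
    using S.simple_quotientD(5) S.submodule_set_add[OF PIdl_a_submodule \<mm>c]
      S.set_add_upper1[OF PIdl_a_submodule \<mm>c] by blast
qed

end

locale orthogonal_data = exact_pair +
  fixes c c' l
  assumes a_notin_sq: "a \<notin> \<mm>pow 2" and a'_notin_sq: "a' \<notin> \<mm>pow 2"
    and c_in_\<mm>: "c \<in> \<mm>" and c_notin_socle_mod_a: "c \<notin> socle_mod_a"
    and c'_in_\<mm>: "c' \<in> \<mm>" and c'_notin_socle_mod_a: "c' \<notin> socle_mod_a"
    and l_in_\<mm>: "l \<in> \<mm>" and c_mult_c': "c \<otimes> c' = l \<otimes> a"
begin

lemma orthogonal_data_swap: "orthogonal_data R e a a' c' c l"
  using orthogonal_data_axioms c_mult_c' m_comm[OF \<mm>_carrier[OF c_in_\<mm>] \<mm>_carrier[OF c'_in_\<mm>]]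
  unfolding orthogonal_data_def orthogonal_data_axioms_def by simp

lemma sq_generated:
  assumes z: "z \<in> \<mm>pow 2"
  shows "\<exists>u\<in>\<mm>. \<exists>v\<in>\<mm>. z = u \<otimes> c \<oplus> v \<otimes> a"
proof -
  have "z \<in> PIdl a <+>\<^bsub>Reg\<^esub> \<mm> \<bullet> c"
    unfolding PIdl_a_add_\<mm>c[OF a_notin_sq a'_notin_sq c_in_\<mm> c_notin_socle_mod_a]
    using z S.set_add_upper2[OF PIdl_a_submodule \<mm>pow_submodule[of 2]] by blast
  then obtain v u where uv: "v \<in> carrier R" "u \<in> \<mm>" "z = v \<otimes> a \<oplus> u \<otimes> c"
    unfolding set_add_iff PIdl_eq_image by auto
  note carriers = \<mm>_carrier[OF uv(2)] \<mm>_carrier[OF c_in_\<mm>] a_carrier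
  have "z \<ominus> u \<otimes> c \<in> \<mm>pow 2" by (rule \<mm>pow_minus[OF z \<mm>_mult_\<mm>[OF uv(2) c_in_\<mm>]])
  moreover have "z \<ominus> u \<otimes> c = v \<otimes> a" using uv carriers by algebra
  ultimately have "v \<in> \<mm>" using mult_a_in_sq[OF a_notin_sq uv(1)] by simp
  then show ?thesis using uv carriers a_comm[of "v \<otimes> a" "u \<otimes> c"] by auto
qed

lemma independent_mod_sq:
  assumes r: "r \<in> carrier R" and t: "t \<in> carrier R" and sq: "r \<otimes> a \<oplus> t \<otimes> c \<in> \<mm>pow 2"
  shows "r \<in> \<mm>" and "t \<in> \<mm>"
proof -
  note carriers = \<mm>_carrier[OF c_in_\<mm>] a_carrier
  have "r \<otimes> a \<in> socle_mod_a" using r PIdl_a_subset_socle_mod_a PIdl_eq_image by blast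
  then have "t \<otimes> c \<in> socle_mod_a"
    using S.submodule_add_cancel[OF socle_mod_a_submodule, of "r \<otimes> a" "t \<otimes> c"] sq sq_subset_socle_mod_a t
      carriers by auto
  then show t\<mm>: "t \<in> \<mm>"
    using ideal_mult_cancel[of socle_mod_a t c] socle_mod_a_submodule t carriers c_notin_socle_mod_a
      submodule_regular_iff by blast
  have "(r \<otimes> a \<oplus> t \<otimes> c) \<ominus> t \<otimes> c \<in> \<mm>pow 2" by (rule \<mm>pow_minus[OF sq \<mm>_mult_\<mm>[OF t\<mm> c_in_\<mm>]])
  moreover have "(r \<otimes> a \<oplus> t \<otimes> c) \<ominus> t \<otimes> c = r \<otimes> a" using r t carriers by algebra
  ultimately show "r \<in> \<mm>" using mult_a_in_sq[OF a_notin_sq r] by simp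
qed

end

context exact_pair
begin

lemma len_\<mm>_mod_preimage_c_le_1:
  assumes ann: "a \<notin> \<mm>pow 2" "a' \<notin> \<mm>pow 2" and c: "c \<in> \<mm>"
  shows "submodule {z \<in> \<mm>. z \<otimes> c \<in> PIdl a} R Reg" and "len\<^sub>R {z \<in> \<mm>. z \<otimes> c \<in> PIdl a} \<mm> \<le> 1"
proof -
  let ?C = "{z \<in> \<mm>. z \<otimes> c \<in> PIdl a}"
  note cR = \<mm>_carrier[OF c]
  note \<mm>c = submodule_mult_image[OF cR \<mm>_submodule]
  have "?C = \<mm> \<inter> {x \<in> carrier R. x \<otimes> c \<in> PIdl a}" using \<mm>_carrier by blast
  then show C: "submodule ?C R Reg"
    using S.submodule_Int[OF \<mm>_submodule] ideal_preimage_mult[OF cgenideal_ideal[OF a_carrier] cR]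
      submodule_regular_iff by simp
  have "len\<^sub>R (?C \<bullet> c) (\<mm> \<bullet> c) = len\<^sub>R ?C \<mm>"
    by (rule len_mult_image[OF cR C \<mm>_submodule]) (use submodule_zero[OF PIdl_a_submodule] in auto)
  moreover have "?C \<bullet> c = \<mm> \<bullet> c \<inter> PIdl a" by blast
  ultimately have "len\<^sub>R ?C \<mm> = len\<^sub>R (PIdl a) (\<mm> \<bullet> c <+>\<^bsub>Reg\<^esub> PIdl a)"
    using S.quotient_length_diamond[OF \<mm>c PIdl_a_submodule] by simp
  also have "\<dots> \<le> len_sq_mod_a"
  proof (rule S.quotient_length_mono[OF PIdl_a_submodule PIdl_a_submodule S.submodule_set_add[OF \<mm>c
    PIdl_a_submodule]
        PIdl_a_add_sq_submodule subset_refl S.set_add_upper2[OF \<mm>c PIdl_a_submodule]])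
    have "\<mm> \<bullet> c \<subseteq> \<mm>pow 2" using \<mm>_mult_\<mm>[OF _ c] by blast
    then show "\<mm> \<bullet> c <+>\<^bsub>Reg\<^esub> PIdl a \<subseteq> PIdl a <+>\<^bsub>Reg\<^esub> \<mm>pow 2"
      using S.set_add_upper1[OF PIdl_a_submodule \<mm>pow_submodule[of 2]]
        S.set_add_upper2[OF PIdl_a_submodule \<mm>pow_submodule[of 2]]
      by (intro S.set_add_least[OF PIdl_a_add_sq_submodule]) auto
  qed
  finally show "len\<^sub>R ?C \<mm> \<le> 1" using len_sq_mod_a_eq_1[OF ann] by simp
qed

theorem orthogonal_data_exists:
  assumes e: "e \<ge> len\<^sub>R {\<zero>} socle + 2"
  obtains c c' l where "orthogonal_data R e a a' c c' l"
proof -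
  have "socle \<noteq> {\<zero>}" using cube_subset_socle \<mm>pow_3_neq_0 \<mm>pow_zero[of 3] by blast
  then have "len\<^sub>R {\<zero>} socle \<noteq> 0"
    using S.quotient_length_eq_0[OF submodule_0 socle_submodule] submodule_zero[OF socle_submodule] by auto
  then have e_ge_3: "e \<ge> 3" using e by simp
  have ann: "a \<notin> \<mm>pow 2" "a' \<notin> \<mm>pow 2" using e_le_2 exact_pair.e_le_2[OF swap] e_ge_3 by auto
  have len2: "len\<^sub>R socle_mod_a \<mm> \<ge> 2" using len_\<mm>_mod_socle_mod_a[OF ann] e e_ge_3 by simp
  then have "socle_mod_a \<noteq> \<mm>" using S.lat.len_refl[of \<mm>] \<mm>_submodule by auto
  then obtain c where c: "c \<in> \<mm>" "c \<notin> socle_mod_a" using socle_mod_a_subset by blast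
  have "socle_mod_a \<subseteq> {z \<in> \<mm>. z \<otimes> c \<in> PIdl a}" using c(1) socle_mod_a_subset unfolding socle_mod_a_def by blast
  moreover have "{z \<in> \<mm>. z \<otimes> c \<in> PIdl a} \<noteq> socle_mod_a"
    using len_\<mm>_mod_preimage_c_le_1(2)[OF ann c(1)] len2 by auto
  ultimately obtain c' where c': "c' \<in> \<mm>" "c' \<otimes> c \<in> PIdl a" "c' \<notin> socle_mod_a" by blast
  then obtain l where l: "l \<in> carrier R" "c' \<otimes> c = l \<otimes> a" unfolding PIdl_eq_image by auto
  have "l \<in> \<mm>" using l mult_a_in_sq[OF ann(1)] \<mm>_mult_\<mm>[OF c'(1) c(1)] by simp
  moreover have "c \<otimes> c' = l \<otimes> a" using l(2) m_comm \<mm>_carrier[OF c(1)] \<mm>_carrier[OF c'(1)] by simp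
  ultimately have "orthogonal_data R e a a' c c' l"
    using ann c c'(1,3) by (intro orthogonal_data.intro exact_pair_axioms orthogonal_data_axioms.intro)
  then show ?thesis by (rule that)
qed

end

section \<open>The socle of a Koszul ring\<close>

declare ideal_power.simps(2) [simp del]

context cring
begin

lemma ideal_vecs_choice:
  assumes I: "ideal I R" and ex: "\<And>t. t < n \<Longrightarrow> \<exists>u\<in>I. P t u"
  obtains u where "u \<in> ideal_vecs R I n" "\<And>t. t < n \<Longrightarrow> P t (u t)"
proof -
  obtain f where f: "\<And>t. t < n \<Longrightarrow> f t \<in> I \<and> P t (f t)" using ex by metis
  let ?u = "\<lambda>t. if t < n then f t else \<zero>"
  have "?u \<in> ideal_vecs R I n" using f ideal.Icarr[OF I] by (auto simp: ideal_vecs_def vecs_def)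
  moreover have "P t (?u t)" if "t < n" for t using f[OF that] that by simp
  ultimately show ?thesis by (rule that)
qed

lemma dot_prod_decompose_left:
  assumes x: "x \<in> carrier R" and \<beta>: "\<And>q. q < n \<Longrightarrow> \<beta> q \<in> carrier R" and \<eta>: "\<And>q. q < n \<Longrightarrow> \<eta> q \<in> carrier R"
    and u: "\<And>q. q < n \<Longrightarrow> u q = x \<otimes> \<beta> q \<oplus> \<eta> q" and v: "\<And>q. q < n \<Longrightarrow> v q \<in> carrier R"
  shows "dot_prod R n u v = x \<otimes> dot_prod R n \<beta> v \<oplus> dot_prod R n \<eta> v"
proof -
  have "dot_prod R n u v = dot_prod R n (\<lambda>q. x \<otimes> \<beta> q \<oplus> \<eta> q) v"
    by (rule dot_prod_cong) (use u v \<beta> \<eta> x in auto)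
  also have "\<dots> = dot_prod R n (\<lambda>q. x \<otimes> \<beta> q) v \<oplus> dot_prod R n \<eta> v"
    by (rule dot_prod_add_left) (use v \<beta> \<eta> x in auto)
  also have "dot_prod R n (\<lambda>q. x \<otimes> \<beta> q) v = x \<otimes> dot_prod R n \<beta> v"
    by (rule dot_prod_smult_left) (use v \<beta> x in auto)
  finally show ?thesis .
qed

lemma simple_quotient_decompose:
  assumes cov: "simple_quotient R Reg B C" and x: "x \<in> C" "x \<notin> B" and u: "u \<in> C"
  shows "\<exists>r\<in>carrier R. \<exists>y\<in>B. u = r \<otimes> x \<oplus> y"
proof -
  interpret M: module R Reg by (rule module_regular)
  note B = M.simple_quotientD(1)[OF cov] and C = M.simple_quotientD(2)[OF cov]
  have "u \<in> B <+>\<^bsub>Reg\<^esub> cyclic_submodule R Reg x" using M.simple_quotient_eq_add_cyclic[OF cov x] u by simp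
  then obtain y r where yr: "y \<in> B" "r \<in> carrier R" "u = y \<oplus> r \<otimes> x"
    by (auto simp: set_add_iff cyclic_submodule_def)
  then have "u = r \<otimes> x \<oplus> y"
    using a_comm[of y "r \<otimes> x"] submodule_carrier[OF B yr(1)] submodule_carrier[OF C x(1)] by simp
  then show ?thesis using yr by blast
qed

end

context local_cring
begin

lemma \<mm>pow_nat_pow: "x \<in> \<mm> \<Longrightarrow> x [^] n \<in> \<mm>pow n" for n :: nat
proof (induction n)
  case (Suc n)
  then have "x \<otimes> x [^] n \<in> \<mm>pow (Suc n)" by (intro \<mm>_mult_\<mm>pow)
  then show ?case using \<mm>_carrier[OF Suc.prems] by (simp add: m_comm)
qed (auto dest: \<mm>_carrier)

lemma \<mm>pow_subset_principal:
  assumes x: "x \<in> \<mm>" and dec: "\<And>u. u \<in> \<mm> \<Longrightarrow> \<exists>r\<in>carrier R. \<exists>y\<in>\<mm>pow 2. u = r \<otimes> x \<oplus> y"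
  shows "\<mm>pow n \<subseteq> PIdl (x [^] n) <+>\<^bsub>Reg\<^esub> \<mm>pow (Suc n)"
proof (induction n)
  case 0
  have "carrier R \<subseteq> PIdl \<one>" by (auto simp: PIdl_eq_image)
  moreover have "PIdl \<one> \<subseteq> PIdl \<one> <+>\<^bsub>Reg\<^esub> \<mm>pow (Suc 0)"
    by (rule module.set_add_upper1[OF module_regular PIdl_submodule \<mm>pow_submodule]) simp
  ultimately show ?case by simp
next
  case (Suc n)
  note x_carrier = \<mm>_carrier[OF x]
  have power_carrier: "x [^] n \<in> carrier R" "x [^] Suc n \<in> carrier R" using x_carrier by auto
  show ?case
  proof (rule \<mm>pow_Suc_subset)
    show "ideal (PIdl (x [^] Suc n) <+>\<^bsub>Reg\<^esub> \<mm>pow (Suc (Suc n))) R"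
      using module.submodule_set_add[OF module_regular PIdl_submodule[OF power_carrier(2)] \<mm>pow_submodule]
        submodule_regular_iff by blast
    fix u v assume u: "u \<in> \<mm>" and v: "v \<in> \<mm>pow n"
    obtain r y where ry: "r \<in> carrier R" "y \<in> \<mm>pow 2" "u = r \<otimes> x \<oplus> y" using dec[OF u] by blast
    obtain t z where tz: "t \<in> carrier R" "z \<in> \<mm>pow (Suc n)" "v = t \<otimes> x [^] n \<oplus> z"
      using Suc v by (auto simp: set_add_iff PIdl_eq_image subset_iff)
    have carriers: "y \<in> carrier R" "z \<in> carrier R" "v \<in> carrier R"
      using \<mm>pow_carrier[OF ry(2)] \<mm>pow_carrier[OF tz(2)] \<mm>pow_carrier[OF v] by auto
    have "u \<otimes> v = (r \<otimes> t) \<otimes> x [^] Suc n \<oplus> (r \<otimes> (x \<otimes> z) \<oplus> y \<otimes> v)"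
      unfolding ry(3)
      using tz(3) ry(1) tz(1) carriers x_carrier power_carrier by (simp add: l_distr r_distr m_ac a_ac)
    moreover have "(r \<otimes> t) \<otimes> x [^] Suc n \<in> PIdl (x [^] Suc n)" using ry tz by (auto simp: PIdl_eq_image)
    moreover have "r \<otimes> (x \<otimes> z) \<in> \<mm>pow (Suc (Suc n))" by (rule \<mm>pow_smult[OF ry(1) \<mm>_mult_\<mm>pow[OF x tz(2)]])
    then have "r \<otimes> (x \<otimes> z) \<oplus> y \<otimes> v \<in> \<mm>pow (Suc (Suc n))"
      using \<mm>pow_mult[OF ry(2) v] by (intro \<mm>pow_add) simp_all
    ultimately show "u \<otimes> v \<in> PIdl (x [^] Suc n) <+>\<^bsub>Reg\<^esub> \<mm>pow (Suc (Suc n))"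
      by (metis set_addI regular_module_simps(3))
  qed
qed

end

text \<open>The beginning of a minimal resolution of the residue field over a Koszul ring: generators of \<open>\<mm>\<close> and their
  syzygies. The last assumption is exactness of the linear part at its second place.\<close>

locale koszul_presentation = short_ring +
  fixes N1 N2 :: nat and gen :: "nat \<Rightarrow> 'a" and D2 :: "(nat \<Rightarrow> 'a) \<Rightarrow> nat \<Rightarrow> 'a"
  assumes gen_in_\<mm>: "q < N1 \<Longrightarrow> gen q \<in> \<mm>"
    and gen_generates: "u \<in> \<mm> \<Longrightarrow> \<exists>v\<in>vecs R N1. dot_prod R N1 gen v = u"
    and D2_linear: "linear_map R (Free N2) (Free N1) D2"
    and D2_minimal: "w \<in> vecs R N2 \<Longrightarrow> D2 w \<in> ideal_vecs R \<mm> N1"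
    and D2_syzygy: "w \<in> vecs R N2 \<Longrightarrow> dot_prod R N1 gen (D2 w) = \<zero>"
    and linear_syzygies: "p \<ge> 1 \<Longrightarrow> v \<in> ideal_vecs R (\<mm>pow p) N1 \<Longrightarrow> dot_prod R N1 gen v \<in> \<mm>pow (p + 2) \<Longrightarrow>
      \<exists>w\<in>ideal_vecs R (\<mm>pow (p - 1)) N2. \<forall>q<N1. v q \<ominus> D2 w q \<in> \<mm>pow (p + 1)"
begin

lemma gen_carrier: "q < N1 \<Longrightarrow> gen q \<in> carrier R"
  using gen_in_\<mm> \<mm>_carrier by blast

lemma relations_in_submodule:
  assumes P: "submodule P R (Free N1)" and p: "p \<ge> 1"
    and high: "ideal_vecs R (\<mm>pow (p + 1)) N1 \<subseteq> P"
    and syz: "\<And>w \<kappa>. w \<in> \<mm>pow (p - 1) \<Longrightarrow> \<kappa> \<in> ideal_vecs R \<mm> N1 \<Longrightarrow> dot_prod R N1 gen \<kappa> = \<zero> \<Longrightarrow> (\<lambda>q. w \<otimes> \<kappa> q) \<in> P"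
    and v: "v \<in> ideal_vecs R (\<mm>pow p) N1" "dot_prod R N1 gen v \<in> \<mm>pow (p + 2)"
  shows "v \<in> P"
proof -
  interpret M: module R "Free N1" by (rule module_Free)
  obtain w where w: "w \<in> ideal_vecs R (\<mm>pow (p - 1)) N2" "\<And>q. q < N1 \<Longrightarrow> v q \<ominus> D2 w q \<in> \<mm>pow (p + 1)"
    using linear_syzygies[OF p v] by blast
  note v_vecs = ideal_vecs_vecs[OF v(1)] and w_vecs = ideal_vecs_vecs[OF w(1)]
  note D2v = ideal_vecs_vecs[OF D2_minimal]
  have "D2 w \<in> P"
  proof (rule linear_map_in_submodule[OF module_Free D2_linear P w_vecs])
    fix k assume "k < N2"
    note single_vecs = single_vec_vecs[OF this one_closed]
    show "w k \<odot>\<^bsub>Free N1\<^esub> D2 (single_vec R k \<one>) \<in> P"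
      using syz[OF ideal_vecs_entry[OF \<mm>pow_ideal w(1)] D2_minimal[OF single_vecs] D2_syzygy[OF single_vecs]]
      by simp
  qed
  moreover have "v \<ominus>\<^bsub>Free N1\<^esub> D2 w \<in> P"
    using high w(2) M.submodule_minus[OF vecs_submodule v_vecs D2v[OF w_vecs]]
    by (auto simp: Free_minus[OF v_vecs D2v[OF w_vecs]] intro!: subsetD[OF high] ideal_vecsI)
  ultimately have "D2 w \<oplus>\<^bsub>Free N1\<^esub> (v \<ominus>\<^bsub>Free N1\<^esub> D2 w) \<in> P" by (rule submodule_add[OF P])
  then show ?thesis using M.minus_add_cancel[of v "D2 w"] v_vecs D2v[OF w_vecs] by simp
qed

end

text \<open>A line \<open>R x\<close> complementary to \<open>Y\<close> in \<open>\<mm>\<close> modulo higher order terms, on which the graded ring modulo \<open>I\<close> is still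
  nonzero in degree \<open>p\<close>; the row \<open>\<beta>\<close> is the coordinate of the generators along \<open>x\<close>.\<close>

locale koszul_line = koszul_presentation +
  fixes Y I :: "'a set" and x and p :: nat and \<beta> \<eta> :: "nat \<Rightarrow> 'a"
  assumes Y_ideal: "ideal Y R" and Y_subset: "Y \<subseteq> \<mm>" and I_ideal: "ideal I R" and x_in_\<mm>: "x \<in> \<mm>"
    and line_decompose: "u \<in> \<mm> \<Longrightarrow> \<exists>r\<in>carrier R. \<exists>y\<in>Y. u = r \<otimes> x \<oplus> y"
    and p_ge_2: "p \<ge> 2" and \<mm>pow_subset_I: "\<mm>pow (p + 1) \<subseteq> I"
    and mult_Y_in_I: "w \<in> \<mm>pow (p - 1) \<Longrightarrow> y \<in> Y \<Longrightarrow> w \<otimes> y \<in> I"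
    and power_notin_I: "x [^] p \<notin> I"
    and \<beta>_carrier: "q < N1 \<Longrightarrow> \<beta> q \<in> carrier R" and \<eta>_in_Y: "q < N1 \<Longrightarrow> \<eta> q \<in> Y"
    and gen_eq: "q < N1 \<Longrightarrow> gen q = x \<otimes> \<beta> q \<oplus> \<eta> q"
begin

lemma x_carrier: "x \<in> carrier R"
  by (rule \<mm>_carrier[OF x_in_\<mm>])

lemma \<eta>_carrier: "q < N1 \<Longrightarrow> \<eta> q \<in> carrier R"
  using \<eta>_in_Y ideal.Icarr[OF Y_ideal] by blast

abbreviation x_coord :: "(nat \<Rightarrow> 'a) \<Rightarrow> 'a" where "x_coord v \<equiv> dot_prod R N1 \<beta> v"

lemma x_coord_carrier: "v \<in> vecs R N1 \<Longrightarrow> x_coord v \<in> carrier R"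
  by (rule dot_prod_closed) (auto simp: \<beta>_carrier vecs_carrier)

lemma unit_mult_x_notin_Y:
  assumes t: "t \<in> carrier R" "t \<otimes> x \<in> Y"
  shows "t \<in> \<mm>"
proof (rule ccontr)
  assume "t \<notin> \<mm>"
  then have "x \<in> Y" using ideal_mult_cancel[OF Y_ideal t(1) _ x_carrier t(2)] by blast
  then have "x [^] (p - 1) \<otimes> x \<in> I" using mult_Y_in_I \<mm>pow_nat_pow[OF x_in_\<mm>] by blast
  then show False using power_notin_I p_ge_2 x_carrier by (simp flip: nat_pow_Suc)
qed

lemma unit_mult_power_notin_I: "t \<in> carrier R \<Longrightarrow> t \<otimes> x [^] p \<in> I \<Longrightarrow> t \<in> \<mm>"
  using ideal_mult_cancel[OF I_ideal, of t "x [^] p"] x_carrier power_notin_I by auto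

lemma gen_dot_prod: "v \<in> vecs R N1 \<Longrightarrow> dot_prod R N1 gen v = x \<otimes> x_coord v \<oplus> dot_prod R N1 \<eta> v"
  by (rule dot_prod_decompose_left) (auto simp: x_carrier \<beta>_carrier \<eta>_carrier gen_eq vecs_carrier)

lemma \<eta>_dot_prod_in_Y: "v \<in> vecs R N1 \<Longrightarrow> dot_prod R N1 \<eta> v \<in> Y"
  using dot_prod_ideal[OF Y_ideal, of N1 v \<eta>] dot_prod_comm[of N1 \<eta> v]
  by (simp add: \<eta>_in_Y \<eta>_carrier vecs_carrier)

lemma x_coord_in_\<mm>:
  assumes v: "v \<in> vecs R N1" and vY: "dot_prod R N1 gen v \<in> Y"
  shows "x_coord v \<in> \<mm>"
proof -
  note \<eta>Y = \<eta>_dot_prod_in_Y[OF v]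
  have "dot_prod R N1 gen v \<ominus> dot_prod R N1 \<eta> v \<in> Y" by (rule ideal_minus[OF Y_ideal vY \<eta>Y])
  moreover have "dot_prod R N1 gen v \<ominus> dot_prod R N1 \<eta> v = x_coord v \<otimes> x"
    unfolding gen_dot_prod[OF v] using x_coord_carrier[OF v] ideal.Icarr[OF Y_ideal \<eta>Y] x_carrier by algebra
  ultimately show ?thesis using unit_mult_x_notin_Y[OF x_coord_carrier[OF v]] by simp
qed

lemma x_coord_decompose:
  assumes \<alpha>: "\<alpha> \<in> vecs R N1" and y: "y \<in> vecs R N1"
  shows "x_coord (\<lambda>q. x \<otimes> \<alpha> q \<oplus> y q) = x \<otimes> x_coord \<alpha> \<oplus> x_coord y"
  using dot_prod_add_right[of N1 \<beta> "\<lambda>q. x \<otimes> \<alpha> q" y] dot_prod_smult_right[OF x_carrier, of N1 \<beta> \<alpha>]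
    \<beta>_carrier vecs_carrier[OF \<alpha>] vecs_carrier[OF y] x_carrier by simp

text \<open>Multiplying the syzygy by \<open>x\<^sup>p\<^sup>-\<^sup>2\<close> leaves only a multiple of \<open>x\<^sup>p\<close> modulo \<open>I\<close>.\<close>

lemma x_coord_syzygy_in_\<mm>:
  assumes \<alpha>: "\<alpha> \<in> vecs R N1" and y: "y \<in> ideal_vecs R Y N1"
    and \<kappa>: "\<kappa> \<in> ideal_vecs R \<mm> N1" "\<kappa> = (\<lambda>q. x \<otimes> \<alpha> q \<oplus> y q)" and syz: "dot_prod R N1 gen \<kappa> = \<zero>"
  shows "x_coord \<alpha> \<in> \<mm>"
proof -
  let ?z = "x [^] (p - 2)" and ?B = "x_coord \<alpha>" and ?y = "x_coord y" and ?\<eta> = "dot_prod R N1 \<eta> \<kappa>"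
  note \<kappa>_vecs = ideal_vecs_vecs[OF \<kappa>(1)] and y_vecs = ideal_vecs_vecs[OF y]
  have yY: "?y \<in> Y" by (rule dot_prod_ideal[OF Y_ideal \<beta>_carrier ideal_vecs_entry[OF Y_ideal y]])
  have z: "?z \<in> \<mm>pow (p - 2)" by (rule \<mm>pow_nat_pow[OF x_in_\<mm>])
  have z\<mm>: "?z \<otimes> u \<in> \<mm>pow (p - 1)" if "u \<in> \<mm>" for u
    using \<mm>pow_mult[OF z, of u 1] that \<mm>pow_1 p_ge_2 by (simp add: Suc_diff_Suc numeral_2_eq_2)
  have carriers: "?z \<in> carrier R" "x \<in> carrier R" "?B \<in> carrier R" "?y \<in> carrier R" "?\<eta> \<in> carrier R"
    using x_carrier x_coord_carrier[OF \<alpha>] x_coord_carrier[OF y_vecs]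
      ideal.Icarr[OF Y_ideal \<eta>_dot_prod_in_Y[OF \<kappa>_vecs]] by auto
  have yI: "(?z \<otimes> x) \<otimes> ?y \<in> I" by (rule mult_Y_in_I[OF z\<mm>[OF x_in_\<mm>] yY])
  have "dot_prod R N1 (\<lambda>q. ?z \<otimes> \<kappa> q) \<eta> \<in> I" unfolding dot_prod_def
    by (rule ideal_finsum_closed[OF I_ideal])
      (auto intro!: mult_Y_in_I z\<mm> \<eta>_in_Y ideal_vecs_entry[OF \<mm>_ideal \<kappa>(1)])
  moreover have "dot_prod R N1 (\<lambda>q. ?z \<otimes> \<kappa> q) \<eta> = ?z \<otimes> ?\<eta>"
    using dot_prod_smult_left[OF carriers(1), of N1 \<eta> \<kappa>] dot_prod_comm[of N1 \<kappa> \<eta>] \<eta>_carrier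
      vecs_carrier[OF \<kappa>_vecs] by simp
  ultimately have \<eta>I: "?z \<otimes> ?\<eta> \<in> I" by simp
  have "x \<otimes> (x \<otimes> ?B \<oplus> ?y) \<oplus> ?\<eta> = \<zero>"
    using gen_dot_prod[OF \<kappa>_vecs] syz x_coord_decompose[OF \<alpha> y_vecs] \<kappa>(2) by simp
  then have "?z \<otimes> (x \<otimes> (x \<otimes> ?B \<oplus> ?y) \<oplus> ?\<eta>) = \<zero>" using carriers(1) by simp
  moreover have "?B \<otimes> (?z \<otimes> (x \<otimes> x)) = ?z \<otimes> (x \<otimes> (x \<otimes> ?B \<oplus> ?y) \<oplus> ?\<eta>) \<ominus> ((?z \<otimes> x) \<otimes> ?y \<oplus> ?z \<otimes> ?\<eta>)"
    using carriers by algebra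
  moreover have "x \<otimes> x = x [^] (2::nat)" using x_carrier by (simp add: numeral_2_eq_2)
  then have "?z \<otimes> (x \<otimes> x) = x [^] p"
    using nat_pow_mult[OF x_carrier, of "p - 2" 2] p_ge_2 by (metis le_add_diff_inverse2)
  ultimately have "?B \<otimes> x [^] p = \<zero> \<ominus> ((?z \<otimes> x) \<otimes> ?y \<oplus> ?z \<otimes> ?\<eta>)" by simp
  also have "\<dots> \<in> I" by (intro ideal_minus[OF I_ideal] ideal_zero[OF I_ideal] ideal_add[OF I_ideal] yI \<eta>I)
  finally show ?thesis by (rule unit_mult_power_notin_I[OF carriers(3)])
qed

lemma mult_x_coord_syzygy_in_I:
  assumes w: "w \<in> \<mm>pow (p - 1)" and \<kappa>: "\<kappa> \<in> ideal_vecs R \<mm> N1" and syz: "dot_prod R N1 gen \<kappa> = \<zero>"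
  shows "w \<otimes> x_coord \<kappa> \<in> I"
proof -
  have "\<exists>r\<in>carrier R. \<exists>y\<in>Y. \<kappa> q = x \<otimes> r \<oplus> y" for q
    using line_decompose[OF ideal_vecs_entry[OF \<mm>_ideal \<kappa>, of q]] m_comm[OF x_carrier] by metis
  then obtain \<alpha>' y' where \<alpha>y': "\<And>q. \<alpha>' q \<in> carrier R \<and> y' q \<in> Y \<and> \<kappa> q = x \<otimes> \<alpha>' q \<oplus> y' q" by metis
  define \<alpha> where "\<alpha> q = (if q < N1 then \<alpha>' q else \<zero>)" for q
  define y where "y q = (if q < N1 then y' q else \<zero>)" for q
  have \<alpha>: "\<alpha> \<in> vecs R N1" using \<alpha>y' by (auto simp: \<alpha>_def vecs_def)
  have y: "y \<in> ideal_vecs R Y N1" using \<alpha>y' ideal.Icarr[OF Y_ideal] by (auto simp: y_def ideal_vecs_def vecs_def)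
  have \<kappa>_eq: "\<kappa> = (\<lambda>q. x \<otimes> \<alpha> q \<oplus> y q)"
    using \<alpha>y' vecs_ge[OF ideal_vecs_vecs[OF \<kappa>]] x_carrier by (auto simp: \<alpha>_def y_def fun_eq_iff)
  have yY: "x_coord y \<in> Y" by (rule dot_prod_ideal[OF Y_ideal \<beta>_carrier ideal_vecs_entry[OF Y_ideal y]])
  have "x_coord \<alpha> \<in> \<mm>" by (rule x_coord_syzygy_in_\<mm>[OF \<alpha> y \<kappa> \<kappa>_eq syz])
  then have "w \<otimes> (x \<otimes> x_coord \<alpha>) \<in> \<mm>pow (p - 1 + 2)" by (intro \<mm>pow_mult[OF w] \<mm>_mult_\<mm> x_in_\<mm>)
  then have x_part: "w \<otimes> (x \<otimes> x_coord \<alpha>) \<in> I"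
    using \<mm>pow_subset_I p_ge_2 by (auto simp: Suc_diff_Suc numeral_2_eq_2)
  have "w \<otimes> x_coord \<kappa> = w \<otimes> (x \<otimes> x_coord \<alpha>) \<oplus> w \<otimes> x_coord y"
    unfolding \<kappa>_eq x_coord_decompose[OF \<alpha> ideal_vecs_vecs[OF y]]
    using \<mm>pow_carrier[OF w] x_carrier x_coord_carrier[OF \<alpha>] ideal.Icarr[OF Y_ideal yY] by (simp add: r_distr)
  also have "\<dots> \<in> I" by (rule ideal_add[OF I_ideal x_part mult_Y_in_I[OF w yY]])
  finally show ?thesis .
qed

lemma x_coord_relation_in_I:
  assumes v: "v \<in> ideal_vecs R (\<mm>pow p) N1" "dot_prod R N1 gen v \<in> \<mm>pow (p + 2)"
  shows "x_coord v \<in> I"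
proof -
  interpret module_hom_pair R "Free N1" Reg x_coord
    by (intro module_hom_pairI module_Free module_regular linear_map_dot_prod \<beta>_carrier)
  let ?P = "{v \<in> vecs R N1. x_coord v \<in> I}"
  have "v \<in> ?P"
  proof (rule relations_in_submodule[OF _ _ _ _ v])
    show "submodule ?P R (Free N1)" using submodule_vimage[of I] I_ideal by (simp add: submodule_regular_iff)
    have "x_coord v \<in> I" if "v \<in> ideal_vecs R (\<mm>pow (p + 1)) N1" for v
      using ideal_vecs_entry[OF \<mm>pow_ideal that] \<mm>pow_subset_I by (intro dot_prod_ideal[OF I_ideal \<beta>_carrier]) auto
    then show "ideal_vecs R (\<mm>pow (p + 1)) N1 \<subseteq> ?P" using ideal_vecs_vecs by blast
    fix w \<kappa> assume w: "w \<in> \<mm>pow (p - 1)" and \<kappa>: "\<kappa> \<in> ideal_vecs R \<mm> N1" "dot_prod R N1 gen \<kappa> = \<zero>"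
    show "(\<lambda>q. w \<otimes> \<kappa> q) \<in> ?P"
      using mult_x_coord_syzygy_in_I[OF w \<kappa>] hom_smult[OF \<mm>pow_carrier[OF w], of \<kappa>]
        vecs_smult[OF \<mm>pow_carrier[OF w] ideal_vecs_vecs[OF \<kappa>(1)]] ideal_vecs_vecs[OF \<kappa>(1)] by simp
  qed (use p_ge_2 in simp)
  then show ?thesis by simp
qed

lemma x_coord_x_notin_\<mm>:
  assumes r: "r \<in> vecs R N1" "dot_prod R N1 gen r = x"
  shows "x_coord r \<notin> \<mm>"
proof
  assume r\<mm>: "x_coord r \<in> \<mm>"
  note \<eta>Y = \<eta>_dot_prod_in_Y[OF r(1)]
  have "(\<one> \<ominus> x_coord r) \<otimes> x = x \<ominus> x \<otimes> x_coord r" using x_carrier x_coord_carrier[OF r(1)] by algebra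
  also have "\<dots> = (x \<otimes> x_coord r \<oplus> dot_prod R N1 \<eta> r) \<ominus> x \<otimes> x_coord r" using gen_dot_prod[OF r(1)] r(2) by simp
  also have "\<dots> = dot_prod R N1 \<eta> r"
    using x_carrier x_coord_carrier[OF r(1)] ideal.Icarr[OF Y_ideal \<eta>Y] by algebra
  finally have "\<one> \<ominus> x_coord r \<in> \<mm>"
    using unit_mult_x_notin_Y[of "\<one> \<ominus> x_coord r"] \<eta>Y x_coord_carrier[OF r(1)] by simp
  then show False using one_minus_\<mm>[OF r\<mm>] by blast
qed

lemma power_relation_notin_\<mm>pow:
  assumes a: "a \<in> Y" and c: "c \<in> \<mm>pow p"
  shows "x \<otimes> x [^] p \<ominus> a \<otimes> c \<notin> \<mm>pow (p + 2)"
proof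
  assume rel: "x \<otimes> x [^] p \<ominus> a \<otimes> c \<in> \<mm>pow (p + 2)"
  obtain r where r: "r \<in> vecs R N1" "dot_prod R N1 gen r = x" using gen_generates[OF x_in_\<mm>] by blast
  obtain s where s: "s \<in> vecs R N1" "dot_prod R N1 gen s = a" using gen_generates[of a] a Y_subset by blast
  have carriers: "x \<in> carrier R" "x [^] p \<in> carrier R" "a \<in> carrier R" "c \<in> carrier R"
    using x_carrier ideal.Icarr[OF Y_ideal a] \<mm>pow_carrier[OF c] by auto
  let ?v = "\<lambda>q. x [^] p \<otimes> r q \<oplus> (\<ominus> c) \<otimes> s q"
  have v_vecs: "?v \<in> vecs R N1" using carriers by (intro vecs_add vecs_smult r(1) s(1)) auto
  have v: "?v \<in> ideal_vecs R (\<mm>pow p) N1"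
    by (intro ideal_vecsI v_vecs \<mm>pow_add \<mm>pow_smult_right[OF vecs_carrier[OF r(1)] \<mm>pow_nat_pow[OF x_in_\<mm>]]
        \<mm>pow_smult_right[OF vecs_carrier[OF s(1)] \<mm>pow_uminus[OF c]])
  have split: "dot_prod R N1 u ?v = x [^] p \<otimes> dot_prod R N1 u r \<oplus> (\<ominus> c) \<otimes> dot_prod R N1 u s"
    if u: "\<And>q. q < N1 \<Longrightarrow> u q \<in> carrier R" for u
    using dot_prod_add_right[of N1 u "\<lambda>q. x [^] p \<otimes> r q" "\<lambda>q. (\<ominus> c) \<otimes> s q"] u carriers
      vecs_carrier[OF r(1)] vecs_carrier[OF s(1)]
      dot_prod_smult_right[OF carriers(2), of N1 u r] dot_prod_smult_right[of "\<ominus> c" N1 u s] by simp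
  have "dot_prod R N1 gen ?v = x [^] p \<otimes> x \<oplus> (\<ominus> c) \<otimes> a" using split[OF gen_carrier] r(2) s(2) by simp
  also have "\<dots> = x \<otimes> x [^] p \<ominus> a \<otimes> c" using carriers by algebra
  finally have "x_coord ?v \<in> I" using x_coord_relation_in_I[OF v] rel by simp
  then have sum: "x [^] p \<otimes> x_coord r \<oplus> (\<ominus> c) \<otimes> x_coord s \<in> I" using split[OF \<beta>_carrier] by simp
  have C: "x_coord r \<in> carrier R" "x_coord s \<in> carrier R" using x_coord_carrier r(1) s(1) by auto
  have "x_coord s \<in> \<mm>" using x_coord_in_\<mm>[OF s(1)] s(2) a by simp
  then have "x_coord s \<otimes> c \<in> \<mm>pow (p + 1)" using \<mm>_mult_\<mm>pow[OF _ c] by simp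
  then have "c \<otimes> x_coord s \<in> I" using \<mm>pow_subset_I m_comm[OF C(2) carriers(4)] by (metis subsetD)
  then have "(x [^] p \<otimes> x_coord r \<oplus> (\<ominus> c) \<otimes> x_coord s) \<oplus> c \<otimes> x_coord s \<in> I" by (rule ideal_add[OF I_ideal sum])
  moreover have "(x [^] p \<otimes> x_coord r \<oplus> (\<ominus> c) \<otimes> x_coord s) \<oplus> c \<otimes> x_coord s = x_coord r \<otimes> x [^] p"
    using C carriers by algebra
  ultimately have "x_coord r \<in> \<mm>" using unit_mult_power_notin_I[OF C(1)] by simp
  then show False using x_coord_x_notin_\<mm>[OF r] by blast
qed

end

context koszul_presentation
begin

theorem power_relation_notin_\<mm>pow:
  assumes Y: "ideal Y R" "Y \<subseteq> \<mm>" and I: "ideal I R" and x: "x \<in> \<mm>"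
    and dec: "\<And>u. u \<in> \<mm> \<Longrightarrow> \<exists>r\<in>carrier R. \<exists>y\<in>Y. u = r \<otimes> x \<oplus> y"
    and p: "p \<ge> 2" and \<mm>I: "\<mm>pow (p + 1) \<subseteq> I" and YI: "\<And>w y. w \<in> \<mm>pow (p - 1) \<Longrightarrow> y \<in> Y \<Longrightarrow> w \<otimes> y \<in> I"
    and xp: "x [^] p \<notin> I" and a: "a \<in> Y" and c: "c \<in> \<mm>pow p"
  shows "x \<otimes> x [^] p \<ominus> a \<otimes> c \<notin> \<mm>pow (p + 2)"
proof -
  have "\<exists>r\<in>carrier R. \<exists>y\<in>Y. gen q = x \<otimes> r \<oplus> y" if "q < N1" for q
    using dec[OF gen_in_\<mm>[OF that]] m_comm[OF \<mm>_carrier[OF x]] by metis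
  then obtain \<beta> \<eta> where \<beta>\<eta>: "\<And>q. q < N1 \<Longrightarrow> \<beta> q \<in> carrier R" "\<And>q. q < N1 \<Longrightarrow> \<eta> q \<in> Y"
    "\<And>q. q < N1 \<Longrightarrow> gen q = x \<otimes> \<beta> q \<oplus> \<eta> q" by metis
  interpret koszul_line R e N1 N2 gen D2 Y I x p \<beta> \<eta>
    by (intro koszul_line.intro koszul_line_axioms.intro koszul_presentation_axioms) (fact assms \<beta>\<eta>)+
  show ?thesis by (rule power_relation_notin_\<mm>pow[OF a c])
qed

end

text \<open>Here \<open>\<mm> = R a + R y\<close> and \<open>\<mm>\<^sup>2 = \<mm> a\<close>, with an annihilator of \<open>a\<close> of order at least two: division by \<open>a\<close> turns
  vectors of quadrics into linear ones, and the cubics obtained by pairing these with the generators of \<open>\<mm>\<close> vanish to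
  third order on multiples of linear syzygies.\<close>

locale koszul_reduction = koszul_presentation +
  fixes a y :: 'a
  assumes a_in_\<mm>: "a \<in> \<mm>" and y_in_\<mm>: "y \<in> \<mm>"
    and annihilates_a_in_sq: "z \<in> carrier R \<Longrightarrow> z \<otimes> a = \<zero> \<Longrightarrow> z \<in> \<mm>pow 2"
    and \<mm>_decompose: "u \<in> \<mm> \<Longrightarrow> \<exists>r\<in>carrier R. \<exists>s\<in>carrier R. u = r \<otimes> a \<oplus> s \<otimes> y"
    and sq_subset_mult_a: "\<mm>pow 2 \<subseteq> \<mm> \<bullet> a"
begin

lemma a_carrier: "a \<in> carrier R" and y_carrier: "y \<in> carrier R"
  using a_in_\<mm> y_in_\<mm> \<mm>_carrier by auto

lemma divide_vec:
  assumes I: "ideal I R" "I \<subseteq> carrier R" and v: "v \<in> vecs R N1" and sub: "\<And>t. t < N1 \<Longrightarrow> v t \<in> I \<bullet> a"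
  obtains Z where "Z \<in> ideal_vecs R I N1" "v = (\<lambda>q. a \<otimes> Z q)"
proof -
  have divisible: "\<exists>u\<in>I. v t = a \<otimes> u" if t: "t < N1" for t
  proof -
    obtain u where u: "u \<in> I" "v t = u \<otimes> a" using sub[OF t] by blast
    then have "v t = a \<otimes> u" using m_comm[OF a_carrier, of u] I(2) by auto
    then show ?thesis using u(1) by blast
  qed
  obtain Z where Z: "Z \<in> ideal_vecs R I N1" "\<And>t. t < N1 \<Longrightarrow> v t = a \<otimes> Z t"
    using ideal_vecs_choice[OF I(1), of N1 "\<lambda>t u. v t = a \<otimes> u"] divisible by metis
  have "v = (\<lambda>q. a \<otimes> Z q)"
    by (rule vecs_eqI[OF v vecs_smult[OF a_carrier ideal_vecs_vecs[OF Z(1)]] Z(2)])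
  with Z(1) show ?thesis by (rule that)
qed

lemma divide_syzygy:
  assumes \<kappa>: "\<kappa> \<in> ideal_vecs R \<mm> N1" and syz: "dot_prod R N1 gen \<kappa> = \<zero>"
  obtains \<zeta> where "\<zeta> \<in> vecs R N1" "(\<lambda>q. y \<otimes> \<kappa> q) = (\<lambda>q. a \<otimes> \<zeta> q)" "dot_prod R N1 gen \<zeta> \<in> \<mm>pow 3"
proof -
  note \<kappa>_vecs = ideal_vecs_vecs[OF \<kappa>]
  note \<kappa>_carrier = vecs_carrier[OF \<kappa>_vecs]
  have "\<exists>r s. r \<in> carrier R \<and> s \<in> carrier R \<and> gen q = a \<otimes> r \<oplus> y \<otimes> s" if "q < N1" for q
    using \<mm>_decompose[OF gen_in_\<mm>[OF that]] m_comm a_carrier y_carrier by metis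
  then obtain \<beta> \<gamma> where \<beta>: "\<And>q. q < N1 \<Longrightarrow> \<beta> q \<in> carrier R" and \<gamma>: "\<And>q. q < N1 \<Longrightarrow> \<gamma> q \<in> carrier R"
    and gen_eq: "\<And>q. q < N1 \<Longrightarrow> gen q = a \<otimes> \<beta> q \<oplus> y \<otimes> \<gamma> q" by metis
  have gen_dot: "dot_prod R N1 gen v = a \<otimes> dot_prod R N1 \<beta> v \<oplus> y \<otimes> dot_prod R N1 \<gamma> v"
    if v: "\<And>q. v q \<in> carrier R" for v
    using dot_prod_decompose_left[of a N1 \<beta> "\<lambda>q. y \<otimes> \<gamma> q" gen v] dot_prod_smult_left[of y N1 v \<gamma>]
      \<beta> \<gamma> a_carrier y_carrier v gen_eq by simp
  obtain \<zeta> where \<zeta>: "\<zeta> \<in> ideal_vecs R \<mm> N1" "(\<lambda>q. y \<otimes> \<kappa> q) = (\<lambda>q. a \<otimes> \<zeta> q)"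
  proof (rule divide_vec[OF \<mm>_ideal _ vecs_smult[OF y_carrier \<kappa>_vecs]])
    show "y \<otimes> \<kappa> t \<in> \<mm> \<bullet> a" for t
      by (rule subsetD[OF sq_subset_mult_a \<mm>_mult_\<mm>[OF y_in_\<mm> ideal_vecs_entry[OF \<mm>_ideal \<kappa>]]])
  qed (use \<mm>_carrier in auto)
  note \<zeta>_vecs = ideal_vecs_vecs[OF \<zeta>(1)] and \<zeta>_carrier = vecs_carrier[OF ideal_vecs_vecs[OF \<zeta>(1)]]
  have swap: "a \<otimes> dot_prod R N1 u \<zeta> = y \<otimes> dot_prod R N1 u \<kappa>" if u: "\<And>q. q < N1 \<Longrightarrow> u q \<in> carrier R" for u
    using dot_prod_smult_right[of a N1 u \<zeta>] dot_prod_smult_right[of y N1 u \<kappa>] u \<zeta>_carrier \<kappa>_carrier a_carrier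
      y_carrier \<zeta>(2) by simp
  let ?T = "dot_prod R N1 \<beta> \<kappa> \<oplus> dot_prod R N1 \<gamma> \<zeta>"
  have dot_carrier: "dot_prod R N1 \<beta> \<kappa> \<in> carrier R" "dot_prod R N1 \<gamma> \<zeta> \<in> carrier R"
    using \<beta> \<gamma> \<kappa>_carrier \<zeta>_carrier by (auto intro: dot_prod_closed)
  have "?T \<otimes> a = a \<otimes> dot_prod R N1 \<beta> \<kappa> \<oplus> a \<otimes> dot_prod R N1 \<gamma> \<zeta>" using dot_carrier a_carrier by algebra
  also have "\<dots> = dot_prod R N1 gen \<kappa>" using swap[OF \<gamma>] gen_dot[OF \<kappa>_carrier] by simp
  finally have "y \<otimes> ?T \<in> \<mm>pow 3"
    using annihilates_a_in_sq[of ?T] syz dot_carrier by (intro \<mm>_mult_sq[OF y_in_\<mm>]) simp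
  moreover have "dot_prod R N1 gen \<zeta> = y \<otimes> ?T"
    using gen_dot[OF \<zeta>_carrier] swap[OF \<beta>] dot_carrier y_carrier by (simp add: r_distr)
  ultimately show ?thesis using that \<zeta>_vecs \<zeta>(2) by simp
qed

definition cubic_vecs :: "(nat \<Rightarrow> 'a) set" where
  "cubic_vecs = {Z \<in> vecs R N1. dot_prod R N1 gen Z \<in> \<mm>pow 3}"

lemma cubic_vecs_submodule: "submodule cubic_vecs R (Free N1)"
proof -
  interpret module_hom_pair R "Free N1" Reg "dot_prod R N1 gen"
    by (intro module_hom_pairI module_Free module_regular linear_map_dot_prod gen_carrier)
  show ?thesis using submodule_vimage[OF \<mm>pow_submodule] by (simp add: cubic_vecs_def)
qed

lemma sq_vecs_cubic: "Z \<in> ideal_vecs R (\<mm>pow 2) N1 \<Longrightarrow> Z \<in> cubic_vecs"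
  using ideal_vecs_entry[OF \<mm>pow_ideal, of Z 2 N1] gen_in_\<mm> ideal_vecs_vecs[of Z "\<mm>pow 2" N1]
  by (auto simp: cubic_vecs_def dot_prod_def intro!: ideal_finsum_closed[OF \<mm>pow_ideal] \<mm>_mult_sq)

lemma mult_syzygy_in_mult_cubic:
  assumes w: "w \<in> \<mm>" and \<kappa>: "\<kappa> \<in> ideal_vecs R \<mm> N1" and syz: "dot_prod R N1 gen \<kappa> = \<zero>"
  shows "(\<lambda>q. w \<otimes> \<kappa> q) \<in> (\<lambda>Z q. a \<otimes> Z q) ` cubic_vecs"
proof -
  note \<kappa>_vecs = ideal_vecs_vecs[OF \<kappa>]
  obtain r t where rt: "r \<in> carrier R" "t \<in> carrier R" "w = r \<otimes> a \<oplus> t \<otimes> y" using \<mm>_decompose[OF w] by blast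
  obtain \<zeta> where \<zeta>: "\<zeta> \<in> vecs R N1" "(\<lambda>q. y \<otimes> \<kappa> q) = (\<lambda>q. a \<otimes> \<zeta> q)" "dot_prod R N1 gen \<zeta> \<in> \<mm>pow 3"
    by (rule divide_syzygy[OF \<kappa> syz]) (rule that)
  have "\<kappa> \<in> cubic_vecs" "\<zeta> \<in> cubic_vecs" using \<kappa>_vecs syz \<zeta> \<mm>pow_zero by (auto simp: cubic_vecs_def)
  then have "r \<odot>\<^bsub>Free N1\<^esub> \<kappa> \<oplus>\<^bsub>Free N1\<^esub> t \<odot>\<^bsub>Free N1\<^esub> \<zeta> \<in> cubic_vecs"
    by (intro submodule_add[OF cubic_vecs_submodule] submodule_smult[OF cubic_vecs_submodule] rt)
  moreover have "w \<otimes> \<kappa> q = a \<otimes> (r \<otimes> \<kappa> q \<oplus> t \<otimes> \<zeta> q)" for q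
  proof -
    have carriers: "\<kappa> q \<in> carrier R" "\<zeta> q \<in> carrier R" using vecs_carrier \<kappa>_vecs \<zeta>(1) by auto
    have "w \<otimes> \<kappa> q = a \<otimes> (r \<otimes> \<kappa> q) \<oplus> t \<otimes> (y \<otimes> \<kappa> q)"
      unfolding rt(3) using rt(1,2) carriers a_carrier y_carrier by algebra
    also have "\<dots> = a \<otimes> (r \<otimes> \<kappa> q \<oplus> t \<otimes> \<zeta> q)"
      unfolding fun_cong[OF \<zeta>(2)] using rt(1,2) carriers a_carrier by algebra
    finally show ?thesis .
  qed
  ultimately show ?thesis by (auto simp: image_iff)
qed

lemma mult_annihilator_in_mult_cubic:
  assumes b: "b \<in> \<mm>pow 2" "b \<otimes> a = \<zero>" and s: "s \<in> vecs R N1" "dot_prod R N1 gen s = a"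
  shows "(\<lambda>q. b \<otimes> s q) \<in> (\<lambda>Z q. a \<otimes> Z q) ` cubic_vecs"
proof (rule relations_in_submodule[of _ 2])
  note b_carrier = \<mm>pow_carrier[OF b(1)]
  interpret mult: module_hom_pair R "Free N1" "Free N1" "\<lambda>v q. a \<otimes> v q"
    by (intro module_hom_pairI module_Free linear_map_smult a_carrier)
  show "submodule ((\<lambda>Z q. a \<otimes> Z q) ` cubic_vecs) R (Free N1)"
    by (rule mult.submodule_image[OF cubic_vecs_submodule])
  show "(\<lambda>q. b \<otimes> s q) \<in> ideal_vecs R (\<mm>pow 2) N1"
    by (intro ideal_vecsI vecs_smult b_carrier s(1) \<mm>pow_smult_right[OF vecs_carrier[OF s(1)] b(1)])
  show "dot_prod R N1 gen (\<lambda>q. b \<otimes> s q) \<in> \<mm>pow (2 + 2)"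
    using dot_prod_smult_right[OF b_carrier, of N1 gen s] gen_carrier vecs_carrier[OF s(1)] s(2) b(2)
      \<mm>pow_zero by simp
  show "ideal_vecs R (\<mm>pow (2 + 1)) N1 \<subseteq> (\<lambda>Z q. a \<otimes> Z q) ` cubic_vecs"
  proof
    fix v assume v: "v \<in> ideal_vecs R (\<mm>pow (2 + 1)) N1"
    have "\<mm>pow (2 + 1) \<subseteq> \<mm>pow 2 \<bullet> a"
      using \<mm>pow_Suc_subset_mult[OF a_carrier, of 1] sq_subset_mult_a \<mm>pow_1
      by (simp add: numeral_3_eq_3 numeral_2_eq_2)
    then obtain Z where "Z \<in> ideal_vecs R (\<mm>pow 2) N1" "v = (\<lambda>q. a \<otimes> Z q)"
      using ideal_vecs_entry[OF \<mm>pow_ideal v] \<mm>pow_carrier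
      by (elim divide_vec[OF \<mm>pow_ideal _ ideal_vecs_vecs[OF v], rotated 2]) auto
    then show "v \<in> (\<lambda>Z q. a \<otimes> Z q) ` cubic_vecs" using sq_vecs_cubic by blast
  qed
  show "(\<lambda>q. w \<otimes> \<kappa> q) \<in> (\<lambda>Z q. a \<otimes> Z q) ` cubic_vecs"
    if "w \<in> \<mm>pow (2 - 1)" "\<kappa> \<in> ideal_vecs R \<mm> N1" "dot_prod R N1 gen \<kappa> = \<zero>" for w \<kappa>
    using mult_syzygy_in_mult_cubic[of w \<kappa>] that \<mm>pow_1 by simp
qed simp

theorem annihilator_in_cube:
  assumes b: "b \<in> \<mm>pow 2" "b \<otimes> a = \<zero>"
  shows "b \<in> \<mm>pow 3"
proof -
  interpret gen: module_hom_pair R "Free N1" Reg "dot_prod R N1 gen"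
    by (intro module_hom_pairI module_Free module_regular linear_map_dot_prod gen_carrier)
  obtain s where s: "s \<in> vecs R N1" "dot_prod R N1 gen s = a" using gen_generates[OF a_in_\<mm>] by blast
  obtain Z where Z: "Z \<in> cubic_vecs" "(\<lambda>q. b \<otimes> s q) = (\<lambda>q. a \<otimes> Z q)"
    using mult_annihilator_in_mult_cubic[OF b s] by blast
  obtain h where h: "h \<in> \<mm>" "b = h \<otimes> a" using sq_subset_mult_a b(1) by blast
  note h_carrier = \<mm>_carrier[OF h(1)]
  have hs: "(\<lambda>q. h \<otimes> s q) \<in> vecs R N1" and Zv: "Z \<in> vecs R N1"
    using vecs_smult[OF h_carrier s(1)] Z(1) by (auto simp: cubic_vecs_def)
  let ?E = "(\<lambda>q. h \<otimes> s q) \<ominus>\<^bsub>Free N1\<^esub> Z"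
  have "?E q \<in> \<mm>pow 2" for q
  proof (rule annihilates_a_in_sq)
    have carriers: "h \<in> carrier R" "s q \<in> carrier R" "Z q \<in> carrier R" using h_carrier vecs_carrier s(1) Zv by auto
    show "?E q \<in> carrier R" using Free_minus[OF hs Zv] carriers by simp
    have "?E q \<otimes> a = b \<otimes> s q \<ominus> a \<otimes> Z q" unfolding Free_minus[OF hs Zv] h(2) using carriers a_carrier by algebra
    also have "\<dots> = \<zero>" using fun_cong[OF Z(2), of q] carriers a_carrier by (simp add: a_minus_def r_neg)
    finally show "?E q \<otimes> a = \<zero>" .
  qed
  then have "?E \<in> cubic_vecs"
    using gen.M.submodule_minus[OF vecs_submodule hs Zv] by (intro sq_vecs_cubic ideal_vecsI) auto
  then have "Z \<oplus>\<^bsub>Free N1\<^esub> ?E \<in> cubic_vecs" by (rule submodule_add[OF cubic_vecs_submodule Z(1)])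
  then have "dot_prod R N1 gen (\<lambda>q. h \<otimes> s q) \<in> \<mm>pow 3"
    using gen.M.minus_add_cancel[of "\<lambda>q. h \<otimes> s q" Z] hs Zv by (simp add: cubic_vecs_def)
  then show ?thesis using gen.hom_smult[OF h_carrier, of s] s h(2) by simp
qed

end

context koszul_presentation
begin

lemma e_neq_0: "e \<noteq> 0"
proof
  assume e0: "e = 0"
  have "\<mm>pow 2 = \<mm>" using S.quotient_length_eq_0[OF \<mm>pow_submodule \<mm>_submodule \<mm>pow_2_subset] len_\<mm>pow e0 by simp
  moreover have "\<mm>pow 3 = \<mm>pow 2"
    using S.quotient_length_eq_0[OF \<mm>pow_submodule \<mm>pow_submodule \<mm>pow_antimono[of 2 3]] len_\<mm>pow e0 by simp
  ultimately have "\<mm>pow 4 = \<mm>pow 3" by (simp add: numeral_eq_Suc ideal_power.simps(2))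
  then show False using \<mm>pow_4 \<mm>pow_3_neq_0 by simp
qed

lemma e_neq_1: "e \<noteq> 1"
proof
  assume e1: "e = 1"
  have cov: "simple_quotient R Reg (\<mm>pow 2) \<mm>"
    by (rule S.quotient_length_1_imp_simple[OF \<mm>pow_submodule \<mm>_submodule \<mm>pow_2_subset]) (use len_\<mm>pow e1 in simp)
  then obtain x where x: "x \<in> \<mm>" "x \<notin> \<mm>pow 2" using S.simple_quotientD(3,4) by blast
  note dec = simple_quotient_decompose[OF cov x]
  have x_cube: "x [^] (3::nat) \<noteq> \<zero>"
  proof
    assume z: "x [^] (3::nat) = \<zero>"
    have "u = \<zero>" if "u \<in> \<mm>pow 3" for u
      using subsetD[OF \<mm>pow_subset_principal[OF x(1) dec] that] z \<mm>pow_4 by (auto simp: set_add_iff PIdl_eq_image)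
    then show False using \<mm>pow_3_neq_0 \<mm>pow_zero[of 3] by blast
  qed
  have "x \<otimes> x [^] (3::nat) \<in> \<mm>pow 4" using \<mm>_mult_\<mm>pow[OF x(1) \<mm>pow_nat_pow[OF x(1), of 3]] by simp
  then have "x \<otimes> x [^] (3::nat) \<ominus> \<zero> \<otimes> \<zero> \<in> \<mm>pow (3 + 2)" using \<mm>pow_4 \<mm>pow_zero by (simp add: a_minus_def)
  moreover have "x \<otimes> x [^] (3::nat) \<ominus> \<zero> \<otimes> \<zero> \<notin> \<mm>pow (3 + 2)"
  proof (rule power_relation_notin_\<mm>pow[of "\<mm>pow 2" "{\<zero>}"])
    show "w \<otimes> y \<in> {\<zero>}" if "w \<in> \<mm>pow (3 - 1)" "y \<in> \<mm>pow 2" for w y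
      using \<mm>pow_mult[OF that] \<mm>pow_ge4[of 4] by simp
  qed (use x x_cube \<mm>pow_ideal zeroideal \<mm>pow_2_subset dec \<mm>pow_zero \<mm>pow_4 in auto)
  ultimately show False by blast
qed

lemma exact_pair_notin_sq:
  assumes pair: "exact_pair R e a a'"
  shows "a' \<notin> \<mm>pow 2"
proof
  assume a'2: "a' \<in> \<mm>pow 2"
  interpret exact_pair R e a a' by fact
  have e: "e = 2" using exact_pair.e_le_2[OF swap a'2] e_neq_0 e_neq_1 by simp
  have "len\<^sub>R {\<zero>} (PIdl a') \<le> 2" using exact_pair.len_PIdl_a_le_2[OF swap a'2] .
  then have len: "len\<^sub>R {\<zero>} (PIdl a) = 4" "len\<^sub>R {\<zero>} (PIdl a') = 2"
    using len_PIdl_a_add_len_PIdl_a' len_PIdl_a_le e by auto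
  have a2: "a \<notin> \<mm>pow 2" using len_PIdl_a_le_2 len by auto
  have len0: "len_sq_mod_a = 0" using len_ring_mod_a[OF a2] len_PIdl_a' len e by simp
  have sq: "\<mm>pow 2 = \<mm> \<bullet> a" by (rule sq_eq_mult_a[OF a2 sq_subset_PIdl_a[OF len0]])
  have "len\<^sub>R (PIdl a) \<mm> = 1" using len_\<mm>_mod_a[OF a2] len0 e by simp
  then have cov: "simple_quotient R Reg (PIdl a) \<mm>"
    by (intro S.quotient_length_1_imp_simple[OF PIdl_a_submodule \<mm>_submodule PIdl_a_subset])
  then obtain y where y: "y \<in> \<mm>" "y \<notin> PIdl a" using S.simple_quotientD(3,4) by blast
  interpret koszul_reduction R e N1 N2 gen D2 a y
  proof unfold_locales
    show "z \<in> \<mm>pow 2" if "z \<in> carrier R" "z \<otimes> a = \<zero>" for z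
      using ann_a[OF that(1)] that(2) \<mm>pow_smult[OF _ a'2] by (auto simp: PIdl_eq_image)
    show "\<exists>r\<in>carrier R. \<exists>s\<in>carrier R. u = r \<otimes> a \<oplus> s \<otimes> y" if u: "u \<in> \<mm>" for u
    proof -
      obtain s r where sr: "s \<in> carrier R" "r \<in> carrier R" "u = s \<otimes> y \<oplus> r \<otimes> a"
        using simple_quotient_decompose[OF cov y u] by (auto simp: PIdl_eq_image)
      then have "u = r \<otimes> a \<oplus> s \<otimes> y" using a_comm \<mm>_carrier[OF y(1)] a_carrier by simp
      then show ?thesis using sr by blast
    qed
  qed (use sq a_in_\<mm> y in auto)
  have "a' \<in> \<mm>pow 3" using annihilator_in_cube[OF a'2] a_mult_a' m_comm[OF a_carrier a'_carrier] by simp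
  then have "PIdl a' \<subseteq> \<mm>pow 3" using \<mm>pow_smult by (auto simp: PIdl_eq_image)
  then have "len\<^sub>R {\<zero>} (PIdl a') \<le> len\<^sub>R {\<zero>} (\<mm>pow 3)"
    using submodule_zero[OF PIdl_a'_submodule]
    by (intro S.quotient_length_mono submodule_0 PIdl_a'_submodule \<mm>pow_submodule) auto
  then show False using len len_\<mm>pow by simp
qed

end

context exact_pair
begin

lemma socle_mod_a_neq_\<mm>:
  assumes ann: "a \<notin> \<mm>pow 2" "a' \<notin> \<mm>pow 2"
  shows "socle_mod_a \<noteq> \<mm>"
proof
  assume "socle_mod_a = \<mm>"
  then have "\<mm>pow (Suc 1) \<subseteq> PIdl a"
    by (intro \<mm>pow_Suc_subset cgenideal_ideal a_carrier) (use \<mm>pow_1 in \<open>auto simp: socle_mod_a_def\<close>)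
  then have "\<mm>pow 2 \<subseteq> PIdl a" by (simp add: numeral_2_eq_2)
  then have "PIdl a <+>\<^bsub>Reg\<^esub> \<mm>pow 2 = PIdl a"
    using S.set_add_least[OF PIdl_a_submodule subset_refl]
      S.set_add_upper1[OF PIdl_a_submodule \<mm>pow_submodule] by blast
  then have "len_sq_mod_a = 0" using S.lat.len_refl[of "PIdl a"] PIdl_a_submodule by simp
  then show False using len_sq_mod_a_eq_1[OF ann] by simp
qed

lemma square_notin_PIdl_a:
  assumes x: "x \<in> \<mm>" "x \<notin> socle_mod_a"
    and dec: "\<And>u. u \<in> \<mm> \<Longrightarrow> \<exists>r\<in>carrier R. \<exists>y\<in>socle_mod_a. u = r \<otimes> x \<oplus> y"
  shows "x \<otimes> x \<notin> PIdl a"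
proof
  assume xx: "x \<otimes> x \<in> PIdl a"
  note x_carrier = \<mm>_carrier[OF x(1)]
  have "x \<otimes> v \<in> PIdl a" if v: "v \<in> \<mm>" for v
  proof -
    obtain r y where ry: "r \<in> carrier R" "y \<in> socle_mod_a" "v = r \<otimes> x \<oplus> y" using dec[OF v] by blast
    have "x \<otimes> v = r \<otimes> (x \<otimes> x) \<oplus> x \<otimes> y"
      using ry x_carrier socle_mod_a_carrier[OF ry(2)] by (simp add: r_distr m_lcomm)
    then show ?thesis
      using submodule_add[OF PIdl_a_submodule] submodule_smult[OF PIdl_a_submodule ry(1) xx]
        mult_socle_mod_a[OF x(1) ry(2)] by simp
  qed
  then show False using x unfolding socle_mod_a_def by blast
qed

end

theorem (in koszul_presentation) socle_bound:
  assumes pair: "exact_pair R e a a'"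
  shows "e \<ge> len\<^sub>R {\<zero>} socle + 2"
proof (rule ccontr)
  interpret exact_pair R e a a' by fact
  assume small: "\<not> e \<ge> len\<^sub>R {\<zero>} socle + 2"
  have ann: "a \<notin> \<mm>pow 2" "a' \<notin> \<mm>pow 2" using exact_pair_notin_sq[OF pair] exact_pair_notin_sq[OF swap] by auto
  have "len\<^sub>R socle_mod_a \<mm> \<le> 1" using len_\<mm>_mod_socle_mod_a[OF ann] e_neq_0 small by simp
  moreover have "len\<^sub>R socle_mod_a \<mm> \<noteq> 0"
    using S.quotient_length_eq_0[OF socle_mod_a_submodule \<mm>_submodule socle_mod_a_subset]
      socle_mod_a_neq_\<mm>[OF ann] by simp
  ultimately have cov: "simple_quotient R Reg socle_mod_a \<mm>"
    by (intro S.quotient_length_1_imp_simple[OF socle_mod_a_submodule \<mm>_submodule socle_mod_a_subset]) simp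
  then obtain x where x: "x \<in> \<mm>" "x \<notin> socle_mod_a" using S.simple_quotientD(3,4) by blast
  note dec = simple_quotient_decompose[OF cov x] and x_carrier = \<mm>_carrier[OF x(1)]
  have x_sq: "x [^] (2::nat) = x \<otimes> x" using x_carrier by (simp add: numeral_2_eq_2)
  have "x \<otimes> (x \<otimes> x) \<in> \<mm>pow 3" using x(1) by (intro \<mm>_mult_sq \<mm>_mult_\<mm>)
  then obtain c where c: "c \<in> \<mm>pow 2" "x \<otimes> (x \<otimes> x) = c \<otimes> a" using mult_a_sq_eq_cube[OF ann] by blast
  have "x \<otimes> x [^] (2::nat) = a \<otimes> c" using c x_sq m_comm[OF a_carrier \<mm>pow_carrier[OF c(1)]] by simp
  then have "x \<otimes> x [^] (2::nat) \<ominus> a \<otimes> c \<in> \<mm>pow (2 + 2)"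
    using \<mm>pow_zero \<mm>pow_carrier[OF c(1)] a_carrier by (simp add: a_minus_def r_neg)
  moreover have "x \<otimes> x [^] (2::nat) \<ominus> a \<otimes> c \<notin> \<mm>pow (2 + 2)"
  proof (rule power_relation_notin_\<mm>pow[of socle_mod_a "PIdl a"])
    show "ideal socle_mod_a R" using socle_mod_a_submodule submodule_regular_iff by simp
    show "\<mm>pow (2 + 1) \<subseteq> PIdl a"
      using cube_subset_socle socle_subset_PIdl_a by (simp add: numeral_3_eq_3 numeral_2_eq_2)
    show "w \<otimes> y \<in> PIdl a" if "w \<in> \<mm>pow (2 - 1)" "y \<in> socle_mod_a" for w y
      using mult_socle_mod_a that \<mm>pow_1 by simp
    show "x [^] (2::nat) \<notin> PIdl a" using square_notin_PIdl_a[OF x dec] x_sq by simp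
    show "a \<in> socle_mod_a" using PIdl_a_subset_socle_mod_a cgenideal_self[OF a_carrier] by blast
  qed (use x socle_mod_a_subset cgenideal_ideal[OF a_carrier] dec c in auto)
  ultimately show False by blast
qed

section \<open>The two-periodic Tate construction\<close>

context orthogonal_data
begin

lemma carriers: "a \<in> carrier R" "a' \<in> carrier R" "c \<in> carrier R" "c' \<in> carrier R" "l \<in> carrier R"
  using a_carrier a'_carrier \<mm>_carrier c_in_\<mm> c'_in_\<mm> l_in_\<mm> by auto

definition tate_a :: "nat \<Rightarrow> 'a" where "tate_a j = (if odd j then a else a')"

definition tate_c :: "nat \<Rightarrow> 'a" where "tate_c i = (if odd i then c else c')"

definition signed_c :: "nat \<Rightarrow> nat \<Rightarrow> 'a" where "signed_c i j = (if even j then tate_c i else \<ominus> tate_c i)"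

text \<open>An array \<open>g\<close> is an element of the algebra that Tate's construction obtains from \<open>R\<close> by adjoining exterior
  variables \<open>x, y\<close> with boundaries \<open>a, c\<close> and divided power variables \<open>z, w\<close> with boundaries \<open>a' x\<close> and
  \<open>c' y - l x\<close>: odd and even first indices \<open>i\<close> stand for the divided powers of \<open>w\<close> with and without the factor \<open>y\<close>,
  second indices \<open>j\<close> likewise for \<open>z\<close> and \<open>x\<close>.\<close>

definition tate_diff :: "(nat \<Rightarrow> nat \<Rightarrow> nat \<Rightarrow> 'a) \<Rightarrow> nat \<Rightarrow> nat \<Rightarrow> nat \<Rightarrow> 'a" where
  "tate_diff g i j = (\<lambda>t. tate_a (Suc j) \<otimes> g i (Suc j) t \<oplus>
     (signed_c (Suc i) j \<otimes> g (Suc i) j t \<oplus> (if odd j then \<ominus> l \<otimes> g (i + 2) (j - 1) t else \<zero>)))"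

lemma tate_a_in_\<mm>: "tate_a j \<in> \<mm>" and tate_a_carrier: "tate_a j \<in> carrier R"
  using a_in_\<mm> a'_in_\<mm> carriers by (auto simp: tate_a_def)

lemma tate_c_in_\<mm>: "tate_c i \<in> \<mm>" and tate_c_carrier: "tate_c i \<in> carrier R"
  using c_in_\<mm> c'_in_\<mm> carriers by (auto simp: tate_c_def)

lemma signed_c_in_\<mm>: "signed_c i j \<in> \<mm>" and signed_c_carrier: "signed_c i j \<in> carrier R"
  using tate_c_in_\<mm>[of i] ideal_uminus[OF \<mm>_ideal] tate_c_carrier[of i] by (auto simp: signed_c_def)

lemmas tate_carriers = carriers tate_a_carrier tate_c_carrier signed_c_carrier

lemma tate_c_mult_Suc: "tate_c i \<otimes> tate_c (Suc i) = l \<otimes> a"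
  using c_mult_c' m_comm carriers by (auto simp: tate_c_def)

lemma annihilator_tate_a: "x \<in> carrier R \<Longrightarrow> x \<otimes> tate_a j = \<zero> \<Longrightarrow> \<exists>u\<in>carrier R. x = u \<otimes> tate_a (Suc j)"
  using ann_a ann_a' by (auto simp: tate_a_def PIdl_eq_image split: if_splits)

lemma mult_tate_a_in_sq: "r \<in> carrier R \<Longrightarrow> r \<otimes> tate_a j \<in> \<mm>pow 2 \<Longrightarrow> r \<in> \<mm>"
  using mult_a_in_sq[OF a_notin_sq] exact_pair.mult_a_in_sq[OF swap a'_notin_sq]
  by (auto simp: tate_a_def split: if_splits)

lemma sq_generated_tate_c: "z \<in> \<mm>pow 2 \<Longrightarrow> \<exists>u\<in>\<mm>. \<exists>v\<in>\<mm>. z = u \<otimes> tate_c i \<oplus> v \<otimes> a"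
  using sq_generated orthogonal_data.sq_generated[OF orthogonal_data_swap] by (auto simp: tate_c_def)

lemma tate_diff_cong: "(\<And>p q. p + q = Suc (i + j) \<Longrightarrow> g p q = h p q) \<Longrightarrow> tate_diff g i j = tate_diff h i j"
  unfolding tate_diff_def by (auto simp: fun_eq_iff)

lemma tate_diff_eq_Free:
  "tate_diff g i j = tate_a (Suc j) \<odot>\<^bsub>Free n\<^esub> g i (Suc j) \<oplus>\<^bsub>Free n\<^esub>
     (signed_c (Suc i) j \<odot>\<^bsub>Free n\<^esub> g (Suc i) j \<oplus>\<^bsub>Free n\<^esub>
      (if odd j then \<ominus> l \<odot>\<^bsub>Free n\<^esub> g (i + 2) (j - 1) else \<zero>\<^bsub>Free n\<^esub>))"
  by (simp add: tate_diff_def zero_vec_def)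

lemma tate_diff_in_submodule:
  assumes V: "submodule V R (Free n)" and g: "\<And>p q. p + q = Suc (i + j) \<Longrightarrow> g p q \<in> V"
  shows "tate_diff g i j \<in> V"
proof -
  have "g (i + 2) (j - 1) \<in> V" if "odd j" using g that by (auto elim: oddE)
  then have "(if odd j then \<ominus> l \<odot>\<^bsub>Free n\<^esub> g (i + 2) (j - 1) else \<zero>\<^bsub>Free n\<^esub>) \<in> V"
    using submodule_smult[OF V, of "\<ominus> l"] submodule_zero[OF V] carriers by simp
  then show ?thesis unfolding tate_diff_eq_Free[of g i j n]
    by (intro submodule_add[OF V] submodule_smult[OF V] tate_carriers g) auto
qed

lemmas tate_diff_vecs = tate_diff_in_submodule[OF vecs_submodule]

lemma tate_diff_\<mm>pow:
  assumes g: "\<And>p q. p + q = Suc (i + j) \<Longrightarrow> g p q \<in> ideal_vecs R (\<mm>pow k) n"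
  shows "tate_diff g i j \<in> ideal_vecs R (\<mm>pow (Suc k)) n"
proof (rule ideal_vecsI)
  show "tate_diff g i j \<in> vecs R n" using g ideal_vecs_vecs by (blast intro: tate_diff_vecs)
  fix t
  have entry: "g p q t \<in> \<mm>pow k" if "p + q = Suc (i + j)" for p q
    by (rule ideal_vecs_entry[OF \<mm>pow_ideal g[OF that]])
  have "g (i + 2) (j - 1) t \<in> \<mm>pow k" if "odd j" using that by (intro entry) (auto elim: oddE)
  then have "(if odd j then \<ominus> l \<otimes> g (i + 2) (j - 1) t else \<zero>) \<in> \<mm>pow (Suc k)"
    using \<mm>_mult_\<mm>pow[OF ideal_uminus[OF \<mm>_ideal l_in_\<mm>]] \<mm>pow_zero by simp
  then show "tate_diff g i j t \<in> \<mm>pow (Suc k)"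
    unfolding tate_diff_def by (intro \<mm>pow_add \<mm>_mult_\<mm>pow tate_a_in_\<mm> signed_c_in_\<mm> entry) auto
qed

lemma linear_map_tate_diff:
  assumes f: "linear_map R (Free n) (Free n') f" and g: "\<And>p q. p + q = Suc (i + j) \<Longrightarrow> g p q \<in> vecs R n"
  shows "f (tate_diff g i j) = tate_diff (\<lambda>p q. f (g p q)) i j"
proof -
  interpret f: module_hom_pair R "Free n" "Free n'" f by (intro module_hom_pairI module_Free f)
  have closed: "r \<odot>\<^bsub>Free n\<^esub> g p q \<in> carrier (Free n)" and smult: "f (r \<odot>\<^bsub>Free n\<^esub> g p q) = r \<odot>\<^bsub>Free n'\<^esub> f (g p q)"
    if "p + q = Suc (i + j)" "r \<in> carrier R" for p q r
    using f.M.smult_closed[OF that(2)] f.hom_smult[OF that(2)] g[OF that(1)] by auto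
  let ?h = "if odd j then \<ominus> l \<odot>\<^bsub>Free n\<^esub> g (i + 2) (j - 1) else \<zero>\<^bsub>Free n\<^esub>"
  have degree: "i + 2 + (j - 1) = Suc (i + j)" if "odd j" using that by (auto elim: oddE)
  have last: "?h \<in> carrier (Free n)"
    "f ?h = (if odd j then \<ominus> l \<odot>\<^bsub>Free n'\<^esub> f (g (i + 2) (j - 1)) else \<zero>\<^bsub>Free n'\<^esub>)"
    using closed[OF degree, of "\<ominus> l"] smult[OF degree, of "\<ominus> l"] carriers f.hom_zero
    by (auto simp del: free_module_simps)
  have deg: "i + Suc j = Suc (i + j)" "Suc i + j = Suc (i + j)" by auto
  show ?thesis
    unfolding tate_diff_eq_Free[of g i j n] tate_diff_eq_Free[of "\<lambda>p q. f (g p q)" i j n']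
    unfolding f.hom_add[OF closed[OF deg(1) tate_a_carrier]
      f.M.a_closed[OF closed[OF deg(2) signed_c_carrier] last(1)]]
      f.hom_add[OF closed[OF deg(2) signed_c_carrier] last(1)] smult[OF deg(1) tate_a_carrier]
      smult[OF deg(2) signed_c_carrier] last(2) ..
qed

lemma tate_diff_smult:
  assumes "\<And>p q. p + q = Suc (i + j) \<Longrightarrow> g p q \<in> vecs R n" and "r \<in> carrier R"
  shows "tate_diff (\<lambda>i j t. r \<otimes> g i j t) i j = (\<lambda>t. r \<otimes> tate_diff g i j t)"
  by (rule linear_map_tate_diff[OF linear_map_smult assms(1), symmetric]) (use assms(2) in auto)

lemma tate_diff_add:
  assumes g: "\<And>p q. p + q = Suc (i + j) \<Longrightarrow> g p q \<in> vecs R n" and h: "\<And>p q. p + q = Suc (i + j) \<Longrightarrow> h p q \<in> vecs R n"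
  shows "tate_diff (\<lambda>i j t. g i j t \<oplus> h i j t) i j = (\<lambda>t. tate_diff g i j t \<oplus> tate_diff h i j t)"
proof
  fix t
  have carriers: "g p q t \<in> carrier R" "h p q t \<in> carrier R" if "p + q = Suc (i + j)" for p q
    using g[OF that] h[OF that] vecs_carrier by auto
  have last: "g (i + 2) (j - 1) t \<in> carrier R" "h (i + 2) (j - 1) t \<in> carrier R" if "odd j"
    using carriers[of "i + 2" "j - 1"] that by (auto elim: oddE)
  have deg: "i + Suc j = Suc (i + j)" "Suc i + j = Suc (i + j)" by auto
  note deg_carriers = carriers[OF deg(1)] carriers[OF deg(2)]
  show "tate_diff (\<lambda>i j t. g i j t \<oplus> h i j t) i j t = tate_diff g i j t \<oplus> tate_diff h i j t"
    using deg_carriers last tate_carriers by (cases "odd j") (simp_all add: tate_diff_def r_distr a_ac)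
qed

lemma tate_diff_tate_diff:
  assumes g: "\<And>p q. p + q = Suc (Suc (i + j)) \<Longrightarrow> g p q \<in> vecs R n"
  shows "tate_diff (tate_diff g) i j = zero_vec R"
proof
  fix t
  have gR: "g p q t \<in> carrier R" if "p + q = Suc (Suc (i + j))" for p q using g[OF that] vecs_carrier by auto
  note all_carriers = carriers tate_a_carrier[of "Suc j"] tate_a_carrier[of j] tate_c_carrier[of "Suc i"]
    tate_c_carrier[of "Suc (Suc i)"]
  let ?A = "g i (Suc (Suc j)) t" and ?B = "g (Suc i) (Suc j) t" and ?C = "g (Suc (Suc i)) j t"
  have ABC: "?A \<in> carrier R" "?B \<in> carrier R" "?C \<in> carrier R" using gR by auto
  have aa': "a \<otimes> (a' \<otimes> ?A) = \<zero>" "a' \<otimes> (a \<otimes> ?A) = \<zero>"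
    using a_mult_a' ABC all_carriers m_comm[of a' a] by (simp_all flip: m_assoc)
  have cc': "tate_c (Suc i) \<otimes> (tate_c (Suc (Suc i)) \<otimes> ?C) = l \<otimes> (a \<otimes> ?C)"
    using tate_c_mult_Suc[of "Suc i"] ABC all_carriers by (simp flip: m_assoc)
  show "tate_diff (tate_diff g) i j t = zero_vec R t"
  proof (cases "odd j")
    case False
    have "tate_diff (tate_diff g) i j t = a \<otimes> (a' \<otimes> ?A \<oplus> (\<ominus> tate_c (Suc i) \<otimes> ?B \<oplus> \<ominus> l \<otimes> ?C)) \<oplus>
        (tate_c (Suc i) \<otimes> (a \<otimes> ?B \<oplus> (tate_c (Suc (Suc i)) \<otimes> ?C \<oplus> \<zero>)) \<oplus> \<zero>)"
      using False by (simp add: tate_diff_def tate_a_def signed_c_def)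
    also have "\<dots> = a \<otimes> (a' \<otimes> ?A) \<oplus> (tate_c (Suc i) \<otimes> (tate_c (Suc (Suc i)) \<otimes> ?C) \<ominus> l \<otimes> (a \<otimes> ?C))"
      using ABC all_carriers by algebra
    also have "\<dots> = \<zero>" unfolding aa' cc' using ABC all_carriers by (simp add: a_minus_def r_neg)
    finally show ?thesis by (simp add: zero_vec_def)
  next
    case True
    then obtain k where k: "j = Suc k" "even k" by (cases j) auto
    let ?E = "g (Suc (Suc (Suc i))) k t"
    have E_carrier: "?E \<in> carrier R" using gR[of "Suc (Suc (Suc i))" k] k by simp
    have "tate_c (Suc (Suc (Suc i))) = tate_c (Suc i)" by (simp add: tate_c_def)
    then have "tate_diff (tate_diff g) i j t = a' \<otimes> (a \<otimes> ?A \<oplus> (tate_c (Suc i) \<otimes> ?B \<oplus> \<zero>)) \<oplus>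
        (\<ominus> tate_c (Suc i) \<otimes> (a' \<otimes> ?B \<oplus> (\<ominus> tate_c (Suc (Suc i)) \<otimes> ?C \<oplus> \<ominus> l \<otimes> ?E)) \<oplus>
         \<ominus> l \<otimes> (a \<otimes> ?C \<oplus> (tate_c (Suc i) \<otimes> ?E \<oplus> \<zero>)))"
      using k by (simp add: tate_diff_def tate_a_def signed_c_def)
    also have "\<dots> = a' \<otimes> (a \<otimes> ?A) \<oplus> (tate_c (Suc i) \<otimes> (tate_c (Suc (Suc i)) \<otimes> ?C) \<ominus> l \<otimes> (a \<otimes> ?C))"
      using ABC E_carrier all_carriers by algebra
    also have "\<dots> = \<zero>" unfolding aa' cc' using ABC all_carriers by (simp add: a_minus_def r_neg)
    finally show ?thesis by (simp add: zero_vec_def)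
  qed
qed

text \<open>Preimages under \<open>tate_diff\<close> are built up by increasing second index.\<close>

definition partial_lift :: "nat \<Rightarrow> nat \<Rightarrow> nat \<Rightarrow> (nat \<Rightarrow> nat \<Rightarrow> nat \<Rightarrow> 'a) \<Rightarrow> (nat \<Rightarrow> nat \<Rightarrow> nat \<Rightarrow> 'a) \<Rightarrow> bool" where
  "partial_lift n k J z h \<longleftrightarrow> (\<forall>i j. i + j = Suc k \<longrightarrow> h i j \<in> ideal_vecs R \<mm> n) \<and>
     (\<forall>i j. i + j = k \<longrightarrow> j < J \<longrightarrow> tate_diff h i j = z i j)"

lemma partial_liftD:
  assumes "partial_lift n k J z h"
  shows "i + j = Suc k \<Longrightarrow> h i j \<in> ideal_vecs R \<mm> n" and "i + j = k \<Longrightarrow> j < J \<Longrightarrow> tate_diff h i j = z i j"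
  using assms unfolding partial_lift_def by auto

lemma partial_lift_first:
  assumes z: "z k 0 \<in> ideal_vecs R (\<mm>pow 2) n"
  shows "\<exists>h. partial_lift n k (Suc 0) z h"
proof -
  have "\<exists>u\<in>\<mm>. \<exists>v\<in>\<mm>. z k 0 t = u \<otimes> tate_c (Suc k) \<oplus> v \<otimes> a" for t
    by (rule sq_generated_tate_c[OF ideal_vecs_entry[OF \<mm>pow_ideal z]])
  then obtain v where v: "v \<in> ideal_vecs R \<mm> n"
    "\<And>t. t < n \<Longrightarrow> \<exists>u\<in>\<mm>. z k 0 t = u \<otimes> tate_c (Suc k) \<oplus> v t \<otimes> a"
    using ideal_vecs_choice[OF \<mm>_ideal, of n "\<lambda>t v. \<exists>u\<in>\<mm>. z k 0 t = u \<otimes> tate_c (Suc k) \<oplus> v \<otimes> a"] by metis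
  obtain u where u: "u \<in> ideal_vecs R \<mm> n" "\<And>t. t < n \<Longrightarrow> z k 0 t = u t \<otimes> tate_c (Suc k) \<oplus> v t \<otimes> a"
    using ideal_vecs_choice[OF \<mm>_ideal, of n "\<lambda>t u. z k 0 t = u \<otimes> tate_c (Suc k) \<oplus> v t \<otimes> a"] v(2) by metis
  let ?h = "\<lambda>i j. if j = 0 then u else if j = 1 then v else zero_vec R"
  have carriers: "u t \<in> carrier R" "v t \<in> carrier R" for t
    using vecs_carrier[OF ideal_vecs_vecs[OF u(1)]] vecs_carrier[OF ideal_vecs_vecs[OF v(1)]] by auto
  have h\<mm>: "?h i j \<in> ideal_vecs R \<mm> n" for i j using u(1) v(1) zero_vec_ideal_vecs[OF \<mm>_ideal] by simp
  have "tate_diff ?h k 0 = z k 0"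
  proof (rule vecs_eqI[OF tate_diff_vecs[OF ideal_vecs_vecs[OF h\<mm>]] ideal_vecs_vecs[OF z]])
    fix t assume t: "t < n"
    have "tate_diff ?h k 0 t = v t \<otimes> a \<oplus> u t \<otimes> tate_c (Suc k)"
      using carriers tate_carriers by (simp add: tate_diff_def tate_a_def signed_c_def m_comm)
    then show "tate_diff ?h k 0 t = z k 0 t" using u(2)[OF t] carriers tate_carriers by (simp add: a_comm)
  qed
  then have "tate_diff ?h i j = z i j" if "i + j = k" "j < Suc 0" for i j using that by simp
  then have "partial_lift n k (Suc 0) z ?h" unfolding partial_lift_def using h\<mm> by blast
  then show ?thesis by blast
qed

lemma tate_cycle_leading_divisible:
  assumes J: "J \<le> k" "J \<noteq> 0" and z: "z (k - J) J \<in> ideal_vecs R (\<mm>pow 2) n"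
    and z0: "\<And>i j. i + j = k \<Longrightarrow> j < J \<Longrightarrow> z i j = zero_vec R"
    and cyc: "tate_diff z (k - J) (J - 1) = zero_vec R"
  shows "\<exists>u\<in>\<mm>. z (k - J) J t = u \<otimes> tate_a (Suc J)"
proof -
  let ?z = "z (k - J) J t"
  have zR: "?z \<in> carrier R" by (rule vecs_carrier[OF ideal_vecs_vecs[OF z]])
  obtain J' where J': "J = Suc J'" using J(2) by (cases J) auto
  have "z (Suc (k - J)) J' = zero_vec R" using z0[of "Suc (k - J)" J'] J(1) J' by simp
  moreover have "z (k - J + 2) (J' - 1) = zero_vec R" if "odd J'"
    using z0[of "k - J + 2" "J' - 1"] J(1) J' that by (auto elim!: oddE)
  ultimately have "tate_diff z (k - J) J' t = tate_a J \<otimes> ?z"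
    using J' zR tate_carriers by (auto simp: tate_diff_def zero_vec_def)
  then have "?z \<otimes> tate_a J = \<zero>" using cyc J' m_comm[OF tate_a_carrier zR] by (simp add: zero_vec_def)
  then obtain u where u: "u \<in> carrier R" "?z = u \<otimes> tate_a (Suc J)" using annihilator_tate_a[OF zR] by blast
  then show ?thesis using mult_tate_a_in_sq[OF u(1), of "Suc J"] ideal_vecs_entry[OF \<mm>pow_ideal z, of t] by auto
qed

lemma partial_lift_next:
  assumes J: "J \<le> k" "J \<noteq> 0" and z: "\<And>i j. i + j = k \<Longrightarrow> z i j \<in> ideal_vecs R (\<mm>pow 2) n"
    and z0: "\<And>i j. i + j = k \<Longrightarrow> j < J \<Longrightarrow> z i j = zero_vec R"
    and cyc: "\<And>i j. Suc (i + j) = k \<Longrightarrow> tate_diff z i j = zero_vec R"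
  shows "\<exists>h. partial_lift n k (Suc J) z h"
proof -
  have "\<exists>u\<in>\<mm>. z (k - J) J t = u \<otimes> tate_a (Suc J)" for t
    by (rule tate_cycle_leading_divisible[where n = n, OF J _ z0]) (use z cyc J in auto)
  then obtain u where u: "u \<in> ideal_vecs R \<mm> n" "\<And>t. t < n \<Longrightarrow> z (k - J) J t = u t \<otimes> tate_a (Suc J)"
    using ideal_vecs_choice[OF \<mm>_ideal, of n "\<lambda>t u. z (k - J) J t = u \<otimes> tate_a (Suc J)"] by metis
  let ?h = "\<lambda>i j. if j = Suc J then u else zero_vec R"
  have carriers: "u t \<in> carrier R" for t by (rule vecs_carrier[OF ideal_vecs_vecs[OF u(1)]])
  have h\<mm>: "?h i j \<in> ideal_vecs R \<mm> n" for i j using u(1) zero_vec_ideal_vecs[OF \<mm>_ideal] by simp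
  have "tate_diff ?h i j = z i j" if ij: "i + j = k" "j < Suc J" for i j
  proof (rule vecs_eqI[OF tate_diff_vecs[OF ideal_vecs_vecs[OF h\<mm>]] ideal_vecs_vecs[OF z[OF ij(1)]]])
    fix t assume t: "t < n"
    show "tate_diff ?h i j t = z i j t"
    proof (cases "j = J")
      case True
      then have "tate_diff ?h i j t = u t \<otimes> tate_a (Suc J)"
        using carriers tate_carriers m_comm[OF tate_a_carrier carriers] by (auto simp: tate_diff_def zero_vec_def)
      moreover have "i = k - J" using True ij(1) by simp
      ultimately show ?thesis using u(2)[OF t] True by simp
    next
      case False
      then have "tate_diff ?h i j t = \<zero>" using ij tate_carriers by (auto simp: tate_diff_def zero_vec_def)
      then show ?thesis using z0[OF ij(1)] False ij(2) by (simp add: zero_vec_def)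
    qed
  qed
  then have "partial_lift n k (Suc J) z ?h" unfolding partial_lift_def using h\<mm> by blast
  then show ?thesis by blast
qed

definition lift_residual :: "(nat \<Rightarrow> nat \<Rightarrow> nat \<Rightarrow> 'a) \<Rightarrow> (nat \<Rightarrow> nat \<Rightarrow> nat \<Rightarrow> 'a) \<Rightarrow> nat \<Rightarrow> nat \<Rightarrow> nat \<Rightarrow> 'a" where
  "lift_residual y h = (\<lambda>i j t. y i j t \<oplus> \<ominus> \<one> \<otimes> tate_diff h i j t)"

lemma tate_diff_partial_lift:
  assumes "partial_lift n k J y h" "i + j = k"
  shows "tate_diff h i j \<in> ideal_vecs R (\<mm>pow 2) n"
  using tate_diff_\<mm>pow[of i j h 1 n] partial_liftD(1)[OF assms(1)] assms(2) \<mm>pow_1 by (simp add: numeral_2_eq_2)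

lemma minus_tate_diff_partial_lift:
  assumes "partial_lift n k J y h" "i + j = k"
  shows "(\<lambda>t. \<ominus> \<one> \<otimes> tate_diff h i j t) \<in> ideal_vecs R (\<mm>pow 2) n"
  using submodule_smult[OF ideal_vecs_submodule[OF \<mm>pow_ideal] _ tate_diff_partial_lift[OF assms], of "\<ominus> \<one>"]
  by simp

lemma lift_residual_sq:
  assumes h: "partial_lift n k J y h" and ij: "i + j = k" and y: "y i j \<in> ideal_vecs R (\<mm>pow 2) n"
  shows "lift_residual y h i j \<in> ideal_vecs R (\<mm>pow 2) n"
  using submodule_add[OF ideal_vecs_submodule[OF \<mm>pow_ideal] y minus_tate_diff_partial_lift[OF h ij]]
  by (simp add: lift_residual_def)

lemma lift_residual_zero:
  assumes h: "partial_lift n k J y h" and ij: "i + j = k" "j < J" and y: "y i j \<in> vecs R n"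
  shows "lift_residual y h i j = zero_vec R"
  using partial_liftD(2)[OF h ij] vecs_carrier[OF y] by (simp add: lift_residual_def zero_vec_def l_minus r_neg)

lemma lift_residual_cycle:
  assumes h: "partial_lift n k J y h" and y: "\<And>i j. i + j = k \<Longrightarrow> y i j \<in> vecs R n"
    and ij: "Suc (i + j) = k" and cyc: "tate_diff y i j = zero_vec R"
  shows "tate_diff (lift_residual y h) i j = zero_vec R"
proof -
  note vecs = ideal_vecs_vecs[OF partial_liftD(1)[OF h]] ideal_vecs_vecs[OF tate_diff_partial_lift[OF h]]
    ideal_vecs_vecs[OF minus_tate_diff_partial_lift[OF h]]
  have "tate_diff (lift_residual y h) i j
      = (\<lambda>t. tate_diff y i j t \<oplus> tate_diff (\<lambda>i j t. \<ominus> \<one> \<otimes> tate_diff h i j t) i j t)"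
    unfolding lift_residual_def by (rule tate_diff_add) (use y vecs ij in auto)
  moreover have "tate_diff (\<lambda>i j t. \<ominus> \<one> \<otimes> tate_diff h i j t) i j = (\<lambda>t. \<ominus> \<one> \<otimes> tate_diff (tate_diff h) i j t)"
    by (rule tate_diff_smult) (use vecs ij in auto)
  moreover have "tate_diff (tate_diff h) i j = zero_vec R" by (rule tate_diff_tate_diff) (use vecs ij in auto)
  ultimately show ?thesis using cyc by (simp add: zero_vec_def)
qed

lemma partial_lift_add:
  assumes h: "partial_lift n k J y h" and h': "partial_lift n k J' (lift_residual y h) h'"
    and y: "\<And>i j. i + j = k \<Longrightarrow> y i j \<in> vecs R n"
  shows "partial_lift n k J' y (\<lambda>i j t. h i j t \<oplus> h' i j t)"
  unfolding partial_lift_def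
proof (intro conjI allI impI)
  fix i j
  show "(\<lambda>t. h i j t \<oplus> h' i j t) \<in> ideal_vecs R \<mm> n" if "i + j = Suc k"
    using submodule_add[OF ideal_vecs_submodule[OF \<mm>_ideal] partial_liftD(1)[OF h that]
      partial_liftD(1)[OF h' that]] by simp
  assume ij: "i + j = k" "j < J'"
  note carriers = vecs_carrier[OF y[OF ij(1)]]
    vecs_carrier[OF ideal_vecs_vecs[OF tate_diff_partial_lift[OF h ij(1)]]]
  have "tate_diff (\<lambda>i j t. h i j t \<oplus> h' i j t) i j = (\<lambda>t. tate_diff h i j t \<oplus> tate_diff h' i j t)"
    by (rule tate_diff_add) (use ideal_vecs_vecs[OF partial_liftD(1)[OF h]]
      ideal_vecs_vecs[OF partial_liftD(1)[OF h']] ij in auto)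
  also have "\<dots> = (\<lambda>t. tate_diff h i j t \<oplus> (y i j t \<oplus> \<ominus> \<one> \<otimes> tate_diff h i j t))"
    using partial_liftD(2)[OF h' ij] by (simp add: lift_residual_def)
  also have "\<dots> = y i j"
  proof
    show "tate_diff h i j t \<oplus> (y i j t \<oplus> \<ominus> \<one> \<otimes> tate_diff h i j t) = y i j t" for t using carriers[of t] by algebra
  qed
  finally show "tate_diff (\<lambda>i j t. h i j t \<oplus> h' i j t) i j = y i j" .
qed

lemma partial_lift_Suc:
  assumes y: "\<And>i j. i + j = k \<Longrightarrow> y i j \<in> ideal_vecs R (\<mm>pow 2) n"
    and cyc: "\<And>i j. Suc (i + j) = k \<Longrightarrow> tate_diff y i j = zero_vec R"
    and J: "J \<le> k" and h: "partial_lift n k J y h"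
  shows "\<exists>h. partial_lift n k (Suc J) y h"
proof -
  note y_vecs = ideal_vecs_vecs[OF y] and sq = lift_residual_sq[OF h _ y]
  have "\<exists>h'. partial_lift n k (Suc J) (lift_residual y h) h'"
  proof (cases "J = 0")
    case True
    then show ?thesis using partial_lift_first[OF sq] by simp
  next
    case False
    show ?thesis
      by (rule partial_lift_next[OF J False sq lift_residual_zero[OF h _ _ y_vecs] lift_residual_cycle[OF h
        y_vecs _ cyc]])
  qed
  then show ?thesis using partial_lift_add[OF h _ y_vecs] by blast
qed

theorem sq_cycle_lift:
  assumes y: "\<And>i j. i + j = k \<Longrightarrow> y i j \<in> ideal_vecs R (\<mm>pow 2) n"
    and cyc: "\<And>i j. Suc (i + j) = k \<Longrightarrow> tate_diff y i j = zero_vec R"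
  obtains h where "\<And>i j. i + j = Suc k \<Longrightarrow> h i j \<in> ideal_vecs R \<mm> n" "\<And>i j. i + j = k \<Longrightarrow> tate_diff h i j = y i j"
proof -
  have "\<exists>h. partial_lift n k J y h" if "J \<le> Suc k" for J
    using that
  proof (induction J)
    case 0
    have "partial_lift n k 0 y (\<lambda>_ _. zero_vec R)"
      using zero_vec_ideal_vecs[OF \<mm>_ideal] by (simp add: partial_lift_def)
    then show ?case by blast
  next
    case (Suc J)
    then obtain h where "partial_lift n k J y h" by auto
    then show ?case using partial_lift_Suc[OF y cyc] Suc.prems by simp
  qed
  then obtain h where h: "partial_lift n k (Suc k) y h" by blast
  show ?thesis by (rule that[of h]) (use partial_liftD[OF h] in auto)
qed

end

locale min_complex = short_ring +
  fixes b :: "nat \<Rightarrow> nat" and D :: "nat \<Rightarrow> (nat \<Rightarrow> 'a) \<Rightarrow> nat \<Rightarrow> 'a"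
  assumes D_linear: "n \<ge> 1 \<Longrightarrow> linear_map R (Free (b n)) (Free (b (n - 1))) (D n)"
    and D_minimal: "n \<ge> 1 \<Longrightarrow> v \<in> vecs R (b n) \<Longrightarrow> D n v \<in> ideal_vecs R \<mm> (b (n - 1))"
    and D_D: "n \<ge> 1 \<Longrightarrow> w \<in> vecs R (b (Suc n)) \<Longrightarrow> D n (D (Suc n) w) = zero_vec R"
    and D_exact: "n \<ge> 1 \<Longrightarrow> v \<in> vecs R (b n) \<Longrightarrow> D n v = zero_vec R \<Longrightarrow> \<exists>w\<in>vecs R (b (Suc n)). v = D (Suc n) w"
begin

lemma D_hom: "n \<ge> 1 \<Longrightarrow> module_hom_pair R (Free (b n)) (Free (b (n - 1))) (D n)"
  by (intro module_hom_pairI module_Free D_linear)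

lemma D_closed: "n \<ge> 1 \<Longrightarrow> v \<in> vecs R (b n) \<Longrightarrow> D n v \<in> vecs R (b (n - 1))"
  using D_minimal ideal_vecs_vecs by blast

lemma D_\<mm>pow:
  assumes n: "n \<ge> 1" and v: "v \<in> ideal_vecs R (\<mm>pow p) (b n)"
  shows "D n v \<in> ideal_vecs R (\<mm>pow (Suc p)) (b (n - 1))"
proof (rule linear_map_in_submodule[OF module_Free D_linear[OF n] ideal_vecs_submodule[OF \<mm>pow_ideal]
  ideal_vecs_vecs[OF v]])
  fix k assume "k < b n"
  then have single_in_\<mm>: "D n (single_vec R k \<one>) \<in> ideal_vecs R \<mm> (b (n - 1))"
    by (intro D_minimal[OF n] single_vec_vecs) auto
  have vk: "v k \<in> \<mm>pow p" by (rule ideal_vecs_entry[OF \<mm>pow_ideal v])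
  have "v k \<otimes> D n (single_vec R k \<one>) j \<in> \<mm>pow (Suc p)" for j
    using \<mm>_mult_\<mm>pow[OF ideal_vecs_entry[OF \<mm>_ideal single_in_\<mm>] vk, of j] m_comm[OF \<mm>pow_carrier[OF vk]]
      vecs_carrier[OF ideal_vecs_vecs[OF single_in_\<mm>], of j] by simp
  then show "v k \<odot>\<^bsub>Free (b (n - 1))\<^esub> D n (single_vec R k \<one>) \<in> ideal_vecs R (\<mm>pow (Suc p)) (b (n - 1))"
    using vecs_smult[OF \<mm>pow_carrier[OF vk] ideal_vecs_vecs[OF single_in_\<mm>]] by (simp add: ideal_vecsI)
qed

end

section \<open>A descending chain condition\<close>

lemma nondecreasing_subsequence:
  fixes x :: "nat \<Rightarrow> nat"
  obtains \<phi> :: "nat \<Rightarrow> nat" where "strict_mono \<phi>" "mono (x \<circ> \<phi>)"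
proof -
  obtain \<phi> where \<phi>: "strict_mono \<phi>" "monoseq (\<lambda>n. x (\<phi> n))" using seq_monosub by blast
  consider "incseq (\<lambda>n. x (\<phi> n))" | "decseq (\<lambda>n. x (\<phi> n))" using \<phi>(2) monoseq_iff by blast
  then show ?thesis
  proof cases
    case 1
    then show ?thesis using that[OF \<phi>(1)] by (simp add: comp_def)
  next
    case 2
    obtain N where N: "\<And>n. x (\<phi> N) \<le> x (\<phi> n)" using ex_has_least_nat[of "\<lambda>_. True" 0 "\<lambda>n. x (\<phi> n)"] by blast
    have const: "x (\<phi> (n + N)) = x (\<phi> N)" for n by (rule antisym[OF decseqD[OF 2] N]) simp
    have "strict_mono (\<lambda>n. \<phi> (n + N))" using \<phi>(1) by (simp add: strict_mono_def)
    moreover have "mono (x \<circ> (\<lambda>n. \<phi> (n + N)))" by (simp add: const mono_def)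
    ultimately show ?thesis by (rule that)
  qed
qed

lemma common_nondecreasing_subsequence:
  fixes F :: "(nat \<Rightarrow> nat) set"
  assumes "finite F"
  shows "\<exists>\<phi> :: nat \<Rightarrow> nat. strict_mono \<phi> \<and> (\<forall>x\<in>F. mono (x \<circ> \<phi>))"
  using assms
proof (induction F rule: finite_induct)
  case empty
  show ?case by (rule exI[of _ id]) (simp add: strict_mono_def)
next
  case (insert x F)
  then obtain \<phi> :: "nat \<Rightarrow> nat" where \<phi>: "strict_mono \<phi>" "\<And>y. y \<in> F \<Longrightarrow> mono (y \<circ> \<phi>)" by blast
  obtain \<psi> :: "nat \<Rightarrow> nat" where \<psi>: "strict_mono \<psi>" "mono (x \<circ> \<phi> \<circ> \<psi>)"
    by (rule nondecreasing_subsequence[of "x \<circ> \<phi>"])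
  have "mono (y \<circ> (\<phi> \<circ> \<psi>))" if "y \<in> insert x F" for y
    using that monoD[OF \<phi>(2)[of y]] strict_mono_mono[OF \<psi>(1)] \<psi>(2) by (auto simp: mono_def)
  moreover have "strict_mono (\<phi> \<circ> \<psi>)" using \<phi>(1) \<psi>(1) by (rule strict_mono_o)
  ultimately show ?case by blast
qed

lemma step_antitone:
  fixes f :: "nat \<Rightarrow> nat"
  assumes "\<And>i. f (i + 2) \<le> f i" "i \<le> j" "i mod 2 = j mod 2"
  shows "f j \<le> f i"
proof -
  have "f (i + 2 * k) \<le> f i" for k
  proof (induction k)
    case (Suc k)
    then show ?case using le_trans[OF assms(1)[of "i + 2 * k"]] by simp
  qed simp
  moreover have "2 dvd j - i" using mod_eq_dvd_iff_nat[OF assms(2), of 2] assms(3) by simp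
  then have "j = i + 2 * ((j - i) div 2)" using assms(2) by simp
  ultimately show ?thesis by metis
qed

lemma unstable_family_decreases:
  fixes f :: "nat \<Rightarrow> 'i \<Rightarrow> nat"
  assumes anti: "\<And>d i. f (Suc d) i \<le> f d i" and unstable: "\<nexists>d0. \<forall>d\<ge>d0. f d = f d0"
  obtains \<delta> s where "strict_mono \<delta>" "\<And>n. f (\<delta> (Suc n)) (s n) < f (\<delta> n) (s n)"
proof -
  have "\<exists>d' i. d < d' \<and> f d' i < f d i" for d
  proof -
    obtain d' where d': "d \<le> d'" "f d' \<noteq> f d" using unstable by blast
    then obtain i where "f d' i \<noteq> f d i" by (meson ext)
    moreover have "f d' i \<le> f d i" by (rule lift_Suc_antimono_le[of "\<lambda>d. f d i", OF anti d'(1)])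
    ultimately show ?thesis using d' by (metis le_neq_implies_less)
  qed
  then obtain nxt s where nxt: "\<And>d. d < nxt d" "\<And>d. f (nxt d) (s d) < f d (s d)" by metis
  define \<delta> where "\<delta> n = (nxt ^^ n) 0" for n
  have Suc: "\<delta> (Suc n) = nxt (\<delta> n)" for n by (simp add: \<delta>_def)
  have "strict_mono \<delta>" unfolding strict_mono_Suc_iff Suc using nxt(1) by blast
  moreover have "f (\<delta> (Suc n)) (s (\<delta> n)) < f (\<delta> n) (s (\<delta> n))" for n unfolding Suc by (rule nxt(2))
  ultimately show ?thesis by (rule that[of \<delta> "\<lambda>n. s (\<delta> n)"])
qed

lemma increasing_subsequence_same_parity:
  fixes s t :: "nat \<Rightarrow> nat"
  obtains \<phi> :: "nat \<Rightarrow> nat" where "strict_mono \<phi>"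
    "\<And>n. s (\<phi> n) \<le> s (\<phi> (Suc n))" "\<And>n. s (\<phi> n) mod 2 = s (\<phi> (Suc n)) mod 2"
    "\<And>n. t (\<phi> n) \<le> t (\<phi> (Suc n))" "\<And>n. t (\<phi> n) mod 2 = t (\<phi> (Suc n)) mod 2"
proof -
  let ?F = "{s, t, \<lambda>n. s n mod 2, \<lambda>n. 1 - s n mod 2, \<lambda>n. t n mod 2, \<lambda>n. 1 - t n mod 2}"
  obtain \<phi> :: "nat \<Rightarrow> nat" where \<phi>: "strict_mono \<phi>" "\<And>x. x \<in> ?F \<Longrightarrow> mono (x \<circ> \<phi>)"
    using common_nondecreasing_subsequence[of ?F] by blast
  have incr: "x (\<phi> n) \<le> x (\<phi> (Suc n))" if "x \<in> ?F" for x n using monoD[OF \<phi>(2)[OF that], of n "Suc n"] by simp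
  have parity: "u mod 2 \<le> v mod 2 \<Longrightarrow> 1 - u mod 2 \<le> 1 - v mod 2 \<Longrightarrow> u mod 2 = v mod 2" for u v :: nat
    by presburger
  show ?thesis
    by (rule that[OF \<phi>(1)])
      (use incr[of s] incr[of t] parity[OF incr[of "\<lambda>n. s n mod 2"] incr[of "\<lambda>n. 1 - s n mod 2"]]
        parity[OF incr[of "\<lambda>n. t n mod 2"] incr[of "\<lambda>n. 1 - t n mod 2"]] in simp_all)
qed

text \<open>Otherwise there is an infinite sequence of strict decreases at places \<open>(s, t)\<close>. By Dickson's lemma it has a
  subsequence along which the places increase within one parity class, so the values there decrease strictly.\<close>

lemma step_antitone_family_stabilises:
  fixes f :: "nat \<Rightarrow> nat \<Rightarrow> nat \<Rightarrow> nat"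
  assumes d: "\<And>d i j. f (Suc d) i j \<le> f d i j" and i: "\<And>d i j. f d (i + 2) j \<le> f d i j"
    and j: "\<And>d i j. f d i (j + 2) \<le> f d i j"
  shows "\<exists>d0. \<forall>d\<ge>d0. f d = f d0"
proof (rule ccontr)
  assume "\<nexists>d0. \<forall>d\<ge>d0. f d = f d0"
  then have "\<nexists>d0. \<forall>d\<ge>d0. case_prod (f d) = case_prod (f d0)" by (metis case_prod_curry curry_case_prod)
  then obtain \<delta> p where \<delta>: "strict_mono \<delta>" "\<And>n. case_prod (f (\<delta> (Suc n))) (p n) < case_prod (f (\<delta> n)) (p n)"
    by (rule unstable_family_decreases[of "\<lambda>d. case_prod (f d)", rotated]) (auto simp: d)
  define s t where "s n = fst (p n)" and "t n = snd (p n)" for n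
  have drop: "f (\<delta> (Suc n)) (s n) (t n) < f (\<delta> n) (s n) (t n)" for n
    using \<delta>(2)[of n] by (simp add: s_def t_def case_prod_beta)
  obtain \<phi> :: "nat \<Rightarrow> nat" where \<phi>: "strict_mono \<phi>" and place: "\<And>n. s (\<phi> n) \<le> s (\<phi> (Suc n))"
    "\<And>n. s (\<phi> n) mod 2 = s (\<phi> (Suc n)) mod 2" "\<And>n. t (\<phi> n) \<le> t (\<phi> (Suc n))"
    "\<And>n. t (\<phi> n) mod 2 = t (\<phi> (Suc n)) mod 2"
    by (rule increasing_subsequence_same_parity[of s t]) (rule that)
  define v where "v n = f (\<delta> (\<phi> n)) (s (\<phi> n)) (t (\<phi> n))" for n
  have decrease: "v (Suc n) < v n" for n
  proof -
    let ?d = "\<delta> (\<phi> (Suc n))" and ?s = "s (\<phi> n)" and ?t = "t (\<phi> n)"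
    have "v (Suc n) \<le> f ?d ?s ?t"
      unfolding v_def using step_antitone[of "\<lambda>i. f ?d i (t (\<phi> (Suc n)))", OF i place(1,2)]
        step_antitone[of "f ?d ?s", OF j place(3,4)] by (rule le_trans)
    also have "\<dots> \<le> f (\<delta> (Suc (\<phi> n))) ?s ?t"
    proof (rule lift_Suc_antimono_le[of "\<lambda>d. f d ?s ?t", OF d])
      have "Suc (\<phi> n) \<le> \<phi> (Suc n)" using \<phi> by (simp add: Suc_le_eq strict_mono_Suc_iff)
      then show "\<delta> (Suc (\<phi> n)) \<le> ?d" by (rule monoD[OF strict_mono_mono[OF \<delta>(1)]])
    qed
    also have "\<dots> < v n" unfolding v_def by (rule drop)
    finally show ?thesis .
  qed
  have "v n + n \<le> v 0" for n
  proof (induction n)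
    case (Suc n)
    then show ?case using decrease[of n] by simp
  qed simp
  from this[of "Suc (v 0)"] show False by simp
qed

text \<open>Graded submodules, closed under the two contractions by two steps, of the modules of homogeneous forms of degree
  \<open>n\<close> in two variables, written as sequences of \<open>n + 1\<close> coefficient vectors.\<close>

locale shift_closed = cring +
  fixes N :: nat and T :: "nat \<Rightarrow> (nat \<Rightarrow> nat \<Rightarrow> 'a) set"
  assumes entries: "\<mu> \<in> T n \<Longrightarrow> i \<le> n \<Longrightarrow> \<mu> i \<in> vecs R N"
    and cong: "\<mu> \<in> T n \<Longrightarrow> (\<And>i. i \<le> n \<Longrightarrow> \<nu> i = \<mu> i) \<Longrightarrow> \<nu> \<in> T n"
    and zero: "(\<lambda>_. zero_vec R) \<in> T n"
    and add: "\<mu> \<in> T n \<Longrightarrow> \<nu> \<in> T n \<Longrightarrow> (\<lambda>i t. \<mu> i t \<oplus> \<nu> i t) \<in> T n"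
    and smult: "r \<in> carrier R \<Longrightarrow> \<mu> \<in> T n \<Longrightarrow> (\<lambda>i t. r \<otimes> \<mu> i t) \<in> T n"
    and shift: "\<mu> \<in> T (n + 2) \<Longrightarrow> (\<lambda>i. \<mu> (i + 2)) \<in> T n"
    and truncate: "\<mu> \<in> T (n + 2) \<Longrightarrow> \<mu> \<in> T n"

definition (in cring) leading_terms :: "(nat \<Rightarrow> (nat \<Rightarrow> nat \<Rightarrow> 'a) set) \<Rightarrow> nat \<Rightarrow> nat \<Rightarrow> (nat \<Rightarrow> 'a) set" where
  "leading_terms T i j = {\<mu> i | \<mu>. \<mu> \<in> T (i + j) \<and> (\<forall>i'<i. \<mu> i' = zero_vec R)}"

lemma (in cring) leading_termsI:
  "\<mu> \<in> T (i + j) \<Longrightarrow> (\<And>i'. i' < i \<Longrightarrow> \<mu> i' = zero_vec R) \<Longrightarrow> x = \<mu> i \<Longrightarrow> x \<in> leading_terms T i j"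
  unfolding leading_terms_def by blast

lemma (in cring) leading_termsE:
  assumes "x \<in> leading_terms T i j"
  obtains \<mu> where "\<mu> \<in> T (i + j)" "\<And>i'. i' < i \<Longrightarrow> \<mu> i' = zero_vec R" "x = \<mu> i"
  using assms unfolding leading_terms_def by blast

context shift_closed
begin

lemma leading_terms_submodule: "submodule (leading_terms T i j) R (Free N)"
proof (rule module.submoduleI_smult[OF module_Free])
  show "leading_terms T i j \<subseteq> carrier (Free N)" using entries by (auto simp: leading_terms_def)
  show "\<zero>\<^bsub>Free N\<^esub> \<in> leading_terms T i j" by (rule leading_termsI[of "\<lambda>_. zero_vec R"]) (simp_all add: zero)
  fix x assume "x \<in> leading_terms T i j"
  then obtain \<mu> where \<mu>: "\<mu> \<in> T (i + j)" "\<And>i'. i' < i \<Longrightarrow> \<mu> i' = zero_vec R" "x = \<mu> i" by (elim leading_termsE) blast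
  show "r \<odot>\<^bsub>Free N\<^esub> x \<in> leading_terms T i j" if "r \<in> carrier R" for r
    by (rule leading_termsI[of "\<lambda>i t. r \<otimes> \<mu> i t"]) (use \<mu> that smult in \<open>simp_all add: zero_vec_def\<close>)
  fix y assume "y \<in> leading_terms T i j"
  then obtain \<nu> where \<nu>: "\<nu> \<in> T (i + j)" "\<And>i'. i' < i \<Longrightarrow> \<nu> i' = zero_vec R" "y = \<nu> i" by (elim leading_termsE) blast
  show "x \<oplus>\<^bsub>Free N\<^esub> y \<in> leading_terms T i j"
    by (rule leading_termsI[of "\<lambda>i t. \<mu> i t \<oplus> \<nu> i t"]) (use \<mu> \<nu> add in \<open>simp_all add: zero_vec_def\<close>)
qed

lemma leading_terms_shift: "leading_terms T (i + 2) j \<subseteq> leading_terms T i j"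
proof
  fix x assume "x \<in> leading_terms T (i + 2) j"
  then obtain \<mu> where \<mu>: "\<mu> \<in> T (i + 2 + j)" "\<And>i'. i' < i + 2 \<Longrightarrow> \<mu> i' = zero_vec R" "x = \<mu> (i + 2)"
    by (elim leading_termsE) blast
  have "\<mu> \<in> T (i + j + 2)" using \<mu>(1) by (simp add: ac_simps)
  from shift[OF this] show "x \<in> leading_terms T i j" by (rule leading_termsI) (use \<mu> in auto)
qed

lemma leading_terms_truncate: "leading_terms T i (j + 2) \<subseteq> leading_terms T i j"
proof
  fix x assume "x \<in> leading_terms T i (j + 2)"
  then obtain \<mu> where \<mu>: "\<mu> \<in> T (i + (j + 2))" "\<And>i'. i' < i \<Longrightarrow> \<mu> i' = zero_vec R" "x = \<mu> i"
    by (elim leading_termsE) blast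
  have "\<mu> \<in> T (i + j + 2)" using \<mu>(1) by (simp add: ac_simps)
  from truncate[OF this] show "x \<in> leading_terms T i j" by (rule leading_termsI) (use \<mu> in auto)
qed

lemma subset_of_leading_terms:
  assumes S: "shift_closed R N S" and sub: "\<And>n. S n \<subseteq> T n"
    and lead: "\<And>i j. leading_terms T i j \<subseteq> leading_terms S i j"
  shows "T n \<subseteq> S n"
proof -
  interpret S: shift_closed R N S by fact
  have "\<mu> \<in> S n" if "m \<le> Suc n" "\<mu> \<in> T n" "\<And>i. i < m \<Longrightarrow> \<mu> i = zero_vec R" for m \<mu>
    using that
  proof (induction m arbitrary: \<mu> rule: inc_induct)
    case base
    then show ?case by (intro S.cong[OF S.zero]) simp
  next
    case (step m)
    note v = vecs_carrier[OF entries[OF step.prems(1)]]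
    have m: "m + (n - m) = n" using step.hyps by simp
    have "\<mu> m \<in> leading_terms T m (n - m)" by (rule leading_termsI[of \<mu>]) (use step.prems m in auto)
    then obtain \<sigma> where \<sigma>: "\<sigma> \<in> S n" "\<And>i. i < m \<Longrightarrow> \<sigma> i = zero_vec R" "\<mu> m = \<sigma> m"
      using lead[of m "n - m"] m by (metis leading_termsE subsetD)
    note w = vecs_carrier[OF S.entries[OF \<sigma>(1)]]
    let ?\<rho> = "\<lambda>i t. \<mu> i t \<oplus> \<ominus> \<one> \<otimes> \<sigma> i t"
    have "?\<rho> \<in> T n" using step.prems(1) \<sigma>(1) sub by (intro add smult) auto
    moreover have "?\<rho> i = zero_vec R" if "i < Suc m" for i
      using that step.prems(2)[of i] \<sigma>(2)[of i] \<sigma>(3) w[of m] step.hyps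
      by (cases "i = m") (auto simp: zero_vec_def l_minus r_neg)
    ultimately have "?\<rho> \<in> S n" by (rule step.IH)
    then have "(\<lambda>i t. ?\<rho> i t \<oplus> \<sigma> i t) \<in> S n" by (rule S.add[OF _ \<sigma>(1)])
    then show ?case by (rule S.cong) (use v w in \<open>simp add: a_assoc l_minus l_neg fun_eq_iff\<close>)
  qed
  from this[of 0] show ?thesis by auto
qed

end

context cring
begin

definition low_degree_part ::
  "(nat \<Rightarrow> (nat \<Rightarrow> nat \<Rightarrow> 'a) set) \<Rightarrow> (nat \<Rightarrow> (nat \<Rightarrow> nat \<Rightarrow> 'a) set) \<Rightarrow> nat \<Rightarrow> nat \<Rightarrow> (nat \<Rightarrow> nat \<Rightarrow> 'a) set" where
  "low_degree_part T S d n = {\<mu> \<in> T n. \<forall>p q m. n = m + 2 * (p + q) \<longrightarrow> m \<le> d \<longrightarrow> (\<lambda>i. \<mu> (i + 2 * p)) \<in> S m}"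

lemma low_degree_partI:
  "\<mu> \<in> T n \<Longrightarrow> (\<And>p q m. n = m + 2 * (p + q) \<Longrightarrow> m \<le> d \<Longrightarrow> (\<lambda>i. \<mu> (i + 2 * p)) \<in> S m) \<Longrightarrow> \<mu> \<in> low_degree_part T S d n"
  unfolding low_degree_part_def by blast

lemma low_degree_partD:
  assumes "\<mu> \<in> low_degree_part T S d n"
  shows "\<mu> \<in> T n" and "n = m + 2 * (p + q) \<Longrightarrow> m \<le> d \<Longrightarrow> (\<lambda>i. \<mu> (i + 2 * p)) \<in> S m"
  using assms unfolding low_degree_part_def by blast+

lemma shift_closed_low_degree_part:
  assumes T: "shift_closed R N T" and S: "shift_closed R N S"
  shows "shift_closed R N (low_degree_part T S d)"
proof -
  interpret T: shift_closed R N T by fact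
  interpret S: shift_closed R N S by fact
  show ?thesis
  proof unfold_locales
    fix n \<mu> assume \<mu>: "\<mu> \<in> low_degree_part T S d n"
    note \<mu>T = low_degree_partD(1)[OF \<mu>] and \<mu>S = low_degree_partD(2)[OF \<mu>]
    show "\<mu> i \<in> vecs R N" if "i \<le> n" for i by (rule T.entries[OF \<mu>T that])
    show "(\<lambda>i t. r \<otimes> \<mu> i t) \<in> low_degree_part T S d n" if "r \<in> carrier R" for r
      by (rule low_degree_partI) (rule T.smult[OF that \<mu>T], rule S.smult[OF that \<mu>S])
    show "\<nu> \<in> low_degree_part T S d n" if eq: "\<And>i. i \<le> n \<Longrightarrow> \<nu> i = \<mu> i" for \<nu>
      by (rule low_degree_partI) (rule T.cong[OF \<mu>T eq], assumption, rule S.cong[OF \<mu>S], use eq in auto)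
    show "(\<lambda>i t. \<mu> i t \<oplus> \<nu> i t) \<in> low_degree_part T S d n" if \<nu>: "\<nu> \<in> low_degree_part T S d n" for \<nu>
      by (rule low_degree_partI)
        (rule T.add[OF \<mu>T low_degree_partD(1)[OF \<nu>]], rule S.add[OF \<mu>S low_degree_partD(2)[OF \<nu>]])
  next
    show "(\<lambda>_. zero_vec R) \<in> low_degree_part T S d n" for n by (rule low_degree_partI) (rule T.zero, rule S.zero)
    fix n \<mu> assume \<mu>: "\<mu> \<in> low_degree_part T S d (n + 2)"
    note \<mu>T = low_degree_partD(1)[OF \<mu>] and \<mu>S = low_degree_partD(2)[OF \<mu>]
    show "(\<lambda>i. \<mu> (i + 2)) \<in> low_degree_part T S d n"
    proof (rule low_degree_partI)
      show "(\<lambda>i. \<mu> (i + 2)) \<in> T n" by (rule T.shift[OF \<mu>T])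
      fix p q m assume "n = m + 2 * (p + q)" "m \<le> d"
      then show "(\<lambda>i. \<mu> (i + 2 * p + 2)) \<in> S m" using \<mu>S[of m "Suc p" q] by (simp add: ac_simps)
    qed
    show "\<mu> \<in> low_degree_part T S d n"
    proof (rule low_degree_partI)
      show "\<mu> \<in> T n" by (rule T.truncate[OF \<mu>T])
      fix p q m assume "n = m + 2 * (p + q)" "m \<le> d"
      then show "(\<lambda>i. \<mu> (i + 2 * p)) \<in> S m" using \<mu>S[of m p "Suc q"] by simp
    qed
  qed
qed

end

context short_ring
begin

lemma finite_length_module_Free: "finite_length_module R (Free n)"
proof -
  interpret M: module R "Free n" by (rule module_Free)
  show ?thesis
    by unfold_locales
      (use has_quotient_length_ideal_vecs[OF has_length_ring, of n]
        in \<open>auto simp: ideal_vecs_0 ideal_vecs_carrier\<close>)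
qed

lemma shift_closed_stabilises:
  assumes P: "\<And>d. shift_closed R N (P d)" and dec: "\<And>d n. P (Suc d) n \<subseteq> P d n"
  shows "\<exists>d0. \<forall>d\<ge>d0. \<forall>n. P d0 n \<subseteq> P d n"
proof -
  interpret F: finite_length_module R "Free N" by (rule finite_length_module_Free)
  note lead = shift_closed.leading_terms_submodule[OF P] and zero = zero_vec_submodule[of N]
  have zero_lead: "{zero_vec R} \<subseteq> leading_terms (P d) i j" for d i j using submodule_zero[OF lead] by simp
  have anti: "leading_terms (P d') i j \<subseteq> leading_terms (P d) i j" if "d \<le> d'" for d d' i j
    using lift_Suc_antimono_le[of "\<lambda>d. P d (i + j)", OF dec that] by (auto simp: leading_terms_def)
  define f where "f d i j = quotient_length R (Free N) {zero_vec R} (leading_terms (P d) i j)" for d i j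
  have mono: "f d i j \<le> f d' i' j'" if "leading_terms (P d) i j \<subseteq> leading_terms (P d') i' j'" for d d' i i' j j'
    unfolding f_def by (rule F.quotient_length_mono[OF zero zero lead lead subset_refl zero_lead that])
  obtain d0 where d0: "\<And>d. d \<ge> d0 \<Longrightarrow> f d = f d0"
    using step_antitone_family_stabilises[of f] mono anti[of d "Suc d" for d]
      shift_closed.leading_terms_shift[OF P] shift_closed.leading_terms_truncate[OF P] by (metis le_Suc_eq le_refl)
  have "P d0 n \<subseteq> P d n" if d: "d \<ge> d0" for d n
  proof (rule shift_closed.subset_of_leading_terms[OF P P])
    show "P d n \<subseteq> P d0 n" for n using lift_Suc_antimono_le[of "\<lambda>d. P d n", OF dec d] .
    fix i j
    have "f d0 i j = f d i j + quotient_length R (Free N) (leading_terms (P d) i j) (leading_terms (P d0) i j)"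
      unfolding f_def by (rule F.quotient_length_add[OF zero lead lead zero_lead anti[OF d]])
    then show "leading_terms (P d0) i j \<subseteq> leading_terms (P d) i j"
      using F.quotient_length_eq_0[OF lead lead anti[OF d]] d0[OF d] by simp
  qed
  then show ?thesis by blast
qed

theorem shift_closed_low_degrees:
  assumes T: "shift_closed R N T" and S: "shift_closed R N S"
  obtains d0 where "\<And>n. low_degree_part T S d0 n \<subseteq> S n"
proof -
  have "\<exists>d0. \<forall>d\<ge>d0. \<forall>n. low_degree_part T S d0 n \<subseteq> low_degree_part T S d n"
    by (rule shift_closed_stabilises[OF shift_closed_low_degree_part[OF T S]]) (auto simp: low_degree_part_def)
  then obtain d0 where d0: "\<And>d n. d \<ge> d0 \<Longrightarrow> low_degree_part T S d0 n \<subseteq> low_degree_part T S d n" by blast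
  have "\<mu> \<in> S n" if "\<mu> \<in> low_degree_part T S d0 n" for \<mu> n
    using low_degree_partD(2)[of \<mu> T S "max d0 n" n n 0 0] that d0[of "max d0 n" n] by auto
  then show ?thesis by (intro that) blast
qed

end

section \<open>Minimal generators of high syzygies have linear boundary\<close>

context min_complex
begin

lemma D_eq_exact:
  assumes n: "n \<ge> 1" and u: "u \<in> vecs R (b n)" and v: "v \<in> vecs R (b n)" and eq: "D n u = D n v"
  shows "\<exists>w\<in>vecs R (b (Suc n)). u = (\<lambda>t. D (Suc n) w t \<oplus> v t)"
proof -
  interpret D: module_hom_pair R "Free (b n)" "Free (b (n - 1))" "D n" by (rule D_hom[OF n])
  have "D n (u \<ominus>\<^bsub>Free (b n)\<^esub> v) = zero_vec R" using D.hom_minus_eq_zero[of u v] u v eq by simp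
  moreover have "u \<ominus>\<^bsub>Free (b n)\<^esub> v \<in> vecs R (b n)" using D.M.M.minus_closed[of u v] u v by simp
  ultimately obtain w where w: "w \<in> vecs R (b (Suc n))" "u \<ominus>\<^bsub>Free (b n)\<^esub> v = D (Suc n) w"
    using D_exact[OF n] by blast
  have "u t = D (Suc n) w t \<oplus> v t" for t
    unfolding w(2)[symmetric] Free_minus[OF u v] using vecs_carrier[OF u, of t] vecs_carrier[OF v, of t] by algebra
  then show ?thesis using w(1) by blast
qed

end

locale orthogonal_complex = orthogonal_data + min_complex
begin

definition tate_cycle :: "nat \<Rightarrow> (nat \<Rightarrow> nat \<Rightarrow> nat \<Rightarrow> 'a) \<Rightarrow> bool" where
  "tate_cycle n g \<longleftrightarrow> (\<forall>i j. i + j \<le> n \<longrightarrow> g i j \<in> vecs R (b (n - (i + j)))) \<and>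
     (\<forall>i j. i + j < n \<longrightarrow> D (n - (i + j)) (g i j) = tate_diff g i j)"

lemma tate_cycleD:
  assumes "tate_cycle n g"
  shows "i + j \<le> n \<Longrightarrow> g i j \<in> vecs R (b (n - (i + j)))"
    and "i + j < n \<Longrightarrow> D (n - (i + j)) (g i j) = tate_diff g i j"
  using assms unfolding tate_cycle_def by auto

lemma tate_cycleD_Suc:
  assumes "tate_cycle n g" "i + j < n" "p + q = Suc (i + j)"
  shows "g p q \<in> vecs R (b (n - (i + j) - 1))"
  using tate_cycleD(1)[OF assms(1), of p q] assms(2,3) by simp

definition bounds_from :: "nat \<Rightarrow> nat \<Rightarrow> (nat \<Rightarrow> nat \<Rightarrow> nat \<Rightarrow> 'a) \<Rightarrow> (nat \<Rightarrow> nat \<Rightarrow> nat \<Rightarrow> 'a) \<Rightarrow> bool" where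
  "bounds_from k n g h \<longleftrightarrow> (\<forall>i j. k \<le> i + j \<longrightarrow> i + j \<le> n \<longrightarrow> h i j \<in> vecs R (b (Suc n - (i + j)))) \<and>
     (\<forall>i j. i + j > n \<longrightarrow> h i j = zero_vec R) \<and>
     (\<forall>i j. k \<le> i + j \<longrightarrow> i + j \<le> n \<longrightarrow> g i j = (\<lambda>t. D (Suc n - (i + j)) (h i j) t \<oplus> tate_diff h i j t))"

lemma bounds_fromD:
  assumes "bounds_from k n g h"
  shows "k \<le> i + j \<Longrightarrow> i + j \<le> n \<Longrightarrow> h i j \<in> vecs R (b (Suc n - (i + j)))"
    and "i + j > n \<Longrightarrow> h i j = zero_vec R"
    and "k \<le> i + j \<Longrightarrow> i + j \<le> n \<Longrightarrow> g i j = (\<lambda>t. D (Suc n - (i + j)) (h i j) t \<oplus> tate_diff h i j t)"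
  using assms unfolding bounds_from_def by blast+

lemma bounds_from_top:
  assumes tail: "\<And>i. i \<le> n \<Longrightarrow> g i (n - i) \<in> D 1 ` vecs R (b 1)"
  shows "\<exists>h. bounds_from n n g h"
proof -
  have "\<forall>i. \<exists>w. i \<le> n \<longrightarrow> w \<in> vecs R (b 1) \<and> g i (n - i) = D 1 w" using tail by blast
  then obtain w where w: "\<And>i. i \<le> n \<Longrightarrow> w i \<in> vecs R (b 1)" "\<And>i. i \<le> n \<Longrightarrow> g i (n - i) = D 1 (w i)" by metis
  let ?h = "\<lambda>i j. if i + j = n then w i else zero_vec R"
  have vanish: "tate_diff ?h i j = zero_vec R" if "i + j = n" for i j
    using that tate_carriers by (auto simp: tate_diff_def zero_vec_def fun_eq_iff)
  have "?h i j \<in> vecs R (b (Suc n - (i + j))) \<and> g i j = (\<lambda>t. D (Suc n - (i + j)) (?h i j) t \<oplus> tate_diff ?h i j t)"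
    if "n \<le> i + j" "i + j \<le> n" for i j
  proof -
    have ij: "i + j = n" "i \<le> n" "j = n - i" using that by auto
    have "D 1 (w i) t \<in> carrier R" for t using vecs_carrier[OF D_closed[OF _ w(1)[OF ij(2)]]] by simp
    then show ?thesis unfolding vanish[OF ij(1)] using w[OF ij(2)] ij by (simp add: zero_vec_def)
  qed
  then have "bounds_from n n g ?h" unfolding bounds_from_def by auto
  then show ?thesis by blast
qed

lemma D_tate_cycle_eq:
  assumes g: "tate_cycle n g" and h: "bounds_from (Suc k) n g h" and k: "k < n" and ij: "i + j = k"
  shows "tate_diff h i j \<in> vecs R (b (n - k))" and "D (n - k) (g i j) = D (n - k) (tate_diff h i j)"
proof -
  let ?m = "n - k"
  have m: "?m \<ge> 1" "Suc n - Suc k = ?m" using k by auto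
  have h_vecs: "h p q \<in> vecs R (b ?m)" if "p + q = Suc (i + j)" for p q
    using bounds_fromD(1)[OF h, of p q] that ij k by simp
  have h_vecs_next: "h p q \<in> vecs R (b (?m - 1))" if pq: "p + q = Suc (Suc (i + j))" for p q
  proof (cases "p + q \<le> n")
    case True
    then show ?thesis using bounds_fromD(1)[OF h, of p q] pq ij by (simp add: Suc_diff_le)
  qed (use bounds_fromD(2)[OF h, of p q] in simp)
  show dh: "tate_diff h i j \<in> vecs R (b ?m)" by (rule tate_diff_vecs[OF h_vecs])
  have "D ?m (g i j) = tate_diff g i j" using tate_cycleD(2)[OF g, of i j] ij k by simp
  also have "\<dots> = tate_diff (\<lambda>p q t. D ?m (h p q) t \<oplus> tate_diff h p q t) i j"
    by (rule tate_diff_cong) (use bounds_fromD(3)[OF h] ij k in auto)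
  also have "\<dots> = (\<lambda>t. tate_diff (\<lambda>p q. D ?m (h p q)) i j t \<oplus> tate_diff (tate_diff h) i j t)"
  proof (rule tate_diff_add)
    fix p q assume pq: "p + q = Suc (i + j)"
    show "D ?m (h p q) \<in> vecs R (b (?m - 1))" by (rule D_closed[OF m(1) h_vecs[OF pq]])
    show "tate_diff h p q \<in> vecs R (b (?m - 1))" by (rule tate_diff_vecs) (use h_vecs_next pq in simp)
  qed
  also have "tate_diff (tate_diff h) i j = zero_vec R" by (rule tate_diff_tate_diff[OF h_vecs_next])
  also have "tate_diff (\<lambda>p q. D ?m (h p q)) i j = D ?m (tate_diff h i j)"
    by (rule linear_map_tate_diff[symmetric, OF D_linear[OF m(1)] h_vecs])
  finally show "D ?m (g i j) = D ?m (tate_diff h i j)"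
    using vecs_carrier[OF D_closed[OF m(1) dh]] by (simp add: zero_vec_def)
qed

lemma bounds_from_step:
  assumes g: "tate_cycle n g" and h: "bounds_from (Suc k) n g h" and k: "k < n"
  shows "\<exists>h. bounds_from k n g h"
proof -
  have m: "n - k \<ge> 1" "Suc n - k = Suc (n - k)" using k by auto
  have "\<exists>w\<in>vecs R (b (Suc (n - k))). g i j = (\<lambda>t. D (Suc (n - k)) w t \<oplus> tate_diff h i j t)" if ij: "i + j = k"
    for i j
    using D_eq_exact[OF m(1) _ D_tate_cycle_eq[OF g h k ij]] tate_cycleD(1)[OF g, of i j] ij k by simp
  then have "\<forall>i j. \<exists>w. i + j = k \<longrightarrow> w \<in> vecs R (b (Suc (n - k))) \<and> g i j
      = (\<lambda>t. D (Suc (n - k)) w t \<oplus> tate_diff h i j t)"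
    by blast
  then obtain w where w: "\<And>i j. i + j = k \<Longrightarrow> w i j \<in> vecs R (b (Suc (n - k)))"
    "\<And>i j. i + j = k \<Longrightarrow> g i j = (\<lambda>t. D (Suc (n - k)) (w i j) t \<oplus> tate_diff h i j t)" by metis
  let ?h = "\<lambda>i j. if i + j = k then w i j else h i j"
  have diff: "tate_diff ?h i j = tate_diff h i j" if "k \<le> i + j" for i j
    by (rule tate_diff_cong) (use that in auto)
  have "?h i j \<in> vecs R (b (Suc n - (i + j))) \<and> g i j = (\<lambda>t. D (Suc n - (i + j)) (?h i j) t \<oplus> tate_diff ?h i j t)"
    if ij: "k \<le> i + j" "i + j \<le> n" for i j
    unfolding diff[OF ij(1)] using ij w[of i j] bounds_fromD(1,3)[OF h, of i j] m(2) by (cases "i + j = k") auto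
  moreover have "?h i j = zero_vec R" if "i + j > n" for i j using that bounds_fromD(2)[OF h] k by auto
  ultimately have "bounds_from k n g ?h" unfolding bounds_from_def by blast
  then show ?thesis by blast
qed

theorem tate_cycle_leading_in_\<mm>:
  assumes g: "tate_cycle n g" and tail: "\<And>i. i \<le> n \<Longrightarrow> g i (n - i) \<in> D 1 ` vecs R (b 1)"
  shows "g 0 0 \<in> ideal_vecs R \<mm> (b n)"
proof -
  have "\<exists>h. bounds_from k n g h" if "k \<le> n" for k
    using that
  proof (induction rule: inc_induct)
    case base
    show ?case using bounds_from_top[of n g] tail by blast
  next
    case (step k)
    then show ?case using bounds_from_step[OF g] by blast
  qed
  then obtain h where h: "bounds_from 0 n g h" by blast
  have "D (Suc n) (h 0 0) \<in> ideal_vecs R \<mm> (b n)"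
    using D_minimal[of "Suc n" "h 0 0"] bounds_fromD(1)[OF h, of 0 0] by simp
  moreover have "h p q \<in> ideal_vecs R (\<mm>pow 0) (b n)" if "p + q = Suc 0" for p q
    using bounds_fromD(1,2)[OF h, of p q] that by (cases "n = 0") (auto simp: ideal_vecs_carrier)
  then have "tate_diff h 0 0 \<in> ideal_vecs R \<mm> (b n)" using tate_diff_\<mm>pow[of 0 0 h 0 "b n"] \<mm>pow_1 by simp
  ultimately have "D (Suc n) (h 0 0) \<oplus>\<^bsub>Free (b n)\<^esub> tate_diff h 0 0 \<in> ideal_vecs R \<mm> (b n)"
    by (rule submodule_add[OF ideal_vecs_submodule[OF \<mm>_ideal]])
  then show ?thesis using bounds_fromD(3)[OF h, of 0 0] by simp
qed

definition partial_tate_cycle :: "nat \<Rightarrow> nat \<Rightarrow> (nat \<Rightarrow> 'a) \<Rightarrow> (nat \<Rightarrow> nat \<Rightarrow> nat \<Rightarrow> 'a) \<Rightarrow> bool" where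
  "partial_tate_cycle k n w g \<longleftrightarrow> g 0 0 = w \<and>
     (\<forall>i j. 1 \<le> i + j \<longrightarrow> i + j \<le> k \<longrightarrow> g i j \<in> ideal_vecs R \<mm> (b (n - (i + j)))) \<and>
     (\<forall>i j. i + j < k \<longrightarrow> D (n - (i + j)) (g i j) = tate_diff g i j)"

lemma partial_tate_cycleD:
  assumes "partial_tate_cycle k n w g"
  shows "g 0 0 = w" and "1 \<le> i + j \<Longrightarrow> i + j \<le> k \<Longrightarrow> g i j \<in> ideal_vecs R \<mm> (b (n - (i + j)))"
    and "i + j < k \<Longrightarrow> D (n - (i + j)) (g i j) = tate_diff g i j"
  using assms unfolding partial_tate_cycle_def by auto

lemma partial_tate_cycle_vecs:
  assumes "partial_tate_cycle k n w g" "w \<in> vecs R (b n)" "i + j \<le> k"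
  shows "g i j \<in> vecs R (b (n - (i + j)))"
  using partial_tate_cycleD(1)[OF assms(1)] partial_tate_cycleD(2)[OF assms(1), of i j] assms(2,3)
    ideal_vecs_vecs by (cases "i + j = 0") auto

lemma partial_tate_cycle_boundary:
  assumes w: "w \<in> vecs R (b n)" "D n w \<in> ideal_vecs R (\<mm>pow 2) (b (n - 1))"
    and g: "partial_tate_cycle k n w g" and k: "k < n"
  shows "i + j = k \<Longrightarrow> D (n - k) (g i j) \<in> ideal_vecs R (\<mm>pow 2) (b (n - k - 1))"
    and "Suc (i + j) = k \<Longrightarrow> tate_diff (\<lambda>i j. D (n - k) (g i j)) i j = zero_vec R"
proof -
  have m: "n - k \<ge> 1" using k by simp
  note gv = partial_tate_cycle_vecs[OF g w(1)]
  show "D (n - k) (g i j) \<in> ideal_vecs R (\<mm>pow 2) (b (n - k - 1))" if ij: "i + j = k"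
  proof (cases "k = 0")
    case True
    then show ?thesis using ij partial_tate_cycleD(1)[OF g] w(2) by simp
  next
    case False
    then have "g i j \<in> ideal_vecs R (\<mm>pow 1) (b (n - k))"
      using partial_tate_cycleD(2)[OF g, of i j] ij \<mm>pow_1 by simp
    then show ?thesis using D_\<mm>pow[OF m] by (simp add: numeral_2_eq_2)
  qed
  show "tate_diff (\<lambda>i j. D (n - k) (g i j)) i j = zero_vec R" if ij: "Suc (i + j) = k"
  proof -
    have Suc_m: "n - (i + j) = Suc (n - k)" using ij k by simp
    have "tate_diff (\<lambda>i j. D (n - k) (g i j)) i j = D (n - k) (tate_diff g i j)"
      by (rule linear_map_tate_diff[symmetric, OF D_linear[OF m]]) (use gv ij in auto)
    also have "\<dots> = D (n - k) (D (Suc (n - k)) (g i j))" using partial_tate_cycleD(3)[OF g, of i j] ij Suc_m by simp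
    also have "\<dots> = zero_vec R" by (rule D_D[OF m]) (use gv[of i j] ij Suc_m in simp)
    finally show ?thesis .
  qed
qed

lemma partial_tate_cycle_extend:
  assumes w: "w \<in> vecs R (b n)" "D n w \<in> ideal_vecs R (\<mm>pow 2) (b (n - 1))"
    and g: "partial_tate_cycle k n w g" and k: "k < n"
  shows "\<exists>g. partial_tate_cycle (Suc k) n w g"
proof -
  obtain h where h: "\<And>i j. i + j = Suc k \<Longrightarrow> h i j \<in> ideal_vecs R \<mm> (b (n - k - 1))"
    "\<And>i j. i + j = k \<Longrightarrow> tate_diff h i j = D (n - k) (g i j)"
    using sq_cycle_lift[of k "\<lambda>i j. D (n - k) (g i j)" "b (n - k - 1)"] partial_tate_cycle_boundary[OF w g k]
    by blast
  let ?g = "\<lambda>i j. if i + j = Suc k then h i j else g i j"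
  have "?g i j \<in> ideal_vecs R \<mm> (b (n - (i + j)))" if "1 \<le> i + j" "i + j \<le> Suc k" for i j
    using h(1)[of i j] partial_tate_cycleD(2)[OF g, of i j] that by (cases "i + j = Suc k") auto
  moreover have "D (n - (i + j)) (?g i j) = tate_diff ?g i j" if ij: "i + j < Suc k" for i j
  proof (cases "i + j = k")
    case True
    have "tate_diff ?g i j = tate_diff h i j" by (rule tate_diff_cong) (use True in auto)
    then show ?thesis using h(2)[OF True] True by simp
  next
    case False
    have "tate_diff ?g i j = tate_diff g i j" by (rule tate_diff_cong) (use False ij in auto)
    then show ?thesis using partial_tate_cycleD(3)[OF g, of i j] False ij by simp
  qed
  ultimately have "partial_tate_cycle (Suc k) n w ?g"
    using partial_tate_cycleD(1)[OF g] unfolding partial_tate_cycle_def by auto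
  then show ?thesis by blast
qed

theorem tate_cycle_extension:
  assumes w: "w \<in> vecs R (b n)" "D n w \<in> ideal_vecs R (\<mm>pow 2) (b (n - 1))"
  obtains g where "tate_cycle n g" "g 0 0 = w"
    "\<And>i j. 1 \<le> i + j \<Longrightarrow> i + j \<le> n \<Longrightarrow> g i j \<in> ideal_vecs R \<mm> (b (n - (i + j)))"
proof -
  have "\<exists>g. partial_tate_cycle k n w g" if "k \<le> n" for k
    using that
  proof (induction k)
    case 0
    have "partial_tate_cycle 0 n w (\<lambda>_ _. w)" by (simp add: partial_tate_cycle_def)
    then show ?case by blast
  next
    case (Suc k)
    then show ?case using partial_tate_cycle_extend[OF w] by auto
  qed
  then obtain g where g: "partial_tate_cycle n n w g" by blast
  have "tate_cycle n g"
    unfolding tate_cycle_def using partial_tate_cycle_vecs[OF g w(1)] partial_tate_cycleD(3)[OF g] by blast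
  then show ?thesis using partial_tate_cycleD(1,2)[OF g] that by blast
qed

lemma tate_diff_shift: "tate_diff (\<lambda>i j. g (i + 2 * p) (j + 2 * q)) i j = tate_diff g (i + 2 * p) (j + 2 * q)"
  by (auto simp: tate_diff_def signed_c_def tate_a_def tate_c_def fun_eq_iff elim!: oddE)

lemma tate_cycle_shift:
  assumes g: "tate_cycle (n + 2 * (p + q)) g"
  shows "tate_cycle n (\<lambda>i j. g (i + 2 * p) (j + 2 * q))"
proof -
  have degree: "n + 2 * (p + q) - (i + 2 * p + (j + 2 * q)) = n - (i + j)" for i j by simp
  show ?thesis
    unfolding tate_cycle_def tate_diff_shift
    using tate_cycleD[OF g, of "i + 2 * p" "j + 2 * q" for i j] unfolding degree by simp
qed

lemma D_ideal_vecs_\<mm>: "n \<ge> 1 \<Longrightarrow> w \<in> ideal_vecs R \<mm> (b n) \<Longrightarrow> D n w t \<in> \<mm>pow 2"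
  using ideal_vecs_entry[OF \<mm>pow_ideal D_\<mm>pow[of n w 1]] \<mm>pow_1 by (simp add: numeral_2_eq_2)

lemma tate_cycle_shift_leading:
  assumes g: "tate_cycle (n + 2) g" and g0: "g 0 0 \<in> ideal_vecs R \<mm> (b (n + 2))"
  shows "g 2 0 \<in> ideal_vecs R \<mm> (b n)" and "g 0 2 \<in> ideal_vecs R \<mm> (b n)"
proof -
  have v: "g 0 1 \<in> vecs R (b (n + 1))" "g 1 0 \<in> vecs R (b (n + 1))" "g 1 1 \<in> vecs R (b n)"
    "g 2 0 \<in> vecs R (b n)" "g 0 2 \<in> vecs R (b n)"
    using tate_cycleD(1)[OF g, of 0 1] tate_cycleD(1)[OF g, of 1 0] tate_cycleD(1)[OF g, of 1 1]
      tate_cycleD(1)[OF g, of 2 0] tate_cycleD(1)[OF g, of 0 2] by auto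
  note v_carriers = v[THEN vecs_carrier]
  have D00: "tate_diff g 0 0 t \<in> \<mm>pow 2" for t
    using D_ideal_vecs_\<mm>[OF _ g0, of t] tate_cycleD(2)[OF g, of 0 0] by simp
  have "tate_diff g 0 0 t = g 0 1 t \<otimes> a \<oplus> g 1 0 t \<otimes> c" for t
    using v_carriers carriers by (simp add: tate_diff_def tate_a_def signed_c_def tate_c_def m_comm)
  then have deg1: "g 0 1 t \<in> \<mm>" "g 1 0 t \<in> \<mm>" for t
    using independent_mod_sq[OF v_carriers(1,2), of t t] D00[of t] by auto
  then have diff_in_sq: "tate_diff g 1 0 t \<in> \<mm>pow 2" "tate_diff g 0 1 t \<in> \<mm>pow 2" for t
    using D_ideal_vecs_\<mm>[of "n + 1" "g 1 0" t] D_ideal_vecs_\<mm>[of "n + 1" "g 0 1" t] v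
      tate_cycleD(2)[OF g, of 1 0] tate_cycleD(2)[OF g, of 0 1] by (auto intro: ideal_vecsI)
  have "tate_diff g 1 0 t = g 1 1 t \<otimes> a \<oplus> g 2 0 t \<otimes> c'" for t
    using v_carriers carriers by (simp add: tate_diff_def tate_a_def signed_c_def tate_c_def m_comm numeral_2_eq_2)
  then have deg2: "g 1 1 t \<in> \<mm>" "g 2 0 t \<in> \<mm>" for t
    using orthogonal_data.independent_mod_sq[OF orthogonal_data_swap v_carriers(3,4), of t t]
      diff_in_sq(1)[of t] by auto
  have "g 0 2 t \<in> \<mm>" for t
  proof (rule exact_pair.mult_a_in_sq[OF swap a'_notin_sq v_carriers(5)])
    let ?r = "\<ominus> c \<otimes> g 1 1 t \<oplus> \<ominus> l \<otimes> g 2 0 t"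
    have r: "?r \<in> \<mm>pow 2" using deg2 c_in_\<mm> l_in_\<mm> ideal_uminus[OF \<mm>_ideal] by (intro \<mm>pow_add \<mm>_mult_\<mm>)
    have "tate_diff g 0 1 t = a' \<otimes> g 0 2 t \<oplus> ?r"
      using v_carriers carriers by (simp add: tate_diff_def tate_a_def signed_c_def tate_c_def numeral_2_eq_2)
    then have "g 0 2 t \<otimes> a' = tate_diff g 0 1 t \<ominus> ?r" using v_carriers(3-5)[of t] carriers by algebra
    then show "g 0 2 t \<otimes> a' \<in> \<mm>pow 2" using \<mm>pow_minus[OF diff_in_sq(2) r] by simp
  qed
  then show "g 2 0 \<in> ideal_vecs R \<mm> (b n)" "g 0 2 \<in> ideal_vecs R \<mm> (b n)"
    using deg2(2) v by (auto intro: ideal_vecsI)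
qed

lemma tate_cycle_zero: "tate_cycle n (\<lambda>_ _. zero_vec R)"
proof -
  have "D m (zero_vec R) = zero_vec R" if "m \<ge> 1" for m
    using module_hom_pair.hom_zero[OF D_hom[OF that]] by simp
  moreover have "tate_diff (\<lambda>_ _. zero_vec R) i j = zero_vec R" for i j
    using tate_carriers by (auto simp: tate_diff_def zero_vec_def fun_eq_iff)
  ultimately show ?thesis unfolding tate_cycle_def by auto
qed

lemma tate_cycle_add:
  assumes g: "tate_cycle n g" and h: "tate_cycle n h"
  shows "tate_cycle n (\<lambda>i j t. g i j t \<oplus> h i j t)"
  unfolding tate_cycle_def
proof (intro conjI allI impI)
  fix i j
  show "(\<lambda>t. g i j t \<oplus> h i j t) \<in> vecs R (b (n - (i + j)))" if "i + j \<le> n"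
    by (intro vecs_add tate_cycleD(1)[OF g that] tate_cycleD(1)[OF h that])
  assume ij: "i + j < n"
  then have m: "n - (i + j) \<ge> 1" by simp
  have "D (n - (i + j)) (\<lambda>t. g i j t \<oplus> h i j t) = (\<lambda>t. tate_diff g i j t \<oplus> tate_diff h i j t)"
    using module_hom_pair.hom_add[OF D_hom[OF m], of "g i j" "h i j"] tate_cycleD[OF g, of i j]
      tate_cycleD[OF h, of i j] ij by simp
  also have "\<dots> = tate_diff (\<lambda>i j t. g i j t \<oplus> h i j t) i j"
    by (rule tate_diff_add[OF tate_cycleD_Suc[OF g ij] tate_cycleD_Suc[OF h ij], symmetric])
  finally show "D (n - (i + j)) (\<lambda>t. g i j t \<oplus> h i j t) = tate_diff (\<lambda>i j t. g i j t \<oplus> h i j t) i j" .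
qed

lemma tate_cycle_smult:
  assumes g: "tate_cycle n g" and r: "r \<in> carrier R"
  shows "tate_cycle n (\<lambda>i j t. r \<otimes> g i j t)"
  unfolding tate_cycle_def
proof (intro conjI allI impI)
  fix i j
  show "(\<lambda>t. r \<otimes> g i j t) \<in> vecs R (b (n - (i + j)))" if "i + j \<le> n"
    by (intro vecs_smult r tate_cycleD(1)[OF g that])
  assume ij: "i + j < n"
  then have m: "n - (i + j) \<ge> 1" by simp
  have "D (n - (i + j)) (\<lambda>t. r \<otimes> g i j t) = (\<lambda>t. r \<otimes> tate_diff g i j t)"
    using module_hom_pair.hom_smult[OF D_hom[OF m] r, of "g i j"] tate_cycleD[OF g, of i j] ij by simp
  also have "\<dots> = tate_diff (\<lambda>i j t. r \<otimes> g i j t) i j"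
    by (rule tate_diff_smult[OF tate_cycleD_Suc[OF g ij] r, symmetric])
  finally show "D (n - (i + j)) (\<lambda>t. r \<otimes> g i j t) = tate_diff (\<lambda>i j t. r \<otimes> g i j t) i j" .
qed

definition tails :: "'a set \<Rightarrow> nat \<Rightarrow> (nat \<Rightarrow> nat \<Rightarrow> 'a) set" where
  "tails I n = {\<mu>. \<exists>g. tate_cycle n g \<and> g 0 0 \<in> ideal_vecs R I (b n) \<and> (\<forall>i\<le>n. \<mu> i = g i (n - i))}"

lemma tailsI: "tate_cycle n g \<Longrightarrow> g 0 0 \<in> ideal_vecs R I (b n) \<Longrightarrow> (\<And>i. i \<le> n \<Longrightarrow> \<mu> i = g i (n - i)) \<Longrightarrow> \<mu> \<in> tails I n"
  unfolding tails_def by blast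

lemma tailsE:
  assumes "\<mu> \<in> tails I n"
  obtains g where "tate_cycle n g" "g 0 0 \<in> ideal_vecs R I (b n)" "\<And>i. i \<le> n \<Longrightarrow> \<mu> i = g i (n - i)"
  using assms unfolding tails_def by blast

lemma shift_closed_tails:
  assumes I: "ideal I R"
    and lead: "\<And>n g. tate_cycle (n + 2) g \<Longrightarrow> g 0 0 \<in> ideal_vecs R I (b (n + 2)) \<Longrightarrow>
      g 2 0 \<in> ideal_vecs R I (b n) \<and> g 0 2 \<in> ideal_vecs R I (b n)"
  shows "shift_closed R (b 0) (tails I)"
proof unfold_locales
  note V = ideal_vecs_submodule[OF I]
  show "(\<lambda>_. zero_vec R) \<in> tails I n" for n
    by (rule tailsI[OF tate_cycle_zero]) (simp_all add: zero_vec_ideal_vecs[OF I])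
  fix n \<mu>
  {
    assume "\<mu> \<in> tails I n"
    then obtain g where g: "tate_cycle n g" "g 0 0 \<in> ideal_vecs R I (b n)" "\<And>i. i \<le> n \<Longrightarrow> \<mu> i = g i (n - i)"
      by (elim tailsE) blast
    show "\<mu> i \<in> vecs R (b 0)" if "i \<le> n" for i
      using tate_cycleD(1)[OF g(1), of i "n - i"] g(3)[OF that] that by simp
    show "\<nu> \<in> tails I n" if "\<And>i. i \<le> n \<Longrightarrow> \<nu> i = \<mu> i" for \<nu> by (rule tailsI[OF g(1,2)]) (use that g(3) in simp)
    show "(\<lambda>i t. r \<otimes> \<mu> i t) \<in> tails I n" if "r \<in> carrier R" for r
      by (rule tailsI[OF tate_cycle_smult[OF g(1) that]]) (use submodule_smult[OF V that g(2)] g(3) in simp_all)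
    fix \<nu> assume "\<nu> \<in> tails I n"
    then obtain h where h: "tate_cycle n h" "h 0 0 \<in> ideal_vecs R I (b n)" "\<And>i. i \<le> n \<Longrightarrow> \<nu> i = h i (n - i)"
      by (elim tailsE) blast
    show "(\<lambda>i t. \<mu> i t \<oplus> \<nu> i t) \<in> tails I n"
      by (rule tailsI[OF tate_cycle_add[OF g(1) h(1)]]) (use submodule_add[OF V g(2) h(2)] g(3) h(3) in simp_all)
  }
  assume "\<mu> \<in> tails I (n + 2)"
  then obtain g where g: "tate_cycle (n + 2) g" "g 0 0 \<in> ideal_vecs R I (b (n + 2))"
    "\<And>i. i \<le> n + 2 \<Longrightarrow> \<mu> i = g i (n + 2 - i)"
    by (elim tailsE) blast
  note lead = lead[OF g(1,2)]
  show "(\<lambda>i. \<mu> (i + 2)) \<in> tails I n"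
    by (rule tailsI[OF tate_cycle_shift[of n 1 0 g]]) (use g lead in \<open>simp_all add: numeral_2_eq_2\<close>)
  show "\<mu> \<in> tails I n"
    by (rule tailsI[OF tate_cycle_shift[of n 0 1 g]]) (use g lead in \<open>simp_all add: numeral_2_eq_2 Suc_diff_le\<close>)
qed

lemma tate_cycle_same_tails:
  assumes g: "tate_cycle n g" and h: "tate_cycle n h" "h 0 0 \<in> ideal_vecs R \<mm> (b n)"
    and tails: "\<And>i. i \<le> n \<Longrightarrow> g i (n - i) = h i (n - i)"
  shows "g 0 0 \<in> ideal_vecs R \<mm> (b n)"
proof -
  let ?k = "\<lambda>i j t. g i j t \<oplus> \<ominus> \<one> \<otimes> h i j t"
  have "tate_cycle n ?k" by (rule tate_cycle_add[OF g tate_cycle_smult[OF h(1)]]) simp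
  moreover have zero_boundary: "zero_vec R \<in> D 1 ` vecs R (b 1)"
    using module_hom_pair.hom_zero[OF D_hom[of 1]] by (auto intro!: rev_image_eqI[OF zero_vec_in_vecs])
  have "?k i (n - i) \<in> D 1 ` vecs R (b 1)" if i: "i \<le> n" for i
  proof -
    have "h i (n - i) t \<in> carrier R" for t using tate_cycleD(1)[OF h(1), of i "n - i"] i vecs_carrier by simp
    then have "?k i (n - i) = zero_vec R" using tails[OF i] by (simp add: zero_vec_def l_minus r_neg)
    then show ?thesis using zero_boundary by simp
  qed
  ultimately have "?k 0 0 \<in> ideal_vecs R \<mm> (b n)" by (rule tate_cycle_leading_in_\<mm>)
  then have "?k 0 0 \<oplus>\<^bsub>Free (b n)\<^esub> h 0 0 \<in> ideal_vecs R \<mm> (b n)"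
    using h(2) by (rule submodule_add[OF ideal_vecs_submodule[OF \<mm>_ideal]])
  moreover have "?k 0 0 \<oplus>\<^bsub>Free (b n)\<^esub> h 0 0 = g 0 0"
    using vecs_carrier[OF tate_cycleD(1)[OF g, of 0 0]] vecs_carrier[OF ideal_vecs_vecs[OF h(2)]]
    by (auto simp: fun_eq_iff l_minus a_assoc l_neg)
  ultimately show ?thesis by simp
qed

theorem linear_boundary_eventually:
  "\<exists>n0\<ge>1. \<forall>n\<ge>n0. \<forall>w\<in>vecs R (b n). D n w \<in> ideal_vecs R (\<mm>pow 2) (b (n - 1)) \<longrightarrow> w \<in> ideal_vecs R \<mm> (b n)"
proof -
  have "shift_closed R (b 0) (tails (carrier R))"
  proof (rule shift_closed_tails[OF oneideal])
    show "g 2 0 \<in> ideal_vecs R (carrier R) (b n) \<and> g 0 2 \<in> ideal_vecs R (carrier R) (b n)"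
      if "tate_cycle (n + 2) g" for n g
      using tate_cycleD(1)[OF that, of 2 0] tate_cycleD(1)[OF that, of 0 2] by (simp add: ideal_vecs_carrier)
  qed
  moreover have "shift_closed R (b 0) (tails \<mm>)"
    by (rule shift_closed_tails[OF \<mm>_ideal]) (blast intro: tate_cycle_shift_leading)
  ultimately obtain d0 where d0: "\<And>n. low_degree_part (tails (carrier R)) (tails \<mm>) d0 n \<subseteq> tails \<mm> n"
    by (rule shift_closed_low_degrees) blast
  have "w \<in> ideal_vecs R \<mm> (b n)"
    if n: "n \<ge> Suc d0" and w: "w \<in> vecs R (b n)" "D n w \<in> ideal_vecs R (\<mm>pow 2) (b (n - 1))" for n w
  proof -
    obtain g where g: "tate_cycle n g" "g 0 0 = w"
      "\<And>i j. 1 \<le> i + j \<Longrightarrow> i + j \<le> n \<Longrightarrow> g i j \<in> ideal_vecs R \<mm> (b (n - (i + j)))"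
      by (rule tate_cycle_extension[OF w]) (rule that)
    have "(\<lambda>i. g i (n - i)) \<in> low_degree_part (tails (carrier R)) (tails \<mm>) d0 n"
    proof (rule low_degree_partI)
      show "(\<lambda>i. g i (n - i)) \<in> tails (carrier R) n"
        by (rule tailsI[OF g(1)]) (use g(2) w in \<open>simp_all add: ideal_vecs_carrier\<close>)
      fix p q m assume m: "n = m + 2 * (p + q)" "m \<le> d0"
      then have "tate_cycle m (\<lambda>i j. g (i + 2 * p) (j + 2 * q))" using g(1) tate_cycle_shift by simp
      moreover have "n - (2 * p + 2 * q) = m" using m(1) by simp
      then have "g (0 + 2 * p) (0 + 2 * q) \<in> ideal_vecs R \<mm> (b m)" using g(3)[of "2 * p" "2 * q"] m n by simp
      moreover have "n - (i + 2 * p) = m - i + 2 * q" if "i \<le> m" for i using m(1) that by simp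
      ultimately show "(\<lambda>i. g (i + 2 * p) (n - (i + 2 * p))) \<in> tails \<mm> m" by (auto intro: tailsI)
    qed
    then have "(\<lambda>i. g i (n - i)) \<in> tails \<mm> n" using d0 by blast
    then obtain h where "tate_cycle n h" "h 0 0 \<in> ideal_vecs R \<mm> (b n)" "\<And>i. i \<le> n \<Longrightarrow> g i (n - i) = h i (n - i)"
      by (elim tailsE) blast
    then show ?thesis using tate_cycle_same_tails[OF g(1)] g(2) by simp
  qed
  then show ?thesis by (intro exI[of _ "Suc d0"]) auto
qed

lemma linear_boundary_residue:
  assumes D1: "D 1 ` vecs R (b 1) = ideal_vecs R \<mm> (b 0)" and n: "n \<ge> 1"
    and w: "w \<in> vecs R (b n)" "D n w \<in> ideal_vecs R (\<mm>pow 2) (b (n - 1))"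
  shows "w \<in> ideal_vecs R \<mm> (b n)"
proof -
  obtain g where g: "tate_cycle n g" "g 0 0 = w"
    "\<And>i j. 1 \<le> i + j \<Longrightarrow> i + j \<le> n \<Longrightarrow> g i j \<in> ideal_vecs R \<mm> (b (n - (i + j)))"
    by (rule tate_cycle_extension[OF w]) (rule that)
  have "g i (n - i) \<in> D 1 ` vecs R (b 1)" if "i \<le> n" for i using g(3)[of i "n - i"] that n D1 by simp
  then show ?thesis using tate_cycle_leading_in_\<mm>[OF g(1)] g(2) by blast
qed

end

section \<open>Hilbert functions of syzygies\<close>

lemma (in short_ring) len_ideal_vecs:
  assumes "submodule I R Reg" "submodule J R Reg" "I \<subseteq> J"
  shows "quotient_length R (Free n) (ideal_vecs R I n) (ideal_vecs R J n) = len\<^sub>R I J * n"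
proof -
  interpret F: finite_length_module R "Free n" by (rule finite_length_module_Free)
  show ?thesis
    by (rule F.lat.len_eq[OF has_quotient_length_ideal_vecs[OF S.has_quotient_length_quotient_length[OF assms]]])
qed

lemma (in short_ring) len_ideal_vecs_\<mm>pow:
  "quotient_length R (Free n) (ideal_vecs R \<mm> n) (vecs R n) = n"
  "quotient_length R (Free n) (ideal_vecs R (\<mm>pow 2) n) (ideal_vecs R \<mm> n) = e * n"
  "quotient_length R (Free n) {zero_vec R} (ideal_vecs R (\<mm>pow 2) n) = (e + 1) * n"
  "quotient_length R (Free n) {zero_vec R} (ideal_vecs R (\<mm>pow 3) n) = n"
  using len_ideal_vecs[OF \<mm>_submodule submodule_R, of n]
    len_ideal_vecs[OF \<mm>pow_submodule \<mm>_submodule \<mm>pow_2_subset, of n]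
    len_ideal_vecs[OF submodule_0 \<mm>pow_submodule, of 2 n] len_ideal_vecs[OF submodule_0 \<mm>pow_submodule, of 3 n]
    len_\<mm>pow \<mm>_carrier \<mm>pow_zero by (auto simp: ideal_vecs_carrier ideal_vecs_0)

context min_complex
begin

abbreviation len\<^sub>F :: "nat \<Rightarrow> (nat \<Rightarrow> 'a) set \<Rightarrow> (nat \<Rightarrow> 'a) set \<Rightarrow> nat" where
  "len\<^sub>F n \<equiv> quotient_length R (Free (b n))"

abbreviation \<mm>vecs :: "nat \<Rightarrow> (nat \<Rightarrow> 'a) set" where "\<mm>vecs n \<equiv> ideal_vecs R \<mm> (b n)"

abbreviation \<mm>pow_vecs :: "nat \<Rightarrow> nat \<Rightarrow> (nat \<Rightarrow> 'a) set" where "\<mm>pow_vecs k n \<equiv> ideal_vecs R (\<mm>pow k) (b n)"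

definition syzygies :: "nat \<Rightarrow> (nat \<Rightarrow> 'a) set" where "syzygies n = D (Suc n) ` vecs R (b (Suc n))"

definition linear_generators :: "nat \<Rightarrow> bool" where
  "linear_generators n \<longleftrightarrow> (\<forall>w\<in>vecs R (b n). D n w \<in> \<mm>pow_vecs 2 (n - 1) \<longrightarrow> w \<in> \<mm>vecs n)"

definition strict_in_cube :: "nat \<Rightarrow> bool" where
  "strict_in_cube n \<longleftrightarrow> \<mm>pow_vecs 3 n \<subseteq> D (Suc n) ` \<mm>pow_vecs 2 (Suc n)"

definition len_\<mm>_image :: "nat \<Rightarrow> nat" where "len_\<mm>_image n = len\<^sub>F (n - 1) {zero_vec R} (D n ` \<mm>vecs n)"

definition len_sq_image :: "nat \<Rightarrow> nat" where "len_sq_image n = len\<^sub>F (n - 1) {zero_vec R} (D n ` \<mm>pow_vecs 2 n)"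

definition sq_add_syzygies :: "nat \<Rightarrow> (nat \<Rightarrow> 'a) set" where
  "sq_add_syzygies n = \<mm>pow_vecs 2 n <+>\<^bsub>Free (b n)\<^esub> syzygies n"

lemmas \<mm>pow_vecs_submodule = ideal_vecs_submodule[OF \<mm>pow_ideal]
lemmas \<mm>vecs_submodule = ideal_vecs_submodule[OF \<mm>_ideal]

lemma D_submodule: "n \<ge> 1 \<Longrightarrow> submodule A R (Free (b n)) \<Longrightarrow> submodule (D n ` A) R (Free (b (n - 1)))"
  by (rule module_hom_pair.submodule_image[OF D_hom])

lemma syzygies_submodule: "submodule (syzygies n) R (Free (b n))"
  using D_submodule[of "Suc n", OF _ vecs_submodule] by (simp add: syzygies_def)

lemma syzygies_vecs: "v \<in> syzygies n \<Longrightarrow> v \<in> vecs R (b n)"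
  using submodule_carrier[OF syzygies_submodule] by simp

lemma syzygies_subset: "syzygies n \<subseteq> \<mm>vecs n"
  using D_minimal[of "Suc n"] by (auto simp: syzygies_def)

lemma D_eq_zero_iff: "n \<ge> 1 \<Longrightarrow> v \<in> vecs R (b n) \<Longrightarrow> D n v = zero_vec R \<longleftrightarrow> v \<in> syzygies n"
  using D_exact[of n v] D_D[of n] by (auto simp: syzygies_def)

lemma D_smult: "n \<ge> 1 \<Longrightarrow> y \<in> carrier R \<Longrightarrow> v \<in> vecs R (b n) \<Longrightarrow> D n (\<lambda>t. y \<otimes> v t) = (\<lambda>t. y \<otimes> D n v t)"
  using module_hom_pair.hom_smult[OF D_hom, of n y v] by simp

lemma D_syzygies:
  assumes n: "n \<ge> 1"
  shows "D n ` syzygies n = {zero_vec R}"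
proof -
  have "D n v = zero_vec R" if "v \<in> syzygies n" for v using D_eq_zero_iff[OF n syzygies_vecs[OF that]] that by simp
  moreover have "zero_vec R \<in> syzygies n" using submodule_zero[OF syzygies_submodule] by simp
  ultimately show ?thesis by force
qed

lemma len_D_image:
  assumes n: "n \<ge> 1" and A: "submodule A R (Free (b n))" and B: "submodule B R (Free (b n))" "A \<subseteq> B"
    and syz: "syzygies n \<subseteq> A"
  shows "len\<^sub>F (n - 1) (D n ` A) (D n ` B) = len\<^sub>F n A B"
  by (rule quotient_length_image[OF finite_length_module_Free module_Free D_linear[OF n] A B])
    (use D_eq_zero_iff[OF n] syz submodule_carrier[OF B(1)] in auto)

lemma D_add_syzygies:
  assumes n: "n \<ge> 1" and A: "submodule A R (Free (b n))"
  shows "D n ` (A <+>\<^bsub>Free (b n)\<^esub> syzygies n) = D n ` A"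
proof
  interpret D: module_hom_pair R "Free (b n)" "Free (b (n - 1))" "D n" by (rule D_hom[OF n])
  show "D n ` A \<subseteq> D n ` (A <+>\<^bsub>Free (b n)\<^esub> syzygies n)" using D.M.set_add_upper1[OF A syzygies_submodule] by blast
  show "D n ` (A <+>\<^bsub>Free (b n)\<^esub> syzygies n) \<subseteq> D n ` A"
  proof
    fix z assume "z \<in> D n ` (A <+>\<^bsub>Free (b n)\<^esub> syzygies n)"
    then obtain x y where xy: "x \<in> A" "y \<in> syzygies n" "z = D n (x \<oplus>\<^bsub>Free (b n)\<^esub> y)" by (auto simp: set_add_iff)
    have y: "y \<in> vecs R (b n)" "D n y = zero_vec R" using D_eq_zero_iff[OF n] syzygies_vecs[OF xy(2)] xy(2) by auto
    then have "z = D n x"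
      using xy(3) D.hom_add[of x y] submodule_carrier[OF A xy(1)] D.N.M.r_zero[of "D n x"] D.hom_closed[of x]
      by simp
    then show "z \<in> D n ` A" using xy(1) by blast
  qed
qed

lemma sq_add_syzygies_submodule: "submodule (sq_add_syzygies n) R (Free (b n))"
  and sq_subset_sq_add_syzygies: "\<mm>pow_vecs 2 n \<subseteq> sq_add_syzygies n"
  and syzygies_subset_sq_add: "syzygies n \<subseteq> sq_add_syzygies n"
  and sq_add_syzygies_subset: "sq_add_syzygies n \<subseteq> \<mm>vecs n"
proof -
  interpret M: module R "Free (b n)" by (rule module_Free)
  note summands = \<mm>pow_vecs_submodule[of 2 "b n"] syzygies_submodule[of n]
  show "submodule (sq_add_syzygies n) R (Free (b n))"
    unfolding sq_add_syzygies_def by (rule M.submodule_set_add[OF summands])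
  show "\<mm>pow_vecs 2 n \<subseteq> sq_add_syzygies n" unfolding sq_add_syzygies_def by (rule M.set_add_upper1[OF summands])
  show "syzygies n \<subseteq> sq_add_syzygies n" unfolding sq_add_syzygies_def by (rule M.set_add_upper2[OF summands])
  show "sq_add_syzygies n \<subseteq> \<mm>vecs n"
    unfolding sq_add_syzygies_def
    by (rule M.set_add_least[OF \<mm>vecs_submodule ideal_vecs_mono[OF \<mm>pow_2_subset] syzygies_subset])
qed

lemma syzygies_Int_sq:
  assumes "linear_generators (Suc n)"
  shows "syzygies n \<inter> \<mm>pow_vecs 2 n = D (Suc n) ` \<mm>vecs (Suc n)"
proof
  show "syzygies n \<inter> \<mm>pow_vecs 2 n \<subseteq> D (Suc n) ` \<mm>vecs (Suc n)"
    using assms unfolding linear_generators_def syzygies_def by auto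
  show "D (Suc n) ` \<mm>vecs (Suc n) \<subseteq> syzygies n \<inter> \<mm>pow_vecs 2 n"
    using D_\<mm>pow[of "Suc n" _ 1] \<mm>pow_1 ideal_vecs_vecs by (auto simp: syzygies_def numeral_2_eq_2)
qed

lemma len_syzygies_mod_\<mm>: "len\<^sub>F n (D (Suc n) ` \<mm>vecs (Suc n)) (syzygies n) = b (Suc n)"
  using len_D_image[of "Suc n", OF _ \<mm>vecs_submodule vecs_submodule _ syzygies_subset] ideal_vecs_vecs
    len_ideal_vecs_\<mm>pow(1) by (auto simp: syzygies_def)

lemma len_sq_image_eq:
  assumes n: "n \<ge> 1"
  shows "len_sq_image n = len\<^sub>F n (syzygies n) (sq_add_syzygies n)"
  using len_D_image[OF n syzygies_submodule sq_add_syzygies_submodule syzygies_subset_sq_add subset_refl]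
  unfolding sq_add_syzygies_def D_syzygies[OF n] D_add_syzygies[OF n \<mm>pow_vecs_submodule] len_sq_image_def by simp

lemma len_\<mm>_image_eq:
  assumes n: "n \<ge> 1"
  shows "len_\<mm>_image n = len_sq_image n + len\<^sub>F n (sq_add_syzygies n) (\<mm>vecs n)"
proof -
  interpret F: finite_length_module R "Free (b n)" by (rule finite_length_module_Free)
  have "len_\<mm>_image n = len\<^sub>F n (syzygies n) (\<mm>vecs n)"
    using len_D_image[OF n syzygies_submodule \<mm>vecs_submodule syzygies_subset] D_syzygies[OF n]
    by (simp add: len_\<mm>_image_def)
  also have "\<dots> = len\<^sub>F n (syzygies n) (sq_add_syzygies n) + len\<^sub>F n (sq_add_syzygies n) (\<mm>vecs n)"
    by (rule F.quotient_length_add[OF syzygies_submodule sq_add_syzygies_submodule \<mm>vecs_submodule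
          syzygies_subset_sq_add sq_add_syzygies_subset])
  finally show ?thesis using len_sq_image_eq[OF n] by simp
qed

lemma len_\<mm>_mod_sq_add_syzygies:
  assumes "linear_generators (Suc n)"
  shows "len\<^sub>F n (sq_add_syzygies n) (\<mm>vecs n) + b (Suc n) = e * b n"
proof -
  interpret F: finite_length_module R "Free (b n)" by (rule finite_length_module_Free)
  note sq = \<mm>pow_vecs_submodule[of 2 "b n"]
  have "syzygies n <+>\<^bsub>Free (b n)\<^esub> \<mm>pow_vecs 2 n = sq_add_syzygies n"
    by (rule equalityI; unfold sq_add_syzygies_def; rule F.set_add_least)
      (use F.submodule_set_add[OF sq syzygies_submodule] F.submodule_set_add[OF syzygies_submodule sq]
        F.set_add_upper1[OF sq syzygies_submodule] F.set_add_upper2[OF sq syzygies_submodule]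
        F.set_add_upper1[OF syzygies_submodule sq] F.set_add_upper2[OF syzygies_submodule sq] in auto)
  then have "len\<^sub>F n (\<mm>pow_vecs 2 n) (sq_add_syzygies n) = b (Suc n)"
    using F.quotient_length_diamond[OF syzygies_submodule sq] syzygies_Int_sq[OF assms]
      len_syzygies_mod_\<mm>[of n] by simp
  moreover have "len\<^sub>F n (\<mm>pow_vecs 2 n) (\<mm>vecs n) =
      len\<^sub>F n (\<mm>pow_vecs 2 n) (sq_add_syzygies n) + len\<^sub>F n (sq_add_syzygies n) (\<mm>vecs n)"
    by (rule F.quotient_length_add[OF sq sq_add_syzygies_submodule \<mm>vecs_submodule sq_subset_sq_add_syzygies
      sq_add_syzygies_subset])
  ultimately show ?thesis using len_ideal_vecs_\<mm>pow(2)[of "b n"] by simp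
qed

lemma len_sq_image_add_len_\<mm>_image:
  assumes n: "n \<ge> 1" and lin: "linear_generators (Suc n)"
  shows "len_sq_image n + len_\<mm>_image (Suc n) = (e + 1) * b n"
proof -
  interpret F: finite_length_module R "Free (b n)" by (rule finite_length_module_Free)
  let ?I = "D (Suc n) ` \<mm>vecs (Suc n)"
  note sq = \<mm>pow_vecs_submodule[of 2 "b n"] and Int = syzygies_Int_sq[OF lin]
  have I: "submodule ?I R (Free (b n))" using D_submodule[of "Suc n", OF _ \<mm>vecs_submodule] by simp
  have I_sub: "?I \<subseteq> \<mm>pow_vecs 2 n" using Int by blast
  have "len_sq_image n = len\<^sub>F n (\<mm>pow_vecs 2 n \<inter> syzygies n) (\<mm>pow_vecs 2 n)"
    using len_sq_image_eq[OF n] F.quotient_length_diamond[OF sq syzygies_submodule]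
    by (simp add: sq_add_syzygies_def)
  also have "\<mm>pow_vecs 2 n \<inter> syzygies n = ?I" using Int by blast
  finally have "len_sq_image n = len\<^sub>F n ?I (\<mm>pow_vecs 2 n)" .
  moreover have "len\<^sub>F n {zero_vec R} (\<mm>pow_vecs 2 n) = len\<^sub>F n {zero_vec R} ?I + len\<^sub>F n ?I (\<mm>pow_vecs 2 n)"
    by (rule F.quotient_length_add[OF zero_vec_submodule I sq _ I_sub]) (use submodule_zero[OF I] in simp)
  ultimately show ?thesis using len_ideal_vecs_\<mm>pow(3)[of "b n"] by (simp add: len_\<mm>_image_def)
qed

lemma len_sq_image_le: "len_sq_image (Suc n) \<le> b n"
  and len_sq_image_eq_imp_strict: "len_sq_image (Suc n) = b n \<Longrightarrow> strict_in_cube n"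
proof -
  interpret F: finite_length_module R "Free (b n)" by (rule finite_length_module_Free)
  let ?I = "D (Suc n) ` \<mm>pow_vecs 2 (Suc n)"
  note cube = \<mm>pow_vecs_submodule[of 3 "b n"]
  have I: "submodule ?I R (Free (b n))" using D_submodule[of "Suc n", OF _ \<mm>pow_vecs_submodule] by simp
  have I_sub: "?I \<subseteq> \<mm>pow_vecs 3 n" using D_\<mm>pow[of "Suc n" _ 2] by (auto simp: numeral_3_eq_3)
  have "len\<^sub>F n {zero_vec R} (\<mm>pow_vecs 3 n) = len\<^sub>F n {zero_vec R} ?I + len\<^sub>F n ?I (\<mm>pow_vecs 3 n)"
    by (rule F.quotient_length_add[OF zero_vec_submodule I cube _ I_sub]) (use submodule_zero[OF I] in simp)
  then have eq: "b n = len_sq_image (Suc n) + len\<^sub>F n ?I (\<mm>pow_vecs 3 n)"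
    using len_ideal_vecs_\<mm>pow(4)[of "b n"] by (simp add: len_sq_image_def)
  then show "len_sq_image (Suc n) \<le> b n" by simp
  assume "len_sq_image (Suc n) = b n"
  then show "strict_in_cube n"
    unfolding strict_in_cube_def using F.quotient_length_eq_0[OF I cube I_sub] eq by simp
qed

text \<open>The Hilbert series of the \<open>n\<close>-th syzygy, evaluated at \<open>- 1\<close>.\<close>

definition hilbert_alternating :: "nat \<Rightarrow> int" where
  "hilbert_alternating n = int (b n) - int (len_\<mm>_image n) + 2 * int (len_sq_image n)"

lemma hilbert_alternating_diff:
  assumes n: "n \<ge> 1" and lin: "linear_generators (Suc n)"
  shows "hilbert_alternating n - hilbert_alternating (Suc n) = 2 * (int (b n) - int (len_sq_image (Suc n)))"
proof -
  have "int (len_\<mm>_image n) = int (len_sq_image n) + (int e * int (b n) - int (b (Suc n)))"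
    using len_\<mm>_image_eq[OF n] arg_cong[OF len_\<mm>_mod_sq_add_syzygies[OF lin], of int] by simp
  moreover have "int (len_sq_image n) + int (len_\<mm>_image (Suc n)) = (int e + 1) * int (b n)"
    using arg_cong[OF len_sq_image_add_len_\<mm>_image[OF n lin], of int] by (simp add: algebra_simps)
  ultimately show ?thesis unfolding hilbert_alternating_def by (simp add: algebra_simps)
qed

lemma cube_subset_syzygies: "n \<ge> 1 \<Longrightarrow> \<mm>pow_vecs 3 n \<subseteq> syzygies n"
proof
  fix v assume n: "n \<ge> 1" and v: "v \<in> \<mm>pow_vecs 3 n"
  have "D n v \<in> \<mm>pow_vecs 4 (n - 1)" using D_\<mm>pow[OF n v] by (simp add: numeral_eq_Suc)
  then have "D n v = zero_vec R" using \<mm>pow_4 ideal_vecs_0 by simp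
  then show "v \<in> syzygies n" using D_eq_zero_iff[OF n ideal_vecs_vecs[OF v]] by simp
qed

definition mult_add_syzygies :: "'a \<Rightarrow> nat \<Rightarrow> (nat \<Rightarrow> 'a) set" where
  "mult_add_syzygies y n = (\<lambda>v t. y \<otimes> v t) ` vecs R (b n) <+>\<^bsub>Free (b n)\<^esub> syzygies n"

definition syzygy_colon :: "'a \<Rightarrow> nat \<Rightarrow> (nat \<Rightarrow> 'a) set" where
  "syzygy_colon y n = {v \<in> vecs R (b n). (\<lambda>t. y \<otimes> v t) \<in> syzygies n}"

lemma mult_submodule: "y \<in> carrier R \<Longrightarrow> submodule A R (Free n) \<Longrightarrow> submodule ((\<lambda>v t. y \<otimes> v t) ` A) R (Free n)"
  by (rule module_hom_pair.submodule_image[OF module_hom_pairI[OF module_Free module_Free linear_map_smult]])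

lemma mult_\<mm>pow_vecs: "y \<in> \<mm> \<Longrightarrow> v \<in> ideal_vecs R (\<mm>pow k) n \<Longrightarrow> (\<lambda>t. y \<otimes> v t) \<in> ideal_vecs R (\<mm>pow (Suc k)) n"
  by (rule ideal_vecsI[OF vecs_smult[OF \<mm>_carrier ideal_vecs_vecs] \<mm>_mult_\<mm>pow[OF _
    ideal_vecs_entry[OF \<mm>pow_ideal]]])

lemma mult_vecs_in_\<mm>vecs: "y \<in> \<mm> \<Longrightarrow> v \<in> vecs R n \<Longrightarrow> (\<lambda>t. y \<otimes> v t) \<in> ideal_vecs R \<mm> n"
  using mult_\<mm>pow_vecs[of y v 0 n] ideal_vecs_carrier \<mm>pow_1 by simp

lemma mult_\<mm>vecs_in_sq: "y \<in> \<mm> \<Longrightarrow> v \<in> ideal_vecs R \<mm> n \<Longrightarrow> (\<lambda>t. y \<otimes> v t) \<in> ideal_vecs R (\<mm>pow 2) n"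
  using mult_\<mm>pow_vecs[of y v 1 n] \<mm>pow_1 by (simp add: numeral_2_eq_2)

lemma mult_add_syzygies_submodule: "y \<in> carrier R \<Longrightarrow> submodule (mult_add_syzygies y n) R (Free (b n))"
  and mult_subset_mult_add_syzygies: "y \<in> carrier R \<Longrightarrow> (\<lambda>v t. y \<otimes> v t) ` vecs R (b n) \<subseteq> mult_add_syzygies y n"
  and syzygies_subset_mult_add: "y \<in> carrier R \<Longrightarrow> syzygies n \<subseteq> mult_add_syzygies y n"
proof -
  assume y: "y \<in> carrier R"
  interpret M: module R "Free (b n)" by (rule module_Free)
  note summands = mult_submodule[OF y vecs_submodule] syzygies_submodule
  show "submodule (mult_add_syzygies y n) R (Free (b n))"
    unfolding mult_add_syzygies_def by (rule M.submodule_set_add[OF summands])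
  show "(\<lambda>v t. y \<otimes> v t) ` vecs R (b n) \<subseteq> mult_add_syzygies y n"
    unfolding mult_add_syzygies_def by (rule M.set_add_upper1[OF summands])
  show "syzygies n \<subseteq> mult_add_syzygies y n" unfolding mult_add_syzygies_def by (rule M.set_add_upper2[OF summands])
qed

lemma syzygy_colon_submodule:
  assumes y: "y \<in> carrier R"
  shows "submodule (syzygy_colon y n) R (Free (b n))"
proof -
  interpret mult: module_hom_pair R "Free (b n)" "Free (b n)" "\<lambda>v t. y \<otimes> v t"
    by (intro module_hom_pairI module_Free linear_map_smult y)
  show ?thesis using mult.submodule_vimage[OF syzygies_submodule] by (simp add: syzygy_colon_def)
qed

lemma syzygies_subset_colon: "y \<in> carrier R \<Longrightarrow> syzygies n \<subseteq> syzygy_colon y n"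
  using submodule_smult[OF syzygies_submodule] syzygies_vecs by (auto simp: syzygy_colon_def)

lemma D_mult_add_syzygies:
  assumes y: "y \<in> carrier R"
  shows "D (Suc n) ` mult_add_syzygies y (Suc n) = (\<lambda>v t. y \<otimes> v t) ` syzygies n"
proof -
  have "D (Suc n) ` mult_add_syzygies y (Suc n) = D (Suc n) ` (\<lambda>v t. y \<otimes> v t) ` vecs R (b (Suc n))"
    unfolding mult_add_syzygies_def by (rule D_add_syzygies[OF _ mult_submodule[OF y vecs_submodule]]) simp
  also have "\<dots> = (\<lambda>v t. y \<otimes> v t) ` syzygies n"
    using D_smult[of "Suc n", OF _ y] unfolding syzygies_def image_image by (intro image_cong) auto
  finally show ?thesis .
qed

end

section \<open>Syzygies modulo an exact pair of zero divisors\<close>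

lemma (in exact_pair) mult_a_vec_eq_zero_iff:
  assumes v: "v \<in> vecs R n"
  shows "(\<lambda>t. a \<otimes> v t) = zero_vec R \<longleftrightarrow> v \<in> (\<lambda>v t. a' \<otimes> v t) ` vecs R n"
proof
  note v_carrier = vecs_carrier[OF v]
  assume zero: "(\<lambda>t. a \<otimes> v t) = zero_vec R"
  have "\<exists>u\<in>carrier R. v t = a' \<otimes> u" for t
  proof -
    have "v t \<otimes> a = \<zero>"
      using m_comm[OF a_carrier v_carrier, of t] fun_cong[OF zero, of t] by (simp add: zero_vec_def)
    then have "v t \<in> carrier R \<bullet> a'" using ann_a[OF v_carrier] PIdl_eq_image by simp
    then obtain u where "u \<in> carrier R" "v t = u \<otimes> a'" by blast
    then show ?thesis using m_comm[OF a'_carrier] by auto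
  qed
  then obtain u where "u \<in> ideal_vecs R (carrier R) n" and eq: "\<And>t. t < n \<Longrightarrow> v t = a' \<otimes> u t"
    using ideal_vecs_choice[OF oneideal, of n "\<lambda>t u. v t = a' \<otimes> u"] by metis
  then have u: "u \<in> vecs R n" by (simp add: ideal_vecs_carrier)
  have "v = (\<lambda>t. a' \<otimes> u t)" by (rule vecs_eqI[OF v vecs_smult[OF a'_carrier u] eq])
  then show "v \<in> (\<lambda>v t. a' \<otimes> v t) ` vecs R n" using u by blast
next
  assume "v \<in> (\<lambda>v t. a' \<otimes> v t) ` vecs R n"
  then obtain u where u: "u \<in> vecs R n" "v = (\<lambda>t. a' \<otimes> u t)" by blast
  have "a \<otimes> (a' \<otimes> u t) = \<zero>" for t
    using a_mult_a' a_carrier a'_carrier vecs_carrier[OF u(1)] by (simp flip: m_assoc)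
  then show "(\<lambda>t. a \<otimes> v t) = zero_vec R" using u(2) by (simp add: zero_vec_def)
qed

locale exact_pair_complex = exact_pair + min_complex
begin

lemma exact_pair_complex_swap: "exact_pair_complex R e a' a b D"
  by (intro exact_pair_complex.intro swap min_complex_axioms)

lemmas mult_a'_vec_eq_zero_iff = exact_pair.mult_a_vec_eq_zero_iff[OF swap]

lemma mult_add_syzygies_subset_colon: "mult_add_syzygies a n \<subseteq> syzygy_colon a' n"
proof -
  interpret M: module R "Free (b n)" by (rule module_Free)
  have "(\<lambda>v t. a \<otimes> v t) ` vecs R (b n) \<subseteq> syzygy_colon a' n"
  proof
    fix v assume v: "v \<in> (\<lambda>v t. a \<otimes> v t) ` vecs R (b n)"
    then have v_vecs: "v \<in> vecs R (b n)" using vecs_smult[OF a_carrier] by blast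
    then have "(\<lambda>t. a' \<otimes> v t) = zero_vec R" using mult_a'_vec_eq_zero_iff v by simp
    then show "v \<in> syzygy_colon a' n"
      using v_vecs submodule_zero[OF syzygies_submodule[of n]] by (simp add: syzygy_colon_def)
  qed
  then show ?thesis
    unfolding mult_add_syzygies_def
    by (rule M.set_add_least[OF syzygy_colon_submodule[OF a'_carrier] _ syzygies_subset_colon[OF a'_carrier]])
qed

lemma syzygy_colon_iff:
  assumes v: "v \<in> vecs R (b (Suc n))"
  shows "v \<in> syzygy_colon a' (Suc n) \<longleftrightarrow> D (Suc n) v \<in> (\<lambda>v t. a \<otimes> v t) ` vecs R (b n)"
proof -
  have Dv: "D (Suc n) v \<in> vecs R (b n)" using D_closed[of "Suc n" v] v by simp
  have "v \<in> syzygy_colon a' (Suc n) \<longleftrightarrow> D (Suc n) (\<lambda>t. a' \<otimes> v t) = zero_vec R"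
    using D_eq_zero_iff[of "Suc n", OF _ vecs_smult[OF a'_carrier v]] v by (simp add: syzygy_colon_def)
  also have "D (Suc n) (\<lambda>t. a' \<otimes> v t) = (\<lambda>t. a' \<otimes> D (Suc n) v t)" by (rule D_smult[OF _ a'_carrier v]) simp
  also have "\<dots> = zero_vec R \<longleftrightarrow> D (Suc n) v \<in> (\<lambda>v t. a \<otimes> v t) ` vecs R (b n)"
    by (rule mult_a'_vec_eq_zero_iff[OF Dv])
  finally show ?thesis .
qed

lemma D_syzygy_colon: "D (Suc n) ` syzygy_colon a' (Suc n) = (\<lambda>v t. a \<otimes> v t) ` vecs R (b n) \<inter> syzygies n"
proof
  have "v \<in> vecs R (b (Suc n))" if "v \<in> syzygy_colon a' (Suc n)" for v using that by (simp add: syzygy_colon_def)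
  then show "D (Suc n) ` syzygy_colon a' (Suc n) \<subseteq> (\<lambda>v t. a \<otimes> v t) ` vecs R (b n) \<inter> syzygies n"
    using syzygy_colon_iff unfolding syzygies_def by blast
  show "(\<lambda>v t. a \<otimes> v t) ` vecs R (b n) \<inter> syzygies n \<subseteq> D (Suc n) ` syzygy_colon a' (Suc n)"
  proof
    fix z assume z: "z \<in> (\<lambda>v t. a \<otimes> v t) ` vecs R (b n) \<inter> syzygies n"
    then obtain v where v: "v \<in> vecs R (b (Suc n))" "z = D (Suc n) v" unfolding syzygies_def by blast
    then have "v \<in> syzygy_colon a' (Suc n)" using z syzygy_colon_iff by simp
    then show "z \<in> D (Suc n) ` syzygy_colon a' (Suc n)" using v(2) by blast
  qed
qed

lemma mult_a_mult_a'_add: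
  assumes "u \<in> vecs R n" "w \<in> vecs R n"
  shows "(\<lambda>t. a \<otimes> (a' \<otimes> u t \<oplus> w t)) = (\<lambda>t. a \<otimes> w t)"
proof
  fix t
  have carriers: "u t \<in> carrier R" "w t \<in> carrier R" using assms vecs_carrier by auto
  then have "a \<otimes> (a' \<otimes> u t \<oplus> w t) = (a \<otimes> a') \<otimes> u t \<oplus> a \<otimes> w t" using a_carrier a'_carrier by algebra
  then show "a \<otimes> (a' \<otimes> u t \<oplus> w t) = a \<otimes> w t" using a_mult_a' carriers a_carrier by simp
qed

lemma mult_a_mult_add_syzygies: "(\<lambda>v t. a \<otimes> v t) ` mult_add_syzygies a' n = (\<lambda>v t. a \<otimes> v t) ` syzygies n"
proof
  show "(\<lambda>v t. a \<otimes> v t) ` syzygies n \<subseteq> (\<lambda>v t. a \<otimes> v t) ` mult_add_syzygies a' n"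
    using syzygies_subset_mult_add[OF a'_carrier] by blast
  show "(\<lambda>v t. a \<otimes> v t) ` mult_add_syzygies a' n \<subseteq> (\<lambda>v t. a \<otimes> v t) ` syzygies n"
  proof
    fix z assume "z \<in> (\<lambda>v t. a \<otimes> v t) ` mult_add_syzygies a' n"
    then obtain u w where uw: "u \<in> vecs R (b n)" "w \<in> syzygies n" "z = (\<lambda>t. a \<otimes> (a' \<otimes> u t \<oplus> w t))"
      by (auto simp: mult_add_syzygies_def set_add_iff)
    then show "z \<in> (\<lambda>v t. a \<otimes> v t) ` syzygies n"
      using mult_a_mult_a'_add[OF uw(1) syzygies_vecs[OF uw(2)]] by blast
  qed
qed

lemma len_colon_periodic:
  "len\<^sub>F (Suc n) (mult_add_syzygies a (Suc n)) (syzygy_colon a' (Suc n))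
    = len\<^sub>F n (mult_add_syzygies a' n) (syzygy_colon a n)"
proof -
  have "len\<^sub>F (Suc n) (mult_add_syzygies a (Suc n)) (syzygy_colon a' (Suc n)) =
      len\<^sub>F n (D (Suc n) ` mult_add_syzygies a (Suc n)) (D (Suc n) ` syzygy_colon a' (Suc n))"
    using len_D_image[of "Suc n", OF _ mult_add_syzygies_submodule[OF a_carrier]
      syzygy_colon_submodule[OF a'_carrier]
        mult_add_syzygies_subset_colon syzygies_subset_mult_add[OF a_carrier]] by simp
  also have "D (Suc n) ` mult_add_syzygies a (Suc n) = (\<lambda>v t. a \<otimes> v t) ` mult_add_syzygies a' n"
    using D_mult_add_syzygies[OF a_carrier] mult_a_mult_add_syzygies by simp
  also have "D (Suc n) ` syzygy_colon a' (Suc n) = (\<lambda>v t. a \<otimes> v t) ` syzygy_colon a n"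
    unfolding D_syzygy_colon by (auto simp: syzygy_colon_def)
  also have "len\<^sub>F n ((\<lambda>v t. a \<otimes> v t) ` mult_add_syzygies a' n) ((\<lambda>v t. a \<otimes> v t) ` syzygy_colon a n) =
      len\<^sub>F n (mult_add_syzygies a' n) (syzygy_colon a n)"
  proof (rule quotient_length_image[OF finite_length_module_Free module_Free linear_map_smult[OF a_carrier]
        mult_add_syzygies_submodule[OF a'_carrier] syzygy_colon_submodule[OF a_carrier]
        exact_pair_complex.mult_add_syzygies_subset_colon[OF exact_pair_complex_swap]])
    fix x assume "x \<in> syzygy_colon a n" "(\<lambda>t. a \<otimes> x t) = \<zero>\<^bsub>Free (b n)\<^esub>"
    then show "x \<in> mult_add_syzygies a' n"
      using mult_a_vec_eq_zero_iff[of x "b n"] mult_subset_mult_add_syzygies[OF a'_carrier, of n]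
      by (auto simp: syzygy_colon_def)
  qed
  finally show ?thesis .
qed

definition \<mm>_colon :: "nat \<Rightarrow> (nat \<Rightarrow> 'a) set" where "\<mm>_colon n = \<mm>vecs n \<inter> syzygy_colon a' n"

definition mult_add_sq_syzygies :: "nat \<Rightarrow> (nat \<Rightarrow> 'a) set" where
  "mult_add_sq_syzygies n = (\<lambda>v t. a \<otimes> v t) ` vecs R (b n) <+>\<^bsub>Free (b n)\<^esub> sq_add_syzygies n"

lemma \<mm>_colon_submodule: "submodule (\<mm>_colon n) R (Free (b n))"
  unfolding \<mm>_colon_def
  by (rule module.submodule_Int[OF module_Free \<mm>vecs_submodule syzygy_colon_submodule[OF a'_carrier]])

lemma mult_add_sq_syzygies_submodule: "submodule (mult_add_sq_syzygies n) R (Free (b n))"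
  and sq_add_syzygies_subset_mult: "sq_add_syzygies n \<subseteq> mult_add_sq_syzygies n"
  and mult_add_syzygies_subset_mult_sq: "mult_add_syzygies a n \<subseteq> mult_add_sq_syzygies n"
proof -
  interpret M: module R "Free (b n)" by (rule module_Free)
  note summands = mult_submodule[OF a_carrier vecs_submodule] sq_add_syzygies_submodule
  show sub: "submodule (mult_add_sq_syzygies n) R (Free (b n))"
    unfolding mult_add_sq_syzygies_def by (rule M.submodule_set_add[OF summands])
  show sq: "sq_add_syzygies n \<subseteq> mult_add_sq_syzygies n"
    unfolding mult_add_sq_syzygies_def by (rule M.set_add_upper2[OF summands])
  have "(\<lambda>v t. a \<otimes> v t) ` vecs R (b n) \<subseteq> mult_add_sq_syzygies n"
    unfolding mult_add_sq_syzygies_def by (rule M.set_add_upper1[OF summands])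
  then show "mult_add_syzygies a n \<subseteq> mult_add_sq_syzygies n"
    unfolding mult_add_syzygies_def[of a] using M.set_add_least[OF sub] syzygies_subset_sq_add sq by blast
qed

lemma mult_add_sq_syzygies_subset:
  assumes n: "n \<ge> 1"
  shows "mult_add_sq_syzygies n \<subseteq> \<mm>_colon n"
proof -
  interpret M: module R "Free (b n)" by (rule module_Free)
  have "(\<lambda>v t. a \<otimes> v t) ` vecs R (b n) \<subseteq> \<mm>_colon n"
    using mult_vecs_in_\<mm>vecs[OF a_in_\<mm>] mult_subset_mult_add_syzygies[OF a_carrier, of n]
      mult_add_syzygies_subset_colon[of n]
    unfolding \<mm>_colon_def by blast
  moreover have "\<mm>pow_vecs 2 n \<subseteq> \<mm>_colon n"
  proof
    fix v assume v: "v \<in> \<mm>pow_vecs 2 n"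
    have "(\<lambda>t. a' \<otimes> v t) \<in> \<mm>pow_vecs 3 n" using mult_\<mm>pow_vecs[OF a'_in_\<mm> v] by (simp add: numeral_3_eq_3)
    then have "v \<in> syzygy_colon a' n"
      using cube_subset_syzygies[OF n] ideal_vecs_vecs[OF v] unfolding syzygy_colon_def by blast
    then show "v \<in> \<mm>_colon n" unfolding \<mm>_colon_def using v ideal_vecs_mono[OF \<mm>pow_2_subset] by blast
  qed
  moreover have "syzygies n \<subseteq> \<mm>_colon n"
    unfolding \<mm>_colon_def using syzygies_subset syzygies_subset_colon[OF a'_carrier] by blast
  ultimately show ?thesis
    unfolding mult_add_sq_syzygies_def sq_add_syzygies_def by (intro M.set_add_least[OF \<mm>_colon_submodule])
qed

lemma len_mult_add_sq_le: "len\<^sub>F n (sq_add_syzygies n) (mult_add_sq_syzygies n) \<le> b n"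
proof -
  interpret F: finite_length_module R "Free (b n)" by (rule finite_length_module_Free)
  let ?aF = "(\<lambda>v t. a \<otimes> v t) ` vecs R (b n)" and ?a\<mm>F = "(\<lambda>v t. a \<otimes> v t) ` \<mm>vecs n"
  note aF = mult_submodule[OF a_carrier vecs_submodule, of "b n"]
    and a\<mm>F = mult_submodule[OF a_carrier \<mm>vecs_submodule, of "b n"]
  have "len\<^sub>F n (sq_add_syzygies n) (mult_add_sq_syzygies n) = len\<^sub>F n (?aF \<inter> sq_add_syzygies n) ?aF"
    using F.quotient_length_diamond[OF aF sq_add_syzygies_submodule] unfolding mult_add_sq_syzygies_def by simp
  also have "\<dots> \<le> len\<^sub>F n ?a\<mm>F ?aF"
  proof (rule F.quotient_length_mono[OF a\<mm>F F.submodule_Int[OF aF sq_add_syzygies_submodule] aF aF])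
    show "?a\<mm>F \<subseteq> ?aF \<inter> sq_add_syzygies n"
      using mult_\<mm>vecs_in_sq[OF a_in_\<mm>] sq_subset_sq_add_syzygies[of n] ideal_vecs_vecs by blast
  qed auto
  also have "\<dots> = len\<^sub>F n (\<mm>vecs n) (vecs R (b n))"
  proof (rule quotient_length_image[OF finite_length_module_Free module_Free linear_map_smult[OF a_carrier]
    \<mm>vecs_submodule vecs_submodule])
    show "\<mm>vecs n \<subseteq> vecs R (b n)" using ideal_vecs_vecs by blast
    fix x assume "x \<in> vecs R (b n)" "(\<lambda>t. a \<otimes> x t) = \<zero>\<^bsub>Free (b n)\<^esub>"
    then have "x \<in> (\<lambda>v t. a' \<otimes> v t) ` vecs R (b n)" using mult_a_vec_eq_zero_iff by simp
    then show "x \<in> \<mm>vecs n" using mult_vecs_in_\<mm>vecs[OF a'_in_\<mm>] by blast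
  qed
  also have "\<dots> = b n" by (rule len_ideal_vecs_\<mm>pow(1))
  finally show ?thesis .
qed

lemma len_\<mm>_mod_colon_le:
  assumes n: "n \<ge> 1"
  shows "len\<^sub>F n (\<mm>_colon n) (\<mm>vecs n) \<le> len_sq_image n"
proof -
  interpret F: finite_length_module R "Free (b n)" by (rule finite_length_module_Free)
  let ?a\<mm>F = "(\<lambda>v t. a' \<otimes> v t) ` \<mm>vecs n"
  note a\<mm>F = mult_submodule[OF a'_carrier \<mm>vecs_submodule, of "b n"]
  have "len\<^sub>F n (\<mm>_colon n) (\<mm>vecs n) = len\<^sub>F n ((\<lambda>v t. a' \<otimes> v t) ` \<mm>_colon n) ?a\<mm>F"
  proof (rule quotient_length_image[symmetric, OF finite_length_module_Free module_Free
    linear_map_smult[OF a'_carrier] \<mm>_colon_submodule \<mm>vecs_submodule])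
    show "\<mm>_colon n \<subseteq> \<mm>vecs n" unfolding \<mm>_colon_def by blast
    fix x assume "x \<in> \<mm>vecs n" "(\<lambda>t. a' \<otimes> x t) = \<zero>\<^bsub>Free (b n)\<^esub>"
    then show "x \<in> \<mm>_colon n"
      using submodule_zero[OF syzygies_submodule[of n]] ideal_vecs_vecs
      by (auto simp: \<mm>_colon_def syzygy_colon_def)
  qed
  also have "(\<lambda>v t. a' \<otimes> v t) ` \<mm>_colon n = ?a\<mm>F \<inter> syzygies n"
    unfolding \<mm>_colon_def syzygy_colon_def using ideal_vecs_vecs by blast
  also have "len\<^sub>F n \<dots> ?a\<mm>F = len\<^sub>F n (syzygies n) (?a\<mm>F <+>\<^bsub>Free (b n)\<^esub> syzygies n)"
    by (rule F.quotient_length_diamond[OF a\<mm>F syzygies_submodule])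
  also have "\<dots> \<le> len\<^sub>F n (syzygies n) (sq_add_syzygies n)"
  proof (rule F.quotient_length_mono[OF syzygies_submodule syzygies_submodule F.submodule_set_add[OF a\<mm>F
    syzygies_submodule]
        sq_add_syzygies_submodule subset_refl F.set_add_upper2[OF a\<mm>F syzygies_submodule]])
    show "?a\<mm>F <+>\<^bsub>Free (b n)\<^esub> syzygies n \<subseteq> sq_add_syzygies n"
      unfolding sq_add_syzygies_def by (rule set_add_mono) (use mult_\<mm>vecs_in_sq[OF a'_in_\<mm>] in auto)
  qed
  finally show ?thesis using len_sq_image_eq[OF n] by simp
qed

lemma hilbert_alternating_ge:
  assumes n: "n \<ge> 1"
  shows "hilbert_alternating n \<ge> - int (len\<^sub>F n (mult_add_sq_syzygies n) (\<mm>_colon n))"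
proof -
  interpret F: finite_length_module R "Free (b n)" by (rule finite_length_module_Free)
  have colon_sub: "\<mm>_colon n \<subseteq> \<mm>vecs n" unfolding \<mm>_colon_def by blast
  have "len\<^sub>F n (sq_add_syzygies n) (\<mm>vecs n) =
      len\<^sub>F n (sq_add_syzygies n) (mult_add_sq_syzygies n) + len\<^sub>F n (mult_add_sq_syzygies n) (\<mm>vecs n)"
    using mult_add_sq_syzygies_subset[OF n] colon_sub
    by (intro F.quotient_length_add sq_add_syzygies_submodule mult_add_sq_syzygies_submodule \<mm>vecs_submodule
        sq_add_syzygies_subset_mult) auto
  also have "len\<^sub>F n (mult_add_sq_syzygies n) (\<mm>vecs n) =
      len\<^sub>F n (mult_add_sq_syzygies n) (\<mm>_colon n) + len\<^sub>F n (\<mm>_colon n) (\<mm>vecs n)"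
    by (rule F.quotient_length_add[OF mult_add_sq_syzygies_submodule \<mm>_colon_submodule \<mm>vecs_submodule
          mult_add_sq_syzygies_subset[OF n] colon_sub])
  finally show ?thesis
    using len_mult_add_sq_le[of n] len_\<mm>_mod_colon_le[OF n] len_\<mm>_image_eq[OF n]
    unfolding hilbert_alternating_def by linarith
qed

lemma hilbert_alternating_ge_periodic:
  assumes n: "n \<ge> 1"
  shows "hilbert_alternating n \<ge> - int (len\<^sub>F n (mult_add_syzygies a n) (syzygy_colon a' n))"
proof -
  interpret F: finite_length_module R "Free (b n)" by (rule finite_length_module_Free)
  have "len\<^sub>F n (mult_add_sq_syzygies n) (\<mm>_colon n) \<le> len\<^sub>F n (mult_add_syzygies a n) (syzygy_colon a' n)"
    by (rule F.quotient_length_mono[OF mult_add_syzygies_submodule[OF a_carrier] mult_add_sq_syzygies_submodule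
          \<mm>_colon_submodule syzygy_colon_submodule[OF a'_carrier] mult_add_syzygies_subset_mult_sq
          mult_add_sq_syzygies_subset[OF n]]) (simp add: \<mm>_colon_def)
  then show ?thesis using hilbert_alternating_ge[OF n] by linarith
qed

lemma hilbert_alternating_bounded_below: "\<exists>c. \<forall>n\<ge>1. hilbert_alternating n \<ge> - int c"
proof -
  interpret swapped: exact_pair_complex R e a' a b D by (rule exact_pair_complex_swap)
  define T where "T n = len\<^sub>F n (mult_add_syzygies a n) (syzygy_colon a' n) + len\<^sub>F n (mult_add_syzygies a' n)
      (syzygy_colon a n)" for n
  have "T (Suc n) = T n" for n unfolding T_def using len_colon_periodic swapped.len_colon_periodic by simp
  then have T_const: "T n = T 0" for n by (induction n) auto
  have "hilbert_alternating n \<ge> - int (T 0)" if "n \<ge> 1" for n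
  proof -
    have "len\<^sub>F n (mult_add_syzygies a n) (syzygy_colon a' n) \<le> T 0"
      unfolding T_const[of n, symmetric] by (simp add: T_def)
    then show ?thesis using hilbert_alternating_ge_periodic[OF that] by linarith
  qed
  then show ?thesis by blast
qed

end

section \<open>High syzygies are strict\<close>

sublocale orthogonal_complex \<subseteq> exact_pair_complex
  by unfold_locales

context orthogonal_complex
begin

theorem strict_eventually: "\<exists>n1\<ge>1. \<forall>n\<ge>n1. linear_generators n \<and> strict_in_cube n"
proof -
  obtain n0 where n0: "n0 \<ge> 1" "\<And>n. n \<ge> n0 \<Longrightarrow> linear_generators n"
    using linear_boundary_eventually unfolding linear_generators_def by blast
  obtain c where c: "\<And>n. n \<ge> 1 \<Longrightarrow> hilbert_alternating n \<ge> - int c" using hilbert_alternating_bounded_below by blast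
  have step: "hilbert_alternating n - hilbert_alternating (Suc n)
      = 2 * (int (b n) - int (len_sq_image (Suc n)))" if "n \<ge> n0" for n
    using hilbert_alternating_diff[of n] n0 that by simp
  define f where "f k = nat (hilbert_alternating (n0 + k) + int c)" for k
  have "f (Suc k) \<le> f k" for k using step[of "n0 + k"] len_sq_image_le[of "n0 + k"] unfolding f_def by simp
  then obtain k0 where k0: "\<And>k. k \<ge> k0 \<Longrightarrow> f k = f k0"
    using step_antitone_family_stabilises[of "\<lambda>k _ _. f k"] by (auto simp: fun_eq_iff)
  have "strict_in_cube n" if n: "n \<ge> n0 + k0" for n
  proof -
    obtain k where k: "n = n0 + k" "k \<ge> k0" using n by (metis le_Suc_ex add.assoc le_add1)
    have "f (Suc k) = f k" using k0[of k] k0[of "Suc k"] k(2) by simp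
    then have "hilbert_alternating (Suc n) = hilbert_alternating n"
      using c[of n] c[of "Suc n"] n0(1) k(1) unfolding f_def by simp
    then have "len_sq_image (Suc n) = b n" using step[of n] k by simp
    then show ?thesis by (rule len_sq_image_eq_imp_strict)
  qed
  then show ?thesis using n0 by (intro exI[of _ "n0 + k0"]) auto
qed

end

section \<open>Resolutions of the residue field\<close>

locale residue_complex = exact_pair_complex +
  assumes D1_image: "D 1 ` vecs R (b 1) = \<mm>vecs 0"
    and a_notin_sq: "a \<notin> \<mm>pow 2" and a'_notin_sq: "a' \<notin> \<mm>pow 2"
begin

lemma residue_complex_swap: "residue_complex R e a' a b D"
  by (intro residue_complex.intro residue_complex_axioms.intro exact_pair_complex_swap D1_image a_notin_sq
    a'_notin_sq)

lemma syzygies_0: "syzygies 0 = \<mm>vecs 0"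
  using D1_image by (simp add: syzygies_def)

lemma \<mm>_colon_descend:
  assumes v: "v \<in> \<mm>_colon (Suc n)"
  shows "\<exists>g\<in>exact_pair_complex.\<mm>_colon R a b D n. D (Suc n) v = (\<lambda>t. a \<otimes> g t)"
proof -
  interpret swapped: exact_pair_complex R e a' a b D by (rule exact_pair_complex_swap)
  have v\<mm>: "v \<in> \<mm>vecs (Suc n)" and vc: "v \<in> syzygy_colon a' (Suc n)" using v unfolding \<mm>_colon_def by auto
  have "D (Suc n) v \<in> (\<lambda>v t. a \<otimes> v t) ` vecs R (b n) \<inter> syzygies n" using vc D_syzygy_colon by blast
  then obtain g where g: "g \<in> vecs R (b n)" "D (Suc n) v = (\<lambda>t. a \<otimes> g t)" "(\<lambda>t. a \<otimes> g t) \<in> syzygies n" by auto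
  have "D (Suc n) v \<in> \<mm>pow_vecs 2 n" using D_\<mm>pow[of "Suc n" v 1] v\<mm> \<mm>pow_1 by (simp add: numeral_2_eq_2)
  then have "g t \<otimes> a \<in> \<mm>pow 2" for t
    using ideal_vecs_entry[OF \<mm>pow_ideal, of "D (Suc n) v" 2 "b n" t] g(2)
      m_comm[OF a_carrier vecs_carrier[OF g(1)]] by simp
  then have "g \<in> \<mm>vecs n" using mult_a_in_sq[OF a_notin_sq vecs_carrier[OF g(1)]] g(1) by (intro ideal_vecsI) auto
  then have "g \<in> swapped.\<mm>_colon n" using g unfolding swapped.\<mm>_colon_def syzygy_colon_def by simp
  then show ?thesis using g(2) by blast
qed

lemma mult_add_syzygies_ascend:
  assumes v: "v \<in> vecs R (b (Suc n))" and g: "g \<in> mult_add_syzygies a' n" and eq: "D (Suc n) v = (\<lambda>t. a \<otimes> g t)"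
  shows "v \<in> mult_add_syzygies a (Suc n)"
proof -
  interpret D: module_hom_pair R "Free (b (Suc n))" "Free (b (Suc n - 1))" "D (Suc n)" by (rule D_hom) simp
  have "D (Suc n) v \<in> (\<lambda>v t. a \<otimes> v t) ` syzygies n" using g eq mult_a_mult_add_syzygies by blast
  then obtain w where w: "w \<in> vecs R (b (Suc n))" "D (Suc n) v = (\<lambda>t. a \<otimes> D (Suc n) w t)"
    by (auto simp: syzygies_def)
  then have "D (Suc n) v = D (Suc n) (\<lambda>t. a \<otimes> w t)" using D_smult[OF _ a_carrier w(1)] by simp
  note aw = vecs_smult[OF a_carrier w(1)]
  have "D (Suc n) (v \<ominus>\<^bsub>Free (b (Suc n))\<^esub> (\<lambda>t. a \<otimes> w t)) = zero_vec R"
    using D.hom_minus_eq_zero[of v "\<lambda>t. a \<otimes> w t"] v aw \<open>D (Suc n) v = D (Suc n) (\<lambda>t. a \<otimes> w t)\<close> by simp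
  then have "v \<ominus>\<^bsub>Free (b (Suc n))\<^esub> (\<lambda>t. a \<otimes> w t) \<in> syzygies (Suc n)"
    using D_eq_zero_iff[of "Suc n"] D.M.M.minus_closed[of v "\<lambda>t. a \<otimes> w t"] v aw by simp
  then have "(\<lambda>t. a \<otimes> w t) \<oplus>\<^bsub>Free (b (Suc n))\<^esub> (v \<ominus>\<^bsub>Free (b (Suc n))\<^esub> (\<lambda>t. a \<otimes> w t)) \<in> mult_add_syzygies a (Suc n)"
    unfolding mult_add_syzygies_def using w(1) by (intro set_addI) auto
  then show ?thesis using D.M.minus_add_cancel[of v "\<lambda>t. a \<otimes> w t"] v aw by simp
qed

lemma \<mm>_colon_subset: "\<mm>_colon n \<subseteq> mult_add_syzygies a n"
  using residue_complex_axioms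
proof (induction n arbitrary: a a')
  case (0 y y')
  then interpret y: residue_complex R e y y' b D .
  show ?case using y.syzygies_0 syzygies_subset_mult_add[OF y.a_carrier, of 0] unfolding y.\<mm>_colon_def by blast
next
  case (Suc n y y')
  then interpret y: residue_complex R e y y' b D by simp
  show ?case
  proof
    fix v assume v: "v \<in> y.\<mm>_colon (Suc n)"
    then obtain g where g: "g \<in> exact_pair_complex.\<mm>_colon R y b D n" "D (Suc n) v = (\<lambda>t. y \<otimes> g t)"
      using y.\<mm>_colon_descend by blast
    have "g \<in> mult_add_syzygies y' n" using Suc.IH[OF y.residue_complex_swap] g(1) by blast
    moreover have "v \<in> vecs R (b (Suc n))" using v ideal_vecs_vecs unfolding y.\<mm>_colon_def by blast
    ultimately show "v \<in> mult_add_syzygies y (Suc n)" using y.mult_add_syzygies_ascend[OF _ _ g(2)] by simp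
  qed
qed

lemma hilbert_alternating_nonneg:
  assumes n: "n \<ge> 1"
  shows "hilbert_alternating n \<ge> 0"
proof -
  interpret F: finite_length_module R "Free (b n)" by (rule finite_length_module_Free)
  have "mult_add_sq_syzygies n = \<mm>_colon n"
    using \<mm>_colon_subset[of n] mult_add_syzygies_subset_mult_sq[of n] mult_add_sq_syzygies_subset[OF n] by blast
  then have "len\<^sub>F n (mult_add_sq_syzygies n) (\<mm>_colon n) = 0" using F.lat.len_refl \<mm>_colon_submodule by simp
  then show ?thesis using hilbert_alternating_ge[OF n] by simp
qed

lemma single_vec_in_D1_image:
  assumes i: "i < b 0" and z: "z \<in> \<mm>pow (Suc k)"
  shows "single_vec R i z \<in> D 1 ` \<mm>pow_vecs k 1"
proof -
  let ?I = "D 1 ` \<mm>pow_vecs k 1"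
  have I: "submodule ?I R (Free (b 0))" using D_submodule[of 1, OF _ \<mm>pow_vecs_submodule] by simp
  have lin: "linear_map R Reg (Free (b 0)) (single_vec R i)"
    unfolding linear_map_def using single_vec_vecs[OF i] by (auto simp: single_vec_def fun_eq_iff)
  have "submodule {r \<in> carrier R. single_vec R i r \<in> ?I} R Reg"
    using module_hom_pair.submodule_vimage[OF module_hom_pairI[OF module_regular module_Free lin] I] by simp
  then have "\<mm>pow (Suc k) \<subseteq> {r \<in> carrier R. single_vec R i r \<in> ?I}"
    unfolding submodule_regular_iff
  proof (rule \<mm>pow_Suc_subset)
    fix u v assume u: "u \<in> \<mm>" and v: "v \<in> \<mm>pow k"
    note carriers = \<mm>_carrier[OF u] \<mm>pow_carrier[OF v]
    obtain w where w: "w \<in> vecs R (b 1)" "single_vec R i u = D 1 w"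
      using single_vec_ideal_vecs[OF i \<mm>_ideal u] D1_image by blast
    have "(\<lambda>t. v \<otimes> w t) \<in> \<mm>pow_vecs k 1"
      by (intro ideal_vecsI vecs_smult carriers w(1) \<mm>pow_smult_right[OF vecs_carrier[OF w(1)] v])
    moreover have "D 1 (\<lambda>t. v \<otimes> w t) = single_vec R i (u \<otimes> v)"
      using D_smult[OF _ carriers(2) w(1)] carriers unfolding w(2)[symmetric] by (auto simp: single_vec_def m_comm)
    ultimately show "u \<otimes> v \<in> {r \<in> carrier R. single_vec R i r \<in> ?I}" using carriers by force
  qed
  then show ?thesis using z by blast
qed

lemma D1_image_\<mm>pow: "D 1 ` \<mm>pow_vecs k 1 = \<mm>pow_vecs (Suc k) 0"
proof
  let ?I = "D 1 ` \<mm>pow_vecs k 1"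
  have I: "submodule ?I R (Free (b 0))" using D_submodule[of 1, OF _ \<mm>pow_vecs_submodule] by simp
  show "?I \<subseteq> \<mm>pow_vecs (Suc k) 0" using D_\<mm>pow[of 1] by auto
  show "\<mm>pow_vecs (Suc k) 0 \<subseteq> ?I"
  proof
    fix v assume v: "v \<in> \<mm>pow_vecs (Suc k) 0"
    from ideal_vecs_vecs[OF v] show "v \<in> ?I"
    proof (induction rule: vec_induct)
      case zero
      show ?case using submodule_zero[OF I] by simp
    next
      case (add x y)
      then show ?case using submodule_add[OF I, of x y] by simp
    next
      case (single i)
      show ?case by (rule single_vec_in_D1_image[OF single ideal_vecs_entry[OF \<mm>pow_ideal v]])
    qed
  qed
qed

lemma strict_in_cube_0: "strict_in_cube 0"
  using D1_image_\<mm>pow[of 2] by (simp add: strict_in_cube_def numeral_3_eq_3)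

lemma hilbert_alternating_1: "hilbert_alternating 1 = int (b 0)"
proof -
  have sq: "D 1 ` \<mm>vecs 1 = \<mm>pow_vecs 2 0" using D1_image_\<mm>pow[of 1] \<mm>pow_1 by (simp add: numeral_2_eq_2)
  then have "len_\<mm>_image 1 = (e + 1) * b 0" using len_ideal_vecs_\<mm>pow(3) by (simp add: len_\<mm>_image_def)
  moreover have "b 1 = e * b 0"
    using len_syzygies_mod_\<mm>[of 0] syzygies_0 sq len_ideal_vecs_\<mm>pow(2)[of "b 0"] by simp
  moreover have "len_sq_image 1 = b 0"
    using D1_image_\<mm>pow[of 2] len_ideal_vecs_\<mm>pow(4) by (simp add: len_sq_image_def numeral_3_eq_3)
  ultimately show ?thesis unfolding hilbert_alternating_def by (simp add: algebra_simps)
qed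

text \<open>The alternating sums are nonnegative and start at one, and their differences are even and nonnegative.\<close>

lemma hilbert_alternating_eq_1:
  assumes b0: "b 0 = 1" and lin: "\<And>n. n \<ge> 1 \<Longrightarrow> linear_generators n" and n: "n \<ge> 1"
  shows "hilbert_alternating n = 1"
  using n
proof (induction rule: dec_induct)
  case base
  show ?case using hilbert_alternating_1 b0 by simp
next
  case (step n)
  have "1 - hilbert_alternating (Suc n) = 2 * (int (b n) - int (len_sq_image (Suc n)))"
    using hilbert_alternating_diff[of n] lin step by simp
  moreover have "hilbert_alternating (Suc n) \<ge> 0" by (rule hilbert_alternating_nonneg) simp
  ultimately show ?case using len_sq_image_le[of n] by presburger
qed

lemma strict_in_cube_residue:
  assumes b0: "b 0 = 1" and lin: "\<And>n. n \<ge> 1 \<Longrightarrow> linear_generators n"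
  shows "strict_in_cube n"
proof (cases "n = 0")
  case True
  then show ?thesis using strict_in_cube_0 by simp
next
  case False
  then have "len_sq_image (Suc n) = b n"
    using hilbert_alternating_diff[of n] hilbert_alternating_eq_1[OF b0 lin, of n]
      hilbert_alternating_eq_1[OF b0 lin, of "Suc n"] lin
    by simp
  then show ?thesis by (rule len_sq_image_eq_imp_strict)
qed

end

theorem (in orthogonal_complex) strict_residue:
  assumes D1: "D 1 ` vecs R (b 1) = \<mm>vecs 0" and b0: "b 0 = 1"
  shows "n \<ge> 1 \<Longrightarrow> linear_generators n" and "strict_in_cube n"
proof -
  interpret residue_complex R e a a' b D
    by (intro residue_complex.intro residue_complex_axioms.intro exact_pair_complex_axioms D1 a_notin_sq
      a'_notin_sq)
  show lin: "linear_generators n" if "n \<ge> 1" for n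
    unfolding linear_generators_def using linear_boundary_residue[OF D1 that] by blast
  show "strict_in_cube n" by (rule strict_in_cube_residue[OF b0 lin])
qed

section \<open>Local rings with the given Hilbert series\<close>

lemma (in local_cring) has_quotient_length_hilbert_fun:
  assumes "Defs.noetherian_ring R"
  shows "has_quotient_length R Reg (\<mm>pow (Suc n)) (\<mm>pow n) (hilbert_fun R n)"
  unfolding hilbert_fun_def
  by (rule has_quotient_length_rank_res[OF \<mm>pow_ideal \<mm>pow_ideal \<mm>pow_Suc_le \<mm>_mult_\<mm>pow])
    (use assms \<mm>pow_ideal in \<open>auto simp: Defs.noetherian_ring_def\<close>)

lemma (in local_cring) \<mm>pow_eq_zero:
  assumes noetherian: "Defs.noetherian_ring R" and eq: "\<mm>pow (Suc n) = \<mm>pow n"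
  shows "\<mm>pow n = {\<zero>}"
proof -
  obtain S where S: "finite S" "S \<subseteq> carrier R" "\<mm>pow n = Idl S"
    using noetherian \<mm>pow_ideal unfolding Defs.noetherian_ring_def by blast
  obtain g where g: "\<And>k. k < card S \<Longrightarrow> g k \<in> S" "Idl S = lin_comb Reg (card S) g ` vecs R (card S)"
    by (rule genideal_lin_comb[OF S(1,2)]) (rule that)
  have "g k \<in> \<mm>pow n" if "k < card S" for k using g(1)[OF that] genideal_self[OF S(2)] S(3) by blast
  then have fg: "\<exists>t g. (\<forall>k<t. g k \<in> \<mm>pow n) \<and> \<mm>pow n \<subseteq> lin_comb Reg t g ` vecs R t"
    using g(2) S(3) by (intro exI[of _ "card S"] exI[of _ g]) simp
  have "\<mm>pow n = {\<zero>\<^bsub>Reg\<^esub>}"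
  proof (rule nakayama[OF module_regular \<mm>pow_submodule fg])
    fix B assume "submodule B R Reg" "\<And>r x. r \<in> \<mm> \<Longrightarrow> x \<in> \<mm>pow n \<Longrightarrow> r \<odot>\<^bsub>Reg\<^esub> x \<in> B"
    then have "\<mm>pow (Suc n) \<subseteq> B" by (intro \<mm>pow_Suc_subset) (simp_all add: submodule_regular_iff)
    then show "\<mm>pow n \<subseteq> B" using eq by simp
  qed
  then show ?thesis by simp
qed

theorem short_ring_of_hilbert_fun:
  assumes loc: "local_noetherian_ring R"
    and hilbert: "hilbert_fun R 1 = e" "hilbert_fun R 2 = e" "hilbert_fun R 3 = 1" "hilbert_fun R 4 = 0"
  shows "short_ring R e"
proof -
  have noetherian: "Defs.noetherian_ring R" using loc by (simp add: local_noetherian_ring_def)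
  interpret local_cring R
    using loc by (intro local_cring.intro local_cring_axioms.intro)
      (simp_all add: local_noetherian_ring_def Defs.noetherian_ring_def)
  interpret M: module R Reg by (rule module_regular)
  note len = has_quotient_length_hilbert_fun[OF noetherian]
  have "has_quotient_length R Reg (\<mm>pow (Suc 4)) (\<mm>pow 4) 0" using len[of 4] hilbert(4) by simp
  then have "\<mm>pow (Suc 4) = \<mm>pow 4" by (cases rule: M.lat.has_length.cases) auto
  then have "\<mm>pow 4 = {\<zero>\<^bsub>R\<^esub>}" by (rule \<mm>pow_eq_zero[OF noetherian])
  moreover have "Suc 1 = 2" "Suc 2 = 3" "Suc 3 = 4" by simp_all
  ultimately show ?thesis
    using len[of 1] len[of 2] len[of 3] hilbert
    by (intro short_ring.intro local_cring_axioms short_ring_axioms.intro) (simp_all only:)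
qed

lemma (in short_ring) socle_rank_eq_len:
  assumes noetherian: "Defs.noetherian_ring R"
  shows "socle_rank R = len\<^sub>R {\<zero>} socle"
proof -
  have socle: "ideal socle R" using socle_submodule submodule_regular_iff by simp
  have "has_quotient_length R Reg {\<zero>} socle (rank_res R socle {\<zero>})"
  proof (rule has_quotient_length_rank_res[OF socle zeroideal])
    show "{\<zero>} \<subseteq> socle" using submodule_zero[OF socle_submodule] by simp
    show "r \<otimes> x \<in> {\<zero>}" if "r \<in> \<mm>" "x \<in> socle" for r x
      using that \<mm>_carrier m_comm[of r x] by (auto simp: socle_def annihilator_def)
  qed (use noetherian socle in \<open>auto simp: Defs.noetherian_ring_def\<close>)
  then show ?thesis using S.lat.len_eq by (simp add: socle_rank_def socle_def)
qed

section \<open>Exact zero divisors and exact pairs\<close>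

context cring
begin

text \<open>Under an isomorphism of \<open>(0 : a)\<close> with \<open>R / a R\<close> the preimage \<open>b\<close> of \<open>1\<close> generates \<open>(0 : a)\<close> and has annihilator
  \<open>a R\<close>.\<close>

lemma exact_zero_divisor_generator:
  assumes ezd: "exact_zero_divisor R a"
  obtains b f where "b \<in> annihilator R {a}" "bij_betw f (annihilator R {a}) (carrier (R Quot PIdl a))"
    "\<And>r. r \<in> carrier R \<Longrightarrow> f (r \<otimes> b) = PIdl a +> r"
proof -
  let ?A = "annihilator R {a}" and ?Q = "R Quot PIdl a"
  have a: "a \<in> carrier R" using ezd by (simp add: exact_zero_divisor_def)
  interpret P: ideal "PIdl a" R by (rule cgenideal_ideal[OF a])
  interpret Q: ring ?Q by (rule P.quotient_is_ring)
  obtain f where bij: "bij_betw f ?A (carrier ?Q)"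
    and smult: "\<And>r x. r \<in> carrier R \<Longrightarrow> x \<in> ?A \<Longrightarrow> f (r \<otimes> x) = (PIdl a +> r) \<otimes>\<^bsub>?Q\<^esub> f x"
    using ezd unfolding exact_zero_divisor_def by blast
  have "\<one>\<^bsub>?Q\<^esub> \<in> f ` ?A" using bij_betw_imp_surj_on[OF bij] Q.one_closed by simp
  then obtain b where b: "b \<in> ?A" "f b = \<one>\<^bsub>?Q\<^esub>" by (auto dest: sym)
  have "f (r \<otimes> b) = PIdl a +> r" if "r \<in> carrier R" for r
    using smult[OF that b(1)] b(2) ring_hom_closed[OF P.rcos_ring_hom that] by simp
  with b(1) bij show ?thesis by (rule that)
qed

theorem exact_zero_divisor_pair:
  assumes ezd: "exact_zero_divisor R a"
  obtains b where "b \<in> carrier R" "\<And>x. x \<in> carrier R \<Longrightarrow> x \<otimes> a = \<zero> \<longleftrightarrow> x \<in> PIdl b"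
    "\<And>x. x \<in> carrier R \<Longrightarrow> x \<otimes> b = \<zero> \<longleftrightarrow> x \<in> PIdl a"
proof -
  let ?A = "annihilator R {a}"
  have a: "a \<in> carrier R" using ezd by (simp add: exact_zero_divisor_def)
  interpret P: ideal "PIdl a" R by (rule cgenideal_ideal[OF a])
  obtain b f where bA: "b \<in> ?A" and bij: "bij_betw f ?A (carrier (R Quot PIdl a))"
    and f: "\<And>r. r \<in> carrier R \<Longrightarrow> f (r \<otimes> b) = PIdl a +> r"
    by (rule exact_zero_divisor_generator[OF ezd]) (rule that)
  have b: "b \<in> carrier R" "b \<otimes> a = \<zero>" using bA by (auto simp: annihilator_def)
  have rb: "r \<otimes> b \<in> ?A" if "r \<in> carrier R" for r using that a b by (simp add: annihilator_def m_assoc)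
  note inj = inj_on_eq_iff[OF bij_betw_imp_inj_on[OF bij]]
  have "x \<otimes> a = \<zero> \<longleftrightarrow> x \<in> PIdl b" if x: "x \<in> carrier R" for x
  proof
    assume "x \<otimes> a = \<zero>"
    then have xA: "x \<in> ?A" using x by (simp add: annihilator_def)
    then have "f x \<in> carrier (R Quot PIdl a)" using bij_betwE[OF bij] by blast
    then obtain r where r: "r \<in> carrier R" "f x = PIdl a +> r" by (auto simp: FactRing_def A_RCOSETS_def')
    then have "x = r \<otimes> b" using f[OF r(1)] inj[OF xA rb[OF r(1)]] by simp
    then show "x \<in> PIdl b" using r unfolding cgenideal_def by blast
  next
    assume "x \<in> PIdl b"
    then show "x \<otimes> a = \<zero>" using rb unfolding cgenideal_def annihilator_def by blast
  qed
  moreover have "x \<otimes> b = \<zero> \<longleftrightarrow> x \<in> PIdl a" if x: "x \<in> carrier R" for x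
  proof -
    have coset: "PIdl a +> r = PIdl a \<longleftrightarrow> r \<in> PIdl a" if "r \<in> carrier R" for r
      using a_coset_join1[OF _ that P.a_subgroup] P.a_rcos_const by blast
    have "f \<zero> = PIdl a" using f[OF zero_closed] coset[OF zero_closed] P.zero_closed b by simp
    moreover have "\<zero> \<in> ?A" using a by (simp add: annihilator_def)
    then have "x \<otimes> b = \<zero> \<longleftrightarrow> f (x \<otimes> b) = f \<zero>" using inj[OF rb[OF x]] by simp
    ultimately show ?thesis using f[OF x] coset[OF x] by simp
  qed
  ultimately show ?thesis using that b(1) by blast
qed

end

theorem (in short_ring) exact_pair_of_exact_zero_divisor:
  assumes a: "a \<in> \<mm>" and ezd: "exact_zero_divisor R a"
  obtains a' where "exact_pair R e a a'"
proof -
  obtain b where b: "b \<in> carrier R" "\<And>x. x \<in> carrier R \<Longrightarrow> x \<otimes> a = \<zero> \<longleftrightarrow> x \<in> PIdl b"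
    "\<And>x. x \<in> carrier R \<Longrightarrow> x \<otimes> b = \<zero> \<longleftrightarrow> x \<in> PIdl a"
    by (rule exact_zero_divisor_pair[OF ezd]) (rule that)
  have "b \<in> \<mm>"
  proof (rule ccontr)
    assume "b \<notin> \<mm>"
    then obtain u where "u \<in> carrier R" "u \<otimes> b = \<one>" using notin_\<mm>_inverse[OF b(1)] by blast
    then have "\<one> \<in> PIdl b" unfolding cgenideal_def by force
    then have "a = \<zero>" using b(2)[OF one_closed] \<mm>_carrier[OF a] by simp
    then have "annihilator R {a} = carrier R" by (auto simp: annihilator_def)
    then show False using ezd by (simp add: exact_zero_divisor_def)
  qed
  then have "exact_pair R e a b"
    using a b(2,3) by (intro exact_pair.intro short_ring_axioms exact_pair_axioms.intro)
  then show ?thesis by (rule that)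
qed

section \<open>Minimal free resolutions\<close>

context cring
begin

abbreviation resolution_map :: "(nat \<Rightarrow> nat) \<Rightarrow> (nat \<Rightarrow> nat \<Rightarrow> nat \<Rightarrow> 'a) \<Rightarrow> nat \<Rightarrow> (nat \<Rightarrow> 'a) \<Rightarrow> nat \<Rightarrow> 'a" where
  "resolution_map b d n \<equiv> matvec R (d n) (b (n - 1)) (b n)"

lemma min_free_resolutionD:
  assumes "min_free_resolution R M b d \<epsilon>"
  shows "i \<ge> 1 \<Longrightarrow> p < b (i - 1) \<Longrightarrow> q < b i \<Longrightarrow> d i p q \<in> max_ideal R"
    and "i \<ge> 1 \<Longrightarrow> w \<in> vecs R (b (Suc i)) \<Longrightarrow> resolution_map b d i (resolution_map b d (Suc i) w) = zero_vec R"
    and "i \<ge> 1 \<Longrightarrow> v \<in> vecs R (b i) \<Longrightarrow> resolution_map b d i v = zero_vec R \<Longrightarrow>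
      \<exists>w\<in>vecs R (b (Suc i)). v = resolution_map b d (Suc i) w"
    and "linear_map R (Free (b 0)) M \<epsilon>" and "\<epsilon> ` vecs R (b 0) = carrier M"
    and "{v \<in> vecs R (b 0). \<epsilon> v = \<zero>\<^bsub>M\<^esub>} = resolution_map b d 1 ` vecs R (b 1)"
  using assms unfolding min_free_resolution_def by simp_all

lemma min_free_resolutionI:
  assumes "\<And>i p q. i \<ge> 1 \<Longrightarrow> p < b (i - 1) \<Longrightarrow> q < b i \<Longrightarrow> d i p q \<in> max_ideal R"
    and "\<And>i w. i \<ge> 1 \<Longrightarrow> w \<in> vecs R (b (Suc i)) \<Longrightarrow> resolution_map b d i (resolution_map b d (Suc i) w) = zero_vec R"
    and "\<And>i v. i \<ge> 1 \<Longrightarrow> v \<in> vecs R (b i) \<Longrightarrow> resolution_map b d i v = zero_vec R \<Longrightarrow>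
      \<exists>w\<in>vecs R (b (Suc i)). v = resolution_map b d (Suc i) w"
    and "linear_map R (Free (b 0)) M \<epsilon>" and "\<epsilon> ` vecs R (b 0) = carrier M"
    and "{v \<in> vecs R (b 0). \<epsilon> v = \<zero>\<^bsub>M\<^esub>} = resolution_map b d 1 ` vecs R (b 1)"
  shows "min_free_resolution R M b d \<epsilon>"
  using assms unfolding min_free_resolution_def by simp

lemma finitely_generated_moduleI:
  assumes M: "module R M" and lin: "linear_map R (Free t) M f" and surj: "f ` vecs R t = carrier M"
  shows "finitely_generated_module R M"
  unfolding finitely_generated_module_def
proof (intro conjI M exI[of _ t] exI[of _ "\<lambda>k. f (single_vec R k \<one>)"] allI impI ballI)
  show "f (single_vec R k \<one>) \<in> carrier M" if "k < t" for k using surj single_vec_vecs[OF that one_closed] by blast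
  fix x assume "x \<in> carrier M"
  then obtain v where v: "v \<in> vecs R t" "x = f v" using surj by blast
  then show "\<exists>c. (\<forall>i<t. c i \<in> carrier R) \<and> x = (\<Oplus>\<^bsub>M\<^esub>i\<in>{..<t}. c i \<odot>\<^bsub>M\<^esub> f (single_vec R i \<one>))"
    using linear_map_eq_lin_comb[OF M lin v(1)] vecs_carrier[OF v(1)]
    by (intro exI[of _ v]) (simp add: lin_comb_def)
qed

lemma finitely_generated_lin_comb:
  assumes fg: "finitely_generated_module R M"
  shows "\<exists>n g. (\<forall>k<n. g k \<in> carrier M) \<and> carrier M \<subseteq> lin_comb M n g ` vecs R n"
proof -
  have M: "module R M" using fg by (simp add: finitely_generated_module_def)
  obtain n :: nat and g where g: "\<And>i. i < n \<Longrightarrow> g i \<in> carrier M"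
    and gen: "\<forall>x\<in>carrier M. \<exists>c. (\<forall>i<n. c i \<in> carrier R) \<and> x = lin_comb M n g c"
    using fg unfolding finitely_generated_module_def lin_comb_def by blast
  have "carrier M \<subseteq> lin_comb M n g ` vecs R n"
  proof
    fix x assume "x \<in> carrier M"
    then obtain c where c: "\<And>i. i < n \<Longrightarrow> c i \<in> carrier R" "x = lin_comb M n g c" using bspec[OF gen] by blast
    let ?c = "\<lambda>i. if i < n then c i else \<zero>"
    have "lin_comb M n g ?c = x" unfolding c(2) by (rule lin_comb_cong[OF M g c(1)]) simp_all
    moreover have "?c \<in> vecs R n" using c by (auto simp: vecs_def)
    ultimately show "x \<in> lin_comb M n g ` vecs R n" by blast
  qed
  then show ?thesis using g by blast
qed

definition matrix_kernel :: "nat \<Rightarrow> nat \<Rightarrow> (nat \<Rightarrow> nat \<Rightarrow> 'a) \<Rightarrow> (nat \<Rightarrow> 'a) set" where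
  "matrix_kernel r t A = {v \<in> vecs R t. matvec R A r t v = zero_vec R}"

end

context short_ring
begin

lemma matvec_in_\<mm>:
  assumes A: "\<And>i j. i < r \<Longrightarrow> j < c \<Longrightarrow> A i j \<in> \<mm>" and v: "v \<in> vecs R c"
  shows "matvec R A r c v \<in> ideal_vecs R \<mm> r"
proof (rule ideal_vecsI)
  show "matvec R A r c v \<in> vecs R r"
    using linear_map_matvec[of r c A] A \<mm>_carrier v by (auto simp: linear_map_def)
  fix i assume i: "i < r"
  then have "dot_prod R c (A i) v \<in> \<mm>"
    using dot_prod_comm[of c "A i" v] dot_prod_ideal[OF \<mm>_ideal, of c v "A i"] A \<mm>_carrier vecs_carrier[OF v]
    by simp
  then show "matvec R A r c v i \<in> \<mm>" using i by (simp add: matvec_eq_dot_prod)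
qed

definition minimal_matrix :: "nat \<Rightarrow> nat \<Rightarrow> (nat \<Rightarrow> nat \<Rightarrow> 'a) \<Rightarrow> bool" where
  "minimal_matrix r t A \<longleftrightarrow> (\<forall>i<r. \<forall>j<t. A i j \<in> \<mm>) \<and> matrix_kernel r t A \<subseteq> ideal_vecs R \<mm> t"

lemma minimal_matrixD:
  assumes "minimal_matrix r t A"
  shows "i < r \<Longrightarrow> j < t \<Longrightarrow> A i j \<in> \<mm>" and "matrix_kernel r t A \<subseteq> ideal_vecs R \<mm> t"
  using assms unfolding minimal_matrix_def by auto

lemma matrix_kernel_submodule:
  assumes "minimal_matrix r t A"
  shows "submodule (matrix_kernel r t A) R (Free t)"
proof -
  interpret module_hom_pair R "Free t" "Free r" "matvec R A r t"
    by (intro module_hom_pairI module_Free linear_map_matvec \<mm>_carrier minimal_matrixD(1)[OF assms])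
  show ?thesis using submodule_vimage[OF zero_vec_submodule] by (simp add: matrix_kernel_def)
qed

lemma submodule_finitely_generated:
  assumes A: "submodule A R (Free n)"
  shows "\<exists>t g. (\<forall>k<t. g k \<in> A) \<and> A \<subseteq> lin_comb (Free n) t g ` vecs R t"
proof -
  interpret F: finite_length_module R "Free n" by (rule finite_length_module_Free)
  have "has_quotient_length R (Free n) {zero_vec R} A (quotient_length R (Free n) {zero_vec R} A)"
    using F.has_quotient_length_quotient_length[OF zero_vec_submodule A] submodule_zero[OF A] by simp
  then obtain t g where g: "\<forall>k<t. g k \<in> A" "A \<subseteq> {zero_vec R} <+>\<^bsub>Free n\<^esub> lin_comb (Free n) t g ` vecs R t"
    using has_quotient_length_generators[OF module_Free] by blast
  have gF: "g k \<in> carrier (Free n)" if "k < t" for k using submodule_carrier[OF A] g(1) that by blast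
  have "{zero_vec R} <+>\<^bsub>Free n\<^esub> lin_comb (Free n) t g ` vecs R t \<subseteq> lin_comb (Free n) t g ` vecs R t"
    using submodule_lin_comb_image[OF module_Free gF]
      submodule_zero[OF submodule_lin_comb_image[OF module_Free gF]]
    by (intro F.set_add_least) auto
  then show ?thesis using g by blast
qed

lemma minimal_matrix_onto:
  assumes K: "submodule K R (Free n)" "K \<subseteq> ideal_vecs R \<mm> n"
  shows "\<exists>t A. minimal_matrix n t A \<and> matvec R A n t ` vecs R t = K"
proof -
  obtain t g where g: "\<And>k. k < t \<Longrightarrow> g k \<in> K" "lin_comb (Free n) t g ` vecs R t = K"
    and ker: "\<And>v. v \<in> vecs R t \<Longrightarrow> lin_comb (Free n) t g v = \<zero>\<^bsub>Free n\<^esub> \<Longrightarrow> v \<in> ideal_vecs R \<mm> t"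
    using minimal_generators[OF module_Free K(1) submodule_finitely_generated[OF K(1)]] by blast
  let ?A = "\<lambda>i k. g k i"
  have gv: "g k \<in> vecs R n" if "k < t" for k using submodule_carrier[OF K(1) g(1)[OF that]] by simp
  have eq: "lin_comb (Free n) t g v = matvec R ?A n t v" if "v \<in> vecs R t" for v
    by (rule lin_comb_Free[OF gv that])
  have "?A i j \<in> \<mm>" if "j < t" for i j using ideal_vecs_entry[OF \<mm>_ideal subsetD[OF K(2) g(1)[OF that]]] .
  moreover have "matrix_kernel n t ?A \<subseteq> ideal_vecs R \<mm> t" using ker eq by (auto simp: matrix_kernel_def)
  moreover have "matvec R ?A n t ` vecs R t = K" using g(2) image_cong[OF refl eq, of "vecs R t"] by simp
  ultimately show ?thesis unfolding minimal_matrix_def by (intro exI[of _ t] exI[of _ ?A]) blast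
qed

lemma minimal_matrix_sequence:
  assumes K: "submodule K R (Free n)" "K \<subseteq> ideal_vecs R \<mm> n"
  obtains b d where "b 0 = n" "\<And>i. minimal_matrix (b i) (b (Suc i)) (d (Suc i))"
    "resolution_map b d 1 ` vecs R (b 1) = K"
    "\<And>i. resolution_map b d (Suc (Suc i)) ` vecs R (b (Suc (Suc i))) = matrix_kernel (b i) (b (Suc i)) (d (Suc i))"
proof -
  define P :: "nat \<Rightarrow> nat \<times> nat \<times> (nat \<Rightarrow> nat \<Rightarrow> 'a) \<Rightarrow> bool" where
    "P i x \<longleftrightarrow> (case x of (r, t, A) \<Rightarrow> minimal_matrix r t A \<and> (i = 0 \<longrightarrow> r = n \<and> matvec R A r t ` vecs R t = K))"
      for i x
  define Q :: "nat \<times> nat \<times> (nat \<Rightarrow> nat \<Rightarrow> 'a) \<Rightarrow> nat \<times> nat \<times> (nat \<Rightarrow> nat \<Rightarrow> 'a) \<Rightarrow> bool" where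
    "Q x y \<longleftrightarrow> (case x of (r, t, A) \<Rightarrow> case y of (r', t', A') \<Rightarrow> r' = t \<and> matvec R A' r' t' ` vecs R t'
      = matrix_kernel r t A)" for x y
  have "\<exists>F. \<forall>i. P i (F i) \<and> Q (F i) (F (Suc i))"
  proof (rule dependent_nat_choice)
    obtain t A where "minimal_matrix n t A" "matvec R A n t ` vecs R t = K"
      using minimal_matrix_onto[OF K] by blast
    then have "P 0 (n, t, A)" by (simp add: P_def)
    then show "\<exists>x. P 0 x" by blast
    fix x i assume "P i x"
    then obtain r t A where x: "x = (r, t, A)" and A: "minimal_matrix r t A" by (cases x) (auto simp: P_def)
    obtain t' A' where "minimal_matrix t t' A'" "matvec R A' t t' ` vecs R t' = matrix_kernel r t A"
      using minimal_matrix_onto[OF matrix_kernel_submodule[OF A] minimal_matrixD(2)[OF A]] by blast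
    then have "P (Suc i) (t, t', A') \<and> Q x (t, t', A')" by (simp add: P_def Q_def x)
    then show "\<exists>y. P (Suc i) y \<and> Q x y" by blast
  qed
  then obtain F where F: "\<And>i. P i (F i)" "\<And>i. Q (F i) (F (Suc i))" by metis
  define b where "b i = fst (F i)" for i
  define d where "d i = snd (snd (F (i - 1)))" for i
  have "fst (snd (F i)) = b (Suc i)" for i using F(2)[of i] by (auto simp: Q_def b_def split: prod.splits)
  then have Fi: "F i = (b i, b (Suc i), d (Suc i))" for i by (simp add: b_def d_def prod_eq_iff)
  show ?thesis
  proof (rule that[of b d])
    show "b 0 = n" "resolution_map b d 1 ` vecs R (b 1) = K" using F(1)[of 0] by (auto simp: P_def Fi)
    show "minimal_matrix (b i) (b (Suc i)) (d (Suc i))" for i using F(1)[of i] by (simp add: P_def Fi)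
    show "resolution_map b d (Suc (Suc i)) ` vecs R (b (Suc (Suc i)))
        = matrix_kernel (b i) (b (Suc i)) (d (Suc i))" for i
      using F(2)[of i] by (simp add: Q_def Fi)
  qed
qed

theorem min_free_resolution_exists:
  assumes fg: "finitely_generated_module R M"
  shows "\<exists>b d \<epsilon>. min_free_resolution R M b d \<epsilon>"
proof -
  have M: "module R M" using fg by (simp add: finitely_generated_module_def)
  interpret M: module R M by fact
  obtain t g where g: "\<And>k. k < t \<Longrightarrow> g k \<in> carrier M" "lin_comb M t g ` vecs R t = carrier M"
    and ker: "\<And>v. v \<in> vecs R t \<Longrightarrow> lin_comb M t g v = \<zero>\<^bsub>M\<^esub> \<Longrightarrow> v \<in> ideal_vecs R \<mm> t"
    using minimal_generators[OF M M.carrier_is_submodule finitely_generated_lin_comb[OF fg]] by blast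
  let ?\<epsilon> = "lin_comb M t g" and ?K = "{v \<in> vecs R t. lin_comb M t g v = \<zero>\<^bsub>M\<^esub>}"
  interpret \<epsilon>: module_hom_pair R "Free t" M ?\<epsilon> by (rule lin_comb_hom[OF M g(1)])
  have K: "submodule ?K R (Free t)" "?K \<subseteq> ideal_vecs R \<mm> t"
    using \<epsilon>.submodule_vimage[OF M.zero_submodule] ker by auto
  obtain b d where b0: "b 0 = t" and min: "\<And>i. minimal_matrix (b i) (b (Suc i)) (d (Suc i))"
    and first: "resolution_map b d 1 ` vecs R (b 1) = ?K"
    and exact: "\<And>i. resolution_map b d (Suc (Suc i)) ` vecs R (b (Suc (Suc i)))
        = matrix_kernel (b i) (b (Suc i)) (d (Suc i))"
    by (rule minimal_matrix_sequence[OF K]) (rule that)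
  have "min_free_resolution R M b d ?\<epsilon>"
  proof (rule min_free_resolutionI)
    fix i :: nat assume "i \<ge> 1"
    then obtain k where k: "i = Suc k" by (cases i) auto
    show "d i p q \<in> \<mm>" if "p < b (i - 1)" "q < b i" for p q using minimal_matrixD(1)[OF min[of k]] that k by simp
    show "resolution_map b d i (resolution_map b d (Suc i) w) = zero_vec R" if w: "w \<in> vecs R (b (Suc i))" for w
    proof -
      have "resolution_map b d (Suc i) w \<in> matrix_kernel (b k) (b (Suc k)) (d (Suc k))"
        using exact[of k] w k by blast
      then show ?thesis using k by (simp add: matrix_kernel_def)
    qed
    show "\<exists>w\<in>vecs R (b (Suc i)). v = resolution_map b d (Suc i) w"
      if "v \<in> vecs R (b i)" "resolution_map b d i v = zero_vec R" for v
    proof -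
      have "v \<in> matrix_kernel (b k) (b (Suc k)) (d (Suc k))" using that k by (simp add: matrix_kernel_def)
      then show ?thesis using exact[of k] k by blast
    qed
  qed (use b0 first g(2) \<epsilon>.lin in simp_all)
  then show ?thesis by blast
qed

lemma min_complex_of_resolution:
  assumes res: "min_free_resolution R M b d \<epsilon>"
  shows "min_complex R e b (resolution_map b d)"
proof (intro min_complex.intro short_ring_axioms min_complex_axioms.intro)
  note entry = min_free_resolutionD(1)[OF res]
  show "linear_map R (Free (b n)) (Free (b (n - 1))) (resolution_map b d n)" if "n \<ge> 1" for n
    by (intro linear_map_matvec \<mm>_carrier entry[OF that])
  show "resolution_map b d n v \<in> ideal_vecs R \<mm> (b (n - 1))" if "n \<ge> 1" "v \<in> vecs R (b n)" for n v
    by (rule matvec_in_\<mm>[OF entry[OF that(1)] that(2)])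
qed (fact min_free_resolutionD(2,3)[OF res])+

theorem syzygy_resolution:
  assumes res: "min_free_resolution R M b d \<epsilon>" and n: "n \<ge> 1"
  shows "min_free_resolution R (syzygy_module R b d n) (\<lambda>i. b (n + i)) (\<lambda>i. d (n + i)) (resolution_map b d n)"
    and "finitely_generated_module R (syzygy_module R b d n)"
proof -
  interpret C: min_complex R e b "resolution_map b d" by (rule min_complex_of_resolution[OF res])
  let ?S = "syzygy_module R b d n"
  have S: "?S = (Free (b (n - 1)))\<lparr>carrier := resolution_map b d n ` vecs R (b n)\<rparr>"
    by (simp add: syzygy_module_def)
  have M: "module R ?S"
    unfolding S by (rule submodule.submodule_is_module[OF C.D_submodule[OF n vecs_submodule] module_Free])
  have lin: "linear_map R (Free (b n)) ?S (resolution_map b d n)"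
    using C.D_linear[OF n] unfolding linear_map_def S by (auto simp: free_module_def)
  have surj: "resolution_map b d n ` vecs R (b n) = carrier ?S" by (simp add: S)
  show "finitely_generated_module R ?S" by (rule finitely_generated_moduleI[OF M lin surj])
  show "min_free_resolution R ?S (\<lambda>i. b (n + i)) (\<lambda>i. d (n + i)) (resolution_map b d n)"
  proof (rule min_free_resolutionI)
    fix i :: nat assume i: "i \<ge> 1"
    then have index: "n + (i - 1) = n + i - 1" "n + Suc i = Suc (n + i)" "n + i \<ge> 1" by auto
    show "d (n + i) p q \<in> \<mm>" if "p < b (n + (i - 1))" "q < b (n + i)" for p q
      using min_free_resolutionD(1)[OF res index(3)] that index(1) by simp
    show "resolution_map (\<lambda>i. b (n + i)) (\<lambda>i. d (n + i)) i (resolution_map (\<lambda>i. b (n + i)) (\<lambda>i. d (n + i))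
        (Suc i) w) = zero_vec R"
      if "w \<in> vecs R (b (n + Suc i))" for w using C.D_D[OF index(3), of w] that unfolding index(1,2) by simp
    show "\<exists>w\<in>vecs R (b (n + Suc i)). v = resolution_map (\<lambda>i. b (n + i)) (\<lambda>i. d (n + i)) (Suc i) w"
      if "v \<in> vecs R (b (n + i))" "resolution_map (\<lambda>i. b (n + i)) (\<lambda>i. d (n + i)) i v = zero_vec R" for v
      using C.D_exact[OF index(3), of v] that unfolding index(1,2) by simp
  next
    have "{v \<in> vecs R (b n). resolution_map b d n v = zero_vec R} = C.syzygies n"
      using C.D_eq_zero_iff[OF n] C.syzygies_vecs by blast
    also have "\<dots> = resolution_map b d (Suc n) ` vecs R (b (Suc n))" by (rule C.syzygies_def)
    finally show "{v \<in> vecs R (b (n + 0)). resolution_map b d n v = \<zero>\<^bsub>?S\<^esub>} =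
        resolution_map (\<lambda>i. b (n + i)) (\<lambda>i. d (n + i)) 1 ` vecs R (b (n + 1))"
      by (simp add: S free_module_def)
  qed (use lin surj in simp_all)
qed

end

section \<open>Acyclicity of the linear part\<close>

context min_complex
begin

definition lifts_linearly :: "nat \<Rightarrow> nat \<Rightarrow> (nat \<Rightarrow> 'a) \<Rightarrow> bool" where
  "lifts_linearly p i v \<longleftrightarrow> (\<exists>w\<in>\<mm>pow_vecs (p - 1) (Suc i). (p = 0 \<longrightarrow> w = zero_vec R) \<and>
     (\<forall>q. v q \<ominus> D (Suc i) w q \<in> \<mm>pow (p + 1)))"

lemma lifts_linearly_zero:
  assumes v: "v \<in> \<mm>pow_vecs (p + 1) i"
  shows "lifts_linearly p i v"
proof -
  have "D (Suc i) (zero_vec R) = zero_vec R" using module_hom_pair.hom_zero[OF D_hom, of "Suc i"] by simp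
  moreover have "v q \<ominus> \<zero> \<in> \<mm>pow (p + 1)" for q by (rule \<mm>pow_minus[OF ideal_vecs_entry[OF \<mm>pow_ideal v] \<mm>pow_zero])
  ultimately show ?thesis
    unfolding lifts_linearly_def using zero_vec_ideal_vecs[OF \<mm>pow_ideal]
    by (intro bexI[of _ "zero_vec R"]) (simp_all add: zero_vec_def)
qed

lemma lifts_linearly_boundary:
  assumes w: "w \<in> \<mm>pow_vecs (p - 1) (Suc i)" and p: "p \<noteq> 0"
  shows "lifts_linearly p i (D (Suc i) w)"
proof -
  have "D (Suc i) w q \<in> carrier R" for q
    using vecs_carrier[OF D_closed[of "Suc i" w]] ideal_vecs_vecs[OF w] by simp
  then show ?thesis
    unfolding lifts_linearly_def using w p \<mm>pow_zero by (intro bexI[of _ w]) (simp_all add: a_minus_def r_neg)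
qed

lemma lifts_linearly_1:
  assumes i: "i \<ge> 1" and strict: "strict_in_cube (i - 1)"
    and v: "v \<in> vecs R (b i)" and Dv: "D i v \<in> \<mm>pow_vecs 3 (i - 1)"
  shows "lifts_linearly 1 i v"
proof -
  have "D i v \<in> D i ` \<mm>pow_vecs 2 i" using strict Dv i unfolding strict_in_cube_def by auto
  then obtain y where y: "y \<in> \<mm>pow_vecs 2 i" "D i v = D i y" by blast
  note y_vecs = ideal_vecs_vecs[OF y(1)]
  obtain w where w: "w \<in> vecs R (b (Suc i))" "v = (\<lambda>t. D (Suc i) w t \<oplus> y t)"
    using D_eq_exact[OF i v y_vecs y(2)] by blast
  have "v q \<ominus> D (Suc i) w q \<in> \<mm>pow (1 + 1)" for q
  proof -
    have "v q \<ominus> D (Suc i) w q = y q"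
      unfolding w(2)
      using vecs_carrier[OF y_vecs, of q] vecs_carrier[OF D_closed[of "Suc i" w], of q] w(1) by (simp, algebra)
    then show ?thesis using ideal_vecs_entry[OF \<mm>pow_ideal y(1), of q] by (simp add: numeral_2_eq_2)
  qed
  then show ?thesis
    unfolding lifts_linearly_def using w(1) by (intro bexI[of _ w]) (simp_all add: ideal_vecs_carrier)
qed

theorem strict_imp_lifts_linearly:
  assumes i: "i \<ge> 1" and lin: "linear_generators i" "linear_generators (Suc i)"
    and strict: "strict_in_cube (i - 1)" "strict_in_cube i"
    and v: "v \<in> \<mm>pow_vecs p i" and Dv: "D i v \<in> \<mm>pow_vecs (p + 2) (i - 1)"
  shows "lifts_linearly p i v"
proof -
  note v_vecs = ideal_vecs_vecs[OF v]
  consider "p = 0" | "p = 1" | "p = 2" | "p = 3" | "p \<ge> 4" by linarith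
  then show ?thesis
  proof cases
    case 1
    then have "v \<in> \<mm>vecs i" using lin(1) v_vecs Dv unfolding linear_generators_def by (simp add: numeral_2_eq_2)
    then show ?thesis using lifts_linearly_zero[of v 0 i] 1 \<mm>pow_1 by simp
  next
    case 2
    then show ?thesis using lifts_linearly_1[OF i strict(1) v_vecs] Dv by (simp add: numeral_3_eq_3)
  next
    case 3
    then have "D i v = zero_vec R" using Dv \<mm>pow_4 ideal_vecs_0 by simp
    then obtain w where w: "w \<in> vecs R (b (Suc i))" "v = D (Suc i) w" using D_exact[OF i v_vecs] by blast
    then have "w \<in> \<mm>vecs (Suc i)" using lin(2) v 3 unfolding linear_generators_def by simp
    then show ?thesis using lifts_linearly_boundary[of w p i] w(2) 3 \<mm>pow_1 by simp
  next
    case 4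
    then obtain w where "w \<in> \<mm>pow_vecs 2 (Suc i)" "v = D (Suc i) w"
      using strict(2) v unfolding strict_in_cube_def by blast
    then show ?thesis using lifts_linearly_boundary[of w p i] 4 by simp
  next
    case 5
    then have "v q = \<zero>" for q using \<mm>pow_ge4[OF 5 ideal_vecs_entry[OF \<mm>pow_ideal v]] by simp
    then have "v = zero_vec R" by (simp add: zero_vec_def fun_eq_iff)
    then show ?thesis using lifts_linearly_zero zero_vec_ideal_vecs[OF \<mm>pow_ideal] by simp
  qed
qed

end

theorem (in short_ring) linear_part_acyclic_of_strict:
  assumes C: "min_complex R e b (resolution_map b d)"
    and lin: "\<And>i. i > n \<Longrightarrow> min_complex.linear_generators R b (resolution_map b d) i"
    and strict: "\<And>i. i \<ge> n \<Longrightarrow> min_complex.strict_in_cube R b (resolution_map b d) i"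
  shows "linear_part_acyclic R (\<lambda>i. b (n + i)) (\<lambda>i. d (n + i))"
  unfolding linear_part_acyclic_def
proof (intro allI impI ballI)
  interpret C: min_complex R e b "resolution_map b d" by (rule C)
  fix i p v
  assume i: "1 \<le> i" and v: "v \<in> vecs R (b (n + i))"
    and low: "(\<forall>q<b (n + i). v q \<in> \<mm>pow p) \<and>
      (\<forall>r<b (n + (i - 1)). matvec R (d (n + i)) (b (n + (i - 1))) (b (n + i)) v r \<in> \<mm>pow (p + 2))"
  have index: "n + (i - 1) = n + i - 1" "n + (i + 1) = Suc (n + i)" "n + i \<ge> 1" using i by auto
  have "v \<in> C.\<mm>pow_vecs p (n + i)" by (rule ideal_vecsI[OF v]) (use low in blast)
  moreover have "resolution_map b d (n + i) v \<in> C.\<mm>pow_vecs (p + 2) (n + i - 1)"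
    by (rule ideal_vecsI[OF C.D_closed[OF index(3) v]]) (use low[unfolded index(1)] in blast)
  ultimately have "C.lifts_linearly p (n + i) v"
    by (intro C.strict_imp_lifts_linearly index(3) lin strict) (use i in auto)
  then obtain w where w: "w \<in> C.\<mm>pow_vecs (p - 1) (Suc (n + i))" "p = 0 \<longrightarrow> w = zero_vec R"
    "\<And>q. v q \<ominus> resolution_map b d (Suc (n + i)) w q \<in> \<mm>pow (p + 1)" unfolding C.lifts_linearly_def by blast
  show "\<exists>w\<in>vecs R (b (n + (i + 1))). (p = 0 \<longrightarrow> w = zero_vec R) \<and> (\<forall>q<b (n + (i + 1)). w q \<in> \<mm>pow (p - 1)) \<and>
      (\<forall>q<b (n + i). v q \<ominus> matvec R (d (n + (i + 1))) (b (n + i)) (b (n + (i + 1))) w q \<in> \<mm>pow (p + 1))"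
    unfolding index(2) using w(2,3) ideal_vecs_entry[OF \<mm>pow_ideal w(1)]
    by (intro bexI[OF _ ideal_vecs_vecs[OF w(1)]] conjI allI impI) simp_all
qed

section \<open>The residue field as a module\<close>

context local_cring
begin

lemma residue_module_simps:
  shows "carrier (residue_module R) = (+>) \<mm> ` carrier R" and "\<zero>\<^bsub>residue_module R\<^esub> = \<mm>"
    and "x \<in> carrier R \<Longrightarrow> y \<in> carrier R \<Longrightarrow> (\<mm> +> x) \<oplus>\<^bsub>residue_module R\<^esub> (\<mm> +> y) = \<mm> +> (x \<oplus> y)"
    and "r \<in> carrier R \<Longrightarrow> x \<in> carrier R \<Longrightarrow> r \<odot>\<^bsub>residue_module R\<^esub> (\<mm> +> x) = \<mm> +> (r \<otimes> x)"
    and "x \<in> carrier R \<Longrightarrow> \<mm> +> x = \<mm> \<longleftrightarrow> x \<in> \<mm>"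
proof -
  interpret I: ideal \<mm> R by (rule \<mm>_ideal)
  show "carrier (residue_module R) = (+>) \<mm> ` carrier R"
    unfolding residue_module_def by (auto simp: FactRing_def A_RCOSETS_def')
  show "\<zero>\<^bsub>residue_module R\<^esub> = \<mm>" unfolding residue_module_def by (simp add: FactRing_def)
  show "(\<mm> +> x) \<oplus>\<^bsub>residue_module R\<^esub> (\<mm> +> y) = \<mm> +> (x \<oplus> y)" if "x \<in> carrier R" "y \<in> carrier R"
    unfolding residue_module_def using that by (simp add: FactRing_def I.a_rcos_sum)
  show "r \<odot>\<^bsub>residue_module R\<^esub> (\<mm> +> x) = \<mm> +> (r \<otimes> x)" if "r \<in> carrier R" "x \<in> carrier R"
    unfolding residue_module_def using that by (simp add: I.rcoset_mult_add)
  show "\<mm> +> x = \<mm> \<longleftrightarrow> x \<in> \<mm>" if "x \<in> carrier R"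
    using a_coset_join1[OF _ that I.a_subgroup] I.a_rcos_const by blast
qed

lemma module_residue: "module R (residue_module R)"
proof (rule moduleI)
  note simps = residue_module_simps
  have zero: "\<mm> = \<mm> +> \<zero>" using simps(5)[OF zero_closed] ideal_zero[OF \<mm>_ideal] by simp
  show "abelian_group (residue_module R)"
  proof (rule abelian_groupI)
    show "\<zero>\<^bsub>residue_module R\<^esub> \<in> carrier (residue_module R)" using zero simps(1,2) by auto
    fix x assume "x \<in> carrier (residue_module R)"
    then obtain r where r: "r \<in> carrier R" "x = \<mm> +> r" using simps(1) by auto
    show "\<zero>\<^bsub>residue_module R\<^esub> \<oplus>\<^bsub>residue_module R\<^esub> x = x"
      using simps(3)[OF zero_closed r(1)] r zero simps(2) by simp
    have "(\<mm> +> \<ominus> r) \<oplus>\<^bsub>residue_module R\<^esub> x = \<zero>\<^bsub>residue_module R\<^esub>"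
      using simps(3)[of "\<ominus> r" r] r zero simps(2) by (simp add: l_neg)
    then show "\<exists>y\<in>carrier (residue_module R). y \<oplus>\<^bsub>residue_module R\<^esub> x = \<zero>\<^bsub>residue_module R\<^esub>"
      using simps(1) r(1) by (intro bexI[of _ "\<mm> +> \<ominus> r"]) auto
  qed (auto simp: simps(1,3) a_ac)
qed (auto simp: residue_module_simps(1,3,4) l_distr r_distr m_assoc is_cring)

lemma linear_map_residue: "linear_map R Reg (residue_module R) ((+>) \<mm>)"
  unfolding linear_map_def by (auto simp: residue_module_simps)

lemma finitely_generated_residue: "finitely_generated_module R (residue_module R)"
proof (rule finitely_generated_moduleI[OF module_residue])
  show "linear_map R (Free 1) (residue_module R) (\<lambda>v. \<mm> +> v 0)"
    unfolding linear_map_def by (auto simp: residue_module_simps vecs_carrier)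
  have "(\<lambda>v. v 0) ` vecs R 1 = carrier R"
  proof
    show "carrier R \<subseteq> (\<lambda>v. v 0) ` vecs R 1"
    proof
      fix r assume "r \<in> carrier R"
      then show "r \<in> (\<lambda>v. v 0) ` vecs R 1"
        using single_vec_vecs[of 0 1 r]
        by (intro rev_image_eqI[of "single_vec R 0 r"]) (simp_all add: single_vec_def)
    qed
  qed (use vecs_carrier in blast)
  then show "(\<lambda>v. \<mm> +> v 0) ` vecs R 1 = carrier (residue_module R)"
    unfolding residue_module_simps(1) by (metis image_image)
qed

lemma simple_quotient_residue: "simple_quotient R (residue_module R) {\<mm>} (carrier (residue_module R))"
proof -
  interpret module_hom_pair R Reg "residue_module R" "(+>) \<mm>"
    by (intro module_hom_pairI module_regular module_residue linear_map_residue)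
  have "\<mm> +> x = \<mm>" if "x \<in> \<mm>" for x using residue_module_simps(5)[OF \<mm>_carrier] that by simp
  then have "(+>) \<mm> ` \<mm> = {\<mm>}" using ideal_zero[OF \<mm>_ideal] by blast
  moreover have "simple_quotient R (residue_module R) ((+>) \<mm> ` \<mm>) ((+>) \<mm> ` carrier R)"
    by (rule simple_quotient_image[OF simple_quotient_\<mm>]) (simp add: residue_module_simps(2,5))
  ultimately show ?thesis by (simp add: residue_module_simps(1))
qed

end

context short_ring
begin

lemma augmentation_\<mm>vecs:
  assumes lin: "linear_map R (Free n) (residue_module R) \<epsilon>" and v: "v \<in> ideal_vecs R \<mm> n"
  shows "\<epsilon> v = \<mm>"
proof -
  interpret K: module R "residue_module R" by (rule module_residue)
  interpret \<epsilon>: module_hom_pair R "Free n" "residue_module R" \<epsilon>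
    by (intro module_hom_pairI module_Free module_residue lin)
  have "\<epsilon> v \<in> {\<zero>\<^bsub>residue_module R\<^esub>}"
  proof (rule linear_map_in_submodule[OF module_residue lin K.zero_submodule ideal_vecs_vecs[OF v]])
    fix k assume "k < n"
    then have "\<epsilon> (single_vec R k \<one>) \<in> carrier (residue_module R)" using \<epsilon>.hom_closed single_vec_vecs by simp
    then obtain t where t: "t \<in> carrier R" "\<epsilon> (single_vec R k \<one>) = \<mm> +> t" using residue_module_simps(1) by auto
    have "v k \<in> \<mm>" by (rule ideal_vecs_entry[OF \<mm>_ideal v])
    then have "v k \<otimes> t \<in> \<mm>" "v k \<in> carrier R" using ideal.I_r_closed[OF \<mm>_ideal _ t(1)] \<mm>_carrier by auto
    then show "v k \<odot>\<^bsub>residue_module R\<^esub> \<epsilon> (single_vec R k \<one>) \<in> {\<zero>\<^bsub>residue_module R\<^esub>}"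
      using t residue_module_simps(2,4,5) by simp
  qed
  then show ?thesis using residue_module_simps(2) by simp
qed

theorem residue_resolution:
  assumes res: "min_free_resolution R (residue_module R) b d \<epsilon>"
  shows "resolution_map b d 1 ` vecs R (b 1) = ideal_vecs R \<mm> (b 0)" and "b 0 = 1"
proof -
  interpret C: min_complex R e b "resolution_map b d" by (rule min_complex_of_resolution[OF res])
  interpret K: module R "residue_module R" by (rule module_residue)
  note lin = min_free_resolutionD(4)[OF res] and ker = min_free_resolutionD(6)[OF res]
  have "ideal_vecs R \<mm> (b 0) \<subseteq> {v \<in> vecs R (b 0). \<epsilon> v = \<zero>\<^bsub>residue_module R\<^esub>}"
    using augmentation_\<mm>vecs[OF lin] ideal_vecs_vecs residue_module_simps(2) by auto
  then show image: "resolution_map b d 1 ` vecs R (b 1) = ideal_vecs R \<mm> (b 0)"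
    using ker C.D_minimal[of 1] by auto
  have "quotient_length R (residue_module R) (\<epsilon> ` ideal_vecs R \<mm> (b 0)) (\<epsilon> ` vecs R (b 0)) = b 0"
    using quotient_length_image[OF finite_length_module_Free module_residue
      lin ideal_vecs_submodule[OF \<mm>_ideal] vecs_submodule]
      ker image ideal_vecs_vecs len_ideal_vecs_\<mm>pow(1) by auto
  moreover have "\<epsilon> ` ideal_vecs R \<mm> (b 0) = {\<mm>}"
    using augmentation_\<mm>vecs[OF lin] zero_vec_ideal_vecs[OF \<mm>_ideal, of "b 0"] by force
  ultimately show "b 0 = 1"
    using K.lat.len_eq[OF K.lat.has_length_covers[OF simple_quotient_residue]] min_free_resolutionD(5)[OF res]
    by simp
qed

section \<open>Koszul rings and Koszul syzygies\<close>

theorem koszul_presentation_of_koszul_ring: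
  assumes koszul: "koszul_ring R"
  obtains N1 N2 gen D2 where "koszul_presentation R e N1 N2 gen D2"
proof -
  obtain b d \<epsilon> where res: "min_free_resolution R (residue_module R) b d \<epsilon>" and acyclic: "linear_part_acyclic R b d"
    using koszul unfolding koszul_ring_def koszul_module_def by blast
  interpret C: min_complex R e b "resolution_map b d" by (rule min_complex_of_resolution[OF res])
  note D1 = residue_resolution(1)[OF res] and b0 = residue_resolution(2)[OF res]
  have dot: "resolution_map b d 1 v 0 = dot_prod R (b 1) (d 1 0) v" for v
    using b0 by (simp add: matvec_eq_dot_prod)
  have two: "Suc 1 = 2" "2 - 1 = (1 :: nat)" by simp_all
  have "koszul_presentation R e (b 1) (b 2) (d 1 0) (resolution_map b d 2)"
  proof (intro koszul_presentation.intro short_ring_axioms koszul_presentation_axioms.intro)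
    show "d 1 0 q \<in> \<mm>" if "q < b 1" for q using min_free_resolutionD(1)[OF res, of 1 0 q] that b0 by simp
    show "\<exists>v\<in>vecs R (b 1). dot_prod R (b 1) (d 1 0) v = u" if u: "u \<in> \<mm>" for u
    proof -
      have "single_vec R 0 u \<in> resolution_map b d 1 ` vecs R (b 1)"
        unfolding D1 using single_vec_ideal_vecs[OF _ \<mm>_ideal u] b0 by simp
      then obtain v where "v \<in> vecs R (b 1)" "single_vec R 0 u = resolution_map b d 1 v" by blast
      then show ?thesis using dot[of v] by (metis single_vec_def)
    qed
    show "linear_map R (Free (b 2)) (Free (b 1)) (resolution_map b d 2)"
      using C.D_linear[of 2] unfolding two by simp
    show "resolution_map b d 2 w \<in> ideal_vecs R \<mm> (b 1)" if "w \<in> vecs R (b 2)" for w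
      using C.D_minimal[of 2 w] that unfolding two by simp
    show "dot_prod R (b 1) (d 1 0) (resolution_map b d 2 w) = \<zero>" if "w \<in> vecs R (b 2)" for w
      using C.D_D[of 1 w] that unfolding dot[symmetric] two by (simp add: zero_vec_def)
    fix p :: nat and v assume v: "v \<in> ideal_vecs R (\<mm>pow p) (b 1)" "dot_prod R (b 1) (d 1 0) v \<in> \<mm>pow (p + 2)"
    have "\<forall>r<b (1 - 1). matvec R (d 1) (b (1 - 1)) (b 1) v r \<in> \<mm>pow (p + 2)" using v(2) dot[of v] b0 by simp
    then obtain w where "w \<in> vecs R (b (1 + 1))" "\<forall>q<b (1 + 1). w q \<in> \<mm>pow (p - 1)"
      "\<forall>q<b 1. v q \<ominus> matvec R (d (1 + 1)) (b 1) (b (1 + 1)) w q \<in> \<mm>pow (p + 1)"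
      using acyclic[unfolded linear_part_acyclic_def, rule_format, of 1 v p] ideal_vecs_vecs[OF v(1)]
        ideal_vecs_entry[OF \<mm>pow_ideal v(1)] by blast
    then show "\<exists>w\<in>ideal_vecs R (\<mm>pow (p - 1)) (b 2). \<forall>q<b 1. v q \<ominus> resolution_map b d 2 w q \<in> \<mm>pow (p + 1)"
      unfolding one_add_one by (intro bexI[of _ w]) (simp_all add: ideal_vecsI)
  qed
  then show ?thesis by (rule that)
qed

theorem koszul_ring_of_orthogonal_data:
  assumes data: "orthogonal_data R e a a' c c' l"
  shows "koszul_ring R"
proof -
  obtain b d \<epsilon> where res: "min_free_resolution R (residue_module R) b d \<epsilon>"
    using min_free_resolution_exists[OF finitely_generated_residue] by blast
  note C = min_complex_of_resolution[OF res]
  interpret C: orthogonal_complex R e a a' c c' l b "resolution_map b d" by (intro orthogonal_complex.intro data C)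
  note strict = C.strict_residue[OF residue_resolution[OF res]]
  have "linear_part_acyclic R (\<lambda>i. b (0 + i)) (\<lambda>i. d (0 + i))"
    by (rule linear_part_acyclic_of_strict[OF C]) (use strict in simp_all)
  then show ?thesis unfolding koszul_ring_def koszul_module_def using res finitely_generated_residue by auto
qed

theorem koszul_syzygy_of_orthogonal_data:
  assumes data: "orthogonal_data R e a a' c c' l" and res: "min_free_resolution R M b d \<epsilon>"
  shows "\<exists>n\<ge>1. koszul_module R (syzygy_module R b d n)"
proof -
  note C = min_complex_of_resolution[OF res]
  interpret C: orthogonal_complex R e a a' c c' l b "resolution_map b d" by (intro orthogonal_complex.intro data C)
  obtain n where n: "n \<ge> 1" "\<And>i. i \<ge> n \<Longrightarrow> C.linear_generators i" "\<And>i. i \<ge> n \<Longrightarrow> C.strict_in_cube i"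
    using C.strict_eventually by blast
  have "linear_part_acyclic R (\<lambda>i. b (n + i)) (\<lambda>i. d (n + i))"
    by (rule linear_part_acyclic_of_strict[OF C]) (use n in simp_all)
  then show ?thesis unfolding koszul_module_def using syzygy_resolution[OF res n(1)] n(1) by blast
qed

end

theorem theorem3p3:
  fixes R :: "('a, 'b) ring_scheme" and e s :: nat
  assumes local: "local_noetherian_ring R"
    and H1: "hilbert_fun R 1 = e" and H2: "hilbert_fun R 2 = e"
    and H3: "hilbert_fun R 3 = 1" and H4: "\<forall>n\<ge>4. hilbert_fun R n = 0"
    and s_def: "s = socle_rank R"
    and ezd: "\<exists>a. a \<in> max_ideal R \<and> a \<noteq> \<zero>\<^bsub>R\<^esub> \<and> exact_zero_divisor R a"
  shows "(koszul_ring R \<longleftrightarrow> e \<ge> s + 2) \<and>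
         (koszul_ring R \<longrightarrow>
            (\<forall>M :: ('a, 'c) module. finitely_generated_module R M \<longrightarrow>
               (\<exists>b d \<epsilon>. min_free_resolution R M b d \<epsilon> \<and>
                  (koszul_module R M \<or>
                   (\<exists>n\<ge>1. koszul_module R (syzygy_module R b d n))))))"
proof -
  interpret short_ring R e using short_ring_of_hilbert_fun[OF local H1 H2 H3] H4 by simp
  have s_eq: "s = quotient_length R (regular_module R) {\<zero>\<^bsub>R\<^esub>} socle"
    using socle_rank_eq_len local s_def by (simp add: local_noetherian_ring_def)
  obtain a a' where pair: "exact_pair R e a a'" using ezd exact_pair_of_exact_zero_divisor by metis
  have bound: "e \<ge> s + 2" if koszul: "koszul_ring R"
  proof -
    obtain N1 N2 gen D2 where "koszul_presentation R e N1 N2 gen D2"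
      by (rule koszul_presentation_of_koszul_ring[OF koszul]) (rule that)
    then show ?thesis unfolding s_eq by (rule koszul_presentation.socle_bound[OF _ pair])
  qed
  have data: "\<exists>c c' l. orthogonal_data R e a a' c c' l" if "e \<ge> s + 2"
    using exact_pair.orthogonal_data_exists[OF pair] that unfolding s_eq by metis
  show ?thesis
    using bound data koszul_ring_of_orthogonal_data koszul_syzygy_of_orthogonal_data
      min_free_resolution_exists by metis
qed

end
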